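(* Let $d\ge 1$, $1<p<\infty$ and $p^*=\max\left(p,\frac{p}{p-1}\right)$. Let $\tilde{\mathbf{R}}f=(\tilde R_1f,\dots,\tilde R_df)$, where $\tilde R_i=\delta_i^*L^{-1/2}$. Then for every $f\in L^p(\mathbb{R}^d)$, $$\|\tilde{\mathbf{R}}f\|_p=\left(\int_{\mathbb{R}^d}|\tilde{\mathbf{R}}f(x)|^p\,dx\right)^{1/p}\le 42\,(p^*-1)\,\|f\|_p .$$
   Context: All functions are real-valued; $|\cdot|$ is the Euclidean norm; $\|\cdot\|_p$ is the $L^p(\mathbb{R}^d)$ norm with respect to Lebesgue measure; $\langle\cdot,\cdot\rangle$ is the $L^2(\mathbb{R}^d)$ inner product; $\mathbb{N}=\{0,1,2,\dots\}$. Hermite functions: for $k\in\mathbb{N}$ and $x\in\mathbb{R}$, $h_k(x)=(2^k k!\sqrt{\pi})^{-1/2}e^{-x^2/2}H_k(x)$ with $H_k(x)=(-1)^ke^{x^2}\frac{d^k}{dx^k}e^{-x^2}$; for $n\in\mathbb{N}^d$ and $x\in\mathbb{R}^d$, $h_n(x)=h_{n_1}(x_1)\cdots h_{n_d}(x_d)$. Let $\mathcal{D}$ be the linear span of $\{h_n:n\in\mathbb{N}^d\}$; it is dense in $L^p(\mathbb{R}^d)$ for $1\le p<\infty$. Let $\delta_i^*=-\partial_{x_i}+x_i$. The harmonic oscillator $L=-\Delta+|x|^2$ satisfies $Lh_n=\lambda_nh_n$ with $\lambda_n=2|n|+d$, $|n|=n_1+\dots+n_d$. The operator $\tilde R_i=\delta_i^*L^{-1/2}$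 is defined by $$\tilde R_if=\sum_{n\in\mathbb{N}^d}\lambda_n^{-1/2}\langle f,h_n\rangle\,\delta_i^*h_n,$$ a finite sum for $f\in\mathcal{D}$. A densely defined bounded operator is identified with its unique bounded extension; thus the statement for $f\in L^p$ means that the inequality holds for $f\in\mathcal{D}$ and that $\tilde{\mathbf{R}}$ on $L^p$ is the bounded extension from $\mathcal{D}$. *)

theory Defs
  imports "HOL-Analysis.Analysis"
begin

definition Hermite_poly :: "nat \<Rightarrow> real \<Rightarrow> real" where
  "Hermite_poly k x = (-1) ^ k * exp (x\<^sup>2) * (deriv ^^ k) (\<lambda>y. exp (- (y\<^sup>2))) x"

definition hermite1 :: "nat \<Rightarrow> real \<Rightarrow> real" where
  "hermite1 k x =
     (2 ^ k * fact k * sqrt pi) powr (- 1 / 2) * exp (- (x\<^sup>2) / 2) * Hermite_poly k x"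

definition hermite :: "nat ^ 'd \<Rightarrow> real ^ 'd \<Rightarrow> real" where
  "hermite n x = (\<Prod>i\<in>UNIV. hermite1 (n $ i) (x $ i))"

text \<open>The linear span of the Hermite functions, as a set of functions (not of classes).\<close>

definition hermite_span :: "(real ^ 'd \<Rightarrow> real) set" where
  "hermite_span = {f. \<exists>S c. finite S \<and> f = (\<lambda>x. \<Sum>n\<in>S. c n * hermite n x)}"

text \<open>Elements of \<open>Lp_space p\<close> are functions; identification almost everywhere is always
  stated explicitly. Since the Bochner integral of a non-integrable function is 0,
  \<open>Lp_norm\<close> is meaningful only on \<open>Lp_space\<close>.\<close>

definition Lp_space :: "real \<Rightarrow> (real ^ 'd \<Rightarrow> 'b::euclidean_space) set" where
  "Lp_space p =
     {f \<in> borel_measurable lebesgue. integrable lebesgue (\<lambda>x. norm (f x) powr p)}"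

definition Lp_norm :: "real \<Rightarrow> (real ^ 'd \<Rightarrow> 'b::euclidean_space) \<Rightarrow> real" where
  "Lp_norm p f = (\<integral>x. norm (f x) powr p \<partial>lebesgue) powr (1 / p)"

definition L2_inner :: "(real ^ 'd \<Rightarrow> real) \<Rightarrow> (real ^ 'd \<Rightarrow> real) \<Rightarrow> real" where
  "L2_inner f g = (\<integral>x. f x * g x \<partial>lebesgue)"

definition partial_deriv :: "'d \<Rightarrow> (real ^ 'd \<Rightarrow> real) \<Rightarrow> real ^ 'd \<Rightarrow> real" where
  "partial_deriv i f x = deriv (\<lambda>t. f (x + t *\<^sub>R axis i 1)) 0"

definition delta_star :: "'d \<Rightarrow> (real ^ 'd \<Rightarrow> real) \<Rightarrow> real ^ 'd \<Rightarrow> real" where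
  "delta_star i f x = - partial_deriv i f x + x $ i * f x"

text \<open>The eigenvalue of the harmonic oscillator \<open>- \<Delta> + |x|\<^sup>2\<close> at \<open>hermite n\<close>.\<close>

definition eigval :: "nat ^ 'd \<Rightarrow> real" where
  "eigval n = 2 * real (\<Sum>i\<in>UNIV. n $ i) + real CARD('d)"

text \<open>For \<open>f \<in> hermite_span\<close> only finitely many terms are nonzero, by orthogonality, so the
  sum below is a finite sum. It is only used for such \<open>f\<close>.\<close>

definition Riesz_comp :: "'d \<Rightarrow> (real ^ 'd \<Rightarrow> real) \<Rightarrow> real ^ 'd \<Rightarrow> real" where
  "Riesz_comp i f x =
     (\<Sum>\<^sub>\<infinity>n. eigval n powr (- 1 / 2) * L2_inner f (hermite n) * delta_star i (hermite n) x)"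

definition Riesz :: "(real ^ 'd \<Rightarrow> real) \<Rightarrow> real ^ 'd \<Rightarrow> real ^ 'd" where
  "Riesz f x = (\<chi> i. Riesz_comp i f x)"

text \<open>\<open>T\<close> is a bounded linear operator from scalar to vector-valued \<open>L\<^sup>p\<close> that extends
  \<open>Riesz\<close> from the span of the Hermite functions. Linearity and boundedness together imply
  that \<open>T\<close> is well defined on classes modulo equality almost everywhere.\<close>

definition Riesz_extension ::
  "real \<Rightarrow> ((real ^ 'd \<Rightarrow> real) \<Rightarrow> real ^ 'd \<Rightarrow> real ^ 'd) \<Rightarrow> bool" where
  "Riesz_extension p T \<longleftrightarrow>
     (\<forall>f\<in>Lp_space p. T f \<in> Lp_space p) \<and>
     (\<forall>f\<in>Lp_space p. \<forall>g\<in>Lp_space p. \<forall>a b.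
        AE x in lebesgue. T (\<lambda>y. a * f y + b * g y) x = a *\<^sub>R T f x + b *\<^sub>R T g x) \<and>
     (\<exists>C. \<forall>f\<in>Lp_space p. Lp_norm p (T f) \<le> C * Lp_norm p f) \<and>
     (\<forall>f\<in>hermite_span. AE x in lebesgue. T f x = Riesz f x)"

definition p_star :: "real \<Rightarrow> real" where
  "p_star p = max p (p / (p - 1))"

end

theory Submission
  imports Defs "HOL-Probability.Distributions"
begin

text \<open>Write \<open>\<delta>\<^sup>* L\<^sup>-\<^sup>1\<^sup>/\<^sup>2\<close> as \<open>\<delta>\<^sup>* (L + 2)\<^sup>-\<^sup>1\<^sup>/\<^sup>2\<close> composed with the multiplier \<open>sqrt ((L + 2) / L)\<close>.

  The first factor is bounded by duality. Since \<open>\<delta>\<^sub>i\<^sup>*\<close> intertwines \<open>L + 2\<close> with \<open>L\<close>, the pairing with \<open>g\<close> is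
  a constant times the integral over \<open>t > 0\<close> of \<open>t \<langle>\<delta>\<^sup>* u, \<partial>\<^sub>t v\<rangle>\<close>, where \<open>u = exp (- t sqrt (L + 2)) f\<close> and
  \<open>v = exp (- t sqrt L) g\<close>. A Bellman function \<open>phi\<close> of Nazarov-Treil type satisfies a lower bound for
  the Laplacian of \<open>phi (|u|\<^sup>2) (|v|\<^sup>2)\<close> in all variables \<open>(x, t)\<close> that controls the integrand; integration by
  parts in \<open>t\<close> then leaves only the size of \<open>phi\<close> at \<open>t = 0\<close>, giving \<open>8 sqrt 2 (p\<^sup>* - 1)\<close>.

  The second factor is the binomial series in \<open>2 / (L + 2)\<close>. On \<open>L\<^sup>p\<close> with a weight \<open>psi\<^sup>2\<^sup>-\<^sup>p\<close> the resolvent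
  \<open>1 / (L + 2)\<close> has norm at most \<open>4/9\<close>, where \<open>psi\<close> is a supersolution of \<open>L - 1/4\<close> with values between
  \<open>1\<close> and \<open>4/3\<close>. The terms with \<open>k > 0\<close> thus sum to at most \<open>4/3 ((1 - 8/9)\<^sup>-\<^sup>1\<^sup>/\<^sup>2 - 1) = 8/3\<close>, so the
  multiplier has norm at most \<open>11/3\<close>, and \<open>8 sqrt 2 (11/3) < 42\<close>.\<close>

section \<open>Gaussian integrals and integration by parts\<close>

text \<open>The shift by 2 is forced by the pairing. \<open>delta_star i\<close> sends
  \<open>hermite n\<close> to a multiple of \<open>hermite (raise i n)\<close>, whose eigenvalue is
  larger by 2, so with \<open>sqrt (L + 2)\<close> on one side and \<open>sqrt L\<close> on the
  other both exponentials decay at the same rate. The pairing then equals J(0) for a function J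
  whose second derivative is the pairing of the two waves, up to a constant. The price is the
  multiplier. Without a weight the resolvent argument yields only the norm 1/2, because the
  potential vanishes at the origin; then 2 / (L + 2) is bounded only by 1, where the binomial series
  diverges. The weight gains 1/4, and 2 * 4/9 = 8/9 lies inside the disc of convergence. The Bellman
  function has non-integral powers and is singular at A = 0 and B = 0. Each wave therefore gets one
  more component, a small multiple of the ground state, which is sent to 0 at the end. All estimates
  are made for finite Hermite expansions, where every integral converges; density of the span in L^q
  then serves duality, and density in L^p the extension.\<close>

lemma integral_lborel_translate:
  fixes f :: "'a::euclidean_space \<Rightarrow> 'b::{banach,second_countable_topology}"
  assumes "f \<in> borel_measurable borel"
  shows "(\<integral>x. f (x + c) \<partial>lborel) = (\<integral>x. f x \<partial>lborel)"
proof -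
  have "lborel = distr lborel borel (\<lambda>x::'a. x + c)"
    using lborel_affine[of 1 c] by (simp add: add.commute density_1)
  then have "(\<integral>x. f x \<partial>lborel) = (\<integral>x. f x \<partial>distr lborel borel (\<lambda>x::'a. x + c))" by simp
  also have "\<dots> = (\<integral>x. f (x + c) \<partial>lborel)"
    by (rule integral_distr) (use assms in auto)
  finally show ?thesis by simp
qed

lemma integrable_lborel_translate:
  fixes f :: "'a::euclidean_space \<Rightarrow> 'b::{banach,second_countable_topology}"
  assumes "integrable lborel f"
  shows "integrable lborel (\<lambda>x. f (x + c))"
proof -
  have "lborel = distr lborel borel (\<lambda>x::'a. x + c)"
    using lborel_affine[of 1 c] by (simp add: add.commute density_1)
  then have "integrable (distr lborel borel (\<lambda>x::'a. x + c)) f" using assms by simp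
  then show ?thesis
    by (rule integrable_distr[rotated]) simp
qed

text \<open>Integrating \<open>f'\<close> along the segment from x to x + b gives
  \<open>f (x + b) - f x\<close>. Integrating this over x and exchanging the integrals leaves the
  integral of \<open>f'\<close> on one side and, by translation invariance, 0 on the other. So no
  cut-off and no boundary terms occur, only integrability.\<close>

lemma integral_directional_derivative_eq_0:
  fixes f f' :: "'a::euclidean_space \<Rightarrow> real" and b :: 'a
  assumes deriv: "\<And>x. ((\<lambda>s. f (x + s *\<^sub>R b)) has_real_derivative f' x) (at 0)"
    and cont: "continuous_on UNIV f'"
    and int: "integrable lborel f" "integrable lborel f'"
  shows "(\<integral>x. f' x \<partial>lborel) = 0"
proof -
  have [measurable]: "f' \<in> borel_measurable borel" "f \<in> borel_measurable borel"
    using int by auto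
  have deriv': "((\<lambda>s. f (x + s *\<^sub>R b)) has_real_derivative f' (x + s *\<^sub>R b)) (at s)" for x s
    using deriv[of "x + s *\<^sub>R b"] DERIV_shift[of "\<lambda>s. f (x + s *\<^sub>R b)" "f' (x + s *\<^sub>R b)" 0 s]
    by (simp add: algebra_simps)
  have ftc: "(\<integral>s. f' (x + s *\<^sub>R b) * indicator {0..1} s \<partial>lborel) = f (x + b) - f x" for x
  proof -
    have "isCont (\<lambda>s. f' (x + s *\<^sub>R b)) s" for s
      using cont by (intro continuous_on_interior[where S = UNIV])
        (auto intro!: continuous_on_compose2[OF cont] continuous_intros)
    then show ?thesis
      using integral_FTC_Icc_real[of 0 1 "\<lambda>s. f (x + s *\<^sub>R b)" "\<lambda>s. f' (x + s *\<^sub>R b)"] deriv'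
      by simp
  qed
  have int_s: "integrable lborel (\<lambda>x. f' (x + s *\<^sub>R b) * indicator {0..1} s)" for s :: real
    using integrable_lborel_translate[OF int(2)] by (intro integrable_mult_left)
  have "(\<integral>x. (\<integral>s. f' (x + s *\<^sub>R b) * indicator {0..1} s \<partial>lborel) \<partial>lborel)
      = (\<integral>s. (\<integral>x. f' (x + s *\<^sub>R b) * indicator {0..1} s \<partial>lborel) \<partial>lborel)"
  proof (rule lborel_pair.Fubini_integral[symmetric])
    have eq: "(\<integral>x. norm (f' (x + s *\<^sub>R b) * indicator {0..1} s) \<partial>lborel)
       = (\<integral>x. norm (f' x) \<partial>lborel) * indicator {0..1} s" for s :: real
    proof -
      have "(\<integral>x. norm (f' (x + s *\<^sub>R b) * indicator {0..1} s) \<partial>lborel)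
        = (\<integral>x. norm (f' (x + s *\<^sub>R b)) * indicator {0..1} s \<partial>lborel)"
        by (intro Bochner_Integration.integral_cong refl) (auto simp: indicator_def)
      also have "\<dots> = (\<integral>x. norm (f' (x + s *\<^sub>R b)) \<partial>lborel) * indicator {0..1} s"
        by simp
      also have "(\<integral>x. norm (f' (x + s *\<^sub>R b)) \<partial>lborel) = (\<integral>x. norm (f' x) \<partial>lborel)"
        using integral_lborel_translate[of "\<lambda>x. norm (f' x)" "s *\<^sub>R b"] by simp
      finally show ?thesis .
    qed
    have "integrable (lborel \<Otimes>\<^sub>M lborel) (\<lambda>(s, x). f' (x + s *\<^sub>R b) * indicator {0..1} s)"
    proof (rule lborel_pair.Fubini_integrable)
      show "integrable lborel (\<lambda>s. \<integral>x. norm (case (s, x) of (s, x) \<Rightarrow> f' (x + s *\<^sub>R b) * indicator {0..1} s) \<partial>lborel)"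
        unfolding prod.case eq by (rule integrable_mult_right) (simp add: integrable_real_indicator)
      show "AE s in lborel. integrable lborel (\<lambda>x. case (s, x) of (s, x) \<Rightarrow> f' (x + s *\<^sub>R b) * indicator {0..1} s)"
        using int_s by simp
    qed measurable
    from lborel_pair.integrable_product_swap[OF this]
    show "integrable (lborel \<Otimes>\<^sub>M lborel) (\<lambda>(x, s). f' (x + s *\<^sub>R b) * indicator {0..1} s)"
      by (simp add: case_prod_beta)
  qed
  also have "\<dots> = (\<integral>s. (\<integral>x. f' x \<partial>lborel) * indicator {0..1::real} s \<partial>lborel)"
    by (simp add: integral_lborel_translate[of f'])
  also have "\<dots> = (\<integral>x. f' x \<partial>lborel)" by simp
  finally have "(\<integral>x. f' x \<partial>lborel) = (\<integral>x. f (x + b) - f x \<partial>lborel)"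
    unfolding ftc by simp
  also have "\<dots> = 0"
    using int integrable_lborel_translate[OF int(1)] by (simp add: integral_lborel_translate)
  finally show ?thesis .
qed

text \<open>\<open>lborel\<close> on \<open>real ^ 'd\<close> is the image of a product measure
  indexed by \<open>Basis\<close>; the work lies in reindexing basis vectors by coordinates through
  \<open>axis_index\<close>.\<close>

lemma lborel_prod_coordinates:
  fixes f :: "'d::finite \<Rightarrow> real \<Rightarrow> real"
  assumes int: "\<And>i. integrable lborel (f i)"
  shows "integrable lborel (\<lambda>x::real^'d. \<Prod>i\<in>UNIV. f i (x $ i))"
    and "(\<integral>(x::real^'d). (\<Prod>i\<in>UNIV. f i (x $ i)) \<partial>lborel) = (\<Prod>i\<in>UNIV. \<integral>s. f i s \<partial>lborel)"
proof -
  interpret product_sigma_finite "\<lambda>_::real^'d. lborel :: real measure" ..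
  define g where "g b = f (axis_index b)" for b :: "real^'d"
  have inj: "inj_on (\<lambda>i. axis i (1::real) :: real^'d) UNIV"
    by (auto simp: inj_on_def axis_eq_axis)
  have Basis: "(Basis :: (real^'d) set) = (\<lambda>i. axis i 1) ` UNIV"
    by (auto simp: Basis_vec_def)
  have idx: "g (axis i 1) = f i" for i
    unfolding g_def by (simp add: axis_eq_axis axis_index_axis)
  have gint: "integrable lborel (g b)" for b using int by (simp add: g_def)
  have [measurable]: "f i \<in> borel_measurable borel" for i using int[of i] by simp
  have [measurable]: "(\<lambda>y. \<Sum>b\<in>Basis. y b *\<^sub>R b) \<in> (\<Pi>\<^sub>M b\<in>(Basis::(real^'d) set). lborel) \<rightarrow>\<^sub>M borel"
    by measurable
  have eq: "(\<Prod>i\<in>UNIV. f i ((\<Sum>b\<in>(Basis::(real^'d) set). y b *\<^sub>R b) $ i)) = (\<Prod>b\<in>Basis. g b (y b))" for y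
  proof -
    have "(\<Sum>b\<in>(Basis::(real^'d) set). y b *\<^sub>R b) $ i = y (axis i 1)" for i
    proof -
      have "(\<Sum>b\<in>(Basis::(real^'d) set). y b *\<^sub>R b) $ i = (\<Sum>j\<in>UNIV. y (axis j 1) * axis j 1 $ i)"
        by (simp add: Basis sum.reindex[OF inj])
      also have "\<dots> = (\<Sum>j\<in>UNIV. if j = i then y (axis j 1) else 0)"
        by (intro sum.cong) (auto simp: axis_def)
      finally show ?thesis by simp
    qed
    then show ?thesis by (simp add: Basis prod.reindex[OF inj] idx)
  qed
  have I: "integrable (\<Pi>\<^sub>M b\<in>(Basis::(real^'d) set). lborel) (\<lambda>y. \<Prod>b\<in>Basis. g b (y b))"
    by (intro product_integrable_prod gint) simp
  have "integrable (distr (\<Pi>\<^sub>M b\<in>(Basis::(real^'d) set). lborel) borel (\<lambda>y. \<Sum>b\<in>Basis. y b *\<^sub>R b))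
      (\<lambda>x::real^'d. \<Prod>i\<in>UNIV. f i (x $ i))"
    using I by (subst integrable_distr_eq) (simp_all only: eq, measurable)
  then show "integrable lborel (\<lambda>x::real^'d. \<Prod>i\<in>UNIV. f i (x $ i))"
    by (simp add: lborel_eq[symmetric])
  have "(\<integral>(x::real^'d). (\<Prod>i\<in>UNIV. f i (x $ i)) \<partial>lborel) =
     (\<integral>x. (\<Prod>i\<in>UNIV. f i (x $ i)) \<partial>distr (\<Pi>\<^sub>M b\<in>(Basis::(real^'d) set). lborel) borel (\<lambda>y. \<Sum>b\<in>Basis. y b *\<^sub>R b))"
    by (simp add: lborel_eq[symmetric])
  also have "\<dots> = (\<integral>y. (\<Prod>b\<in>Basis. g b (y b)) \<partial>(\<Pi>\<^sub>M b\<in>(Basis::(real^'d) set). lborel))"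
    by (subst integral_distr) (simp_all only: eq, measurable)
  also have "\<dots> = (\<Prod>b\<in>(Basis::(real^'d) set). integral\<^sup>L lborel (g b))"
    by (intro product_integral_prod gint) simp
  also have "\<dots> = (\<Prod>i\<in>UNIV. \<integral>s. f i s \<partial>lborel)"
    by (simp add: Basis prod.reindex[OF inj] idx)
  finally show "(\<integral>(x::real^'d). (\<Prod>i\<in>UNIV. f i (x $ i)) \<partial>lborel) = (\<Prod>i\<in>UNIV. \<integral>s. f i s \<partial>lborel)" .
qed

lemma gaussian_integral: "has_bochner_integral lborel (\<lambda>x::real. exp (- x\<^sup>2)) (sqrt pi)"
  using has_bochner_integral_even_function[OF gaussian_moment_0] by simp

lemma integrable_gaussian_real:
  assumes "0 < s" shows "integrable lborel (\<lambda>x::real. exp (- s * x\<^sup>2))"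
proof -
  have "integrable lborel (\<lambda>x::real. exp (- x\<^sup>2))"
    using gaussian_integral by (simp add: has_bochner_integral_iff)
  then have "integrable lborel (\<lambda>x::real. exp (- (0 + sqrt s * x)\<^sup>2))"
    by (rule lborel_integrable_real_affine) (use assms in simp)
  then show ?thesis using assms by (simp add: power_mult_distrib)
qed

lemma norm_power2_vec: "(norm (x :: real^'d))\<^sup>2 = (\<Sum>i\<in>UNIV. (x $ i)\<^sup>2)"
  by (simp add: norm_vec_def L2_set_def sum_nonneg)

lemma integrable_gaussian_vec:
  assumes "0 < s" shows "integrable lborel (\<lambda>x::real^'d. exp (- s * (norm x)\<^sup>2))"
proof -
  have "(\<lambda>x::real^'d. exp (- s * (norm x)\<^sup>2)) = (\<lambda>x. \<Prod>i\<in>UNIV. exp (- s * (x $ i)\<^sup>2))"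
    by (simp add: norm_power2_vec exp_sum[symmetric] sum_distrib_left)
  then show ?thesis
    using lborel_prod_coordinates(1)[of "\<lambda>_ s'. exp (- s * s'\<^sup>2)"] integrable_gaussian_real[OF assms]
    by simp
qed

section \<open>Hermite functions\<close>

text \<open>The recursion is what one more derivative of the Gaussian produces, see
  \<open>iterated_deriv_gaussian\<close>.\<close>

primrec hpoly :: "nat \<Rightarrow> real poly" where
  "hpoly 0 = 1"
| "hpoly (Suc k) = [:0, 2:] * hpoly k - pderiv (hpoly k)"

lemma iterated_deriv_gaussian:
  "(deriv ^^ k) (\<lambda>y. exp (- (y\<^sup>2))) = (\<lambda>x. (-1) ^ k * poly (hpoly k) x * exp (- (x\<^sup>2)))"
proof (induction k)
  case (Suc k)
  have "((\<lambda>x. (-1) ^ k * poly (hpoly k) x * exp (- (x\<^sup>2))) has_real_derivative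
      (-1) ^ Suc k * poly (hpoly (Suc k)) x * exp (- (x\<^sup>2))) (at x)" for x :: real
    by (rule derivative_eq_intros poly_DERIV refl)+ (simp add: algebra_simps)
  then show ?case by (simp only: funpow.simps o_def Suc) (auto intro!: DERIV_imp_deriv)
qed simp

lemma Hermite_poly_eq: "Hermite_poly k x = poly (hpoly k) x"
proof -
  have "Hermite_poly k x = ((-1) ^ k * (-1) ^ k) * (exp (x\<^sup>2) * exp (- (x\<^sup>2))) * poly (hpoly k) x"
    by (simp only: Hermite_poly_def iterated_deriv_gaussian) (simp only: mult_ac)
  then show ?thesis by (simp only: power_mult_distrib[symmetric] exp_add[symmetric]) simp
qed

lemma pderiv_hpoly: "pderiv (hpoly k) = smult (2 * real k) (hpoly (k - 1))"
proof (induction k)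
  case (Suc k)
  \<comment> \<open>Hermite's differential equation. It follows from the induction hypothesis and
    the recursion, and it closes the induction.\<close>
  have k: "[:0, 2:] * pderiv (hpoly k) - pderiv (pderiv (hpoly k)) = smult (2 * real k) (hpoly k)"
  proof (cases k)
    case (Suc j)
    show ?thesis
      unfolding Suc.IH pderiv_smult by (simp add: Suc smult_diff_right del: smult_pCons mult_pCons_left)
  qed simp
  have "pderiv (hpoly (Suc k)) = smult 2 (hpoly k) + ([:0, 2:] * pderiv (hpoly k) - pderiv (pderiv (hpoly k)))"
    by (simp add: pderiv_diff pderiv_mult pderiv_pCons pderiv_smult)
  also have "\<dots> = smult (2 * real (Suc k)) (hpoly k)"
    unfolding k by (simp add: smult_add_left[symmetric])
  finally show ?case by simp
qed simp

lemma powr_minus_half: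
  assumes "0 \<le> (x::real)" shows "x powr (- 1 / 2) = 1 / sqrt x"
proof -
  have "x powr (- 1 / 2) = x powr (- (1 / 2))" by (simp only: minus_divide_left)
  then show ?thesis by (simp only: powr_minus powr_half_sqrt[OF assms] inverse_eq_divide)
qed

definition hconst :: "nat \<Rightarrow> real" where
  "hconst k = (2 ^ k * fact k * sqrt pi) powr (- 1 / 2)"

lemma hermite1_eq: "hermite1 k x = hconst k * exp (- (x\<^sup>2) / 2) * poly (hpoly k) x"
  by (simp add: hermite1_def hconst_def Hermite_poly_eq)

lemma hconst_pos: "hconst k > 0"
  by (simp add: hconst_def)

lemma hconst_Suc: "hconst k = sqrt (2 * (real k + 1)) * hconst (Suc k)"
proof -
  have "(2 ^ Suc k * fact (Suc k) * sqrt pi :: real) = (2 * (real k + 1)) * (2 ^ k * fact k * sqrt pi)"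
    by (simp add: algebra_simps)
  then have "hconst (Suc k) = ((2 * (real k + 1)) * (2 ^ k * fact k * sqrt pi)) powr (- 1 / 2)"
    by (simp only: hconst_def)
  also have "\<dots> = (2 * (real k + 1)) powr (- 1 / 2) * hconst k"
    unfolding hconst_def by (rule powr_mult)
  also have "(2 * (real k + 1)) powr (- 1 / 2) = 1 / sqrt (2 * (real k + 1))"
    by (rule powr_minus_half) simp
  finally show ?thesis by simp
qed

lemma hermite1_deriv_up:
  "(hermite1 k has_real_derivative x * hermite1 k x - sqrt (2 * (real k + 1)) * hermite1 (Suc k) x) (at x)"
proof -
  have e: "((\<lambda>x. exp (- (x\<^sup>2) / 2)) has_real_derivative - x * exp (- (x\<^sup>2) / 2)) (at x)"
    by (auto intro!: derivative_eq_intros)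
  have "((\<lambda>x. hconst k * exp (- (x\<^sup>2) / 2) * poly (hpoly k) x) has_real_derivative
     hconst k * exp (- (x\<^sup>2) / 2) * (poly (pderiv (hpoly k)) x - x * poly (hpoly k) x)) (at x)"
    by (rule DERIV_cong[OF DERIV_mult[OF DERIV_cmult[OF e] poly_DERIV]]) (simp add: algebra_simps)
  moreover have "hconst k * exp (- (x\<^sup>2) / 2) * (poly (pderiv (hpoly k)) x - x * poly (hpoly k) x)
     = x * hermite1 k x - sqrt (2 * (real k + 1)) * hermite1 (Suc k) x"
    unfolding hermite1_eq by (simp only: mult.assoc[symmetric] hconst_Suc[of k, symmetric])
       (simp add: algebra_simps)
  ultimately show ?thesis unfolding hermite1_eq[abs_def] by simp
qed

text \<open>The three-term recurrence in normalised form; comparing it with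
  \<open>hermite1_deriv_up\<close> yields \<open>hermite1_deriv_down\<close>. At k = 0 the truncated
  index \<open>k - 1\<close> is harmless, since its coefficient \<open>sqrt (2 * real k)\<close> is
  0.\<close>

lemma hermite1_recurrence:
  "2 * x * hermite1 k x = sqrt (2 * (real k + 1)) * hermite1 (Suc k) x + sqrt (2 * real k) * hermite1 (k - 1) x"
proof -
  have 1: "sqrt (2 * (real k + 1)) * hermite1 (Suc k) x
     = hconst k * exp (- (x\<^sup>2) / 2) * (2 * x * poly (hpoly k) x - poly (pderiv (hpoly k)) x)"
    unfolding hermite1_eq by (simp only: mult.assoc[symmetric] hconst_Suc[of k, symmetric])
       (simp add: algebra_simps)
  have 2: "sqrt (2 * real k) * hermite1 (k - 1) x = hconst k * exp (- (x\<^sup>2) / 2) * poly (pderiv (hpoly k)) x"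
  proof (cases k)
    case (Suc j)
    have "sqrt (2 * real k) * hconst j = (sqrt (2 * real k) * sqrt (2 * real k)) * hconst k"
      using Suc by (subst hconst_Suc) (simp add: add.commute)
    also have "\<dots> = 2 * real k * hconst k" by simp
    finally have e: "sqrt (2 * real k) * hconst j = 2 * real k * hconst k" .
    have "sqrt (2 * real k) * hermite1 (k - 1) x = (sqrt (2 * real k) * hconst j) * exp (- (x\<^sup>2) / 2) * poly (hpoly j) x"
      using Suc by (simp add: hermite1_eq)
    then show ?thesis
      unfolding e pderiv_hpoly using Suc by simp
  qed simp
  show ?thesis unfolding 1 2 by (simp add: hermite1_eq algebra_simps)
qed

lemma hermite1_deriv_down:
  "(hermite1 k has_real_derivative sqrt (2 * real k) * hermite1 (k - 1) x - x * hermite1 k x) (at x)"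
proof (rule DERIV_cong[OF hermite1_deriv_up])
  show "x * hermite1 k x - sqrt (2 * (real k + 1)) * hermite1 (Suc k) x
      = sqrt (2 * real k) * hermite1 (k - 1) x - x * hermite1 k x"
    using hermite1_recurrence[of x k] by linarith
qed

text \<open>Each degree contributes one factor \<open>x\<close>, which is absorbed by half of the
  exponent; hence the induction runs over all \<open>e\<close> at once.\<close>

lemma poly_exp_bound:
  fixes p :: "real poly"
  assumes "0 < e"
  shows "\<exists>C\<ge>0. \<forall>x. \<bar>poly p x\<bar> \<le> C * exp (e * x\<^sup>2)"
  using assms
proof (induction p arbitrary: e)
  case 0
  show ?case by (intro exI[of _ 0]) simp
next
  case (pCons a p)
  obtain C where C: "C \<ge> 0" "\<And>x. \<bar>poly p x\<bar> \<le> C * exp (e / 2 * x\<^sup>2)"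
    using pCons.IH[of "e / 2"] pCons.prems by auto
  \<comment> \<open>Chosen so that both \<open>D\<close> and \<open>D * e / 2\<close> are at least
    1.\<close>
  define D where "D = 1 + 2 / e"
  have D: "\<bar>x\<bar> \<le> D * exp (e / 2 * x\<^sup>2)" for x :: real
  proof -
    have "\<bar>x\<bar> \<le> 1 + x\<^sup>2" using zero_le_power2[of "\<bar>x\<bar> - 1 / 2"] by (simp add: power2_diff power_divide)
    also have "\<dots> \<le> D * (1 + e / 2 * x\<^sup>2)"
      using pCons.prems by (simp add: D_def field_simps)
    also have "\<dots> \<le> D * exp (e / 2 * x\<^sup>2)"
      using pCons.prems by (intro mult_left_mono) (auto simp: D_def)
    finally show ?thesis .
  qed
  have "\<bar>poly (pCons a p) x\<bar> \<le> (\<bar>a\<bar> + D * C) * exp (e * x\<^sup>2)" for x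
  proof -
    have "\<bar>poly (pCons a p) x\<bar> \<le> \<bar>a\<bar> + \<bar>x\<bar> * \<bar>poly p x\<bar>" by (simp add: abs_mult[symmetric])
    also have "\<bar>x\<bar> * \<bar>poly p x\<bar> \<le> (D * exp (e / 2 * x\<^sup>2)) * (C * exp (e / 2 * x\<^sup>2))"
      using C D[of x] by (intro mult_mono) auto
    also have "\<dots> = D * C * exp (e * x\<^sup>2)"
      by (simp add: exp_add[symmetric] mult_exp_exp)
    also have "\<bar>a\<bar> \<le> \<bar>a\<bar> * exp (e * x\<^sup>2)"
      using pCons.prems mult_left_mono[of 1 "exp (e * x\<^sup>2)" "\<bar>a\<bar>"] by simp
    finally show ?thesis by (simp add: algebra_simps)
  qed
  then show ?case using C pCons.prems by (intro exI[of _ "\<bar>a\<bar> + D * C"]) (auto simp: D_def)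
qed

lemma hermite1_bound:
  assumes "0 < e"
  shows "\<exists>C\<ge>0. \<forall>x. \<bar>hermite1 k x\<bar> \<le> C * exp (- (1 / 2 - e) * x\<^sup>2)"
proof -
  obtain C where C: "C \<ge> 0" "\<And>x. \<bar>poly (hpoly k) x\<bar> \<le> C * exp (e * x\<^sup>2)"
    using poly_exp_bound[OF assms, of "hpoly k"] by auto
  have "\<bar>hermite1 k x\<bar> \<le> (hconst k * C) * exp (- (1 / 2 - e) * x\<^sup>2)" for x
  proof -
    have "\<bar>hermite1 k x\<bar> = hconst k * exp (- (x\<^sup>2) / 2) * \<bar>poly (hpoly k) x\<bar>"
      using hconst_pos[of k] by (simp add: hermite1_eq abs_mult)
    also have "\<dots> \<le> hconst k * exp (- (x\<^sup>2) / 2) * (C * exp (e * x\<^sup>2))"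
      using C hconst_pos[of k] by (intro mult_left_mono) auto
    also have "\<dots> = (hconst k * C) * exp (- (x\<^sup>2) / 2 + e * x\<^sup>2)"
      by (simp only: exp_add) (simp only: mult_ac)
    also have "- (x\<^sup>2) / 2 + e * x\<^sup>2 = - (1 / 2 - e) * x\<^sup>2" by (simp add: algebra_simps)
    finally show ?thesis .
  qed
  then show ?thesis using C hconst_pos[of k] by (intro exI[of _ "hconst k * C"]) auto
qed

lemma continuous_on_hermite1: "continuous_on S (hermite1 k)"
  by (rule DERIV_continuous_on[OF has_field_derivative_at_within[OF hermite1_deriv_up]])

lemma borel_measurable_hermite1 [measurable]: "hermite1 k \<in> borel_measurable borel"
  by (intro borel_measurable_continuous_onI continuous_on_hermite1)

lemma integrable_gaussian_dominated_real:
  fixes f :: "real \<Rightarrow> real"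
  assumes "f \<in> borel_measurable borel" "0 < s" "\<And>x. \<bar>f x\<bar> \<le> C * exp (- s * x\<^sup>2)"
  shows "integrable lborel f"
proof (rule Bochner_Integration.integrable_bound)
  show "integrable lborel (\<lambda>x::real. C * exp (- s * x\<^sup>2))"
    using integrable_gaussian_real[OF assms(2)] by simp
  show "AE x in lborel. norm (f x) \<le> norm (C * exp (- s * x\<^sup>2))"
    using assms(3) by (intro AE_I2) (smt (verit) real_norm_def)
qed (use assms in simp)

lemma hermite1_mult_bound:
  "\<exists>C\<ge>0. \<forall>x. \<bar>hermite1 k x * hermite1 m x\<bar> \<le> C * exp (- (1 / 2) * x\<^sup>2)"
proof -
  obtain C where C: "C \<ge> 0" "\<And>x. \<bar>hermite1 k x\<bar> \<le> C * exp (- (1 / 2 - 1 / 4) * x\<^sup>2)"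
    using hermite1_bound[of "1/4" k] by auto
  obtain D where D: "D \<ge> 0" "\<And>x. \<bar>hermite1 m x\<bar> \<le> D * exp (- (1 / 2 - 1 / 4) * x\<^sup>2)"
    using hermite1_bound[of "1/4" m] by auto
  have "\<bar>hermite1 k x * hermite1 m x\<bar> \<le> (C * D) * exp (- (1 / 2) * x\<^sup>2)" for x
  proof -
    have "\<bar>hermite1 k x\<bar> * \<bar>hermite1 m x\<bar> \<le> (C * exp (- (1 / 2 - 1 / 4) * x\<^sup>2)) * (D * exp (- (1 / 2 - 1 / 4) * x\<^sup>2))"
      using C D by (intro mult_mono) auto
    also have "\<dots> = (C * D) * exp (- (1 / 2 - 1 / 4) * x\<^sup>2 + - (1 / 2 - 1 / 4) * x\<^sup>2)"
      by (simp only: exp_add) (simp add: mult_ac)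
    also have "- (1 / 2 - 1 / 4) * x\<^sup>2 + - (1 / 2 - 1 / 4) * x\<^sup>2 = - (1 / 2) * x\<^sup>2" by simp
    finally show ?thesis by (simp add: abs_mult)
  qed
  then show ?thesis using C D by (intro exI[of _ "C * D"]) auto
qed

lemma integrable_hermite1_mult: "integrable lborel (\<lambda>x. hermite1 k x * hermite1 m x)"
proof -
  obtain C where "\<And>x. \<bar>hermite1 k x * hermite1 m x\<bar> \<le> C * exp (- (1 / 2) * x\<^sup>2)"
    using hermite1_mult_bound by blast
  then show ?thesis by (intro integrable_gaussian_dominated_real[where s = "1/2"]) auto
qed

text \<open>Raising is adjoint to lowering. The product of the two functions is differentiated with
  the raising formula on the first factor and the lowering formula on the second, so that the terms
  with \<open>x\<close> cancel; the derivative has integral 0.\<close>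

lemma hermite1_adjoint:
  "sqrt (2 * (real k + 1)) * (\<integral>x. hermite1 (Suc k) x * hermite1 m x \<partial>lborel)
     = sqrt (2 * real m) * (\<integral>x. hermite1 k x * hermite1 (m - 1) x \<partial>lborel)"
proof -
  define f' where "f' x = sqrt (2 * real m) * (hermite1 k x * hermite1 (m - 1) x)
      - sqrt (2 * (real k + 1)) * (hermite1 (Suc k) x * hermite1 m x)" for x
  have "((\<lambda>x. hermite1 k x * hermite1 m x) has_real_derivative f' x) (at x)" for x
    by (rule DERIV_cong[OF DERIV_mult[OF hermite1_deriv_up hermite1_deriv_down]])
       (simp add: f'_def algebra_simps)
  then have der: "((\<lambda>s. hermite1 k (x + s *\<^sub>R 1) * hermite1 m (x + s *\<^sub>R 1)) has_real_derivative f' x) (at 0)" for x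
    using DERIV_shift[of "\<lambda>x. hermite1 k x * hermite1 m x" "f' x" 0 x] by (simp add: add.commute)
  have "(\<integral>x. f' x \<partial>lborel) = 0"
  proof (rule integral_directional_derivative_eq_0[OF der])
    show "continuous_on UNIV f'"
      unfolding f'_def by (intro continuous_intros continuous_on_hermite1)
    show "integrable lborel f'"
      unfolding f'_def by (intro Bochner_Integration.integrable_diff integrable_mult_right integrable_hermite1_mult)
  qed (rule integrable_hermite1_mult)
  then show ?thesis
    by (simp add: f'_def integrable_hermite1_mult)
qed

lemma hermite1_0: "hermite1 0 x = pi powr (- 1 / 4) * exp (- (x\<^sup>2) / 2)"
  using powr_powr[of pi "1/2" "-1/2"] by (simp add: hermite1_eq hconst_def powr_half_sqrt)

text \<open>Induction on k, since \<open>hermite1_adjoint\<close> lowers both indices. For index 0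
  against \<open>Suc j\<close> the same identity has the coefficient \<open>sqrt 0\<close> on one
  side, which gives orthogonality to the ground state.\<close>

lemma hermite1_orthonormal:
  "(\<integral>x. hermite1 k x * hermite1 m x \<partial>lborel) = (if k = m then 1 else 0)"
proof (induction k arbitrary: m)
  case 0
  show ?case
  proof (cases m)
    case 0
    have "hermite1 0 x * hermite1 0 x = pi powr (- 1 / 2) * exp (- x\<^sup>2)" for x
    proof -
      have "hermite1 0 x * hermite1 0 x = (pi powr (- 1 / 4) * pi powr (- 1 / 4)) * (exp (- (x\<^sup>2) / 2) * exp (- (x\<^sup>2) / 2))"
        by (simp add: hermite1_0)
      also have "\<dots> = pi powr (- 1 / 2) * exp (- x\<^sup>2)"
        by (simp only: powr_add[symmetric] exp_add[symmetric]) simp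
      finally show ?thesis .
    qed
    moreover have "pi powr (- 1 / 2) * sqrt pi = 1"
      by (subst powr_minus_half) auto
    ultimately show ?thesis
      using gaussian_integral 0 by (simp add: has_bochner_integral_iff)
  next
    case (Suc j)
    have "sqrt (2 * (real j + 1)) * (\<integral>x. hermite1 (Suc j) x * hermite1 0 x \<partial>lborel) = 0"
      using hermite1_adjoint[of j 0] by simp
    then show ?thesis using Suc by (simp add: mult.commute)
  qed
next
  case (Suc k)
  have "sqrt (2 * (real k + 1)) * (\<integral>x. hermite1 (Suc k) x * hermite1 m x \<partial>lborel)
     = sqrt (2 * real m) * (if k = m - 1 then 1 else 0)"
    unfolding hermite1_adjoint Suc.IH ..
  then show ?case
    by (cases m) (auto split: if_splits simp: add.commute)
qed

section \<open>Hermite functions in several variables\<close>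

definition upd_index :: "nat ^ 'd \<Rightarrow> 'd \<Rightarrow> nat \<Rightarrow> nat ^ 'd" where
  "upd_index n i k = (\<chi> j. if j = i then k else n $ j)"

abbreviation raise :: "'d \<Rightarrow> nat ^ 'd \<Rightarrow> nat ^ 'd" where
  "raise i n \<equiv> upd_index n i (n $ i + 1)"

abbreviation lower :: "'d \<Rightarrow> nat ^ 'd \<Rightarrow> nat ^ 'd" where
  "lower i n \<equiv> upd_index n i (n $ i - 1)"

lemma upd_index_nth [simp]: "upd_index n i k $ j = (if j = i then k else n $ j)"
  by (simp add: upd_index_def)

lemma upd_index_same [simp]: "upd_index n i (n $ i) = n"
  by (simp add: vec_eq_iff)

lemma eigval_raise: "eigval (raise i n) = eigval n + 2"
proof -
  have "(\<Sum>j\<in>UNIV. raise i n $ j) = (\<Sum>j\<in>UNIV. n $ j + (if j = i then 1 else 0))"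
    by (intro sum.cong) auto
  then show ?thesis by (simp add: eigval_def sum.distrib)
qed

lemma eigval_ge_1: "eigval (n :: nat ^ 'd) \<ge> 1"
proof -
  have "real CARD('d) \<ge> 1" by (simp add: Suc_leI)
  moreover have "0 \<le> (\<Sum>i\<in>UNIV. real (n $ i))" by (intro sum_nonneg) simp
  ultimately show ?thesis unfolding eigval_def of_nat_sum by linarith
qed

lemma hermite_upd_line:
  "hermite (upd_index n i k) (x + s *\<^sub>R axis i 1)
     = hermite1 k (x $ i + s) * (\<Prod>j\<in>UNIV - {i}. hermite1 (n $ j) (x $ j))"
proof -
  have "hermite (upd_index n i k) (x + s *\<^sub>R axis i 1)
      = (\<Prod>j\<in>insert i (UNIV - {i}). hermite1 (upd_index n i k $ j) ((x + s *\<^sub>R axis i 1) $ j))"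
    by (simp add: hermite_def insert_absorb)
  also have "\<dots> = hermite1 k (x $ i + s) * (\<Prod>j\<in>UNIV - {i}. hermite1 (upd_index n i k $ j) ((x + s *\<^sub>R axis i 1) $ j))"
    by (subst prod.insert) (auto simp: axis_def)
  also have "(\<Prod>j\<in>UNIV - {i}. hermite1 (upd_index n i k $ j) ((x + s *\<^sub>R axis i 1) $ j))
     = (\<Prod>j\<in>UNIV - {i}. hermite1 (n $ j) (x $ j))"
    by (intro prod.cong) (auto simp: axis_def)
  finally show ?thesis .
qed

lemmas hermite_upd = hermite_upd_line[where s = 0, simplified]

lemma hermite_coord_mult:
  "2 * x $ i * hermite n x
     = sqrt (2 * (real (n $ i) + 1)) * hermite (raise i n) x + sqrt (2 * real (n $ i)) * hermite (lower i n) x"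
proof -
  define P where "P = (\<Prod>j\<in>UNIV - {i}. hermite1 (n $ j) (x $ j))"
  have "hermite n x = hermite1 (n $ i) (x $ i) * P"
    using hermite_upd[of n i "n $ i" x] by (simp add: P_def)
  then have "2 * x $ i * hermite n x = (2 * x $ i * hermite1 (n $ i) (x $ i)) * P" by simp
  then show ?thesis
    unfolding hermite1_recurrence hermite_upd P_def[symmetric] by (simp add: algebra_simps)
qed

text \<open>In this form the difference of \<open>x $ i * hermite n x\<close> and the derivative is
  a single raised Hermite function, which is the action of \<open>delta_star i\<close>.\<close>

definition hermite_dx :: "'d \<Rightarrow> nat ^ 'd \<Rightarrow> real ^ 'd \<Rightarrow> real" where
  "hermite_dx i n x = x $ i * hermite n x - sqrt (2 * (real (n $ i) + 1)) * hermite (raise i n) x"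

text \<open>The eigenvalue equation of the one-dimensional oscillator, solved for the second
  derivative.\<close>

definition hermite_dxx :: "'d \<Rightarrow> nat ^ 'd \<Rightarrow> real ^ 'd \<Rightarrow> real" where
  "hermite_dxx i n x = ((x $ i)\<^sup>2 - (2 * real (n $ i) + 1)) * hermite n x"

lemma hermite_has_deriv_0:
  "((\<lambda>s. hermite n (x + s *\<^sub>R axis i 1)) has_real_derivative hermite_dx i n x) (at 0)"
proof -
  define P where "P = (\<Prod>j\<in>UNIV - {i}. hermite1 (n $ j) (x $ j))"
  have "((\<lambda>s. hermite1 (n $ i) (x $ i + s)) has_real_derivative
     x $ i * hermite1 (n $ i) (x $ i) - sqrt (2 * (real (n $ i) + 1)) * hermite1 (Suc (n $ i)) (x $ i)) (at 0)"
    using hermite1_deriv_up[of "n $ i" "x $ i"] DERIV_shift[of "hermite1 (n $ i)" _ 0 "x $ i"]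
    by (simp add: add.commute)
  from DERIV_cmult_right[OF this, of P]
  show ?thesis
    unfolding hermite_upd_line[of n i "n $ i", unfolded upd_index_same] P_def[symmetric]
    by (rule DERIV_cong)
       (use hermite_upd[of n i "n $ i" x] hermite_upd[of n i "Suc (n $ i)" x] in
          \<open>simp add: hermite_dx_def P_def algebra_simps\<close>)
qed

lemma hermite_has_deriv:
  "((\<lambda>s. hermite n (x + s *\<^sub>R axis i 1)) has_real_derivative hermite_dx i n (x + s *\<^sub>R axis i 1)) (at s)"
  using hermite_has_deriv_0[of n "x + s *\<^sub>R axis i 1" i]
    DERIV_shift[of "\<lambda>s. hermite n (x + s *\<^sub>R axis i 1)" _ 0 s]
  by (simp add: algebra_simps)

lemma hermite_dx_has_deriv:
  "((\<lambda>s. hermite_dx i n (x + s *\<^sub>R axis i 1)) has_real_derivative hermite_dxx i n (x + s *\<^sub>R axis i 1)) (at s)"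
proof -
  let ?x = "\<lambda>s. x + s *\<^sub>R axis i 1"
  let ?r = "sqrt (2 * (real (n $ i) + 1))"
  have low: "lower i (raise i n) = n"
    by (simp add: vec_eq_iff)
  \<comment> \<open>At the raised index the derivative is rewritten in its lowering form, so that
    the second derivative returns to \<open>n\<close> instead of climbing by two.\<close>
  have up: "hermite_dx i (raise i n) y = ?r * hermite n y - y $ i * hermite (raise i n) y" for y
    using hermite_coord_mult[of y i "raise i n"] low unfolding hermite_dx_def
    by (simp add: algebra_simps)
  have "((\<lambda>s. ?x s $ i * hermite n (?x s) - ?r * hermite (raise i n) (?x s)) has_real_derivative
     1 * hermite n (?x s) + hermite_dx i n (?x s) * (?x s $ i) - ?r * hermite_dx i (raise i n) (?x s)) (at s)"
    by (intro DERIV_diff DERIV_cmult DERIV_mult hermite_has_deriv)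
       (auto intro!: derivative_eq_intros simp: axis_def)
  note der = this
  have "1 * hermite n y + hermite_dx i n y * (y $ i) - ?r * hermite_dx i (raise i n) y = hermite_dxx i n y" for y
  proof -
    have "?r * ?r = 2 * (real (n $ i) + 1)" by (rule real_sqrt_mult_self[THEN trans]) simp
    then have "?r * (?r * hermite n y) = 2 * (real (n $ i) + 1) * hermite n y"
      by (simp only: mult.assoc[symmetric])
    then show ?thesis
      unfolding up unfolding hermite_dx_def hermite_dxx_def right_diff_distrib
      by (simp add: algebra_simps power2_eq_square)
  qed
  from der[unfolded this] show ?thesis by (simp only: hermite_dx_def)
qed

lemma sum_hermite_dxx: "(\<Sum>i\<in>UNIV. hermite_dxx i n x) = ((norm x)\<^sup>2 - eigval n) * hermite n x"
  by (simp add: hermite_dxx_def sum_distrib_right[symmetric] sum_subtractf norm_power2_vec eigval_def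
      sum.distrib sum_distrib_left)

lemma delta_star_hermite:
  "delta_star i (hermite n) x = sqrt (2 * (real (n $ i) + 1)) * hermite (raise i n) x"
  using DERIV_imp_deriv[OF hermite_has_deriv_0[of n x i]]
  by (simp add: delta_star_def partial_deriv_def hermite_dx_def)

lemma continuous_on_hermite: "continuous_on S (hermite n)"
  unfolding hermite_def
  by (intro continuous_intros continuous_on_compose2[OF continuous_on_hermite1[of UNIV]]) auto

lemma borel_measurable_hermite [measurable]: "hermite n \<in> borel_measurable borel"
  by (intro borel_measurable_continuous_onI continuous_on_hermite)

lemma hermite_bound:
  assumes "0 < e"
  shows "\<exists>C\<ge>0. \<forall>x. \<bar>hermite n x\<bar> \<le> C * exp (- (1 / 2 - e) * (norm x)\<^sup>2)"
proof -
  have "\<exists>C. \<forall>i. C i \<ge> 0 \<and> (\<forall>x. \<bar>hermite1 (n $ i) x\<bar> \<le> C i * exp (- (1 / 2 - e) * x\<^sup>2))"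
    using hermite1_bound[OF assms] by (intro choice) blast
  then obtain C where C: "\<And>i. C i \<ge> 0" "\<And>i x. \<bar>hermite1 (n $ i) x\<bar> \<le> C i * exp (- (1 / 2 - e) * x\<^sup>2)"
    by blast
  have "\<bar>hermite n x\<bar> \<le> (\<Prod>i\<in>UNIV. C i) * exp (- (1 / 2 - e) * (norm x)\<^sup>2)" for x
  proof -
    have "\<bar>hermite n x\<bar> \<le> (\<Prod>i\<in>UNIV. C i * exp (- (1 / 2 - e) * (x $ i)\<^sup>2))"
      unfolding hermite_def abs_prod by (intro prod_mono) (use C in auto)
    also have "\<dots> = (\<Prod>i\<in>UNIV. C i) * exp (- (1 / 2 - e) * (norm x)\<^sup>2)"
      by (simp only: prod.distrib norm_power2_vec exp_sum[symmetric] sum_distrib_left finite)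
    finally show ?thesis .
  qed
  then show ?thesis using C by (intro exI[of _ "\<Prod>i\<in>UNIV. C i"]) (auto intro!: prod_nonneg)
qed

lemma hermite_orthonormal:
  "integrable lborel (\<lambda>x. hermite n x * hermite m x)"
  "(\<integral>x. hermite n x * hermite m x \<partial>lborel) = (if n = m then 1 else 0)"
proof -
  have eq: "hermite n x * hermite m x = (\<Prod>i\<in>UNIV. (\<lambda>s. hermite1 (n $ i) s * hermite1 (m $ i) s) (x $ i))" for x
    by (simp add: hermite_def prod.distrib)
  show "integrable lborel (\<lambda>x. hermite n x * hermite m x)"
    unfolding eq by (rule lborel_prod_coordinates(1)) (rule integrable_hermite1_mult)
  have "(\<integral>x. hermite n x * hermite m x \<partial>lborel) = (\<Prod>i\<in>UNIV. if n $ i = m $ i then 1 else 0)"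
    unfolding eq
    by (subst lborel_prod_coordinates(2)) (simp_all only: integrable_hermite1_mult hermite1_orthonormal)
  also have "\<dots> = (if n = m then 1 else 0)"
    by (auto simp: vec_eq_iff prod_zero_iff intro: exI)
  finally show "(\<integral>x. hermite n x * hermite m x \<partial>lborel) = (if n = m then 1 else 0)" .
qed

lemma hermite_0: "hermite (0 :: nat ^ 'd) x = (pi powr (- 1 / 4)) ^ CARD('d) * exp (- ((norm x)\<^sup>2) / 2)"
proof -
  have "hermite (0 :: nat ^ 'd) x = (\<Prod>i\<in>(UNIV :: 'd set). pi powr (- 1 / 4)) * (\<Prod>i\<in>UNIV. exp (- ((x $ i)\<^sup>2) / 2))"
    unfolding hermite_def by (simp add: hermite1_0 prod.distrib)
  also have "(\<Prod>i\<in>UNIV. exp (- ((x $ i)\<^sup>2) / 2)) = exp (\<Sum>i\<in>UNIV. - ((x $ i)\<^sup>2) / 2)"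
    by (simp add: exp_sum)
  also have "(\<Sum>i\<in>UNIV. - ((x $ i)\<^sup>2) / 2) = - ((norm x)\<^sup>2) / 2"
    by (simp add: norm_power2_vec sum_negf sum_divide_distrib)
  finally show ?thesis by simp
qed

section \<open>The Bellman function\<close>

lemma DERIV_powr_log:
  fixes f :: "real \<Rightarrow> real"
  assumes "(f has_real_derivative f') (at s)" "0 < f s"
  shows "((\<lambda>s. f s powr r) has_real_derivative r * (f s powr r) * (f' / f s)) (at s)"
proof -
  have "((\<lambda>s. f s powr r) has_real_derivative (r * f s powr (r - 1)) * f') (at s)"
    by (rule DERIV_chain2[OF has_real_derivative_powr[OF assms(2)] assms(1)])
  moreover have "(r * f s powr (r - 1)) * f' = r * (f s powr r) * (f' / f s)"
    using assms(2) by (simp add: powr_diff)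
  ultimately show ?thesis by simp
qed

text \<open>The first variable always carries an exponent of at least 2. For p < 2 the two waves
  exchange roles and the conjugate exponent takes the place of \<open>P\<close>.\<close>

locale bellman =
  fixes P Q :: real
  assumes P_ge_2: "2 \<le> P" and conj: "1 / P + 1 / Q = 1"
begin

definition al :: real where "al = P / 2"
definition be :: real where "be = Q / 2"
definition th :: real where "th = 1 - 2 / P"
text \<open>With this value \<open>8 * dl = Q * (Q - 1)\<close>, the constant in the second
  derivative of |v|^Q, and \<open>1 / dl = 8 * (P - 1) / Q\<close>, which is the source of the
  linear growth of the final bound in \<open>P\<close>.\<close>

definition dl :: real where "dl = Q * (Q - 1) / 8"

lemma Q_eq: "Q = P / (P - 1)"
proof -
  have "1 / Q = (P - 1) / P" using conj P_ge_2 by (simp add: field_simps)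
  then show ?thesis by (metis inverse_eq_divide inverse_divide inverse_inverse_eq)
qed

lemma Q_bounds: "1 < Q" "Q \<le> 2"
  using P_ge_2 by (auto simp: Q_eq field_simps)

lemma PQ: "P * (Q - 1) = Q"
  using P_ge_2 by (simp add: Q_eq field_simps)

lemma al_ge: "1 \<le> al" and be_bounds: "1 / 2 < be" "be \<le> 1"
  using P_ge_2 Q_bounds by (auto simp: al_def be_def)

lemma th_bounds: "0 \<le> th" "th < 1"
  using P_ge_2 by (auto simp: th_def field_simps)

lemma al_th: "al * (1 - th) = 1"
  using P_ge_2 by (simp add: al_def th_def)

lemma be_th: "be * (1 - th) = 2 * be - 1" "be * th = 1 - be"
proof -
  have "Q / P = Q - 1" using PQ P_ge_2 by (simp add: field_simps)
  then show "be * (1 - th) = 2 * be - 1" by (simp add: be_def th_def)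
  then show "be * th = 1 - be" by (simp add: algebra_simps)
qed

lemma dl_bounds: "0 < dl" "dl \<le> 1 / 4"
proof -
  show "0 < dl" using Q_bounds by (simp add: dl_def)
  have "Q * (Q - 1) \<le> 2 * 1" using Q_bounds by (intro mult_mono) auto
  then show "dl \<le> 1 / 4" by (simp add: dl_def)
qed

lemma dl_be: "8 * dl = 2 * be * (2 * be - 1)"
  by (simp add: dl_def be_def)

text \<open>The discriminant condition for completing the square in \<open>laplacian_lower\<close>.
  There 3 - Q splits as 1 + (2 - Q): the part 2 - Q pays for the mixed term of
  \<open>phi2_lower\<close>, and the part 1 survives as the lower bound.\<close>

lemma dl_quad: "(3 - Q)\<^sup>2 \<le> 4 * (1 - dl)"
proof -
  have "0 \<le> (Q - 1) * (4 - Q / 2 - (Q - 1))"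
    using Q_bounds by (intro mult_nonneg_nonneg) auto
  also have "(Q - 1) * (4 - Q / 2 - (Q - 1)) = 4 * (1 - dl) - (3 - Q)\<^sup>2"
    by (simp add: dl_def power2_eq_square field_simps)
  finally show ?thesis by simp
qed

text \<open>The arguments of \<open>phi\<close> are the squares \<open>A = |u|\<^sup>2\<close> and \<open>B = |v|\<^sup>2\<close>, so that
  \<open>phi A B = |v|\<^sup>Q + dl |u|\<^sup>2 (|u|\<^sup>P + |v|\<^sup>Q)\<^sup>1\<^sup>-\<^sup>2\<^sup>/\<^sup>P\<close>. Along a curve with first derivatives \<open>A1, B1\<close> and second
  derivatives \<open>A2, B2\<close>, its first and second derivatives are \<open>phi1\<close> and \<open>phi2\<close>; they are written in
  terms of logarithmic derivatives.\<close>

definition MM :: "real \<Rightarrow> real \<Rightarrow> real" where "MM A B = A powr al + B powr be"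
text \<open>A smooth substitute for the piecewise term of Nazarov and Treil: within a factor 2 it is
  |u|^2 |v|^(2 - Q) where |u|^P <= |v|^Q, and |u|^P elsewhere.\<close>

definition ZZ :: "real \<Rightarrow> real \<Rightarrow> real" where "ZZ A B = A * MM A B powr th"
definition phi :: "real \<Rightarrow> real \<Rightarrow> real" where "phi A B = B powr be + dl * ZZ A B"

definition logM :: "real \<Rightarrow> real \<Rightarrow> real \<Rightarrow> real \<Rightarrow> real" where
  "logM A B A1 B1 = (al * A powr al * (A1 / A) + be * B powr be * (B1 / B)) / MM A B"

definition phi1 :: "real \<Rightarrow> real \<Rightarrow> real \<Rightarrow> real \<Rightarrow> real" where
  "phi1 A B A1 B1 = be * B powr be * (B1 / B) + dl * (ZZ A B * (A1 / A + th * logM A B A1 B1))"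

definition phi2 :: "real \<Rightarrow> real \<Rightarrow> real \<Rightarrow> real \<Rightarrow> real \<Rightarrow> real \<Rightarrow> real" where
  "phi2 A B A1 B1 A2 B2 =
     B powr be * (be\<^sup>2 * (B1 / B)\<^sup>2 + be * (B2 / B - (B1 / B)\<^sup>2))
     + dl * (ZZ A B * ((A1 / A + th * logM A B A1 B1)\<^sup>2 + (A2 / A - (A1 / A)\<^sup>2)
        + th * ((A powr al * (al\<^sup>2 * (A1 / A)\<^sup>2 + al * (A2 / A - (A1 / A)\<^sup>2))
              + B powr be * (be\<^sup>2 * (B1 / B)\<^sup>2 + be * (B2 / B - (B1 / B)\<^sup>2))) / MM A B
            - (logM A B A1 B1)\<^sup>2)))"

context
  fixes A B :: real
  assumes A: "0 < A" and B: "0 < B"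
begin

lemma MM_pos: "0 < MM A B"
  using A B by (simp add: MM_def add_pos_pos)

lemma ZZ_pos: "0 < ZZ A B"
  using A MM_pos by (simp add: ZZ_def)

lemma A_eq: "A = (A powr al) powr (1 - th)"
  using A by (simp add: powr_powr al_th)

text \<open>By \<open>al * (1 - th) = 1\<close>, \<open>A\<close> is the power \<open>1 - th\<close>
  of \<open>A powr al\<close>, hence at most the same power of \<open>MM\<close>; the remaining
  power \<open>th\<close> completes it to \<open>MM\<close>.\<close>

lemma ZZ_le: "ZZ A B \<le> MM A B"
proof -
  have "A \<le> MM A B powr (1 - th)"
    by (subst A_eq, rule powr_mono2) (use th_bounds B in \<open>auto simp: MM_def\<close>)
  then have "ZZ A B \<le> MM A B powr (1 - th) * MM A B powr th"
    unfolding ZZ_def by (intro mult_right_mono) auto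
  also have "\<dots> = MM A B" using MM_pos by (simp add: powr_add[symmetric])
  finally show ?thesis .
qed

text \<open>By \<open>be * th + be = 1\<close>, \<open>B\<close> is the product of
  \<open>B powr be\<close> and its power \<open>th\<close>. Thus the inverse of the weight
  \<open>MM A B powr th\<close>, which appears in front of the energy of v, is compensated by
  \<open>B powr be\<close>.\<close>

lemma Mth_Y: "B \<le> MM A B powr th * B powr be"
proof -
  have "B = B powr (be * th + be)" using B by (simp add: be_th)
  also have "\<dots> = (B powr be) powr th * B powr be" by (simp add: powr_add powr_powr)
  also have "\<dots> \<le> MM A B powr th * B powr be"
    by (intro mult_right_mono powr_mono2) (use th_bounds A in \<open>auto simp: MM_def\<close>)
  finally show ?thesis .
qed

text \<open>The mixed term of the second derivative carries the factor on the left.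
  \<open>sqrt A\<close> is at most a power of \<open>MM\<close>, \<open>sqrt B\<close> is a power of
  \<open>B powr be\<close>, and the powers of \<open>MM\<close> that remain in the numerator have
  total exponent 2.\<close>

lemma ZZ_n2: "ZZ A B * (B powr be / MM A B)\<^sup>2 \<le> sqrt A * sqrt B"
proof -
  let ?M = "MM A B" and ?Y = "B powr be"
  have M: "0 < ?M" and Y: "0 < ?Y" "?Y \<le> ?M" using MM_pos B by (auto simp: MM_def)
  have sA: "sqrt A \<le> ?M powr ((1 - th) / 2)"
  proof -
    have "sqrt A = A powr (1/2)" using A by (simp add: powr_half_sqrt)
    also have "\<dots> = (A powr al) powr ((1 - th) / 2)"
      using al_th by (simp add: powr_powr)
    also have "\<dots> \<le> ?M powr ((1 - th) / 2)"
      by (rule powr_mono2) (use th_bounds B in \<open>auto simp: MM_def\<close>)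
    finally show ?thesis .
  qed
  have sB: "sqrt B = ?Y powr ((1 + th) / 2)"
  proof -
    have "be * ((1 + th) / 2) = 1 / 2" using be_th(2) by (simp add: field_simps)
    then show ?thesis using B by (simp add: powr_powr powr_half_sqrt)
  qed
  have "?Y\<^sup>2 = ?Y powr 2" using Y by simp
  also have "\<dots> = ?Y powr ((1 + th) / 2) * ?Y powr (2 - (1 + th) / 2)"
    by (simp only: powr_add[symmetric]) simp
  also have "\<dots> \<le> sqrt B * ?M powr (2 - (1 + th) / 2)"
    unfolding sB by (intro mult_left_mono powr_mono2) (use Y th_bounds in auto)
  finally have Y2: "?Y\<^sup>2 \<le> sqrt B * ?M powr (2 - (1 + th) / 2)" .
  have "ZZ A B * (?Y / ?M)\<^sup>2 = (sqrt A * sqrt A) * ?M powr th * (?Y\<^sup>2 / ?M\<^sup>2)"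
    using A by (simp add: ZZ_def power_divide)
  also have "\<dots> \<le> (sqrt A * ?M powr ((1 - th) / 2)) * ?M powr th * ((sqrt B * ?M powr (2 - (1 + th) / 2)) / ?M\<^sup>2)"
    using A B M Y2 sA by (intro mult_mono divide_right_mono) auto
  also have "\<dots> = sqrt A * sqrt B * ((?M powr ((1 - th) / 2) * ?M powr th * ?M powr (2 - (1 + th) / 2)) / ?M\<^sup>2)"
    by simp
  also have "?M powr ((1 - th) / 2) * ?M powr th * ?M powr (2 - (1 + th) / 2) = ?M powr 2"
    by (simp only: powr_add[symmetric]) (simp add: field_simps)
  also have "?M powr 2 / ?M\<^sup>2 = 1" using M by simp
  finally show ?thesis by simp
qed

end

text \<open>Because \<open>phi1\<close> and \<open>phi2\<close> depend on point values only, one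
  statement about curves serves the derivatives in t and in every coordinate of x.\<close>

lemma phi_has_derivs:
  fixes A B A1 B1 A2 B2 :: "real \<Rightarrow> real"
  assumes pos: "\<And>s. 0 < A s" "\<And>s. 0 < B s"
    and d1: "\<And>s. (A has_real_derivative A1 s) (at s)" "\<And>s. (B has_real_derivative B1 s) (at s)"
    and d2: "\<And>s. (A1 has_real_derivative A2 s) (at s)" "\<And>s. (B1 has_real_derivative B2 s) (at s)"
  shows "((\<lambda>s. phi (A s) (B s)) has_real_derivative phi1 (A s) (B s) (A1 s) (B1 s)) (at s)"
    and "((\<lambda>s. phi1 (A s) (B s) (A1 s) (B1 s)) has_real_derivative
            phi2 (A s) (B s) (A1 s) (B1 s) (A2 s) (B2 s)) (at s)"
proof -
  have nz: "A s \<noteq> 0" "B s \<noteq> 0" for s using pos[of s] by auto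
  have Mp: "0 < MM (A s) (B s)" for s by (rule MM_pos[OF pos])
  then have Mnz: "MM (A s) (B s) \<noteq> 0" for s by (simp add: less_imp_neq[symmetric])
  have x: "((\<lambda>s. A1 s / A s) has_real_derivative A2 s / A s - (A1 s / A s)\<^sup>2) (at s)" for s
    by (rule DERIV_cong[OF DERIV_divide[OF d2(1) d1(1) nz(1)]])
       (simp add: nz field_simps power2_eq_square)
  have y: "((\<lambda>s. B1 s / B s) has_real_derivative B2 s / B s - (B1 s / B s)\<^sup>2) (at s)" for s
    by (rule DERIV_cong[OF DERIV_divide[OF d2(2) d1(2) nz(2)]])
       (simp add: nz field_simps power2_eq_square)
  have X: "((\<lambda>s. A s powr al) has_real_derivative al * A s powr al * (A1 s / A s)) (at s)" for s
    by (rule DERIV_powr_log[OF d1(1) pos(1)])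
  have Y: "((\<lambda>s. B s powr be) has_real_derivative be * B s powr be * (B1 s / B s)) (at s)" for s
    by (rule DERIV_powr_log[OF d1(2) pos(2)])
  have M: "((\<lambda>s. MM (A s) (B s)) has_real_derivative MM (A s) (B s) * logM (A s) (B s) (A1 s) (B1 s)) (at s)" for s
    using DERIV_add[OF X Y] Mnz[of s] by (simp add: MM_def[symmetric] logM_def)
  have Z: "((\<lambda>s. ZZ (A s) (B s)) has_real_derivative
      ZZ (A s) (B s) * (A1 s / A s + th * logM (A s) (B s) (A1 s) (B1 s))) (at s)" for s
    unfolding ZZ_def
    by (rule DERIV_cong[OF DERIV_mult[OF d1(1) DERIV_powr_log[OF M Mp]]])
       (simp add: nz Mnz field_simps)
  show "((\<lambda>s. phi (A s) (B s)) has_real_derivative phi1 (A s) (B s) (A1 s) (B1 s)) (at s)"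
    unfolding phi_def phi1_def by (intro DERIV_add DERIV_cmult Y Z)
  \<comment> \<open>Derivative of \<open>r * f * g\<close> when \<open>f\<close> is a power with
    logarithmic derivative \<open>r * g\<close>; it is used for both powers in
    \<open>MM\<close>.\<close>
  have N: "((\<lambda>s. r * f s * g s) has_real_derivative f s * (r\<^sup>2 * (g s)\<^sup>2 + r * g')) (at s)"
    if "(f has_real_derivative r * f s * g s) (at s)" "(g has_real_derivative g') (at s)" for f g :: "real \<Rightarrow> real" and r g' s
    by (rule DERIV_cong[OF DERIV_mult[OF DERIV_cmult[OF that(1)] that(2)]])
       (simp add: algebra_simps power2_eq_square)
  note NX = N[OF X x] and NY = N[OF Y y]
  have L: "((\<lambda>s. logM (A s) (B s) (A1 s) (B1 s)) has_real_derivative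
      (A s powr al * (al\<^sup>2 * (A1 s / A s)\<^sup>2 + al * (A2 s / A s - (A1 s / A s)\<^sup>2))
       + B s powr be * (be\<^sup>2 * (B1 s / B s)\<^sup>2 + be * (B2 s / B s - (B1 s / B s)\<^sup>2))) / MM (A s) (B s)
      - (logM (A s) (B s) (A1 s) (B1 s))\<^sup>2) (at s)" for s
  proof -
    have e: "(al * A s powr al * (A1 s / A s) + be * B s powr be * (B1 s / B s))
        = MM (A s) (B s) * logM (A s) (B s) (A1 s) (B1 s)"
      using Mnz[of s] by (simp add: logM_def)
    have "((\<lambda>s. (al * A s powr al * (A1 s / A s) + be * B s powr be * (B1 s / B s)) / MM (A s) (B s)) has_real_derivative
      (A s powr al * (al\<^sup>2 * (A1 s / A s)\<^sup>2 + al * (A2 s / A s - (A1 s / A s)\<^sup>2))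
       + B s powr be * (be\<^sup>2 * (B1 s / B s)\<^sup>2 + be * (B2 s / B s - (B1 s / B s)\<^sup>2))) / MM (A s) (B s)
      - (logM (A s) (B s) (A1 s) (B1 s))\<^sup>2) (at s)"
      by (rule DERIV_cong[OF DERIV_divide[OF DERIV_add[OF NX NY] M Mnz]], unfold e)
         (simp add: Mnz diff_divide_distrib power2_eq_square)
    then show ?thesis by (simp only: logM_def)
  qed
  have S: "((\<lambda>s. ZZ (A s) (B s) * (A1 s / A s + th * logM (A s) (B s) (A1 s) (B1 s))) has_real_derivative
     ZZ (A s) (B s) * ((A1 s / A s + th * logM (A s) (B s) (A1 s) (B1 s))\<^sup>2 + (A2 s / A s - (A1 s / A s)\<^sup>2)
        + th * ((A s powr al * (al\<^sup>2 * (A1 s / A s)\<^sup>2 + al * (A2 s / A s - (A1 s / A s)\<^sup>2))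
       + B s powr be * (be\<^sup>2 * (B1 s / B s)\<^sup>2 + be * (B2 s / B s - (B1 s / B s)\<^sup>2))) / MM (A s) (B s)
      - (logM (A s) (B s) (A1 s) (B1 s))\<^sup>2))) (at s)"
    by (rule DERIV_cong[OF DERIV_mult[OF Z DERIV_add[OF x DERIV_cmult[OF L]]]])
       (simp only: distrib_left distrib_right power2_eq_square mult_ac add_ac)
  show "((\<lambda>s. phi1 (A s) (B s) (A1 s) (B1 s)) has_real_derivative
            phi2 (A s) (B s) (A1 s) (B1 s) (A2 s) (B2 s)) (at s)"
    unfolding phi1_def phi2_def by (intro DERIV_add DERIV_cmult NY S)
qed

text \<open>Pure algebra in logarithmic quantities: \<open>x\<close>, \<open>y\<close> stand for
  A'/A and B'/B, \<open>ex\<close>, \<open>fy\<close> for |u'|^2/|u|^2 and |v'|^2/|v|^2, and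
  \<open>p\<close>, \<open>n\<close> for the shares of the two powers in \<open>MM\<close>. After
  expansion the terms in x^2 are nonnegative, the negative terms in y^2 are absorbed through y^2 <=
  4 fy, and one indefinite term in x y remains.\<close>

lemma phi2_lower_algebra:
  fixes Y Z x y ex fy p n w :: real
  assumes pos: "0 \<le> Y" "0 \<le> Z" "0 \<le> p" "0 \<le> n" "p + n = 1" "Z * n \<le> Y"
    and x: "x\<^sup>2 \<le> 4 * ex" and y: "y\<^sup>2 \<le> 4 * fy" and xy: "\<bar>x * y\<bar> \<le> 4 * w"
  shows "2 * dl * Z * ex + 8 * dl * (1 - dl) * Y * fy - 4 * dl * (2 - Q) * (Z * n\<^sup>2) * w
    \<le> be * Y * ((be - 1) * y\<^sup>2 + 2 * fy) + dl * Z * (2 * ex + 2 * th * x * (al * p * x + be * n * y)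
       - th * (1 - th) * (al * p * x + be * n * y)\<^sup>2
       + th * (p * (al * (al - 1) * x\<^sup>2 + 2 * al * ex) + n * (be * (be - 1) * y\<^sup>2 + 2 * be * fy)))"
    (is "?L \<le> ?R")
proof -
  have ex0: "0 \<le> ex" and fy0: "0 \<le> fy" using x y zero_le_power2[of x] zero_le_power2[of y] by linarith+
  define cyy where "cyy = be * Y * (1 - be) + dl * Z * th * ((1 - th) * be\<^sup>2 * n\<^sup>2 + n * be * (1 - be))"
  \<comment> \<open>The identity \<open>al * (1 - th) = 1\<close> reduces al^2 to al here, so the
    subtracted square cannot outweigh the positive terms in x^2, however large \<open>P\<close>
    is.\<close>
  have sq: "(1 - th) * (al * p * x + be * n * y)\<^sup>2 = al * p\<^sup>2 * x\<^sup>2 + 2 * be * p * n * (x * y) + (1 - th) * be\<^sup>2 * n\<^sup>2 * y\<^sup>2"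
  proof -
    have "(1 - th) * (al * p * x + be * n * y)\<^sup>2 = (al * (1 - th)) * (al * p\<^sup>2 * x\<^sup>2) + 2 * (al * (1 - th)) * be * p * n * (x * y) + (1 - th) * be\<^sup>2 * n\<^sup>2 * y\<^sup>2"
      by (simp add: power2_eq_square algebra_simps)
    then show ?thesis unfolding al_th by simp
  qed
  have sq': "th * (1 - th) * (al * p * x + be * n * y)\<^sup>2
      = th * (al * p\<^sup>2 * x\<^sup>2 + 2 * be * p * n * (x * y) + (1 - th) * be\<^sup>2 * n\<^sup>2 * y\<^sup>2)"
    using arg_cong[OF sq, of "\<lambda>z. th * z"] by (simp only: mult.assoc[of th "1 - th"])
  have pn: "p = 1 - n" using pos by simp
  have R: "?R = 2 * dl * Z * ex + 2 * dl * Z * th * p * al * ex + dl * Z * th * al * p * (1 - p + al) * x\<^sup>2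
      + 2 * dl * Z * th * be * n\<^sup>2 * (x * y) + 2 * fy * (be * Y + dl * Z * th * n * be) - cyy * y\<^sup>2"
    unfolding sq' cyy_def unfolding pn by (simp add: algebra_simps power2_eq_square)
  have cyy0: "0 \<le> cyy"
    unfolding cyy_def using pos dl_bounds th_bounds be_bounds
    by (intro add_nonneg_nonneg mult_nonneg_nonneg) auto
  have t1: "0 \<le> 2 * dl * Z * th * p * al * ex"
    using pos dl_bounds th_bounds al_ge ex0 by (intro mult_nonneg_nonneg) auto
  have t2: "0 \<le> dl * Z * th * al * p * (1 - p + al) * x\<^sup>2"
    using pos dl_bounds th_bounds al_ge by (intro mult_nonneg_nonneg) auto
  have t3: "2 * dl * Z * th * be * n\<^sup>2 * (x * y) \<ge> - (4 * dl * (2 - Q) * (Z * n\<^sup>2) * w)"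
  proof -
    have c: "2 * dl * Z * th * be * n\<^sup>2 = dl * (2 - Q) * (Z * n\<^sup>2)"
    proof -
      have "2 * (be * th) = 2 - Q" using be_th(2) by (simp add: be_def)
      moreover have "2 * dl * Z * th * be * n\<^sup>2 = dl * (2 * (be * th)) * (Z * n\<^sup>2)" by simp
      ultimately show ?thesis by simp
    qed
    have "0 \<le> dl * (2 - Q) * (Z * n\<^sup>2)"
      using pos dl_bounds Q_bounds by (intro mult_nonneg_nonneg) auto
    then have "dl * (2 - Q) * (Z * n\<^sup>2) * (- (4 * w)) \<le> dl * (2 - Q) * (Z * n\<^sup>2) * (x * y)"
      using xy by (intro mult_left_mono) auto
    then show ?thesis unfolding c by simp
  qed
  have t4: "cyy * y\<^sup>2 \<le> cyy * (4 * fy)" using y cyy0 by (rule mult_left_mono)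
  have t5: "2 * fy * (be * Y + dl * Z * th * n * be) - cyy * (4 * fy)
     = 2 * fy * be * (2 * be - 1) * (Y + dl * Z * th * (n - 2 * n\<^sup>2))"
  proof -
    have "(1 - th) * be\<^sup>2 = be * (2 * be - 1)"
      using be_th(1) by (simp add: power2_eq_square mult_ac)
    then have cyy_eq: "cyy = be * Y * (1 - be) + dl * Z * th * (be * (2 * be - 1) * n\<^sup>2 + n * be * (1 - be))"
      by (simp add: cyy_def)
    show ?thesis unfolding cyy_eq by (simp add: algebra_simps power2_eq_square)
  qed
  \<comment> \<open>From n - 2 n^2 >= - n and Z n <= Y: at most the fraction \<open>dl\<close> of
    \<open>Y\<close> is lost.\<close>
  have t6: "Y + dl * Z * th * (n - 2 * n\<^sup>2) \<ge> Y * (1 - dl)"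
  proof -
    have "n\<^sup>2 \<le> n" using pos by (simp add: power2_eq_square mult_left_le)
    then have "- n \<le> n - 2 * n\<^sup>2" by simp
    then have "dl * Z * th * (- n) \<le> dl * Z * th * (n - 2 * n\<^sup>2)"
      using pos dl_bounds th_bounds by (intro mult_left_mono) auto
    moreover have "dl * th * (Z * n) \<le> dl * 1 * Y"
      using pos dl_bounds th_bounds by (intro mult_mono) auto
    ultimately show ?thesis by (simp add: algebra_simps)
  qed
  have "2 * fy * be * (2 * be - 1) * (Y * (1 - dl)) \<le> 2 * fy * be * (2 * be - 1) * (Y + dl * Z * th * (n - 2 * n\<^sup>2))"
    using t6 fy0 be_bounds by (intro mult_left_mono) auto
  moreover have "2 * fy * be * (2 * be - 1) * (Y * (1 - dl)) = 8 * dl * (1 - dl) * Y * fy"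
    unfolding dl_be by (simp add: mult_ac)
  ultimately have t7: "8 * dl * (1 - dl) * Y * fy \<le> 2 * fy * (be * Y + dl * Z * th * n * be) - cyy * (4 * fy)"
    unfolding t5 by simp
  show ?thesis unfolding R using t1 t2 t3 t4 t7 by linarith
qed

text \<open>\<open>E\<close>, \<open>F\<close> stand for |u'|^2, |v'|^2 and \<open>g\<close>,
  \<open>h\<close> for the inner products of u with u'' and of v with v'', so the hypotheses on
  \<open>A1\<close> and \<open>B1\<close> are Cauchy-Schwarz. The terms with \<open>g\<close> and
  \<open>h\<close> are kept exact, because their sum over all variables is known from the equation
  of the waves.\<close>

lemma phi2_lower:
  fixes A B A1 B1 E F g h :: real
  assumes A: "0 < A" and B: "0 < B" and A1: "A1\<^sup>2 \<le> 4 * A * E" and B1: "B1\<^sup>2 \<le> 4 * B * F"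
    and EF: "0 \<le> E" "0 \<le> F"
  defines "m \<equiv> MM A B powr th"
  shows "2 * dl * (m * E + 4 * (1 - dl) * F / m - 2 * (2 - Q) * (sqrt E * sqrt F))
     + 2 * dl * (ZZ A B) * (1 + th * al * (A powr al / MM A B)) * (g / A)
     + 2 * (be * B powr be + dl * ZZ A B * th * be * (B powr be / MM A B)) * (h / B)
     \<le> phi2 A B A1 B1 (2 * E + 2 * g) (2 * F + 2 * h)"
proof -
  let ?M = "MM A B" let ?Z = "ZZ A B" let ?X = "A powr al" let ?Y = "B powr be"
  define x where "x = A1 / A" define y where "y = B1 / B"
  define ex where "ex = E / A" define fy where "fy = F / B"
  define p where "p = ?X / ?M" define n where "n = ?Y / ?M"
  define w where "w = sqrt ex * sqrt fy"
  have M: "0 < ?M" and Z: "0 < ?Z" by (rule MM_pos[OF A B] ZZ_pos[OF A B])+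
  have XY: "0 < ?X" "0 < ?Y" using A B by auto
  have m: "0 < m" using M by (simp add: m_def)
  have ex0: "0 \<le> ex" and fy0: "0 \<le> fy" using EF A B by (auto simp: ex_def fy_def)
  have x2: "x\<^sup>2 \<le> 4 * ex"
  proof -
    have "x\<^sup>2 = A1\<^sup>2 / A\<^sup>2" by (simp add: x_def power_divide)
    also have "\<dots> \<le> (4 * A * E) / A\<^sup>2" using A1 by (intro divide_right_mono) auto
    also have "\<dots> = 4 * ex" using A by (simp add: ex_def power2_eq_square)
    finally show ?thesis .
  qed
  have y2: "y\<^sup>2 \<le> 4 * fy"
  proof -
    have "y\<^sup>2 = B1\<^sup>2 / B\<^sup>2" by (simp add: y_def power_divide)
    also have "\<dots> \<le> (4 * B * F) / B\<^sup>2" using B1 by (intro divide_right_mono) auto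
    also have "\<dots> = 4 * fy" using B by (simp add: fy_def power2_eq_square)
    finally show ?thesis .
  qed
  have xy: "\<bar>x * y\<bar> \<le> 4 * w"
  proof (rule power2_le_imp_le)
    have "(x * y)\<^sup>2 \<le> (4 * ex) * (4 * fy)"
      unfolding power_mult_distrib using x2 y2 ex0 fy0 by (intro mult_mono) auto
    also have "\<dots> = (4 * w)\<^sup>2" using ex0 fy0 by (simp add: w_def power_mult_distrib)
    finally show "\<bar>x * y\<bar>\<^sup>2 \<le> (4 * w)\<^sup>2" by simp
  qed (simp add: w_def ex0 fy0)
  have pn: "p + n = 1" using M by (simp add: p_def n_def MM_def add_divide_distrib[symmetric])
  have Zn: "?Z * n \<le> ?Y"
  proof -
    have "?Z * n \<le> ?M * n" using ZZ_le[OF A B] XY M by (intro mult_right_mono) (auto simp: n_def)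
    then show ?thesis using M by (simp add: n_def)
  qed
  have logM: "logM A B A1 B1 = al * p * x + be * n * y"
    by (simp add: logM_def x_def y_def p_def n_def add_divide_distrib mult_ac)
  have A2: "(2 * E + 2 * g) / A = 2 * ex + 2 * (g / A)" "(2 * F + 2 * h) / B = 2 * fy + 2 * (h / B)"
    by (auto simp: ex_def fy_def add_divide_distrib)
  have div: "(?X * u + ?Y * v) / ?M = p * u + n * v" for u v
    by (simp add: p_def n_def add_divide_distrib)
  have eq: "phi2 A B A1 B1 (2 * E + 2 * g) (2 * F + 2 * h) =
     be * ?Y * ((be - 1) * y\<^sup>2 + 2 * fy) + dl * ?Z * (2 * ex + 2 * th * x * (al * p * x + be * n * y)
       - th * (1 - th) * (al * p * x + be * n * y)\<^sup>2
       + th * (p * (al * (al - 1) * x\<^sup>2 + 2 * al * ex) + n * (be * (be - 1) * y\<^sup>2 + 2 * be * fy)))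
     + 2 * dl * ?Z * (1 + th * al * p) * (g / A)
     + 2 * (be * ?Y + dl * ?Z * th * be * n) * (h / B)"
    unfolding phi2_def div A2 logM x_def[symmetric] y_def[symmetric]
    by (simp add: algebra_simps power2_eq_square)
  have core: "2 * dl * ?Z * ex + 8 * dl * (1 - dl) * ?Y * fy - 4 * dl * (2 - Q) * (?Z * n\<^sup>2) * w
    \<le> be * ?Y * ((be - 1) * y\<^sup>2 + 2 * fy) + dl * ?Z * (2 * ex + 2 * th * x * (al * p * x + be * n * y)
       - th * (1 - th) * (al * p * x + be * n * y)\<^sup>2
       + th * (p * (al * (al - 1) * x\<^sup>2 + 2 * al * ex) + n * (be * (be - 1) * y\<^sup>2 + 2 * be * fy)))"
    by (rule phi2_lower_algebra) (use XY Z M pn Zn x2 y2 xy in \<open>auto simp: p_def n_def\<close>)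
  have Zex: "?Z * ex = m * E" using A by (simp add: ZZ_def m_def ex_def)
  have "F / m \<le> ?Y * fy"
  proof -
    have "B * F \<le> (m * ?Y) * F"
      using Mth_Y[OF A B] EF by (intro mult_right_mono) (auto simp: m_def)
    then show ?thesis using m B by (simp add: fy_def field_simps)
  qed
  then have "8 * dl * (1 - dl) * (F / m) \<le> 8 * dl * (1 - dl) * (?Y * fy)"
    using dl_bounds by (intro mult_left_mono) auto
  then have i1: "8 * dl * (1 - dl) * (F / m) \<le> 8 * dl * (1 - dl) * ?Y * fy"
    by (simp only: mult.assoc)
  have "(?Z * n\<^sup>2) * w \<le> sqrt E * sqrt F"
  proof -
    have "(?Z * n\<^sup>2) * w \<le> (sqrt A * sqrt B) * w"
      using ZZ_n2[OF A B] ex0 fy0 by (intro mult_right_mono) (auto simp: n_def w_def)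
    also have "\<dots> = sqrt E * sqrt F"
      using A B by (simp add: w_def ex_def fy_def real_sqrt_divide)
    finally show ?thesis .
  qed
  then have "4 * dl * (2 - Q) * ((?Z * n\<^sup>2) * w) \<le> 4 * dl * (2 - Q) * (sqrt E * sqrt F)"
    using dl_bounds Q_bounds by (intro mult_left_mono) auto
  then have i2: "4 * dl * (2 - Q) * (?Z * n\<^sup>2) * w \<le> 4 * dl * (2 - Q) * (sqrt E * sqrt F)"
    by (simp only: mult.assoc)
  have "2 * dl * (m * E + 4 * (1 - dl) * F / m - 2 * (2 - Q) * (sqrt E * sqrt F))
     = 2 * dl * (m * E) + 8 * dl * (1 - dl) * (F / m) - 4 * dl * (2 - Q) * (sqrt E * sqrt F)"
    using m by (simp add: field_simps)
  then have "2 * dl * (m * E + 4 * (1 - dl) * F / m - 2 * (2 - Q) * (sqrt E * sqrt F))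
     \<le> 2 * dl * ?Z * ex + 8 * dl * (1 - dl) * ?Y * fy - 4 * dl * (2 - Q) * (?Z * n\<^sup>2) * w"
    using i1 i2 unfolding Zex[symmetric] by linarith
  note order.trans[OF this core]
  then show ?thesis unfolding eq p_def[symmetric] n_def[symmetric] by (intro add_right_mono)
qed

lemma phi_le: "0 < A \<Longrightarrow> 0 < B \<Longrightarrow> phi A B \<le> dl * A powr al + (1 + dl) * B powr be"
  using mult_left_mono[OF ZZ_le[of A B], of dl] dl_bounds by (simp add: phi_def MM_def algebra_simps)

lemma phi_nonneg: "0 < A \<Longrightarrow> 0 < B \<Longrightarrow> 0 \<le> phi A B"
  using ZZ_pos[of A B] dl_bounds by (simp add: phi_def)

text \<open>Crude bounds that serve integrability. Relative to \<open>MM\<close> the singular powers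
  disappear: every term is at most \<open>MM\<close> times a polynomial in logarithmic derivatives,
  and those are controlled by \<open>r\<close>.\<close>

lemma phi_derivs_bound:
  "\<exists>C\<ge>0. \<forall>A B A1 B1 A2 B2 r. 0 < A \<longrightarrow> 0 < B \<longrightarrow> 1 \<le> r \<longrightarrow> \<bar>A1\<bar> \<le> 2 * r * A \<longrightarrow> \<bar>B1\<bar> \<le> 2 * r * B \<longrightarrow>
     \<bar>A2\<bar> \<le> 4 * r\<^sup>2 * A \<longrightarrow> \<bar>B2\<bar> \<le> 4 * r\<^sup>2 * B \<longrightarrow>
     \<bar>phi1 A B A1 B1\<bar> \<le> C * r\<^sup>2 * MM A B \<and> \<bar>phi2 A B A1 B1 A2 B2\<bar> \<le> C * r\<^sup>2 * MM A B"
proof -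
  define K1 where "K1 = 2 * al + 2 * be"
  define c where "c u = 4 * u\<^sup>2 + 8 * u" for u :: real
  define K2 where "K2 = c al + c be"
  define C1 where "C1 = 2 * be + dl * (2 + th * K1)"
  define C2 where "C2 = c be + dl * ((2 + th * K1)\<^sup>2 + 8 + th * (K2 + K1\<^sup>2))"
  have K: "0 \<le> K1" "0 \<le> K2" "0 \<le> c be" "0 \<le> c al" using al_ge be_bounds by (auto simp: K1_def K2_def c_def)
  have C: "0 \<le> C1" "0 \<le> C2" using K al_ge be_bounds dl_bounds th_bounds by (auto simp: C1_def C2_def)
  {
    fix A B A1 B1 A2 B2 r :: real
    assume A: "0 < A" and B: "0 < B" and r: "1 \<le> r" and b1: "\<bar>A1\<bar> \<le> 2 * r * A" "\<bar>B1\<bar> \<le> 2 * r * B"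
      and b2: "\<bar>A2\<bar> \<le> 4 * r\<^sup>2 * A" "\<bar>B2\<bar> \<le> 4 * r\<^sup>2 * B"
    let ?M = "MM A B" let ?Z = "ZZ A B" let ?X = "A powr al" let ?Y = "B powr be"
    define x where "x = A1 / A" define y where "y = B1 / B"
    define p where "p = ?X / ?M" define n where "n = ?Y / ?M"
    have M: "0 < ?M" and Z: "0 < ?Z" by (rule MM_pos[OF A B] ZZ_pos[OF A B])+
    have pn: "0 \<le> p" "p \<le> 1" "0 \<le> n" "n \<le> 1" using M by (auto simp: p_def n_def MM_def)
    have x: "\<bar>x\<bar> \<le> 2 * r" and y: "\<bar>y\<bar> \<le> 2 * r"
      using b1 A B by (auto simp: x_def y_def abs_divide field_simps)
    have x2: "x\<^sup>2 \<le> 4 * r\<^sup>2" and y2: "y\<^sup>2 \<le> 4 * r\<^sup>2"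
      using power_mono[OF x, of 2] power_mono[OF y, of 2] by (auto simp: power_mult_distrib)
    have x': "\<bar>A2 / A - x\<^sup>2\<bar> \<le> 8 * r\<^sup>2" and y': "\<bar>B2 / B - y\<^sup>2\<bar> \<le> 8 * r\<^sup>2"
    proof -
      have "\<bar>A2 / A\<bar> \<le> 4 * r\<^sup>2" "\<bar>B2 / B\<bar> \<le> 4 * r\<^sup>2"
        using b2 A B by (auto simp: abs_divide field_simps)
      then show "\<bar>A2 / A - x\<^sup>2\<bar> \<le> 8 * r\<^sup>2" "\<bar>B2 / B - y\<^sup>2\<bar> \<le> 8 * r\<^sup>2"
        using x2 y2 zero_le_power2[of x] zero_le_power2[of y] by linarith+
    qed
    have mul: "\<bar>a * b\<bar> \<le> c * d" if "\<bar>a\<bar> \<le> c" "\<bar>b\<bar> \<le> d" for a b c d :: real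
      using that unfolding abs_mult by (intro mult_mono) auto
    have logM: "logM A B A1 B1 = p * (al * x) + n * (be * y)"
      by (simp add: logM_def x_def y_def p_def n_def add_divide_distrib mult_ac)
    have l: "\<bar>logM A B A1 B1\<bar> \<le> K1 * r"
    proof -
      have "\<bar>p * (al * x)\<bar> \<le> 1 * (al * (2 * r))" "\<bar>n * (be * y)\<bar> \<le> 1 * (be * (2 * r))"
        using pn al_ge be_bounds x y by (intro mul; simp)+
      then show ?thesis unfolding logM K1_def by (simp add: algebra_simps; linarith?)
    qed
    define l where "l = logM A B A1 B1"
    have q: "\<bar>u\<^sup>2 * z\<^sup>2 + u * z'\<bar> \<le> c u * r\<^sup>2" if "0 \<le> u" "z\<^sup>2 \<le> 4 * r\<^sup>2" "\<bar>z'\<bar> \<le> 8 * r\<^sup>2" for u z z' :: real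
    proof -
      have "\<bar>u\<^sup>2 * z\<^sup>2\<bar> \<le> u\<^sup>2 * (4 * r\<^sup>2)" "\<bar>u * z'\<bar> \<le> u * (8 * r\<^sup>2)"
        using that by (intro mul; simp)+
      then have "\<bar>u\<^sup>2 * z\<^sup>2 + u * z'\<bar> \<le> u\<^sup>2 * (4 * r\<^sup>2) + u * (8 * r\<^sup>2)" by linarith
      also have "\<dots> = c u * r\<^sup>2" by (simp add: c_def algebra_simps)
      finally show ?thesis .
    qed
    have qa: "\<bar>al\<^sup>2 * x\<^sup>2 + al * (A2 / A - x\<^sup>2)\<bar> \<le> c al * r\<^sup>2"
      by (rule q) (use al_ge x2 x' in auto)
    have qb: "\<bar>be\<^sup>2 * y\<^sup>2 + be * (B2 / B - y\<^sup>2)\<bar> \<le> c be * r\<^sup>2"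
      by (rule q) (use be_bounds y2 y' in auto)
    have s: "\<bar>x + th * l\<bar> \<le> (2 + th * K1) * r"
    proof -
      have "\<bar>th * l\<bar> \<le> th * (K1 * r)" using l th_bounds by (intro mul) (auto simp: l_def)
      then show ?thesis using x by (simp add: algebra_simps; linarith?)
    qed
    have Yb: "\<bar>?Y\<bar> \<le> ?M" by (simp add: MM_def)
    have Zb: "\<bar>?Z\<bar> \<le> ?M" using ZZ_le[OF A B] Z by simp
    have rr: "r \<le> r\<^sup>2" using r by (simp add: power2_eq_square)
    have "\<bar>phi1 A B A1 B1\<bar> \<le> C1 * r * ?M"
    proof -
      have 1: "\<bar>be * (?Y * y)\<bar> \<le> be * (?M * (2 * r))"
        using be_bounds y Yb by (intro mul) auto
      have 2: "\<bar>dl * (?Z * (x + th * l))\<bar> \<le> dl * (?M * ((2 + th * K1) * r))"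
        using dl_bounds by (intro mul Zb s) auto
      have "phi1 A B A1 B1 = be * (?Y * y) + dl * (?Z * (x + th * l))"
        by (simp add: phi1_def x_def y_def l_def)
      then have "\<bar>phi1 A B A1 B1\<bar> \<le> be * (?M * (2 * r)) + dl * (?M * ((2 + th * K1) * r))"
        using 1 2 by linarith
      also have "\<dots> = C1 * r * ?M" by (simp add: C1_def algebra_simps)
      finally show ?thesis .
    qed
    also have "C1 * r * ?M \<le> (C1 + C2) * r\<^sup>2 * ?M"
      using C r rr M by (intro mult_right_mono mult_mono) auto
    finally have R1: "\<bar>phi1 A B A1 B1\<bar> \<le> (C1 + C2) * r\<^sup>2 * ?M" .
    define D where "D = p * (al\<^sup>2 * x\<^sup>2 + al * (A2 / A - x\<^sup>2)) + n * (be\<^sup>2 * y\<^sup>2 + be * (B2 / B - y\<^sup>2))"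
    have D: "\<bar>D\<bar> \<le> K2 * r\<^sup>2"
    proof -
      have "\<bar>p * (al\<^sup>2 * x\<^sup>2 + al * (A2 / A - x\<^sup>2))\<bar> \<le> 1 * (c al * r\<^sup>2)"
        using pn by (intro mul qa) auto
      moreover have "\<bar>n * (be\<^sup>2 * y\<^sup>2 + be * (B2 / B - y\<^sup>2))\<bar> \<le> 1 * (c be * r\<^sup>2)"
        using pn by (intro mul qb) auto
      ultimately show ?thesis unfolding D_def K2_def by (simp add: algebra_simps; linarith?)
    qed
    have l2: "l\<^sup>2 \<le> K1\<^sup>2 * r\<^sup>2"
      using power_mono[OF l, of 2] by (simp add: power_mult_distrib l_def)
    have s2: "(x + th * l)\<^sup>2 \<le> (2 + th * K1)\<^sup>2 * r\<^sup>2"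
      using power_mono[OF s, of 2] by (simp add: power_mult_distrib)
    have "\<bar>phi2 A B A1 B1 A2 B2\<bar> \<le> C2 * r\<^sup>2 * ?M"
    proof -
      have 1: "\<bar>?Y * (be\<^sup>2 * y\<^sup>2 + be * (B2 / B - y\<^sup>2))\<bar> \<le> ?M * (c be * r\<^sup>2)"
        by (intro mul Yb qb)
      have "\<bar>D - l\<^sup>2\<bar> \<le> (K2 + K1\<^sup>2) * r\<^sup>2"
        using D l2 zero_le_power2[of l] by (simp add: algebra_simps; linarith?)
      then have "\<bar>th * (D - l\<^sup>2)\<bar> \<le> th * ((K2 + K1\<^sup>2) * r\<^sup>2)"
        using th_bounds by (intro mul) auto
      then have 2: "\<bar>(x + th * l)\<^sup>2 + (A2 / A - x\<^sup>2) + th * (D - l\<^sup>2)\<bar>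
          \<le> ((2 + th * K1)\<^sup>2 + 8 + th * (K2 + K1\<^sup>2)) * r\<^sup>2" (is "\<bar>?s\<bar> \<le> ?S")
        using s2 x' zero_le_power2[of "x + th * l"] unfolding distrib_right mult.assoc by linarith
      have 3: "\<bar>dl * (?Z * ?s)\<bar> \<le> dl * (?M * ?S)"
        using dl_bounds by (intro mul Zb 2) auto
      have "phi2 A B A1 B1 A2 B2 = ?Y * (be\<^sup>2 * y\<^sup>2 + be * (B2 / B - y\<^sup>2)) + dl * (?Z * ?s)"
        by (simp add: phi2_def x_def y_def l_def D_def p_def n_def add_divide_distrib)
      then have "\<bar>phi2 A B A1 B1 A2 B2\<bar> \<le> ?M * (c be * r\<^sup>2) + dl * (?M * ?S)"
        using abs_triangle_ineq[THEN order.trans, OF add_mono[OF 1 3]] by (simp only:)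
      also have "\<dots> = C2 * r\<^sup>2 * ?M" by (simp add: C2_def algebra_simps)
      finally show ?thesis .
    qed
    also have "C2 * r\<^sup>2 * ?M \<le> (C1 + C2) * r\<^sup>2 * ?M"
      using C M by (intro mult_right_mono) auto
    finally have R2: "\<bar>phi2 A B A1 B1 A2 B2\<bar> \<le> (C1 + C2) * r\<^sup>2 * ?M" .
    note R1 R2
  }
  then show ?thesis using C by (intro exI[of _ "C1 + C2"]) simp
qed

end

section \<open>Poisson extensions of Hermite expansions\<close>

lemma DERIV_inner:
  fixes f g :: "real \<Rightarrow> 'a::real_inner"
  assumes "(f has_vector_derivative f') (at s)" "(g has_vector_derivative g') (at s)"
  shows "((\<lambda>s. f s \<bullet> g s) has_real_derivative f s \<bullet> g' + f' \<bullet> g s) (at s)"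
  using bounded_bilinear.has_vector_derivative[OF bounded_bilinear_inner assms]
  by (simp add: has_real_derivative_iff_has_vector_derivative)

text \<open>\<open>F\<close> and \<open>c\<close> are parameters because differentiation in x
  replaces \<open>F\<close> and differentiation in t replaces \<open>c\<close>; every derivative of
  a wave is again such a sum.\<close>

definition wave_sum ::
  "('i \<Rightarrow> 'x \<Rightarrow> real) \<Rightarrow> 'i set \<Rightarrow> ('i \<Rightarrow> real) \<Rightarrow> ('i \<Rightarrow> 'e::euclidean_space) \<Rightarrow> 'x \<Rightarrow> real \<Rightarrow> 'e" where
  "wave_sum F S \<mu> c x t = (\<Sum>n\<in>S. (exp (- (t * \<mu> n)) * F n x) *\<^sub>R c n)"

lemma wave_sum_deriv_line:
  fixes F G :: "'i \<Rightarrow> 'x::real_vector \<Rightarrow> real"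
  assumes "\<And>n x s. ((\<lambda>s. F n (x + s *\<^sub>R b)) has_real_derivative G n (x + s *\<^sub>R b)) (at s)"
  shows "((\<lambda>s. wave_sum F S \<mu> c (x + s *\<^sub>R b) t) has_vector_derivative wave_sum G S \<mu> c (x + s *\<^sub>R b) t) (at s)"
  unfolding wave_sum_def
proof (intro has_vector_derivative_sum)
  fix n
  from has_vector_derivative_scaleR[OF DERIV_cmult[OF assms] has_vector_derivative_const]
  show "((\<lambda>s. (exp (- (t * \<mu> n)) * F n (x + s *\<^sub>R b)) *\<^sub>R c n) has_vector_derivative
      (exp (- (t * \<mu> n)) * G n (x + s *\<^sub>R b)) *\<^sub>R c n) (at s)"
    by simp
qed

lemma wave_sum_deriv_time:
  "((\<lambda>t. wave_sum F S \<mu> c x t) has_vector_derivative wave_sum F S \<mu> (\<lambda>n. - \<mu> n *\<^sub>R c n) x t) (at t)"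
  unfolding wave_sum_def
proof (intro has_vector_derivative_sum)
  fix n
  have "((\<lambda>t. exp (- (t * \<mu> n)) * F n x) has_real_derivative - \<mu> n * (exp (- (t * \<mu> n)) * F n x)) (at t)"
    by (auto intro!: derivative_eq_intros)
  from has_vector_derivative_scaleR[OF this has_vector_derivative_const]
  show "((\<lambda>t. (exp (- (t * \<mu> n)) * F n x) *\<^sub>R c n) has_vector_derivative
      (exp (- (t * \<mu> n)) * F n x) *\<^sub>R - \<mu> n *\<^sub>R c n) (at t)"
    by (simp add: mult_ac)
qed

lemma continuous_on_wave_sum:
  assumes "\<And>n. continuous_on UNIV (F n)"
  shows "continuous_on UNIV (\<lambda>z. wave_sum F S \<mu> c (fst z) (snd z))"
  unfolding wave_sum_def
  by (intro continuous_intros continuous_on_compose2[OF assms]) auto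

text \<open>Decay arbitrarily close to that of the ground state. The loss \<open>e\<close> stays
  free because derivatives are later divided by the ground state, and such a quotient grows no
  faster than exp(e |x|^2).\<close>

definition gauss_dominated :: "('i \<Rightarrow> real ^ 'd \<Rightarrow> real) \<Rightarrow> bool" where
  "gauss_dominated F \<longleftrightarrow> (\<forall>n e. 0 < e \<longrightarrow> (\<exists>C\<ge>0. \<forall>x. \<bar>F n x\<bar> \<le> C * exp (- (1 / 2 - e) * (norm x)\<^sup>2)))"

lemma gauss_dominated_hermite: "gauss_dominated hermite"
  unfolding gauss_dominated_def using hermite_bound by blast

lemma gauss_dominated_add:
  assumes "gauss_dominated F" "gauss_dominated G"
  shows "gauss_dominated (\<lambda>n x. F n x + G n x)"
  unfolding gauss_dominated_def
proof (intro allI impI)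
  fix n and e :: real assume "0 < e"
  then obtain C D where C: "C \<ge> 0" "\<And>x. \<bar>F n x\<bar> \<le> C * exp (- (1 / 2 - e) * (norm x)\<^sup>2)"
    and D: "D \<ge> 0" "\<And>x. \<bar>G n x\<bar> \<le> D * exp (- (1 / 2 - e) * (norm x)\<^sup>2)"
    using assms unfolding gauss_dominated_def by meson
  have "\<bar>F n x + G n x\<bar> \<le> (C + D) * exp (- (1 / 2 - e) * (norm x)\<^sup>2)" for x
    using C(2)[of x] D(2)[of x] abs_triangle_ineq[of "F n x" "G n x"] unfolding distrib_right by linarith
  then show "\<exists>C\<ge>0. \<forall>x. \<bar>F n x + G n x\<bar> \<le> C * exp (- (1 / 2 - e) * (norm x)\<^sup>2)"
    using C D by (intro exI[of _ "C + D"]) simp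
qed

lemma gauss_dominated_reindex:
  assumes "gauss_dominated F"
  shows "gauss_dominated (\<lambda>n x. a n * F (k n) x)"
  unfolding gauss_dominated_def
proof (intro allI impI)
  fix n and e :: real assume "0 < e"
  then obtain C where C: "C \<ge> 0" "\<And>x. \<bar>F (k n) x\<bar> \<le> C * exp (- (1 / 2 - e) * (norm x)\<^sup>2)"
    using assms unfolding gauss_dominated_def by meson
  have "\<bar>a n * F (k n) x\<bar> \<le> (\<bar>a n\<bar> * C) * exp (- (1 / 2 - e) * (norm x)\<^sup>2)" for x
    using mult_left_mono[OF C(2)[of x], of "\<bar>a n\<bar>"] by (simp add: abs_mult)
  then show "\<exists>C\<ge>0. \<forall>x. \<bar>a n * F (k n) x\<bar> \<le> C * exp (- (1 / 2 - e) * (norm x)\<^sup>2)"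
    using C by (intro exI[of _ "\<bar>a n\<bar> * C"]) simp
qed

lemma gauss_dominated_coord:
  assumes "gauss_dominated F"
  shows "gauss_dominated (\<lambda>n x. x $ i * F n x)"
  unfolding gauss_dominated_def
proof (intro allI impI)
  fix n and e :: real assume e: "0 < e"
  then obtain C where C: "C \<ge> 0" "\<And>x. \<bar>F n x\<bar> \<le> C * exp (- (1 / 2 - e / 2) * (norm x)\<^sup>2)"
    using assms unfolding gauss_dominated_def by (meson half_gt_zero)
  obtain D where D: "D \<ge> 0" "\<And>s. \<bar>poly [:0, 1:] s\<bar> \<le> D * exp (e / 2 * s\<^sup>2)"
    using poly_exp_bound[of "e / 2" "[:0, 1:]"] e by auto
  have "\<bar>x $ i * F n x\<bar> \<le> (D * C) * exp (- (1 / 2 - e) * (norm x)\<^sup>2)" for x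
  proof -
    have "\<bar>x $ i\<bar> \<le> D * exp (e / 2 * (x $ i)\<^sup>2)" using D(2)[of "x $ i"] by simp
    also have "\<dots> \<le> D * exp (e / 2 * (norm x)\<^sup>2)"
    proof -
      have "(x $ i)\<^sup>2 \<le> (norm x)\<^sup>2"
        using power_mono[OF component_le_norm_cart[of x i], of 2] by simp
      then show ?thesis using D e by (intro mult_left_mono) auto
    qed
    finally have "\<bar>x $ i\<bar> * \<bar>F n x\<bar> \<le> (D * exp (e / 2 * (norm x)\<^sup>2)) * (C * exp (- (1 / 2 - e / 2) * (norm x)\<^sup>2))"
      using C D by (intro mult_mono) auto
    also have "\<dots> = (D * C) * exp (e / 2 * (norm x)\<^sup>2 + - (1 / 2 - e / 2) * (norm x)\<^sup>2)"
      by (simp only: exp_add) (simp only: mult_ac)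
    also have "e / 2 * (norm x)\<^sup>2 + - (1 / 2 - e / 2) * (norm x)\<^sup>2 = - (1 / 2 - e) * (norm x)\<^sup>2"
      by (simp add: algebra_simps)
    finally show ?thesis by (simp add: abs_mult)
  qed
  then show "\<exists>C\<ge>0. \<forall>x. \<bar>x $ i * F n x\<bar> \<le> C * exp (- (1 / 2 - e) * (norm x)\<^sup>2)"
    using C D by (intro exI[of _ "D * C"]) simp
qed

lemma gauss_dominated_hermite_dx: "gauss_dominated (hermite_dx i)"
proof -
  have "gauss_dominated (\<lambda>n x. x $ i * hermite n x + (- sqrt (2 * (real (n $ i) + 1))) * hermite (raise i n) x)"
    by (intro gauss_dominated_add gauss_dominated_coord gauss_dominated_reindex gauss_dominated_hermite)
  then show ?thesis by (simp add: hermite_dx_def[abs_def])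
qed

lemma gauss_dominated_hermite_dxx: "gauss_dominated (hermite_dxx i)"
proof -
  have "gauss_dominated (\<lambda>n x. x $ i * (x $ i * hermite n x) + (- (2 * real (n $ i) + 1)) * hermite n x)"
    by (intro gauss_dominated_add gauss_dominated_coord gauss_dominated_reindex[where k = "\<lambda>n. n"]
        gauss_dominated_hermite)
  then show ?thesis by (simp add: hermite_dxx_def[abs_def] power2_eq_square algebra_simps)
qed

lemma continuous_on_hermite_dx: "continuous_on UNIV (hermite_dx i n)"
  unfolding hermite_dx_def[abs_def] by (intro continuous_intros continuous_on_hermite)

lemma continuous_on_hermite_dxx: "continuous_on UNIV (hermite_dxx i n)"
  unfolding hermite_dxx_def[abs_def] by (intro continuous_intros continuous_on_hermite)

lemma wave_sum_bound:
  fixes c :: "'i \<Rightarrow> 'e::euclidean_space"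
  assumes F: "gauss_dominated F" and e: "0 < e" and m: "\<And>n. n \<in> S \<Longrightarrow> m \<le> \<mu> n"
  shows "\<exists>C\<ge>0. \<forall>x t. 0 \<le> t \<longrightarrow>
    norm (wave_sum F S \<mu> c x t) \<le> C * (exp (- (t * m)) * exp (- (1 / 2 - e) * (norm x)\<^sup>2))"
proof -
  have "\<exists>C. \<forall>n. C n \<ge> 0 \<and> (\<forall>x. \<bar>F n x\<bar> \<le> C n * exp (- (1 / 2 - e) * (norm x)\<^sup>2))"
    using F e unfolding gauss_dominated_def by (intro choice) blast
  then obtain C where C: "\<And>n. C n \<ge> 0" "\<And>n x. \<bar>F n x\<bar> \<le> C n * exp (- (1 / 2 - e) * (norm x)\<^sup>2)"
    by blast
  have "norm (wave_sum F S \<mu> c x t)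
     \<le> (\<Sum>n\<in>S. C n * norm (c n)) * (exp (- (t * m)) * exp (- (1 / 2 - e) * (norm x)\<^sup>2))"
    if t: "0 \<le> t" for x t
  proof -
    have "norm (wave_sum F S \<mu> c x t) \<le> (\<Sum>n\<in>S. norm ((exp (- (t * \<mu> n)) * F n x) *\<^sub>R c n))"
      unfolding wave_sum_def by (rule norm_sum)
    also have "\<dots> \<le> (\<Sum>n\<in>S. (C n * norm (c n)) * (exp (- (t * m)) * exp (- (1 / 2 - e) * (norm x)\<^sup>2)))"
    proof (rule sum_mono)
      fix n assume "n \<in> S"
      then have "exp (- (t * \<mu> n)) \<le> exp (- (t * m))" using m t by (simp add: mult_left_mono)
      then have "exp (- (t * \<mu> n)) * \<bar>F n x\<bar> \<le> exp (- (t * m)) * (C n * exp (- (1 / 2 - e) * (norm x)\<^sup>2))"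
        using C by (intro mult_mono) auto
      from mult_right_mono[OF this, of "norm (c n)"]
      show "norm ((exp (- (t * \<mu> n)) * F n x) *\<^sub>R c n)
          \<le> (C n * norm (c n)) * (exp (- (t * m)) * exp (- (1 / 2 - e) * (norm x)\<^sup>2))"
        by (simp add: abs_mult mult_ac)
    qed
    finally show ?thesis by (simp add: sum_distrib_right)
  qed
  then show ?thesis
    using C by (intro exI[of _ "\<Sum>n\<in>S. C n * norm (c n)"]) (auto intro!: sum_nonneg)
qed

text \<open>The direction \<open>z\<close> carries a positive multiple of the ground state, which keeps the wave away
  from the singularity of the Bellman function at the origin.\<close>

locale wave =
  fixes S :: "(nat ^ 'd) set" and c :: "nat ^ 'd \<Rightarrow> 'e::euclidean_space" and \<kappa> :: real and z :: 'e
  assumes finite_S: "finite S" and S_0: "0 \<in> S" and kappa: "0 \<le> \<kappa>"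
    and z: "norm z = 1" "0 < c 0 \<bullet> z" "\<And>n. n \<in> S \<Longrightarrow> n \<noteq> 0 \<Longrightarrow> c n \<bullet> z = 0"
begin

text \<open>\<open>\<kappa> = 0\<close> gives the Poisson semigroup of L, and
  \<open>\<kappa> = 2\<close> that of L + 2.\<close>

definition freq :: "nat ^ 'd \<Rightarrow> real" where "freq n = sqrt (eigval n + \<kappa>)"
definition U where "U = wave_sum hermite S freq c"
definition Ut where "Ut = wave_sum hermite S freq (\<lambda>n. - freq n *\<^sub>R c n)"
definition Utt where "Utt = wave_sum hermite S freq (\<lambda>n. - freq n *\<^sub>R (- freq n *\<^sub>R c n))"
definition Ux where "Ux i = wave_sum (hermite_dx i) S freq c"
definition Uxx where "Uxx i = wave_sum (hermite_dxx i) S freq c"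

lemma freq_ge: "freq 0 \<le> freq n" "1 \<le> freq n"
proof -
  have "eigval (0 :: nat ^ 'd) \<le> eigval n" by (simp add: eigval_def sum_nonneg)
  then show "freq 0 \<le> freq n" by (simp add: freq_def)
  show "1 \<le> freq n" using eigval_ge_1[of n] kappa by (simp add: freq_def)
qed

lemma U_derivs:
  "((\<lambda>t. U x t) has_vector_derivative Ut x t) (at t)"
  "((\<lambda>t. Ut x t) has_vector_derivative Utt x t) (at t)"
  "((\<lambda>s. U (x + s *\<^sub>R axis i 1) t) has_vector_derivative Ux i (x + s *\<^sub>R axis i 1) t) (at s)"
  "((\<lambda>s. Ux i (x + s *\<^sub>R axis i 1) t) has_vector_derivative Uxx i (x + s *\<^sub>R axis i 1) t) (at s)"
  unfolding U_def Ut_def Utt_def Ux_def Uxx_def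
  by (rule wave_sum_deriv_time wave_sum_deriv_line hermite_has_deriv hermite_dx_has_deriv)+

text \<open>Termwise the eigenvalue in the Laplacian cancels against the one in the squared
  frequency.\<close>

lemma U_pde: "Utt x t + (\<Sum>i\<in>UNIV. Uxx i x t) = ((norm x)\<^sup>2 + \<kappa>) *\<^sub>R U x t"
proof -
  have "(\<Sum>i\<in>UNIV. Uxx i x t) = (\<Sum>n\<in>S. \<Sum>i\<in>UNIV. (exp (- (t * freq n)) * hermite_dxx i n x) *\<^sub>R c n)"
    unfolding Uxx_def wave_sum_def by (rule sum.swap)
  also have "\<dots> = (\<Sum>n\<in>S. (exp (- (t * freq n)) * (((norm x)\<^sup>2 - eigval n) * hermite n x)) *\<^sub>R c n)"
    by (simp only: scaleR_sum_left[symmetric] sum_distrib_left[symmetric] sum_hermite_dxx)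
  finally have 1: "(\<Sum>i\<in>UNIV. Uxx i x t) = \<dots>" .
  have fr: "freq n * freq n = eigval n + \<kappa>" for n
    using eigval_ge_1[of n] kappa by (simp add: freq_def)
  have "Utt x t = (\<Sum>n\<in>S. (exp (- (t * freq n)) * ((eigval n + \<kappa>) * hermite n x)) *\<^sub>R c n)"
    unfolding Utt_def wave_sum_def fr[symmetric] by (simp add: mult_ac)
  then have "Utt x t + (\<Sum>i\<in>UNIV. Uxx i x t)
      = (\<Sum>n\<in>S. (exp (- (t * freq n)) * ((eigval n + \<kappa>) * hermite n x)) *\<^sub>R c n
          + (exp (- (t * freq n)) * (((norm x)\<^sup>2 - eigval n) * hermite n x)) *\<^sub>R c n)"
    unfolding 1 by (simp only: sum.distrib)
  also have "\<dots> = (\<Sum>n\<in>S. (((norm x)\<^sup>2 + \<kappa>) * (exp (- (t * freq n)) * hermite n x)) *\<^sub>R c n)"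
    by (intro sum.cong refl, simp only: scaleR_add_left[symmetric])
       (rule arg_cong[where f = "\<lambda>a. a *\<^sub>R _"], simp add: algebra_simps)
  also have "\<dots> = ((norm x)\<^sup>2 + \<kappa>) *\<^sub>R U x t"
    by (simp only: U_def wave_sum_def scaleR_sum_right scaleR_scaleR)
  finally show ?thesis .
qed

text \<open>Pairing with \<open>z\<close> isolates the ground state, since all other coefficients
  are orthogonal to \<open>z\<close>.\<close>

lemma U_lower:
  "exp (- (t * freq 0)) * ((pi powr (- 1 / 4)) ^ CARD('d) * exp (- ((norm x)\<^sup>2) / 2)) * (c 0 \<bullet> z) \<le> norm (U x t)"
proof -
  have "U x t \<bullet> z = (\<Sum>n\<in>S. (exp (- (t * freq n)) * hermite n x) * (c n \<bullet> z))"
    by (simp add: U_def wave_sum_def inner_sum_left)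
  also have "\<dots> = (\<Sum>n\<in>{0}. (exp (- (t * freq n)) * hermite n x) * (c n \<bullet> z))"
    using finite_S S_0 z by (intro sum.mono_neutral_right) auto
  finally have "U x t \<bullet> z = exp (- (t * freq 0)) * ((pi powr (- 1 / 4)) ^ CARD('d) * exp (- ((norm x)\<^sup>2) / 2)) * (c 0 \<bullet> z)"
    by (simp add: hermite_0)
  moreover have "U x t \<bullet> z \<le> norm (U x t)"
    using Cauchy_Schwarz_ineq2[of "U x t" z] z by simp
  ultimately show ?thesis by simp
qed

lemma U_pos: "0 < U x t \<bullet> U x t"
proof -
  have "0 < exp (- (t * freq 0)) * ((pi powr (- 1 / 4)) ^ CARD('d) * exp (- ((norm x)\<^sup>2) / 2)) * (c 0 \<bullet> z)"
    using z by simp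
  then have "0 < norm (U x t)" using U_lower[of t x] by linarith
  then show ?thesis by simp
qed

lemma U_cont:
  "continuous_on UNIV (\<lambda>z. U (fst z) (snd z))"
  "continuous_on UNIV (\<lambda>z. Ut (fst z) (snd z))"
  "continuous_on UNIV (\<lambda>z. Utt (fst z) (snd z))"
  "continuous_on UNIV (\<lambda>z. Ux i (fst z) (snd z))"
  "continuous_on UNIV (\<lambda>z. Uxx i (fst z) (snd z))"
  unfolding U_def Ut_def Utt_def Ux_def Uxx_def
  by (intro continuous_on_wave_sum continuous_on_hermite continuous_on_hermite_dx continuous_on_hermite_dxx)+

lemma U_bound:
  "\<exists>C\<ge>1. \<forall>x t. 0 \<le> t \<longrightarrow> norm (U x t) \<le> C * (exp (- t) * exp (- (7 / 16) * (norm x)\<^sup>2))"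
proof -
  obtain C where "C \<ge> 0" and C: "\<And>x t. 0 \<le> t \<Longrightarrow>
    norm (U x t) \<le> C * (exp (- (t * 1)) * exp (- (1 / 2 - 1 / 16) * (norm x)\<^sup>2))"
    using wave_sum_bound[OF gauss_dominated_hermite, of "1/16" S 1 freq c] freq_ge unfolding U_def by auto
  have "norm (U x t) \<le> (C + 1) * (exp (- t) * exp (- (7 / 16) * (norm x)\<^sup>2))" if "0 \<le> t" for x t
  proof -
    have "norm (U x t) \<le> C * (exp (- t) * exp (- (7 / 16) * (norm x)\<^sup>2))" using C[OF that, of x] by simp
    also have "\<dots> \<le> (C + 1) * (exp (- t) * exp (- (7 / 16) * (norm x)\<^sup>2))" by (intro mult_right_mono) auto
    finally show ?thesis .
  qed
  then show ?thesis using \<open>C \<ge> 0\<close> by (intro exI[of _ "C + 1"]) auto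
qed

text \<open>The ground state has the smallest frequency, so in t the sum decays at least as fast as
  the lower bound of \<open>U_lower\<close>. In x the quotient loses only the Gaussian exponent
  1/32.\<close>

lemma wave_ratio:
  assumes F: "gauss_dominated F"
  shows "\<exists>C\<ge>0. \<forall>x t. 0 \<le> t \<longrightarrow> norm (wave_sum F S freq c' x t) \<le> C * exp ((norm x)\<^sup>2 / 32) * norm (U x t)"
proof -
  obtain C where C: "C \<ge> 0" "\<And>x t. 0 \<le> t \<Longrightarrow>
    norm (wave_sum F S freq c' x t) \<le> C * (exp (- (t * freq 0)) * exp (- (1 / 2 - 1 / 32) * (norm x)\<^sup>2))"
    using wave_sum_bound[OF F, of "1/32" S "freq 0" freq c'] freq_ge by auto
  define b where "b = (pi powr (- 1 / 4)) ^ CARD('d) * (c 0 \<bullet> z)"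
  have b: "0 < b" using z by (simp add: b_def)
  have "norm (wave_sum F S freq c' x t) \<le> (C / b) * exp ((norm x)\<^sup>2 / 32) * norm (U x t)" if t: "0 \<le> t" for x t
  proof -
    have "norm (wave_sum F S freq c' x t) \<le> C * (exp (- (t * freq 0)) * exp (- (1 / 2 - 1 / 32) * (norm x)\<^sup>2))"
      by (rule C(2)[OF t])
    also have "exp (- (1 / 2 - 1 / 32) * (norm x)\<^sup>2) = exp ((norm x)\<^sup>2 / 32) * exp (- ((norm x)\<^sup>2) / 2)"
      by (simp add: exp_add[symmetric] algebra_simps)
    also have "C * (exp (- (t * freq 0)) * (exp ((norm x)\<^sup>2 / 32) * exp (- ((norm x)\<^sup>2) / 2)))
      = (C / b) * exp ((norm x)\<^sup>2 / 32) * (exp (- (t * freq 0)) * ((pi powr (- 1 / 4)) ^ CARD('d) * exp (- ((norm x)\<^sup>2) / 2)) * (c 0 \<bullet> z))"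
      using b z by (simp add: b_def)
    also have "\<dots> \<le> (C / b) * exp ((norm x)\<^sup>2 / 32) * norm (U x t)"
      using C b by (intro mult_left_mono U_lower) auto
    finally show ?thesis .
  qed
  then show ?thesis using C b by (intro exI[of _ "C / b"]) auto
qed

lemma U_derivs_bound:
  "\<exists>C\<ge>1. \<forall>x t i. 0 \<le> t \<longrightarrow>
     norm (Ut x t) \<le> C * exp ((norm x)\<^sup>2 / 32) * norm (U x t) \<and>
     norm (Utt x t) \<le> C * exp ((norm x)\<^sup>2 / 32) * norm (U x t) \<and>
     norm (Ux i x t) \<le> C * exp ((norm x)\<^sup>2 / 32) * norm (U x t) \<and>
     norm (Uxx i x t) \<le> C * exp ((norm x)\<^sup>2 / 32) * norm (U x t)"
proof -
  let ?P = "\<lambda>C f. \<forall>x t. 0 \<le> t \<longrightarrow> norm (f x t) \<le> C * exp ((norm x)\<^sup>2 / 32) * norm (U x t)"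
  obtain C1 where C1: "C1 \<ge> 0" "?P C1 Ut" using wave_ratio[OF gauss_dominated_hermite] unfolding Ut_def by blast
  obtain C2 where C2: "C2 \<ge> 0" "?P C2 Utt" using wave_ratio[OF gauss_dominated_hermite] unfolding Utt_def by blast
  have "\<exists>C. \<forall>i. C i \<ge> 0 \<and> ?P (C i) (Ux i)"
    using wave_ratio[OF gauss_dominated_hermite_dx] unfolding Ux_def by (intro choice) blast
  then obtain C3 where C3: "\<And>i. C3 i \<ge> 0" "\<And>i. ?P (C3 i) (Ux i)" by blast
  have "\<exists>C. \<forall>i. C i \<ge> 0 \<and> ?P (C i) (Uxx i)"
    using wave_ratio[OF gauss_dominated_hermite_dxx] unfolding Uxx_def by (intro choice) blast
  then obtain C4 where C4: "\<And>i. C4 i \<ge> 0" "\<And>i. ?P (C4 i) (Uxx i)" by blast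
  define C where "C = 1 + C1 + C2 + (\<Sum>i\<in>UNIV. C3 i) + (\<Sum>i\<in>UNIV. C4 i)"
  have le: "C1 \<le> C" "C2 \<le> C" "C3 i \<le> C" "C4 i \<le> C" "1 \<le> C" for i
  proof -
    have "C3 i \<le> (\<Sum>i\<in>UNIV. C3 i)" "C4 i \<le> (\<Sum>i\<in>UNIV. C4 i)"
      using C3(1) C4(1) by (auto intro!: member_le_sum)
    moreover have "0 \<le> C3 i" "0 \<le> C4 i" by (rule C3 C4)+
    ultimately show "C1 \<le> C" "C2 \<le> C" "C3 i \<le> C" "C4 i \<le> C" "1 \<le> C"
      using C1(1) C2(1) unfolding C_def by linarith+
  qed
  have up: "?P C f" if "?P D f" "D \<le> C" for D and f :: "real ^ 'd \<Rightarrow> real \<Rightarrow> 'e"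
    using that by (meson exp_ge_zero mult_right_mono norm_ge_zero order_trans)
  show ?thesis
    using le(5) up[OF C1(2) le(1)] up[OF C2(2) le(2)] up[OF C3(2) le(3)] up[OF C4(2) le(4)]
    by (intro exI[of _ C]) blast
qed

end

lemma integrable_gauss_dominated:
  fixes f :: "real ^ 'd \<Rightarrow> real"
  assumes "f \<in> borel_measurable borel" "\<And>x. \<bar>f x\<bar> \<le> K * exp (- s * (norm x)\<^sup>2)" "0 < s"
  shows "integrable lborel f"
proof (rule Bochner_Integration.integrable_bound)
  show "integrable lborel (\<lambda>x::real^'d. K * exp (- s * (norm x)\<^sup>2))"
    by (rule integrable_mult_right) (rule integrable_gaussian_vec[OF assms(3)])
  show "AE x in lborel. norm (f x) \<le> norm (K * exp (- s * (norm x)\<^sup>2))"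
    using assms(2) by (intro AE_I2) (smt (verit) real_norm_def)
qed (use assms in simp)

section \<open>The Bellman function along a pair of waves\<close>

locale wave_pair = bellman P Q + u: wave S c \<kappa> z + v: wave S' c' \<kappa>' z'
  for P Q :: real and S :: "(nat ^ 'd) set" and c :: "nat ^ 'd \<Rightarrow> 'e::euclidean_space" and \<kappa> z
    and S' :: "(nat ^ 'd) set" and c' :: "nat ^ 'd \<Rightarrow> 'f::euclidean_space" and \<kappa>' z'
begin

definition AA where "AA x t = u.U x t \<bullet> u.U x t"
definition BB where "BB x t = v.U x t \<bullet> v.U x t"
definition f0 where "f0 x t = phi (AA x t) (BB x t)"
definition ft where "ft x t = phi1 (AA x t) (BB x t) (2 * (u.U x t \<bullet> u.Ut x t)) (2 * (v.U x t \<bullet> v.Ut x t))"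
definition ftt where "ftt x t = phi2 (AA x t) (BB x t) (2 * (u.U x t \<bullet> u.Ut x t)) (2 * (v.U x t \<bullet> v.Ut x t))
   (2 * (u.Ut x t \<bullet> u.Ut x t) + 2 * (u.U x t \<bullet> u.Utt x t)) (2 * (v.Ut x t \<bullet> v.Ut x t) + 2 * (v.U x t \<bullet> v.Utt x t))"
definition fx where "fx i x t = phi1 (AA x t) (BB x t) (2 * (u.U x t \<bullet> u.Ux i x t)) (2 * (v.U x t \<bullet> v.Ux i x t))"
definition fxx where "fxx i x t = phi2 (AA x t) (BB x t) (2 * (u.U x t \<bullet> u.Ux i x t)) (2 * (v.U x t \<bullet> v.Ux i x t))
   (2 * (u.Ux i x t \<bullet> u.Ux i x t) + 2 * (u.U x t \<bullet> u.Uxx i x t)) (2 * (v.Ux i x t \<bullet> v.Ux i x t) + 2 * (v.U x t \<bullet> v.Uxx i x t))"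

lemma AB_pos: "0 < AA x t" "0 < BB x t"
  by (simp_all add: AA_def BB_def u.U_pos v.U_pos del: inner_gt_zero_iff)

lemma DERIV_inner_self:
  fixes f :: "real \<Rightarrow> 'a::real_inner"
  assumes "(f has_vector_derivative f') (at s)"
  shows "((\<lambda>s. f s \<bullet> f s) has_real_derivative 2 * (f s \<bullet> f')) (at s)"
  using DERIV_inner[OF assms assms] by (simp add: inner_commute)

lemma DERIV_inner_self2:
  fixes f :: "real \<Rightarrow> 'a::real_inner"
  assumes "(f has_vector_derivative f' s) (at s)" "(f' has_vector_derivative f'') (at s)"
  shows "((\<lambda>s. 2 * (f s \<bullet> f' s)) has_real_derivative 2 * (f' s \<bullet> f' s) + 2 * (f s \<bullet> f'')) (at s)"
  using DERIV_cmult[OF DERIV_inner[OF assms], of 2] by (simp add: algebra_simps)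

lemma f_derivs_t:
  "((\<lambda>t. f0 x t) has_real_derivative ft x t) (at t)"
  "((\<lambda>t. ft x t) has_real_derivative ftt x t) (at t)"
proof -
  have A: "((\<lambda>s. AA x s) has_real_derivative 2 * (u.U x s \<bullet> u.Ut x s)) (at s)"
    "((\<lambda>s. BB x s) has_real_derivative 2 * (v.U x s \<bullet> v.Ut x s)) (at s)" for s
    unfolding AA_def BB_def by (rule DERIV_inner_self[OF u.U_derivs(1)] DERIV_inner_self[OF v.U_derivs(1)])+
  have A2: "((\<lambda>s. 2 * (u.U x s \<bullet> u.Ut x s)) has_real_derivative
      2 * (u.Ut x s \<bullet> u.Ut x s) + 2 * (u.U x s \<bullet> u.Utt x s)) (at s)"
    "((\<lambda>s. 2 * (v.U x s \<bullet> v.Ut x s)) has_real_derivative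
      2 * (v.Ut x s \<bullet> v.Ut x s) + 2 * (v.U x s \<bullet> v.Utt x s)) (at s)" for s
    by (rule DERIV_inner_self2[OF u.U_derivs(1) u.U_derivs(2)] DERIV_inner_self2[OF v.U_derivs(1) v.U_derivs(2)])+
  note D = phi_has_derivs[OF AB_pos(1) AB_pos(2) A A2]
  show "((\<lambda>t. f0 x t) has_real_derivative ft x t) (at t)"
    "((\<lambda>t. ft x t) has_real_derivative ftt x t) (at t)"
    unfolding f0_def ft_def ftt_def by (rule D)+
qed

lemma f_derivs_x:
  "((\<lambda>s. f0 (x + s *\<^sub>R axis i 1) t) has_real_derivative fx i (x + s *\<^sub>R axis i 1) t) (at s)"
  "((\<lambda>s. fx i (x + s *\<^sub>R axis i 1) t) has_real_derivative fxx i (x + s *\<^sub>R axis i 1) t) (at s)"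
proof -
  have A: "((\<lambda>s. AA (x + s *\<^sub>R axis i 1) t) has_real_derivative 2 * (u.U (x + s *\<^sub>R axis i 1) t \<bullet> u.Ux i (x + s *\<^sub>R axis i 1) t)) (at s)"
    "((\<lambda>s. BB (x + s *\<^sub>R axis i 1) t) has_real_derivative 2 * (v.U (x + s *\<^sub>R axis i 1) t \<bullet> v.Ux i (x + s *\<^sub>R axis i 1) t)) (at s)" for s
    unfolding AA_def BB_def by (rule DERIV_inner_self[OF u.U_derivs(3)] DERIV_inner_self[OF v.U_derivs(3)])+
  have A2: "((\<lambda>s. 2 * (u.U (x + s *\<^sub>R axis i 1) t \<bullet> u.Ux i (x + s *\<^sub>R axis i 1) t)) has_real_derivative
      2 * (u.Ux i (x + s *\<^sub>R axis i 1) t \<bullet> u.Ux i (x + s *\<^sub>R axis i 1) t) + 2 * (u.U (x + s *\<^sub>R axis i 1) t \<bullet> u.Uxx i (x + s *\<^sub>R axis i 1) t)) (at s)"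
    "((\<lambda>s. 2 * (v.U (x + s *\<^sub>R axis i 1) t \<bullet> v.Ux i (x + s *\<^sub>R axis i 1) t)) has_real_derivative
      2 * (v.Ux i (x + s *\<^sub>R axis i 1) t \<bullet> v.Ux i (x + s *\<^sub>R axis i 1) t) + 2 * (v.U (x + s *\<^sub>R axis i 1) t \<bullet> v.Uxx i (x + s *\<^sub>R axis i 1) t)) (at s)" for s
    by (rule DERIV_inner_self2[OF u.U_derivs(3) u.U_derivs(4)] DERIV_inner_self2[OF v.U_derivs(3) v.U_derivs(4)])+
  note D = phi_has_derivs[OF AB_pos(1) AB_pos(2) A A2]
  show "((\<lambda>s. f0 (x + s *\<^sub>R axis i 1) t) has_real_derivative fx i (x + s *\<^sub>R axis i 1) t) (at s)"
    "((\<lambda>s. fx i (x + s *\<^sub>R axis i 1) t) has_real_derivative fxx i (x + s *\<^sub>R axis i 1) t) (at s)"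
    unfolding f0_def fx_def fxx_def by (rule D)+
qed

lemma cont_AB:
  "continuous_on UNIV (\<lambda>z. AA (fst z) (snd z))" "continuous_on UNIV (\<lambda>z. BB (fst z) (snd z))"
  unfolding AA_def BB_def by (intro continuous_intros u.U_cont v.U_cont)+

lemma cont_parts:
  "continuous_on UNIV (\<lambda>z. MM (AA (fst z) (snd z)) (BB (fst z) (snd z)))"
  "continuous_on UNIV (\<lambda>z. ZZ (AA (fst z) (snd z)) (BB (fst z) (snd z)))"
  "continuous_on UNIV (\<lambda>z. f0 (fst z) (snd z))"
proof -
  have nz: "AA x t \<noteq> 0" "BB x t \<noteq> 0" "MM (AA x t) (BB x t) \<noteq> 0" for x t
    using AB_pos[of x t] MM_pos[OF AB_pos(1)[of x t] AB_pos(2)[of x t]] by auto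
  show M: "continuous_on UNIV (\<lambda>z. MM (AA (fst z) (snd z)) (BB (fst z) (snd z)))"
    unfolding MM_def by (intro continuous_intros cont_AB) (auto simp: nz)
  show Z: "continuous_on UNIV (\<lambda>z. ZZ (AA (fst z) (snd z)) (BB (fst z) (snd z)))"
    unfolding ZZ_def by (intro continuous_intros cont_AB M) (auto simp: nz)
  show "continuous_on UNIV (\<lambda>z. f0 (fst z) (snd z))"
    unfolding f0_def phi_def by (intro continuous_intros cont_AB Z) (auto simp: nz)
qed

lemma cont_phi12:
  assumes "continuous_on UNIV a1" "continuous_on UNIV b1" "continuous_on UNIV a2" "continuous_on UNIV b2"
  shows "continuous_on UNIV (\<lambda>z. phi1 (AA (fst z) (snd z)) (BB (fst z) (snd z)) (a1 z) (b1 z))"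
    "continuous_on UNIV (\<lambda>z. phi2 (AA (fst z) (snd z)) (BB (fst z) (snd z)) (a1 z) (b1 z) (a2 z) (b2 z))"
proof -
  have nz: "AA x t \<noteq> 0" "BB x t \<noteq> 0" "MM (AA x t) (BB x t) \<noteq> 0" for x t
    using AB_pos[of x t] MM_pos[OF AB_pos(1)[of x t] AB_pos(2)[of x t]] by auto
  have L: "continuous_on UNIV (\<lambda>z. logM (AA (fst z) (snd z)) (BB (fst z) (snd z)) (a1 z) (b1 z))"
    unfolding logM_def by (intro continuous_intros cont_AB cont_parts assms) (auto simp: nz)
  show "continuous_on UNIV (\<lambda>z. phi1 (AA (fst z) (snd z)) (BB (fst z) (snd z)) (a1 z) (b1 z))"
    unfolding phi1_def by (intro continuous_intros cont_AB cont_parts assms L) (auto simp: nz)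
  show "continuous_on UNIV (\<lambda>z. phi2 (AA (fst z) (snd z)) (BB (fst z) (snd z)) (a1 z) (b1 z) (a2 z) (b2 z))"
    unfolding phi2_def by (intro continuous_intros cont_AB cont_parts assms L) (auto simp: nz)
qed

lemma cont_f:
  "continuous_on UNIV (\<lambda>z. ft (fst z) (snd z))"
  "continuous_on UNIV (\<lambda>z. ftt (fst z) (snd z))"
  "continuous_on UNIV (\<lambda>z. fx i (fst z) (snd z))"
  "continuous_on UNIV (\<lambda>z. fxx i (fst z) (snd z))"
  unfolding ft_def ftt_def fx_def fxx_def
  by (rule cont_phi12[where ?a2.0 = "\<lambda>_. 0" and ?b2.0 = "\<lambda>_. 0"] cont_phi12(2);
      intro continuous_intros u.U_cont v.U_cont)+

lemma MM_bound: "\<exists>K\<ge>0. \<forall>x t. 0 \<le> t \<longrightarrow> MM (AA x t) (BB x t) \<le> K * (exp (- t) * exp (- (7 / 16) * (norm x)\<^sup>2))"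
proof -
  obtain C where C: "C \<ge> 1" "\<And>x t. 0 \<le> t \<Longrightarrow> norm (u.U x t) \<le> C * (exp (- t) * exp (- (7 / 16) * (norm x)\<^sup>2))"
    using u.U_bound by auto
  obtain D where D: "D \<ge> 1" "\<And>x t. 0 \<le> t \<Longrightarrow> norm (v.U x t) \<le> D * (exp (- t) * exp (- (7 / 16) * (norm x)\<^sup>2))"
    using v.U_bound by auto
  \<comment> \<open>A power p >= 1 of a quantity w <= 1 is at most w; this makes the decay rate
    independent of the exponents.\<close>
  have pw: "(a \<bullet> a) powr (p / 2) \<le> E powr p * w"
    if "norm a \<le> E * w" "1 \<le> p" "0 < w" "w \<le> 1" "1 \<le> E" for a :: "'g::real_inner" and E w p
  proof -
    have "(a \<bullet> a) powr (p / 2) = norm a powr p"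
      by (cases "a = 0") (simp_all add: dot_square_norm powr_half_sqrt_powr[symmetric] powr_powr flip: powr_numeral)
    also have "\<dots> \<le> (E * w) powr p" using that by (intro powr_mono2) auto
    also have "\<dots> = E powr p * w powr p" by (rule powr_mult)
    also have "w powr p \<le> w powr 1" using that by (intro powr_mono') auto
    finally show ?thesis using that by (simp add: mult_left_mono)
  qed
  have "MM (AA x t) (BB x t) \<le> (C powr P + D powr Q) * (exp (- t) * exp (- (7 / 16) * (norm x)\<^sup>2))"
    if t: "0 \<le> t" for x t
  proof -
    let ?w = "exp (- t) * exp (- (7 / 16) * (norm x)\<^sup>2)"
    have w: "0 < ?w" "?w \<le> 1" using t by (auto simp: mult_le_one)
    have "AA x t powr al \<le> C powr P * ?w" unfolding AA_def al_def
      by (rule pw[OF C(2)[OF t]]) (use P_ge_2 w C in auto)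
    moreover have "BB x t powr be \<le> D powr Q * ?w" unfolding BB_def be_def
      by (rule pw[OF D(2)[OF t]]) (use Q_bounds w D in auto)
    ultimately show ?thesis unfolding MM_def distrib_right by linarith
  qed
  then show ?thesis by (intro exI[of _ "C powr P + D powr Q"]) auto
qed

lemma inner_ratio_bounds:
  fixes a a1 a2 :: "'g::real_inner"
  assumes "norm a1 \<le> r * norm a" "norm a2 \<le> r * norm a" "1 \<le> r"
  shows "\<bar>2 * (a \<bullet> a1)\<bar> \<le> 2 * r * (a \<bullet> a)" "\<bar>2 * (a1 \<bullet> a1) + 2 * (a \<bullet> a2)\<bar> \<le> 4 * r\<^sup>2 * (a \<bullet> a)"
proof -
  have ip: "\<bar>a \<bullet> b\<bar> \<le> r * (a \<bullet> a)" if "norm b \<le> r * norm a" for b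
    using Cauchy_Schwarz_ineq2[of a b] mult_left_mono[OF that norm_ge_zero[of a]]
    by (simp add: dot_square_norm power2_eq_square mult_ac)
  show "\<bar>2 * (a \<bullet> a1)\<bar> \<le> 2 * r * (a \<bullet> a)" using ip[OF assms(1)] by simp
  have "a1 \<bullet> a1 \<le> r\<^sup>2 * (a \<bullet> a)"
    using power_mono[OF assms(1) norm_ge_zero, of 2] by (simp add: dot_square_norm power_mult_distrib)
  moreover have "r * (a \<bullet> a) \<le> r\<^sup>2 * (a \<bullet> a)"
    using assms(3) by (intro mult_right_mono) (auto simp: power2_eq_square)
  ultimately show "\<bar>2 * (a1 \<bullet> a1) + 2 * (a \<bullet> a2)\<bar> \<le> 4 * r\<^sup>2 * (a \<bullet> a)"
    using ip[OF assms(2)] inner_ge_zero[of a1] by linarith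
qed

text \<open>Budget of Gaussian exponents: \<open>MM\<close> decays at rate 7/16, the squared ratio
  from \<open>U_derivs_bound\<close> costs 2/32, and the remaining 3/8 exceeds 1/4.\<close>

lemma f_bounds:
  "\<exists>K\<ge>0. \<forall>x t i. 0 \<le> t \<longrightarrow>
     \<bar>f0 x t\<bar> \<le> K * (exp (- t) * exp (- (1 / 4) * (norm x)\<^sup>2)) \<and>
     \<bar>ft x t\<bar> \<le> K * (exp (- t) * exp (- (1 / 4) * (norm x)\<^sup>2)) \<and>
     \<bar>ftt x t\<bar> \<le> K * (exp (- t) * exp (- (1 / 4) * (norm x)\<^sup>2)) \<and>
     \<bar>fx i x t\<bar> \<le> K * (exp (- t) * exp (- (1 / 4) * (norm x)\<^sup>2)) \<and>
     \<bar>fxx i x t\<bar> \<le> K * (exp (- t) * exp (- (1 / 4) * (norm x)\<^sup>2))"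
proof -
  obtain K where K: "K \<ge> 0" "\<And>x t. 0 \<le> t \<Longrightarrow> MM (AA x t) (BB x t) \<le> K * (exp (- t) * exp (- (7 / 16) * (norm x)\<^sup>2))"
    using MM_bound by auto
  obtain C where C: "1 \<le> C" "\<And>x t i. 0 \<le> t \<Longrightarrow>
     norm (u.Ut x t) \<le> C * exp ((norm x)\<^sup>2 / 32) * norm (u.U x t) \<and>
     norm (u.Utt x t) \<le> C * exp ((norm x)\<^sup>2 / 32) * norm (u.U x t) \<and>
     norm (u.Ux i x t) \<le> C * exp ((norm x)\<^sup>2 / 32) * norm (u.U x t) \<and>
     norm (u.Uxx i x t) \<le> C * exp ((norm x)\<^sup>2 / 32) * norm (u.U x t)"
    using u.U_derivs_bound by blast
  obtain D where D: "1 \<le> D" "\<And>x t i. 0 \<le> t \<Longrightarrow>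
     norm (v.Ut x t) \<le> D * exp ((norm x)\<^sup>2 / 32) * norm (v.U x t) \<and>
     norm (v.Utt x t) \<le> D * exp ((norm x)\<^sup>2 / 32) * norm (v.U x t) \<and>
     norm (v.Ux i x t) \<le> D * exp ((norm x)\<^sup>2 / 32) * norm (v.U x t) \<and>
     norm (v.Uxx i x t) \<le> D * exp ((norm x)\<^sup>2 / 32) * norm (v.U x t)"
    using v.U_derivs_bound by blast
  obtain L where L: "L \<ge> 0" "\<And>A B A1 B1 A2 B2 r. 0 < A \<Longrightarrow> 0 < B \<Longrightarrow> 1 \<le> r \<Longrightarrow> \<bar>A1\<bar> \<le> 2 * r * A \<Longrightarrow> \<bar>B1\<bar> \<le> 2 * r * B \<Longrightarrow>
     \<bar>A2\<bar> \<le> 4 * r\<^sup>2 * A \<Longrightarrow> \<bar>B2\<bar> \<le> 4 * r\<^sup>2 * B \<Longrightarrow>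
     \<bar>phi1 A B A1 B1\<bar> \<le> L * r\<^sup>2 * MM A B \<and> \<bar>phi2 A B A1 B1 A2 B2\<bar> \<le> L * r\<^sup>2 * MM A B"
    using phi_derivs_bound by blast
  define E where "E = C + D"
  have E: "1 \<le> E" "C \<le> E" "D \<le> E" using C(1) D(1) by (auto simp: E_def)
  define K' where "K' = (L + 2) * E\<^sup>2 * K"
  {
    fix x :: "real ^ 'd" and t :: real and i :: 'd assume t: "0 \<le> t"
    define r where "r = E * exp ((norm x)\<^sup>2 / 32)"
    have r: "1 \<le> r" unfolding r_def using E mult_mono[of 1 E 1 "exp ((norm x)\<^sup>2 / 32)"] by simp
    have up: "G \<le> r * N" if "G \<le> H * exp ((norm x)\<^sup>2 / 32) * N" "H \<le> E" "0 \<le> N" for G H N :: real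
    proof -
      have "H * exp ((norm x)\<^sup>2 / 32) * N \<le> r * N" unfolding r_def using that by (intro mult_right_mono) auto
      then show ?thesis using that by linarith
    qed
    have bu: "norm (u.Ut x t) \<le> r * norm (u.U x t)" "norm (u.Utt x t) \<le> r * norm (u.U x t)"
      "norm (u.Ux i x t) \<le> r * norm (u.U x t)" "norm (u.Uxx i x t) \<le> r * norm (u.U x t)"
      using C(2)[OF t, of x i] by (auto intro!: up[of _ C] E)
    have bv: "norm (v.Ut x t) \<le> r * norm (v.U x t)" "norm (v.Utt x t) \<le> r * norm (v.U x t)"
      "norm (v.Ux i x t) \<le> r * norm (v.U x t)" "norm (v.Uxx i x t) \<le> r * norm (v.U x t)"
      using D(2)[OF t, of x i] by (auto intro!: up[of _ D] E)
    have fin: "b \<le> K' * (exp (- t) * exp (- (1 / 4) * (norm x)\<^sup>2))"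
      if "b \<le> (L + 2) * r\<^sup>2 * MM (AA x t) (BB x t)" for b
    proof -
      have "(L + 2) * r\<^sup>2 * MM (AA x t) (BB x t)
          \<le> (L + 2) * r\<^sup>2 * (K * (exp (- t) * exp (- (7 / 16) * (norm x)\<^sup>2)))"
        using L by (intro mult_left_mono K t) auto
      also have "(L + 2) * r\<^sup>2 * (K * (exp (- t) * exp (- (7 / 16) * (norm x)\<^sup>2)))
         = K' * (exp (- t) * (exp ((norm x)\<^sup>2 / 16) * exp (- (7 / 16) * (norm x)\<^sup>2)))"
        by (simp add: K'_def r_def power_mult_distrib exp_double[symmetric])
      also have "exp ((norm x)\<^sup>2 / 16) * exp (- (7 / 16) * (norm x)\<^sup>2) = exp ((norm x)\<^sup>2 / 16 + - (7 / 16) * (norm x)\<^sup>2)"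
        by (simp only: exp_add)
      also have "K' * (exp (- t) * \<dots>) \<le> K' * (exp (- t) * exp (- (1 / 4) * (norm x)\<^sup>2))"
        using L K by (intro mult_left_mono) (auto simp: K'_def)
      finally show ?thesis using that by linarith
    qed
    have M: "0 < MM (AA x t) (BB x t)" by (rule MM_pos[OF AB_pos])
    have p12: "\<bar>b\<bar> \<le> K' * (exp (- t) * exp (- (1 / 4) * (norm x)\<^sup>2))"
      if "\<bar>b\<bar> \<le> L * r\<^sup>2 * MM (AA x t) (BB x t)" for b
    proof (rule fin)
      have "L * r\<^sup>2 * MM (AA x t) (BB x t) \<le> (L + 2) * r\<^sup>2 * MM (AA x t) (BB x t)"
        using M by (intro mult_right_mono) auto
      then show "\<bar>b\<bar> \<le> (L + 2) * r\<^sup>2 * MM (AA x t) (BB x t)" using that by linarith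
    qed
    note b1 = L(2)[OF AB_pos(1)[of x t] AB_pos(2)[of x t] r
        inner_ratio_bounds(1)[OF bu(1,2) r, folded AA_def] inner_ratio_bounds(1)[OF bv(1,2) r, folded BB_def]
        inner_ratio_bounds(2)[OF bu(1,2) r, folded AA_def] inner_ratio_bounds(2)[OF bv(1,2) r, folded BB_def]]
    note b2 = L(2)[OF AB_pos(1)[of x t] AB_pos(2)[of x t] r
        inner_ratio_bounds(1)[OF bu(3,4) r, folded AA_def] inner_ratio_bounds(1)[OF bv(3,4) r, folded BB_def]
        inner_ratio_bounds(2)[OF bu(3,4) r, folded AA_def] inner_ratio_bounds(2)[OF bv(3,4) r, folded BB_def]]
    have 1: "\<bar>ft x t\<bar> \<le> K' * (exp (- t) * exp (- (1 / 4) * (norm x)\<^sup>2))"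
      "\<bar>ftt x t\<bar> \<le> K' * (exp (- t) * exp (- (1 / 4) * (norm x)\<^sup>2))"
      unfolding ft_def ftt_def by (rule p12[OF conjunct1[OF b1]] p12[OF conjunct2[OF b1]])+
    have 2: "\<bar>fx i x t\<bar> \<le> K' * (exp (- t) * exp (- (1 / 4) * (norm x)\<^sup>2))"
      "\<bar>fxx i x t\<bar> \<le> K' * (exp (- t) * exp (- (1 / 4) * (norm x)\<^sup>2))"
      unfolding fx_def fxx_def by (rule p12[OF conjunct1[OF b2]] p12[OF conjunct2[OF b2]])+
    have 3: "\<bar>f0 x t\<bar> \<le> K' * (exp (- t) * exp (- (1 / 4) * (norm x)\<^sup>2))"
    proof (rule fin)
      have "\<bar>f0 x t\<bar> = f0 x t" unfolding f0_def using phi_nonneg[OF AB_pos] by simp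
      also have "\<dots> \<le> MM (AA x t) (BB x t) + 1 * MM (AA x t) (BB x t)"
        unfolding f0_def phi_def using ZZ_le[OF AB_pos] ZZ_pos[OF AB_pos] dl_bounds
        by (intro add_mono mult_mono) (auto simp: MM_def less_imp_le)
      also have "\<dots> = 2 * 1 * MM (AA x t) (BB x t)" by simp
      also have "\<dots> \<le> (L + 2) * r\<^sup>2 * MM (AA x t) (BB x t)"
        using L r M by (intro mult_right_mono mult_mono) auto
      finally show "\<bar>f0 x t\<bar> \<le> (L + 2) * r\<^sup>2 * MM (AA x t) (BB x t)" .
    qed
    note 1 2 3
  }
  moreover have "0 \<le> K'" using L K by (simp add: K'_def)
  ultimately show ?thesis by (intro exI[of _ K']) blast
qed

text \<open>The potential term is part of the energy because x u - grad u has to be bounded, not the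
  gradient alone.\<close>

definition eU where "eU x t = u.Ut x t \<bullet> u.Ut x t + (\<Sum>i\<in>UNIV. u.Ux i x t \<bullet> u.Ux i x t) + (norm x)\<^sup>2 * AA x t"
definition eV where "eV x t = v.Ut x t \<bullet> v.Ut x t + (\<Sum>i\<in>UNIV. v.Ux i x t \<bullet> v.Ux i x t) + (norm x)\<^sup>2 * BB x t"

lemma energy_nonneg: "0 \<le> eU x t" "0 \<le> eV x t"
  using AB_pos[of x t] by (auto simp: eU_def eV_def intro!: add_nonneg_nonneg sum_nonneg mult_nonneg_nonneg)

text \<open>\<open>phi2_lower\<close> is summed over t and all coordinates. The terms of second
  order combine, by the equation of the waves, to multiples of |x|^2 plus the shift, and these
  dominate the potential parts of the two energies. The weights \<open>m\<close> and 1/m are then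
  removed by completing a square.\<close>

lemma laplacian_lower: "4 * dl * (sqrt (eU x t) * sqrt (eV x t)) \<le> ftt x t + (\<Sum>i\<in>UNIV. fxx i x t)"
proof -
  let ?A = "AA x t" let ?B = "BB x t" let ?M = "MM ?A ?B" let ?Z = "ZZ ?A ?B"
  define m where "m = ?M powr th"
  define cA where "cA = 2 * dl * ?Z * (1 + th * al * (?A powr al / ?M))"
  define cB where "cB = 2 * (be * ?B powr be + dl * ?Z * th * be * (?B powr be / ?M))"
  define r2 where "r2 = (norm x)\<^sup>2"
  have A: "0 < ?A" and B: "0 < ?B" by (rule AB_pos)+
  have M: "0 < ?M" and Z: "0 < ?Z" by (rule MM_pos[OF A B] ZZ_pos[OF A B])+
  have m: "0 < m" using M by (simp add: m_def)
  have r2: "0 \<le> r2" by (simp add: r2_def)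
  have low: "2 * dl * (m * (a1 \<bullet> a1) + 4 * (1 - dl) * (b1 \<bullet> b1) / m - 2 * (2 - Q) * (sqrt (a1 \<bullet> a1) * sqrt (b1 \<bullet> b1)))
      + cA * ((u.U x t \<bullet> a2) / ?A) + cB * ((v.U x t \<bullet> b2) / ?B)
    \<le> phi2 ?A ?B (2 * (u.U x t \<bullet> a1)) (2 * (v.U x t \<bullet> b1)) (2 * (a1 \<bullet> a1) + 2 * (u.U x t \<bullet> a2)) (2 * (b1 \<bullet> b1) + 2 * (v.U x t \<bullet> b2))"
    for a1 a2 b1 b2
  proof -
    have "(2 * (u.U x t \<bullet> a1))\<^sup>2 \<le> 4 * ?A * (a1 \<bullet> a1)" "(2 * (v.U x t \<bullet> b1))\<^sup>2 \<le> 4 * ?B * (b1 \<bullet> b1)"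
      using Cauchy_Schwarz_ineq[of "u.U x t" a1] Cauchy_Schwarz_ineq[of "v.U x t" b1]
      by (auto simp: AA_def BB_def power_mult_distrib)
    from phi2_lower[OF A B this, of "u.U x t \<bullet> a2" "v.U x t \<bullet> b2"]
    show ?thesis by (simp add: m_def cA_def cB_def)
  qed
  define sE where "sE = u.Ut x t \<bullet> u.Ut x t + (\<Sum>i\<in>UNIV. u.Ux i x t \<bullet> u.Ux i x t)"
  define sF where "sF = v.Ut x t \<bullet> v.Ut x t + (\<Sum>i\<in>UNIV. v.Ux i x t \<bullet> v.Ux i x t)"
  define sEF where "sEF = norm (u.Ut x t) * norm (v.Ut x t) + (\<Sum>i\<in>UNIV. norm (u.Ux i x t) * norm (v.Ux i x t))"
  have "2 * dl * (m * sE + 4 * (1 - dl) * sF / m - 2 * (2 - Q) * sEF) + cA * (r2 + \<kappa>) + cB * (r2 + \<kappa>')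
     \<le> ftt x t + (\<Sum>i\<in>UNIV. fxx i x t)"
  proof -
    have gA: "(u.U x t \<bullet> u.Utt x t) / ?A + (\<Sum>i\<in>UNIV. (u.U x t \<bullet> u.Uxx i x t) / ?A) = r2 + \<kappa>"
    proof -
      have "(u.U x t \<bullet> u.Utt x t) / ?A + (\<Sum>i\<in>UNIV. (u.U x t \<bullet> u.Uxx i x t) / ?A)
         = (u.U x t \<bullet> (u.Utt x t + (\<Sum>i\<in>UNIV. u.Uxx i x t))) / ?A"
        by (simp add: inner_add_right inner_sum_right add_divide_distrib sum_divide_distrib)
      also have "\<dots> = r2 + \<kappa>" unfolding u.U_pde using A by (simp add: AA_def r2_def)
      finally show ?thesis .
    qed
    have gB: "(v.U x t \<bullet> v.Utt x t) / ?B + (\<Sum>i\<in>UNIV. (v.U x t \<bullet> v.Uxx i x t) / ?B) = r2 + \<kappa>'"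
    proof -
      have "(v.U x t \<bullet> v.Utt x t) / ?B + (\<Sum>i\<in>UNIV. (v.U x t \<bullet> v.Uxx i x t) / ?B)
         = (v.U x t \<bullet> (v.Utt x t + (\<Sum>i\<in>UNIV. v.Uxx i x t))) / ?B"
        by (simp add: inner_add_right inner_sum_right add_divide_distrib sum_divide_distrib)
      also have "\<dots> = r2 + \<kappa>'" unfolding v.U_pde using B by (simp add: BB_def r2_def)
      finally show ?thesis .
    qed
    have "(2 * dl * (m * (u.Ut x t \<bullet> u.Ut x t) + 4 * (1 - dl) * (v.Ut x t \<bullet> v.Ut x t) / m - 2 * (2 - Q) * (norm (u.Ut x t) * norm (v.Ut x t)))
      + cA * ((u.U x t \<bullet> u.Utt x t) / ?A) + cB * ((v.U x t \<bullet> v.Utt x t) / ?B))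
      + (\<Sum>i\<in>UNIV. 2 * dl * (m * (u.Ux i x t \<bullet> u.Ux i x t) + 4 * (1 - dl) * (v.Ux i x t \<bullet> v.Ux i x t) / m - 2 * (2 - Q) * (norm (u.Ux i x t) * norm (v.Ux i x t)))
      + cA * ((u.U x t \<bullet> u.Uxx i x t) / ?A) + cB * ((v.U x t \<bullet> v.Uxx i x t) / ?B))
      \<le> ftt x t + (\<Sum>i\<in>UNIV. fxx i x t)"
      unfolding ftt_def fxx_def norm_eq_sqrt_inner by (intro add_mono sum_mono low)
    also have "(2 * dl * (m * (u.Ut x t \<bullet> u.Ut x t) + 4 * (1 - dl) * (v.Ut x t \<bullet> v.Ut x t) / m - 2 * (2 - Q) * (norm (u.Ut x t) * norm (v.Ut x t)))
      + cA * ((u.U x t \<bullet> u.Utt x t) / ?A) + cB * ((v.U x t \<bullet> v.Utt x t) / ?B))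
      + (\<Sum>i\<in>UNIV. 2 * dl * (m * (u.Ux i x t \<bullet> u.Ux i x t) + 4 * (1 - dl) * (v.Ux i x t \<bullet> v.Ux i x t) / m - 2 * (2 - Q) * (norm (u.Ux i x t) * norm (v.Ux i x t)))
      + cA * ((u.U x t \<bullet> u.Uxx i x t) / ?A) + cB * ((v.U x t \<bullet> v.Uxx i x t) / ?B))
      = 2 * dl * (m * sE + 4 * (1 - dl) * sF / m - 2 * (2 - Q) * sEF)
       + cA * ((u.U x t \<bullet> u.Utt x t) / ?A + (\<Sum>i\<in>UNIV. (u.U x t \<bullet> u.Uxx i x t) / ?A))
       + cB * ((v.U x t \<bullet> v.Utt x t) / ?B + (\<Sum>i\<in>UNIV. (v.U x t \<bullet> v.Uxx i x t) / ?B))"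
      unfolding sE_def sF_def sEF_def
      by (simp only: sum.distrib sum_subtractf sum_distrib_left[symmetric] sum_divide_distrib[symmetric])
         (simp add: algebra_simps add_divide_distrib diff_divide_distrib)
    finally show ?thesis unfolding gA gB .
  qed
  moreover have "2 * dl * (m * (r2 * ?A)) \<le> cA * (r2 + \<kappa>)"
  proof -
    have "2 * dl * ?Z * 1 \<le> cA" unfolding cA_def
      using dl_bounds Z th_bounds al_ge M by (intro mult_left_mono) auto
    moreover have "0 \<le> 2 * dl * ?Z" using dl_bounds Z by simp
    ultimately have "2 * dl * ?Z * r2 \<le> cA * (r2 + \<kappa>)" using r2 u.kappa by (intro mult_mono) auto
    then show ?thesis by (simp add: ZZ_def m_def mult_ac)
  qed
  \<comment> \<open>Since \<open>8 * dl = 2 * be * (2 * be - 1)\<close> and 2 be - 1 <= 1, the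
    summand |v|^Q of \<open>phi\<close> alone pays for the potential part of
    \<open>eV\<close>.\<close>
  moreover have "2 * dl * (4 * (1 - dl) * (r2 * ?B) / m) \<le> cB * (r2 + \<kappa>')"
  proof -
    have "8 * dl * (1 - dl) \<le> 2 * be * 1"
      unfolding dl_be using be_bounds dl_bounds by (intro mult_mono) auto
    then have "8 * dl * (1 - dl) * (?B / m) \<le> 2 * be * (?B powr be)"
    proof (rule order.trans[OF mult_right_mono])
      show "0 \<le> ?B / m" using B m by simp
      have "?B / m \<le> ?B powr be" using Mth_Y[OF A B] m by (simp add: m_def field_simps)
      then have "2 * be * (?B / m) \<le> 2 * be * ?B powr be"
        using be_bounds by (intro mult_left_mono) auto
      then show "2 * be * 1 * (?B / m) \<le> 2 * be * ?B powr be" by (simp only: mult_1_right)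
    qed
    also have "2 * be * (?B powr be) \<le> cB" unfolding cB_def
      using dl_bounds Z th_bounds be_bounds M by simp
    finally have le: "8 * dl * (1 - dl) * (?B / m) \<le> cB" .
    moreover have "0 \<le> 8 * dl * (1 - dl) * (?B / m)" using B m dl_bounds by simp
    ultimately have "8 * dl * (1 - dl) * (?B / m) * r2 \<le> cB * (r2 + \<kappa>')"
      using r2 v.kappa by (intro mult_mono) auto
    moreover have "2 * dl * (4 * (1 - dl) * (r2 * ?B) / m) = 8 * dl * (1 - dl) * (?B / m) * r2"
      using m by (simp add: field_simps)
    ultimately show ?thesis by (simp only:)
  qed
  moreover have eE: "eU x t = sE + r2 * ?A" "eV x t = sF + r2 * ?B"
    by (simp_all add: eU_def eV_def sE_def sF_def r2_def)
  \<comment> \<open>Cauchy-Schwarz in d + 1 variables: the coordinates are first collapsed to one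
    number, then paired with the time derivative.\<close>
  have sEF: "sEF \<le> sqrt (eU x t) * sqrt (eV x t)"
  proof -
    have L: "(\<Sum>i\<in>UNIV. norm (u.Ux i x t) * norm (v.Ux i x t))
        \<le> sqrt (\<Sum>i\<in>UNIV. u.Ux i x t \<bullet> u.Ux i x t) * sqrt (\<Sum>i\<in>UNIV. v.Ux i x t \<bullet> v.Ux i x t)"
      using L2_set_mult_ineq[of "\<lambda>i. norm (u.Ux i x t)" "\<lambda>i. norm (v.Ux i x t)" UNIV]
      by (simp add: L2_set_def dot_square_norm)
    define a b where "a = (\<Sum>i\<in>UNIV. u.Ux i x t \<bullet> u.Ux i x t)" and "b = (\<Sum>i\<in>UNIV. v.Ux i x t \<bullet> v.Ux i x t)"
    have ab: "0 \<le> a" "0 \<le> b" by (auto simp: a_def b_def intro!: sum_nonneg)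
    have "sEF \<le> (norm (u.Ut x t), sqrt a) \<bullet> (norm (v.Ut x t), sqrt b)"
      using L by (simp add: sEF_def a_def b_def)
    also have "\<dots> \<le> norm (norm (u.Ut x t), sqrt a) * norm (norm (v.Ut x t), sqrt b)"
      by (rule norm_cauchy_schwarz)
    also have "\<dots> = sqrt sE * sqrt sF"
      using ab by (simp add: norm_Pair sE_def sF_def dot_square_norm a_def b_def)
    also have "\<dots> \<le> sqrt (eU x t) * sqrt (eV x t)"
      unfolding eE using A B r2 ab
      by (intro mult_mono real_sqrt_le_mono) (auto simp: sE_def sF_def a_def b_def)
    finally show ?thesis .
  qed
  \<comment> \<open>The weights \<open>m\<close> and 1/m have product 1, so \<open>m\<close> leaves
    no trace in the geometric mean on the left.\<close>
  moreover have "2 * (3 - Q) * (sqrt (eU x t) * sqrt (eV x t)) \<le> m * eU x t + 4 * (1 - dl) * eV x t / m"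
  proof -
    have e0: "0 \<le> eU x t" "0 \<le> eV x t" by (rule energy_nonneg)+
    have "0 \<le> (sqrt m * sqrt (eU x t) - (3 - Q) * (sqrt (eV x t) / sqrt m))\<^sup>2" by simp
    also have "\<dots> = m * eU x t + (3 - Q)\<^sup>2 * eV x t / m - 2 * (3 - Q) * (sqrt (eU x t) * sqrt (eV x t))"
      using e0 m by (simp add: power2_diff power_mult_distrib power_divide)
    finally have "2 * (3 - Q) * (sqrt (eU x t) * sqrt (eV x t)) \<le> m * eU x t + (3 - Q)\<^sup>2 * eV x t / m" by simp
    also have "(3 - Q)\<^sup>2 * eV x t / m \<le> 4 * (1 - dl) * eV x t / m"
      using dl_quad e0 m by (intro divide_right_mono mult_right_mono) auto
    finally show ?thesis by simp
  qed
  moreover have "2 * (2 - Q) * sEF \<le> 2 * (2 - Q) * (sqrt (eU x t) * sqrt (eV x t))"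
    using sEF Q_bounds by (intro mult_left_mono) auto
  ultimately have 1: "2 * dl * (m * sE + 4 * (1 - dl) * sF / m - 2 * (2 - Q) * sEF)
       + 2 * dl * (m * (r2 * ?A)) + 2 * dl * (4 * (1 - dl) * (r2 * ?B) / m) \<le> ftt x t + (\<Sum>i\<in>UNIV. fxx i x t)"
    and 2: "2 * (sqrt (eU x t) * sqrt (eV x t)) \<le> m * eU x t + 4 * (1 - dl) * eV x t / m - 2 * (2 - Q) * sEF"
    by (simp_all add: algebra_simps)
  have "2 * dl * (2 * (sqrt (eU x t) * sqrt (eV x t))) \<le> 2 * dl * (m * eU x t + 4 * (1 - dl) * eV x t / m - 2 * (2 - Q) * sEF)"
    using dl_bounds by (intro mult_left_mono 2) auto
  also have "\<dots> = 2 * dl * (m * sE + 4 * (1 - dl) * sF / m - 2 * (2 - Q) * sEF)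
       + 2 * dl * (m * (r2 * ?A)) + 2 * dl * (4 * (1 - dl) * (r2 * ?B) / m)"
    unfolding eE by (simp add: algebra_simps add_divide_distrib diff_divide_distrib)
  finally show ?thesis using 1 by simp
qed

end

section \<open>Integration over space and time\<close>

context wave_pair
begin

lemma cont_f_slices:
  "continuous_on UNIV (\<lambda>x. f0 x t)" "continuous_on UNIV (\<lambda>x. ft x t)" "continuous_on UNIV (\<lambda>x. ftt x t)"
  "continuous_on UNIV (\<lambda>x. fx i x t)" "continuous_on UNIV (\<lambda>x. fxx i x t)" "continuous_on UNIV (\<lambda>t. ftt x t)"
proof -
  have S: "continuous_on UNIV (\<lambda>x. g x t)" if "continuous_on UNIV (\<lambda>z. g (fst z) (snd z))" for g :: "real ^ 'd \<Rightarrow> real \<Rightarrow> real"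
    using continuous_on_compose2[OF that, of UNIV "\<lambda>x. (x, t)"] by (simp add: continuous_intros)
  show "continuous_on UNIV (\<lambda>x. f0 x t)" "continuous_on UNIV (\<lambda>x. ft x t)" "continuous_on UNIV (\<lambda>x. ftt x t)"
    "continuous_on UNIV (\<lambda>x. fx i x t)" "continuous_on UNIV (\<lambda>x. fxx i x t)"
    by (rule S, rule cont_parts cont_f)+
  show "continuous_on UNIV (\<lambda>t. ftt x t)"
    using continuous_on_compose2[OF cont_f(2), of UNIV "\<lambda>t. (x, t)"] by (simp add: continuous_intros)
qed

lemma f_integrable:
  assumes t: "0 \<le> t"
  shows "integrable lborel (\<lambda>x. f0 x t)" "integrable lborel (\<lambda>x. ft x t)" "integrable lborel (\<lambda>x. ftt x t)"
    "integrable lborel (\<lambda>x. fx i x t)" "integrable lborel (\<lambda>x. fxx i x t)"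
proof -
  obtain K where K: "\<And>x t i. 0 \<le> t \<Longrightarrow>
     \<bar>f0 x t\<bar> \<le> K * (exp (- t) * exp (- (1 / 4) * (norm x)\<^sup>2)) \<and>
     \<bar>ft x t\<bar> \<le> K * (exp (- t) * exp (- (1 / 4) * (norm x)\<^sup>2)) \<and>
     \<bar>ftt x t\<bar> \<le> K * (exp (- t) * exp (- (1 / 4) * (norm x)\<^sup>2)) \<and>
     \<bar>fx i x t\<bar> \<le> K * (exp (- t) * exp (- (1 / 4) * (norm x)\<^sup>2)) \<and>
     \<bar>fxx i x t\<bar> \<le> K * (exp (- t) * exp (- (1 / 4) * (norm x)\<^sup>2))"
    using f_bounds by blast
  have I: "integrable lborel g" if "continuous_on UNIV g" "\<And>x. \<bar>g x\<bar> \<le> K * (exp (- t) * exp (- (1 / 4) * (norm x)\<^sup>2))" for g :: "real ^ 'd \<Rightarrow> real"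
    by (rule integrable_gauss_dominated[where K = "K * exp (- t)" and s = "1/4"])
       (use that in \<open>auto intro: borel_measurable_continuous_onI simp: mult.assoc\<close>)
  show "integrable lborel (\<lambda>x. f0 x t)" "integrable lborel (\<lambda>x. ft x t)" "integrable lborel (\<lambda>x. ftt x t)"
    "integrable lborel (\<lambda>x. fx i x t)" "integrable lborel (\<lambda>x. fxx i x t)"
    by (rule I, rule cont_f_slices, use K[OF t] in blast)+
qed

lemma integral_fxx_0: "0 \<le> t \<Longrightarrow> (\<integral>x. fxx i x t \<partial>lborel) = 0"
  by (rule integral_directional_derivative_eq_0[where f = "\<lambda>x. fx i x t" and b = "axis i 1"])
     (use f_derivs_x(2)[where s = 0] in \<open>auto intro!: cont_f_slices f_integrable\<close>)

text \<open>J(0) is the integral of t J''(t) over t > 0, and in the same way \<open>f0\<close> at t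
  = 0 is the integral of t \<open>ftt\<close>. After integration over x the derivatives
  \<open>fxx\<close> drop out, and \<open>laplacian_lower\<close> compares the two integrands.
  Keeping \<open>J\<close> abstract allows either wave to carry the function or its dual.\<close>

lemma bilinear_bound:
  fixes J J1 J2 :: "real \<Rightarrow> real"
  assumes J: "\<And>t. (J has_real_derivative J1 t) (at t)" "\<And>t. (J1 has_real_derivative J2 t) (at t)"
    and J2: "continuous_on UNIV J2" and k: "0 \<le> k"
    and q: "\<And>t. 0 \<le> t \<Longrightarrow> \<exists>q. (\<forall>x. \<bar>q x\<bar> \<le> sqrt (eU x t) * sqrt (eV x t)) \<and> J2 t = k * (\<integral>x. q x \<partial>lborel)"
    and lim: "((\<lambda>T. J T - T * J1 T) \<longlongrightarrow> 0) at_top"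
  shows "\<bar>J 0\<bar> \<le> k / (4 * dl) * (\<integral>x. f0 x 0 \<partial>lborel)"
proof -
  obtain K where K0: "0 \<le> K" and K: "\<And>x t i. 0 \<le> t \<Longrightarrow>
     \<bar>ft x t\<bar> \<le> K * (exp (- t) * exp (- (1 / 4) * (norm x)\<^sup>2)) \<and>
     \<bar>ftt x t\<bar> \<le> K * (exp (- t) * exp (- (1 / 4) * (norm x)\<^sup>2))"
    using f_bounds by blast
  define w where "w x = exp (- (1 / 4) * (norm x)\<^sup>2)" for x :: "real ^ 'd"
  have wi: "integrable lborel w" unfolding w_def by (rule integrable_gaussian_vec) simp
  define W where "W = (\<integral>x. w x \<partial>lborel)"
  define \<Psi> where "\<Psi> t = (\<integral>x. ftt x t \<partial>lborel)" for t
  have J2b: "\<bar>J2 t\<bar> \<le> k / (4 * dl) * \<Psi> t" if t: "0 \<le> t" for t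
  proof -
    obtain g where g: "\<And>x. \<bar>g x\<bar> \<le> sqrt (eU x t) * sqrt (eV x t)" "J2 t = k * (\<integral>x. g x \<partial>lborel)"
      using q[OF t] by blast
    have lap: "integrable lborel (\<lambda>x. ftt x t + (\<Sum>i\<in>UNIV. fxx i x t))"
      by (intro Bochner_Integration.integrable_add Bochner_Integration.integrable_sum f_integrable t)
    have gl: "4 * dl * \<bar>g x\<bar> \<le> ftt x t + (\<Sum>i\<in>UNIV. fxx i x t)" for x
    proof -
      have "4 * dl * \<bar>g x\<bar> \<le> 4 * dl * (sqrt (eU x t) * sqrt (eV x t))"
        using dl_bounds by (intro mult_left_mono g(1)) auto
      then show ?thesis using laplacian_lower[of x t] by linarith
    qed
    have "4 * dl * \<bar>\<integral>x. g x \<partial>lborel\<bar> \<le> 4 * dl * (\<integral>x. \<bar>g x\<bar> \<partial>lborel)"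
      using dl_bounds integral_abs_bound[of lborel g] by (intro mult_left_mono) auto
    also have "\<dots> = (\<integral>x. 4 * dl * \<bar>g x\<bar> \<partial>lborel)" by simp
    also have "\<dots> \<le> (\<integral>x. ftt x t + (\<Sum>i\<in>UNIV. fxx i x t) \<partial>lborel)"
      by (rule integral_mono'[OF lap gl])
         (use gl dl_bounds in \<open>auto intro: order.trans[OF _ gl]\<close>)
    also have "\<dots> = \<Psi> t"
      by (simp add: \<Psi>_def integral_fxx_0[OF t] f_integrable[OF t] Bochner_Integration.integral_sum)
    finally have "4 * dl * \<bar>\<integral>x. g x \<partial>lborel\<bar> \<le> \<Psi> t" .
    then have "\<bar>\<integral>x. g x \<partial>lborel\<bar> \<le> \<Psi> t / (4 * dl)" using dl_bounds by (simp add: field_simps)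
    from mult_left_mono[OF this k] show ?thesis unfolding g(2) using k by (simp add: abs_mult)
  qed
  \<comment> \<open>Integration by parts on [0, T]. Of the boundary terms at T,
    \<open>- f0 x T\<close> is nonpositive and is dropped, while \<open>T * ft x T\<close>
    contributes at most a constant times T exp(- T).\<close>
  have main: "\<bar>T * J1 T - J T + J 0\<bar> \<le> k / (4 * dl) * ((\<integral>x. f0 x 0 \<partial>lborel) + K * W * (T * exp (- T)))" if T: "0 \<le> T" for T
  proof -
    let ?g = "\<lambda>x t. t * ftt x t * indicator {0..T} t"
    have meas: "(\<lambda>(x, t). ?g x t) \<in> borel_measurable (lborel \<Otimes>\<^sub>M lborel)"
    proof -
      have "(\<lambda>z. ftt (fst z) (snd z)) \<in> borel_measurable (borel \<Otimes>\<^sub>M borel)"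
        unfolding borel_prod by (rule borel_measurable_continuous_onI[OF cont_f(2)])
      then have [measurable]: "(\<lambda>z. ftt (fst z) (snd z)) \<in> borel_measurable (lborel \<Otimes>\<^sub>M lborel)"
        by (simp cong: measurable_cong_sets)
      show ?thesis unfolding case_prod_beta by measurable
    qed
    have gint: "integrable (lborel \<Otimes>\<^sub>M lborel) (\<lambda>(x, t). ?g x t)"
    proof (rule Bochner_Integration.integrable_bound)
      show "integrable (lborel \<Otimes>\<^sub>M lborel) (\<lambda>(x, t). w x * (K * T * indicator {0..T} t))"
      proof (rule lborel_pair.Fubini_integrable)
        show "(\<lambda>(x, t). w x * (K * T * indicator {0..T} t)) \<in> borel_measurable (lborel \<Otimes>\<^sub>M lborel)"
          unfolding w_def by measurable
        have "(\<lambda>x. \<integral>t. norm (w x * (K * T * indicator {0..T} t)) \<partial>lborel)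
            = (\<lambda>x. w x * (\<integral>t. \<bar>K * T * indicator {0..T} t\<bar> \<partial>lborel))"
          by (simp add: abs_mult w_def)
        then show "integrable lborel (\<lambda>x. \<integral>t. norm (case (x, t) of (x, t) \<Rightarrow> w x * (K * T * indicator {0..T} t)) \<partial>lborel)"
          using wi by simp
      qed (use integrable_real_indicator[of "{0..T}" lborel] in \<open>simp add: emeasure_lborel_Icc_eq T\<close>)
      show "AE z in lborel \<Otimes>\<^sub>M lborel. norm (case z of (x, t) \<Rightarrow> ?g x t)
          \<le> norm (case z of (x, t) \<Rightarrow> w x * (K * T * indicator {0..T} t))"
      proof (rule AE_I2)
        fix z :: "(real ^ 'd) \<times> real"
        obtain x t where z: "z = (x, t)" by force
        show "norm (case z of (x, t) \<Rightarrow> ?g x t) \<le> norm (case z of (x, t) \<Rightarrow> w x * (K * T * indicator {0..T} t))"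
        proof (cases "t \<in> {0..T}")
          case True
          then have t: "0 \<le> t" "t \<le> T" by auto
          have "\<bar>ftt x t\<bar> \<le> K * (exp (- t) * w x)" using K[OF t(1), of x] by (simp add: w_def)
          also have "\<dots> \<le> K * (1 * w x)" using t K0 by (intro mult_left_mono mult_right_mono) (auto simp: w_def)
          finally have "\<bar>t\<bar> * \<bar>ftt x t\<bar> \<le> T * (K * w x)" using t by (intro mult_mono) (auto simp: w_def K0)
          then show ?thesis using True T K0 by (simp add: z abs_mult w_def mult_ac)
        qed (simp add: z)
      qed
    qed (rule meas)
    have ftc_t: "(\<integral>t. ?g x t \<partial>lborel) = T * ft x T - f0 x T + f0 x 0" for x
    proof -
      have d: "((\<lambda>t. t * ft x t - f0 x t) has_real_derivative t * ftt x t) (at t)" for t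
        by (rule DERIV_cong[OF DERIV_diff[OF DERIV_mult[OF DERIV_ident f_derivs_t(2)] f_derivs_t(1)]]) simp
      have c: "isCont (\<lambda>t. t * ftt x t) t" for t
        using cont_f_slices(6)[of x] by (intro continuous_intros) (simp add: continuous_on_eq_continuous_at)
      show ?thesis using integral_FTC_Icc_real[OF T d c] by simp
    qed
    have ftc_J: "(\<integral>t. t * J2 t * indicator {0..T} t \<partial>lborel) = T * J1 T - J T + J 0"
    proof -
      have d: "((\<lambda>t. t * J1 t - J t) has_real_derivative t * J2 t) (at t)" for t
        by (rule DERIV_cong[OF DERIV_diff[OF DERIV_mult[OF DERIV_ident J(2)] J(1)]]) simp
      have c: "isCont (\<lambda>t. t * J2 t) t" for t
        using J2 by (intro continuous_intros) (simp add: continuous_on_eq_continuous_at)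
      show ?thesis using integral_FTC_Icc_real[OF T d c] by simp
    qed
    have swap: "(\<integral>t. (\<integral>x. ?g x t \<partial>lborel) \<partial>lborel) = (\<integral>x. (\<integral>t. ?g x t \<partial>lborel) \<partial>lborel)"
      by (rule lborel_pair.Fubini_integral[OF gint])
    have inner: "(\<integral>x. ?g x t \<partial>lborel) = t * \<Psi> t * indicator {0..T} t" for t
      by (simp add: \<Psi>_def)
    have Pint: "integrable lborel (\<lambda>t. t * \<Psi> t * indicator {0..T} t)"
      using lborel_pair.integrable_snd[OF gint] unfolding inner .
    have "\<bar>T * J1 T - J T + J 0\<bar> \<le> (\<integral>t. \<bar>t * J2 t * indicator {0..T} t\<bar> \<partial>lborel)"
      unfolding ftc_J[symmetric] by (rule integral_abs_bound)
    also have "\<dots> \<le> (\<integral>t. k / (4 * dl) * (t * \<Psi> t * indicator {0..T} t) \<partial>lborel)"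
    proof (rule integral_mono')
      show "integrable lborel (\<lambda>t. k / (4 * dl) * (t * \<Psi> t * indicator {0..T} t))"
        by (rule integrable_mult_right[OF Pint])
      show *: "\<bar>t * J2 t * indicator {0..T} t\<bar> \<le> k / (4 * dl) * (t * \<Psi> t * indicator {0..T} t)" for t
      proof (cases "t \<in> {0..T}")
        case True
        then have "t * \<bar>J2 t\<bar> \<le> t * (k / (4 * dl) * \<Psi> t)" using J2b by (intro mult_left_mono) auto
        then show ?thesis using True by (simp add: abs_mult mult.left_commute)
      qed simp
      show "0 \<le> k / (4 * dl) * (t * \<Psi> t * indicator {0..T} t)" for t
        using *[of t] abs_ge_zero order.trans by blast
    qed
    also have "\<dots> = k / (4 * dl) * (\<integral>x. T * ft x T - f0 x T + f0 x 0 \<partial>lborel)"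
      using swap unfolding inner ftc_t by simp
    also have "\<dots> \<le> k / (4 * dl) * ((\<integral>x. f0 x 0 \<partial>lborel) + K * W * (T * exp (- T)))"
    proof (rule mult_left_mono)
      have "(\<integral>x. T * ft x T - f0 x T + f0 x 0 \<partial>lborel) \<le> (\<integral>x. T * (K * exp (- T)) * w x + f0 x 0 \<partial>lborel)"
      proof (rule integral_mono)
        show "integrable lborel (\<lambda>x. T * ft x T - f0 x T + f0 x 0)"
          using f_integrable[OF T] f_integrable[of 0] by auto
        show "integrable lborel (\<lambda>x. T * (K * exp (- T)) * w x + f0 x 0)"
          using wi f_integrable[of 0] by auto
        fix x
        have "ft x T \<le> K * (exp (- T) * w x)" using conjunct1[OF K[OF T, of x]] unfolding w_def by linarith
        then have "T * ft x T \<le> T * (K * (exp (- T) * w x))" using T by (intro mult_left_mono)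
        moreover have "0 \<le> f0 x T" unfolding f0_def by (rule phi_nonneg[OF AB_pos])
        ultimately show "T * ft x T - f0 x T + f0 x 0 \<le> T * (K * exp (- T)) * w x + f0 x 0" by (simp add: mult_ac)
      qed
      also have "\<dots> = (\<integral>x. f0 x 0 \<partial>lborel) + K * W * (T * exp (- T))"
        using wi f_integrable[of 0] by (simp add: W_def)
      finally show "(\<integral>x. T * ft x T - f0 x T + f0 x 0 \<partial>lborel) \<le> (\<integral>x. f0 x 0 \<partial>lborel) + K * W * (T * exp (- T))" .
    qed (use k dl_bounds in simp)
    finally show ?thesis .
  qed
  have "((\<lambda>T. \<bar>J 0 - (J T - T * J1 T)\<bar>) \<longlongrightarrow> \<bar>J 0 - 0\<bar>) at_top"
    by (intro tendsto_intros lim)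
  moreover have "((\<lambda>T. k / (4 * dl) * ((\<integral>x. f0 x 0 \<partial>lborel) + K * W * (T * exp (- T)))) \<longlongrightarrow>
      k / (4 * dl) * ((\<integral>x. f0 x 0 \<partial>lborel) + K * W * 0)) at_top"
    using tendsto_power_div_exp_0[of 1] by (intro tendsto_intros) (simp add: exp_minus divide_inverse)
  moreover have "eventually (\<lambda>T. \<bar>J 0 - (J T - T * J1 T)\<bar> \<le> k / (4 * dl) * ((\<integral>x. f0 x 0 \<partial>lborel) + K * W * (T * exp (- T)))) at_top"
    using eventually_ge_at_top[of 0]
  proof eventually_elim
    case (elim T)
    have "J 0 - (J T - T * J1 T) = T * J1 T - J T + J 0" by simp
    then show ?case using main[OF elim] by (simp only:)
  qed
  ultimately show ?thesis
    using tendsto_le[OF trivial_limit_at_top_linorder] by fastforce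
qed

lemma f0_integral_le:
  "(\<integral>x. f0 x 0 \<partial>lborel) \<le> (\<integral>x. dl * norm (u.U x 0) powr P + (1 + dl) * norm (v.U x 0) powr Q \<partial>lborel)"
  if "integrable lborel (\<lambda>x. norm (u.U x 0) powr P)" "integrable lborel (\<lambda>x. norm (v.U x 0) powr Q)"
proof (rule integral_mono)
  show "integrable lborel (\<lambda>x. f0 x 0)" by (rule f_integrable) simp
  show "integrable lborel (\<lambda>x. dl * norm (u.U x 0) powr P + (1 + dl) * norm (v.U x 0) powr Q)"
    using that by auto
  fix x
  have "AA x 0 powr al = norm (u.U x 0) powr P" "BB x 0 powr be = norm (v.U x 0) powr Q"
    using u.U_pos[of x 0] v.U_pos[of x 0]
    by (simp_all add: AA_def BB_def al_def be_def dot_square_norm powr_powr flip: powr_numeral)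
  then show "f0 x 0 \<le> dl * norm (u.U x 0) powr P + (1 + dl) * norm (v.U x 0) powr Q"
    using phi_le[OF AB_pos, of x 0 x 0] by (simp add: f0_def)
qed

end

section \<open>Lebesgue spaces\<close>

text \<open>Convexity of \<open>powr\<close> up to the endpoint 0, where it reduces to k^p <= k for
  0 < k < 1.\<close>

lemma powr_convex_combination:
  fixes a b l p :: real
  assumes "0 \<le> a" "0 \<le> b" "0 < l" "l < 1" "1 \<le> p"
  shows "(l * a + (1 - l) * b) powr p \<le> l * a powr p + (1 - l) * b powr p"
proof (cases "a = 0 \<or> b = 0")
  case True
  have sc: "(k * c) powr p \<le> k * c powr p" if "0 < k" "k < 1" "0 \<le> c" for k c :: real
  proof -
    have "k powr p \<le> k powr 1" using that assms by (intro powr_mono') auto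
    then show ?thesis using that by (simp add: powr_mult mult_right_mono)
  qed
  from True show ?thesis
    using sc[of l a] sc[of "1 - l" b] assms by auto
next
  case False
  have "convex_on {0<..} (\<lambda>x::real. x powr p)" by (rule powr_convex[OF assms(5)])
  from convex_onD[OF this, of "1 - l" a b] show ?thesis using False assms by simp
qed

lemma Lp_spaceI:
  assumes "f \<in> borel_measurable lebesgue" "integrable lebesgue (\<lambda>x. norm (f x) powr p)"
  shows "f \<in> Lp_space p"
  using assms by (simp add: Lp_space_def)

lemma Lp_spaceD:
  assumes "f \<in> Lp_space p"
  shows "f \<in> borel_measurable lebesgue" "integrable lebesgue (\<lambda>x. norm (f x) powr p)"
  using assms by (simp_all add: Lp_space_def)

lemma Lp_norm_nonneg: "0 \<le> Lp_norm p f"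
  by (simp add: Lp_norm_def)

lemma Lp_norm_powr:
  assumes "0 < p" shows "Lp_norm p f powr p = (\<integral>x. norm (f x) powr p \<partial>lebesgue)"
  using assms by (simp add: Lp_norm_def powr_powr integral_nonneg_AE)

lemma Lp_norm_le_iff:
  assumes "0 < p" "0 \<le> C"
  shows "Lp_norm p f \<le> C \<longleftrightarrow> (\<integral>x. norm (f x) powr p \<partial>lebesgue) \<le> C powr p"
proof -
  have "Lp_norm p f powr p \<le> C powr p" if "Lp_norm p f \<le> C"
    using that assms Lp_norm_nonneg by (intro powr_mono2) auto
  moreover have "C powr p < Lp_norm p f powr p" if "\<not> Lp_norm p f \<le> C"
    using that assms by (intro powr_less_mono2) auto
  ultimately show ?thesis using assms(1) by (auto simp: Lp_norm_powr not_le[symmetric])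
qed

lemma Lp_space_bound:
  fixes f :: "real ^ 'd \<Rightarrow> 'b::euclidean_space" and g :: "real ^ 'd \<Rightarrow> 'c::euclidean_space"
  assumes "f \<in> borel_measurable lebesgue" "g \<in> Lp_space p" "AE x in lebesgue. norm (f x) \<le> norm (g x)" "0 \<le> p"
  shows "f \<in> Lp_space p" "Lp_norm p f \<le> Lp_norm p g"
proof -
  have le: "AE x in lebesgue. norm (f x) powr p \<le> norm (g x) powr p"
    using assms(3) by eventually_elim (use assms(4) in \<open>auto intro: powr_mono2\<close>)
  note [measurable] = assms(1)
  show f: "f \<in> Lp_space p"
  proof (rule Lp_spaceI[OF assms(1)])
    show "integrable lebesgue (\<lambda>x. norm (f x) powr p)"
      by (rule Bochner_Integration.integrable_bound[OF Lp_spaceD(2)[OF assms(2)]]) (use le in auto)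
  qed
  show "Lp_norm p f \<le> Lp_norm p g"
    unfolding Lp_norm_def using assms(4)
    by (intro powr_mono2 integral_mono_AE Lp_spaceD[OF f] Lp_spaceD[OF assms(2)] le) (auto intro: integral_nonneg_AE)
qed

lemma Lp_norm_cong:
  fixes f g :: "real ^ 'd \<Rightarrow> 'b::euclidean_space"
  assumes "f \<in> borel_measurable lebesgue" "g \<in> borel_measurable lebesgue" "AE x in lebesgue. f x = g x"
  shows "Lp_norm p f = Lp_norm p g"
  unfolding Lp_norm_def using assms
  by (intro arg_cong[where f = "\<lambda>a. a powr _"] integral_cong_AE) auto

lemma Lp_space_scaleR:
  fixes f :: "real ^ 'd \<Rightarrow> 'b::euclidean_space"
  assumes "f \<in> Lp_space p"
  shows "(\<lambda>x. a *\<^sub>R f x) \<in> Lp_space p"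
  using assms unfolding Lp_space_def by (auto simp: powr_mult)

lemma Lp_norm_scaleR: "0 < p \<Longrightarrow> Lp_norm p (\<lambda>x. a *\<^sub>R f x) = \<bar>a\<bar> * Lp_norm p f"
  by (simp add: Lp_norm_def powr_mult powr_powr integral_nonneg_AE)

lemma Lp_space_add:
  fixes f g :: "real ^ 'd \<Rightarrow> 'b::euclidean_space"
  assumes f: "f \<in> Lp_space p" and g: "g \<in> Lp_space p" and p: "0 \<le> p"
  shows "(\<lambda>x. f x + g x) \<in> Lp_space p"
proof (rule Lp_spaceI)
  note [measurable] = Lp_spaceD(1)[OF f] Lp_spaceD(1)[OF g]
  show "(\<lambda>x. f x + g x) \<in> borel_measurable lebesgue" by measurable
  show "integrable lebesgue (\<lambda>x. norm (f x + g x) powr p)"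
  proof (rule Bochner_Integration.integrable_bound)
    show "integrable lebesgue (\<lambda>x. 2 powr p * (norm (f x) powr p + norm (g x) powr p))"
      using Lp_spaceD[OF f] Lp_spaceD[OF g] by auto
    have "norm (f x + g x) powr p \<le> 2 powr p * (norm (f x) powr p + norm (g x) powr p)" for x
    proof -
      have "norm (f x + g x) \<le> 2 * max (norm (f x)) (norm (g x))"
        using norm_triangle_ineq[of "f x" "g x"] by linarith
      then have "norm (f x + g x) powr p \<le> (2 * max (norm (f x)) (norm (g x))) powr p"
        using p by (intro powr_mono2) auto
      also have "\<dots> = 2 powr p * (max (norm (f x)) (norm (g x))) powr p" by (rule powr_mult)
      also have "\<dots> \<le> 2 powr p * (norm (f x) powr p + norm (g x) powr p)"
        by (intro mult_left_mono) (auto simp: max_def)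
      finally show ?thesis .
    qed
    then show "AE x in lebesgue. norm (norm (f x + g x) powr p) \<le> norm (2 powr p * (norm (f x) powr p + norm (g x) powr p))"
      by (intro AE_I2) (smt (verit) powr_ge_zero real_norm_def)
  qed measurable
qed

lemma Lp_space_diff:
  fixes f g :: "real ^ 'd \<Rightarrow> 'b::euclidean_space"
  assumes f: "f \<in> Lp_space p" and g: "g \<in> Lp_space p" and p: "0 \<le> p"
  shows "(\<lambda>x. f x - g x) \<in> Lp_space p"
  using Lp_space_add[OF f Lp_space_scaleR[OF g, of "-1"] p] by simp

lemma Lp_norm_zero_AE:
  fixes f :: "real ^ 'd \<Rightarrow> 'b::euclidean_space"
  assumes f: "f \<in> Lp_space p" and "Lp_norm p f = 0" "0 < p"
  shows "AE x in lebesgue. f x = 0"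
proof -
  have "(\<integral>x. norm (f x) powr p \<partial>lebesgue) = 0"
    using assms(2,3) Lp_norm_powr[OF assms(3), of f] by simp
  then have "AE x in lebesgue. norm (f x) powr p = 0"
    using integral_nonneg_eq_0_iff_AE[OF Lp_spaceD(2)[OF f]] by auto
  then show ?thesis by eventually_elim auto
qed

text \<open>Minkowski by convexity: with a and b the two norms, |f + g| / (a + b) is at most a
  convex combination of |f| / a and |g| / b, and its p-th power has integral at most 1. Vanishing
  norms are split off because of the divisions.\<close>

lemma Lp_norm_triangle:
  fixes f g :: "real ^ 'd \<Rightarrow> 'b::euclidean_space"
  assumes f: "f \<in> Lp_space p" and g: "g \<in> Lp_space p" and p: "1 \<le> p"
  shows "Lp_norm p (\<lambda>x. f x + g x) \<le> Lp_norm p f + Lp_norm p g"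
proof -
  have fg: "(\<lambda>x. f x + g x) \<in> Lp_space p" using Lp_space_add[OF f g] p by simp
  consider (f) "Lp_norm p f = 0" | (g) "Lp_norm p g = 0" | (pos) "0 < Lp_norm p f" "0 < Lp_norm p g"
    using Lp_norm_nonneg[of p f] Lp_norm_nonneg[of p g] by linarith
  then show ?thesis
  proof cases
    case f
    have "Lp_norm p (\<lambda>x. f x + g x) = Lp_norm p g"
      using Lp_norm_zero_AE[OF assms(1) f] p Lp_spaceD(1)[OF fg] Lp_spaceD(1)[OF g]
      by (intro Lp_norm_cong) auto
    then show ?thesis using f by simp
  next
    case g
    have "Lp_norm p (\<lambda>x. f x + g x) = Lp_norm p f"
      using Lp_norm_zero_AE[OF assms(2) g] p Lp_spaceD(1)[OF fg] Lp_spaceD(1)[OF f]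
      by (intro Lp_norm_cong) auto
    then show ?thesis using g by simp
  next
    case pos
    define a b where "a = Lp_norm p f" and "b = Lp_norm p g"
    have ab: "0 < a" "0 < b" using pos by (auto simp: a_def b_def)
    define l where "l = a / (a + b)"
    have l: "0 < l" "l < 1" "1 - l = b / (a + b)" using ab by (auto simp: l_def field_simps)
    have "norm (f x + g x) powr p \<le> (a + b) powr p * (l * (norm (f x) powr p / a powr p) + (1 - l) * (norm (g x) powr p / b powr p))" for x
    proof -
      have "norm (f x + g x) powr p \<le> (norm (f x) + norm (g x)) powr p"
        using p by (intro powr_mono2 norm_triangle_ineq) auto
      also have "norm (f x) + norm (g x) = (a + b) * (l * (norm (f x) / a) + (1 - l) * (norm (g x) / b))"
      proof -
        have "l * (norm (f x) / a) = norm (f x) / (a + b)" "(1 - l) * (norm (g x) / b) = norm (g x) / (a + b)"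
          using ab by (simp_all add: l(3)) (simp add: l_def)
        then show ?thesis using ab by (simp add: distrib_left)
      qed
      also have "\<dots> powr p = (a + b) powr p * (l * (norm (f x) / a) + (1 - l) * (norm (g x) / b)) powr p"
        by (rule powr_mult)
      also have "\<dots> \<le> (a + b) powr p * (l * (norm (f x) / a) powr p + (1 - l) * (norm (g x) / b) powr p)"
        using l p ab by (intro mult_left_mono powr_convex_combination) auto
      finally show ?thesis using ab by (simp add: powr_divide)
    qed
    then have "(\<integral>x. norm (f x + g x) powr p \<partial>lebesgue) \<le> (\<integral>x. (a + b) powr p * (l * (norm (f x) powr p / a powr p) + (1 - l) * (norm (g x) powr p / b powr p)) \<partial>lebesgue)"
      using Lp_spaceD(2)[OF f] Lp_spaceD(2)[OF g] Lp_spaceD(2)[OF fg]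
      by (intro integral_mono) auto
    also have "\<dots> = (a + b) powr p * (l * (a powr p / a powr p) + (1 - l) * (b powr p / b powr p))"
      using Lp_spaceD(2)[OF f] Lp_spaceD(2)[OF g] p unfolding a_def b_def by (simp add: Lp_norm_powr)
    also have "\<dots> = (a + b) powr p" using ab by simp
    finally show ?thesis using ab p by (subst Lp_norm_le_iff) (auto simp: a_def b_def)
  qed
qed

lemma Lp_norm_diff_commute: "Lp_norm p (\<lambda>x. f x - g x) = Lp_norm p (\<lambda>x. g x - f x)"
  by (simp add: Lp_norm_def norm_minus_commute)

lemma Lp_norm_triangle_diff:
  fixes f g h :: "real ^ 'd \<Rightarrow> 'b::euclidean_space"
  assumes "f \<in> Lp_space p" "g \<in> Lp_space p" "h \<in> Lp_space p" and p: "1 \<le> p"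
  shows "Lp_norm p (\<lambda>x. f x - h x) \<le> Lp_norm p (\<lambda>x. f x - g x) + Lp_norm p (\<lambda>x. g x - h x)"
  using Lp_norm_triangle[OF Lp_space_diff[OF assms(1,2)] Lp_space_diff[OF assms(2,3)] p] p by simp

lemma Lp_norm_le_add_diff:
  fixes f g :: "real ^ 'd \<Rightarrow> 'b::euclidean_space"
  assumes "f \<in> Lp_space p" "g \<in> Lp_space p" and p: "1 \<le> p"
  shows "Lp_norm p f \<le> Lp_norm p g + Lp_norm p (\<lambda>x. f x - g x)"
  using Lp_norm_triangle[OF assms(2) Lp_space_diff[OF assms(1,2)] p] p by simp

lemma Lp_sum:
  fixes f :: "'i \<Rightarrow> real ^ 'd \<Rightarrow> 'b::euclidean_space"
  assumes "finite I" "\<And>i. i \<in> I \<Longrightarrow> f i \<in> Lp_space p" and p: "1 \<le> p"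
  shows "(\<lambda>x. \<Sum>i\<in>I. f i x) \<in> Lp_space p \<and> Lp_norm p (\<lambda>x. \<Sum>i\<in>I. f i x) \<le> (\<Sum>i\<in>I. Lp_norm p (f i))"
  using assms(1,2)
proof (induction I)
  case empty
  then show ?case using p by (auto simp: Lp_space_def Lp_norm_def)
next
  case (insert i I)
  then have IH: "(\<lambda>x. \<Sum>i\<in>I. f i x) \<in> Lp_space p" "Lp_norm p (\<lambda>x. \<Sum>i\<in>I. f i x) \<le> (\<Sum>i\<in>I. Lp_norm p (f i))"
    and fi: "f i \<in> Lp_space p" by auto
  have "(\<lambda>x. f i x + (\<Sum>i\<in>I. f i x)) \<in> Lp_space p"
    using p by (intro Lp_space_add fi IH) auto
  moreover have "Lp_norm p (\<lambda>x. f i x + (\<Sum>i\<in>I. f i x)) \<le> Lp_norm p (f i) + Lp_norm p (\<lambda>x. \<Sum>i\<in>I. f i x)"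
    by (rule Lp_norm_triangle[OF fi IH(1) p])
  ultimately show ?case using insert.hyps IH(2) by simp
qed

text \<open>Young's inequality for f / s and g / t integrates to a bound with free scales; then s
  and t are set to the two norms.\<close>

lemma Holder_Lp:
  fixes f g :: "real ^ 'd \<Rightarrow> 'b::euclidean_space"
  assumes f: "f \<in> Lp_space p" and g: "g \<in> Lp_space q" and pq: "1 < p" "1 < q" "1 / p + 1 / q = 1"
  shows "integrable lebesgue (\<lambda>x. f x \<bullet> g x)"
    and "\<bar>\<integral>x. f x \<bullet> g x \<partial>lebesgue\<bar> \<le> Lp_norm p f * Lp_norm q g"
proof -
  note [measurable] = Lp_spaceD(1)[OF f] Lp_spaceD(1)[OF g]
  note fi = Lp_spaceD(2)[OF f] and gi = Lp_spaceD(2)[OF g]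
  have Y: "\<bar>f x \<bullet> g x\<bar> \<le> s * t * ((norm (f x) powr p / s powr p) / p + (norm (g x) powr q / t powr q) / q)" if "0 < s" "0 < t" for x s t
  proof -
    have "\<bar>f x \<bullet> g x\<bar> \<le> norm (f x) * norm (g x)" by (rule Cauchy_Schwarz_ineq2)
    also have "\<dots> = s * t * ((norm (f x) / s) * (norm (g x) / t))" using that by simp
    also have "\<dots> \<le> s * t * ((norm (f x) / s) powr p / p + (norm (g x) / t) powr q / q)"
      using that pq by (intro mult_left_mono Youngs_inequality) auto
    finally show ?thesis using that by (simp add: powr_divide)
  qed
  have I: "integrable lebesgue (\<lambda>x. s * t * ((norm (f x) powr p / s powr p) / p + (norm (g x) powr q / t powr q) / q))" for s t
    using fi gi by auto
  show int: "integrable lebesgue (\<lambda>x. f x \<bullet> g x)"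
    by (rule Bochner_Integration.integrable_bound[OF I[of 1 1]])
       (use Y[of 1 1] in \<open>auto intro!: AE_I2 intro: order.trans[OF _ abs_ge_self]\<close>)
  have B: "\<bar>\<integral>x. f x \<bullet> g x \<partial>lebesgue\<bar> \<le> s * t * ((Lp_norm p f powr p / s powr p) / p + (Lp_norm q g powr q / t powr q) / q)"
    if "0 < s" "0 < t" for s t
  proof -
    have "\<bar>\<integral>x. f x \<bullet> g x \<partial>lebesgue\<bar> \<le> (\<integral>x. \<bar>f x \<bullet> g x\<bar> \<partial>lebesgue)" by (rule integral_abs_bound)
    also have "\<dots> \<le> (\<integral>x. s * t * ((norm (f x) powr p / s powr p) / p + (norm (g x) powr q / t powr q) / q) \<partial>lebesgue)"
      by (intro integral_mono I Y that) (use int in auto)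
    also have "\<dots> = s * t * ((Lp_norm p f powr p / s powr p) / p + (Lp_norm q g powr q / t powr q) / q)"
      using fi gi pq by (simp add: Lp_norm_powr)
    finally show ?thesis .
  qed
  have zero: "(\<integral>x. f x \<bullet> g x \<partial>lebesgue) = 0" if "AE x in lebesgue. f x = 0 \<or> g x = 0"
    by (rule integral_eq_zero_AE) (use that in \<open>eventually_elim, auto\<close>)
  show "\<bar>\<integral>x. f x \<bullet> g x \<partial>lebesgue\<bar> \<le> Lp_norm p f * Lp_norm q g"
  proof (cases "Lp_norm p f = 0 \<or> Lp_norm q g = 0")
    case True
    then have "AE x in lebesgue. f x = 0 \<or> g x = 0"
      using Lp_norm_zero_AE[OF f] Lp_norm_zero_AE[OF g] pq by (auto elim: eventually_mono)
    from zero[OF this] True show ?thesis by auto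
  next
    case False
    then have pos: "0 < Lp_norm p f" "0 < Lp_norm q g"
      using Lp_norm_nonneg[of p f] Lp_norm_nonneg[of q g] by auto
    from B[OF this] show ?thesis using pos pq by simp
  qed
qed

lemma Lp_dominated_convergence:
  fixes f :: "nat \<Rightarrow> real ^ 'd \<Rightarrow> 'b::euclidean_space" and h :: "real ^ 'd \<Rightarrow> real"
  assumes f: "\<And>n. f n \<in> borel_measurable lebesgue" and g: "g \<in> borel_measurable lebesgue"
    and h: "h \<in> Lp_space p" and lim: "AE x in lebesgue. (\<lambda>n. f n x) \<longlonglongrightarrow> g x"
    and bnd: "\<And>n. AE x in lebesgue. norm (f n x - g x) \<le> h x" and p: "0 < p"
  shows "(\<lambda>n. Lp_norm p (\<lambda>x. f n x - g x)) \<longlonglongrightarrow> 0"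
proof -
  note [measurable] = f g
  have "(\<lambda>n. \<integral>x. norm (f n x - g x) powr p \<partial>lebesgue) \<longlonglongrightarrow> (\<integral>x. 0 \<partial>(lebesgue :: (real ^ 'd) measure))"
  proof (rule integral_dominated_convergence)
    show "integrable lebesgue (\<lambda>x. norm (h x) powr p)" by (rule Lp_spaceD[OF h])
    show "AE x in lebesgue. (\<lambda>n. norm (f n x - g x) powr p) \<longlonglongrightarrow> 0"
      using lim
    proof eventually_elim
      case (elim x)
      have "(\<lambda>n. norm (f n x - g x)) \<longlonglongrightarrow> 0" using elim by (simp add: LIM_zero tendsto_norm_zero)
      from tendsto_powr'[OF this tendsto_const, of p] show ?case using p by auto
    qed
    show "AE x in lebesgue. norm (norm (f n x - g x) powr p) \<le> norm (h x) powr p" for n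
      using bnd[of n] by eventually_elim (use p in \<open>auto intro!: powr_mono2\<close>)
  qed auto
  then have "(\<lambda>n. (\<integral>x. norm (f n x - g x) powr p \<partial>lebesgue) powr (1 / p)) \<longlonglongrightarrow> 0 powr (1 / p)"
    using p by (intro tendsto_powr') (auto intro!: always_eventually integral_nonneg_AE)
  then show ?thesis using p by (simp add: Lp_norm_def)
qed

text \<open>Completeness for geometric increments. The sums \<open>G N\<close> of the pointwise
  increments are bounded in L^p, so monotone convergence yields convergence almost everywhere;
  Fatou's lemma, applied to the tails, turns this into convergence in norm.\<close>

lemma Lp_complete:
  fixes f :: "nat \<Rightarrow> real ^ 'd \<Rightarrow> 'b::euclidean_space"
  assumes f: "\<And>n. f n \<in> Lp_space p" and p: "1 \<le> p"
    and fast: "\<And>n. Lp_norm p (\<lambda>x. f (Suc n) x - f n x) \<le> (1 / 2) ^ n"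
  shows "\<exists>F\<in>Lp_space p. (\<lambda>n. Lp_norm p (\<lambda>x. f n x - F x)) \<longlonglongrightarrow> 0"
proof -
  note [measurable] = Lp_spaceD(1)[OF f]
  have p0: "0 < p" using p by simp
  define d where "d k x = norm (f (Suc k) x - f k x)" for k x
  have d: "d k \<in> Lp_space p" "Lp_norm p (d k) \<le> (1 / 2) ^ k" for k
    using Lp_space_diff[OF f f, of "Suc k" k] p fast[of k]
    by (auto simp: d_def[abs_def] Lp_space_def Lp_norm_def)
  have half: "(\<Sum>k<N. (1 / 2) ^ k) \<le> (2::real)" for N
    by (induction N) (simp_all add: sum_gp_strict)
  define G where "G N x = (\<Sum>k<N. d k x)" for N x
  have G: "G N \<in> Lp_space p" "Lp_norm p (G N) \<le> 2" for N
  proof -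
    have "G N \<in> Lp_space p \<and> Lp_norm p (G N) \<le> (\<Sum>k<N. Lp_norm p (d k))"
      unfolding G_def[abs_def] using d p by (intro Lp_sum) auto
    moreover have "(\<Sum>k<N. Lp_norm p (d k)) \<le> (\<Sum>k<N. (1 / 2) ^ k)" by (intro sum_mono d)
    ultimately show "G N \<in> Lp_space p" "Lp_norm p (G N) \<le> 2" using half[of N] by auto
  qed
  have [measurable]: "G N \<in> borel_measurable lebesgue" for N by (rule Lp_spaceD[OF G(1)])
  have G0: "0 \<le> G N x" for N x by (simp add: G_def d_def sum_nonneg)
  have Gmono: "G M x \<le> G N x" if "M \<le> N" for M N x
    unfolding G_def using that by (intro sum_mono2) (auto simp: d_def)
  have nn: "(\<integral>\<^sup>+x. ennreal (norm (g x) powr p) \<partial>lebesgue) \<le> ennreal (C powr p)"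
    if "g \<in> Lp_space p" "Lp_norm p g \<le> C" "0 \<le> C" for g :: "real ^ 'd \<Rightarrow> 'g::euclidean_space" and C
  proof -
    have "(\<integral>\<^sup>+x. ennreal (norm (g x) powr p) \<partial>lebesgue) = ennreal (\<integral>x. norm (g x) powr p \<partial>lebesgue)"
      by (rule nn_integral_eq_integral[OF Lp_spaceD(2)[OF that(1)]]) auto
    also have "\<dots> \<le> ennreal (C powr p)"
      using that(2) Lp_norm_le_iff[OF p0 that(3), of g] by (intro ennreal_leI) auto
    finally show ?thesis .
  qed
  have "(\<integral>\<^sup>+x. (SUP N. ennreal (norm (G N x) powr p)) \<partial>lebesgue) = (SUP N. \<integral>\<^sup>+x. ennreal (norm (G N x) powr p) \<partial>lebesgue)"
    by (rule nn_integral_monotone_convergence_SUP)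
       (use p G0 Gmono in \<open>auto simp: incseq_def le_fun_def intro!: ennreal_leI powr_mono2\<close>)
  also have "\<dots> \<le> ennreal (2 powr p)" by (rule SUP_least, rule nn, rule G, rule G, simp)
  finally have "(\<integral>\<^sup>+x. (SUP N. ennreal (norm (G N x) powr p)) \<partial>lebesgue) \<noteq> \<infinity>"
    by (auto simp: top_unique)
  then have "AE x in lebesgue. (SUP N. ennreal (norm (G N x) powr p)) \<noteq> \<infinity>"
    by (rule nn_integral_noteq_infinite[rotated]) measurable
  then have conv: "AE x in lebesgue. convergent (\<lambda>n. f n x)"
  proof eventually_elim
    case (elim x)
    then obtain r where r: "0 \<le> r" "(SUP N. ennreal (norm (G N x) powr p)) = ennreal r"
      by (metis ennreal_cases infinity_ennreal_def)
    have "G N x \<le> r powr (1 / p)" for N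
    proof -
      have "ennreal (norm (G N x) powr p) \<le> ennreal r" unfolding r(2)[symmetric] by (rule SUP_upper) simp
      then have "G N x powr p \<le> r" using r(1) G0[of N x] by simp
      then have "(G N x powr p) powr (1 / p) \<le> r powr (1 / p)" using p by (intro powr_mono2) auto
      then show ?thesis using p0 G0[of N x] by (simp add: powr_powr)
    qed
    then have "summable (\<lambda>k. d k x)"
      unfolding G_def by (intro summableI_nonneg_bounded[of _ "r powr (1 / p)"]) (auto simp: d_def)
    then have "summable (\<lambda>k. f (Suc k) x - f k x)" unfolding d_def by (rule summable_norm_cancel)
    then have "convergent (\<lambda>n. (\<Sum>k<n. f (Suc k) x - f k x) + f 0 x)"
      by (intro convergent_add convergent_const) (simp add: summable_iff_convergent)
    then show ?case by (simp add: sum_lessThan_telescope[of "\<lambda>k. f k x"])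
  qed
  define F where "F x = lim (\<lambda>n. f n x)" for x
  have [measurable]: "F \<in> borel_measurable lebesgue" unfolding F_def[abs_def] by measurable
  have limF: "AE x in lebesgue. (\<lambda>n. f n x) \<longlonglongrightarrow> F x"
    using conv by eventually_elim (simp add: F_def convergent_LIMSEQ_iff)
  have tele: "Lp_norm p (\<lambda>x. f (n + k) x - f n x) \<le> 2 * (1 / 2) ^ n" for n k
  proof -
    have "Lp_norm p (\<lambda>x. \<Sum>j<k. f (Suc (n + j)) x - f (n + j) x) \<le> (\<Sum>j<k. Lp_norm p (\<lambda>x. f (Suc (n + j)) x - f (n + j) x))"
      using Lp_sum[of "{..<k}" "\<lambda>j x. f (Suc (n + j)) x - f (n + j) x" p] Lp_space_diff[OF f f] p by auto
    also have "\<dots> \<le> (\<Sum>j<k. (1 / 2) ^ (n + j))" by (intro sum_mono fast)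
    also have "\<dots> = (1 / 2) ^ n * (\<Sum>j<k. (1 / 2) ^ j)" by (simp add: power_add sum_distrib_left)
    also have "\<dots> \<le> (1 / 2) ^ n * 2" by (intro mult_left_mono half) auto
    also have "(\<lambda>x. \<Sum>j<k. f (Suc (n + j)) x - f (n + j) x) = (\<lambda>x. f (n + k) x - f n x)"
      using sum_lessThan_telescope[of "\<lambda>j. f (n + j) x" k for x] by (simp add: fun_eq_iff)
    finally show ?thesis by simp
  qed
  have fatou: "(\<integral>\<^sup>+x. ennreal (norm (F x - f n x) powr p) \<partial>lebesgue) \<le> ennreal ((2 * (1 / 2) ^ n) powr p)" for n
  proof -
    have "(\<integral>\<^sup>+x. ennreal (norm (F x - f n x) powr p) \<partial>lebesgue)
        = (\<integral>\<^sup>+x. liminf (\<lambda>k. ennreal (norm (f (n + k) x - f n x) powr p)) \<partial>lebesgue)"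
    proof (rule nn_integral_cong_AE, use limF in eventually_elim)
      case (elim x)
      have "(\<lambda>k. f (n + k) x) \<longlonglongrightarrow> F x" using LIMSEQ_ignore_initial_segment[OF elim, of n] by (simp add: add.commute)
      then have "(\<lambda>k. norm (f (n + k) x - f n x) powr p) \<longlonglongrightarrow> norm (F x - f n x) powr p"
        using p by (intro tendsto_powr' tendsto_intros) auto
      then have "(\<lambda>k. ennreal (norm (f (n + k) x - f n x) powr p)) \<longlonglongrightarrow> ennreal (norm (F x - f n x) powr p)"
        by (rule tendsto_ennrealI)
      then show ?case by (rule lim_imp_Liminf[OF sequentially_bot, symmetric])
    qed
    also have "\<dots> \<le> liminf (\<lambda>k. \<integral>\<^sup>+x. ennreal (norm (f (n + k) x - f n x) powr p) \<partial>lebesgue)"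
      by (rule nn_integral_liminf) measurable
    also have "\<dots> \<le> liminf (\<lambda>k. ennreal ((2 * (1 / 2) ^ n) powr p))"
      by (intro Liminf_mono always_eventually allI nn Lp_space_diff f tele) (use p in auto)
    finally show ?thesis by (simp add: Liminf_const)
  qed
  have Ff: "(\<lambda>x. F x - f n x) \<in> Lp_space p" for n
  proof (rule Lp_spaceI)
    show "integrable lebesgue (\<lambda>x. norm (F x - f n x) powr p)"
      using fatou[of n] by (intro integrableI_bounded) (auto intro: le_less_trans)
  qed measurable
  have FL: "F \<in> Lp_space p"
    using Lp_space_add[OF Ff[of 0] f[of 0]] p by simp
  have b: "Lp_norm p (\<lambda>x. f n x - F x) \<le> 2 * (1 / 2) ^ n" for n
  proof -
    have "ennreal (\<integral>x. norm (F x - f n x) powr p \<partial>lebesgue) \<le> ennreal ((2 * (1 / 2) ^ n) powr p)"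
      using fatou[of n] nn_integral_eq_integral[OF Lp_spaceD(2)[OF Ff[of n]]] by simp
    then have "Lp_norm p (\<lambda>x. F x - f n x) \<le> 2 * (1 / 2) ^ n"
      using p0 by (subst Lp_norm_le_iff) (auto simp: ennreal_le_iff)
    then show ?thesis by (simp add: Lp_norm_diff_commute)
  qed
  have "(\<lambda>n. Lp_norm p (\<lambda>x. f n x - F x)) \<longlonglongrightarrow> 0"
  proof (rule tendsto_sandwich[OF _ _ tendsto_const])
    show "(\<lambda>n. 2 * (1 / 2) ^ n) \<longlonglongrightarrow> (0::real)"
      using LIMSEQ_power_zero[of "1 / 2 :: real"] by (intro tendsto_mult_right_zero) simp
  qed (use b Lp_norm_nonneg in \<open>auto intro!: always_eventually\<close>)
  with FL show ?thesis by blast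
qed

section \<open>Density of the Hermite functions\<close>

lemma hermite_in_span: "hermite n \<in> hermite_span"
  unfolding hermite_span_def by (intro CollectI exI[of _ "{n}"] exI[of _ "\<lambda>_. 1"]) simp

lemma hermite_span_scale:
  assumes "f \<in> hermite_span" shows "(\<lambda>x. a * f x) \<in> hermite_span"
proof -
  obtain S c where "finite S" "f = (\<lambda>x. \<Sum>n\<in>S. c n * hermite n x)"
    using assms unfolding hermite_span_def by auto
  then show ?thesis unfolding hermite_span_def
    by (intro CollectI exI[of _ S] exI[of _ "\<lambda>n. a * c n"]) (simp add: sum_distrib_left mult.assoc)
qed

lemma hermite_span_add:
  assumes "f \<in> hermite_span" "g \<in> hermite_span" shows "(\<lambda>x. f x + g x) \<in> hermite_span"
proof -
  obtain S c where S: "finite S" "f = (\<lambda>x. \<Sum>n\<in>S. c n * hermite n x)"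
    using assms unfolding hermite_span_def by auto
  obtain S' c' where S': "finite S'" "g = (\<lambda>x. \<Sum>n\<in>S'. c' n * hermite n x)"
    using assms unfolding hermite_span_def by auto
  define b where "b n = (if n \<in> S then c n else 0) + (if n \<in> S' then c' n else 0)" for n
  have "f x + g x = (\<Sum>n\<in>S \<union> S'. b n * hermite n x)" for x
  proof -
    have "f x = (\<Sum>n\<in>S \<union> S'. (if n \<in> S then c n else 0) * hermite n x)"
      unfolding S(2) using S(1) S'(1) by (intro sum.mono_neutral_cong_left) auto
    moreover have "g x = (\<Sum>n\<in>S \<union> S'. (if n \<in> S' then c' n else 0) * hermite n x)"
      unfolding S'(2) using S(1) S'(1) by (intro sum.mono_neutral_cong_left) auto
    ultimately show ?thesis by (simp add: b_def distrib_right sum.distrib)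
  qed
  then show ?thesis unfolding hermite_span_def using S S' by blast
qed

lemma hermite_span_sum:
  assumes "finite I" "\<And>i. i \<in> I \<Longrightarrow> f i \<in> hermite_span" shows "(\<lambda>x. \<Sum>i\<in>I. f i x) \<in> hermite_span"
  using assms
proof (induction I)
  case empty
  then show ?case unfolding hermite_span_def by (intro CollectI exI[of _ "{}"]) simp
next
  case (insert i I)
  then show ?case using hermite_span_add[of "f i" "\<lambda>x. \<Sum>i\<in>I. f i x"] by simp
qed

lemma hermite_span_diff:
  assumes "f \<in> hermite_span" "g \<in> hermite_span" shows "(\<lambda>x. f x - g x) \<in> hermite_span"
  using hermite_span_add[OF assms(1) hermite_span_scale[OF assms(2), of "-1"]] by simp

lemma hermite_span_coord:
  assumes "f \<in> hermite_span" shows "(\<lambda>x. x $ i * f x) \<in> hermite_span"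
proof -
  obtain S c where S: "finite S" "f = (\<lambda>x. \<Sum>n\<in>S. c n * hermite n x)"
    using assms unfolding hermite_span_def by auto
  have h: "(\<lambda>x. x $ i * hermite n x) \<in> hermite_span" for n
  proof -
    have "x $ i * hermite n x = (sqrt (2 * (real (n $ i) + 1)) / 2) * hermite (raise i n) x
        + (sqrt (2 * real (n $ i)) / 2) * hermite (lower i n) x" for x
      using hermite_coord_mult[of x i n] by (simp add: field_simps)
    then show ?thesis
      by (simp only:) (intro hermite_span_add hermite_span_scale hermite_in_span)
  qed
  have "(\<lambda>x. x $ i * f x) = (\<lambda>x. \<Sum>n\<in>S. c n * (x $ i * hermite n x))"
    unfolding S(2) by (simp add: sum_distrib_left mult_ac)
  then show ?thesis using S(1) h by (simp only:) (intro hermite_span_sum hermite_span_scale)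
qed

lemma bounded_linear_coords:
  fixes f :: "real ^ 'd \<Rightarrow> real" assumes "bounded_linear f"
  shows "f x = (\<Sum>i\<in>UNIV. f (axis i 1) * x $ i)"
proof -
  interpret bounded_linear f by fact
  have "f x = f (\<Sum>i\<in>UNIV. x $ i *\<^sub>R axis i 1)"
    using basis_expansion[of x] by (simp add: scalar_mult_eq_scaleR)
  also have "\<dots> = (\<Sum>i\<in>UNIV. f (axis i 1) * x $ i)" by (simp add: sum scaleR mult.commute)
  finally show ?thesis .
qed

text \<open>Multiplication by one coordinate stays in the span by the three-term recurrence; linear
  forms and products follow.\<close>

lemma hermite_span_poly:
  fixes Q :: "real ^ 'd \<Rightarrow> real"
  assumes "real_polynomial_function Q" "f \<in> hermite_span"
  shows "(\<lambda>x. Q x * f x) \<in> hermite_span"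
  using assms
proof (induction arbitrary: f)
  case (linear Q)
  have "(\<lambda>x. \<Sum>i\<in>UNIV. Q (axis i 1) * (x $ i * f x)) \<in> hermite_span"
    by (intro hermite_span_sum hermite_span_scale hermite_span_coord linear) simp
  moreover have "Q x * f x = (\<Sum>i\<in>UNIV. Q (axis i 1) * (x $ i * f x))" for x
    by (subst bounded_linear_coords[OF linear(1)]) (simp add: sum_distrib_right mult.assoc)
  ultimately show ?case by simp
next
  case (const c)
  then show ?case by (rule hermite_span_scale)
next
  case (add Q R)
  then show ?case using hermite_span_add[of "\<lambda>x. Q x * f x" "\<lambda>x. R x * f x"] by (simp add: distrib_right)
next
  case (mult Q R)
  then show ?case by (simp add: mult.assoc)
qed

lemma real_polynomial_function_norm_sq: "real_polynomial_function (\<lambda>x :: real ^ 'd. (norm x)\<^sup>2)"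
proof -
  have "real_polynomial_function (\<lambda>x :: real ^ 'd. \<Sum>i\<in>UNIV. x $ i * x $ i)"
    by (rule real_polynomial_function_sum, simp,
        rule real_polynomial_function.intros(4); rule real_polynomial_function.intros(1), rule bounded_linear_vec_nth)
  then show ?thesis by (simp only: norm_power2_vec power2_eq_square[of "_ $ _"])
qed

lemma real_polynomial_function_exp_bound:
  fixes Q :: "real ^ 'd \<Rightarrow> real"
  assumes "real_polynomial_function Q" "0 < e"
  shows "\<exists>C\<ge>0. \<forall>x. \<bar>Q x\<bar> \<le> C * exp (e * (norm x)\<^sup>2)"
  using assms
proof (induction arbitrary: e)
  case (linear Q)
  obtain D where D: "D \<ge> 0" "\<And>s. \<bar>poly [:0, 1:] s\<bar> \<le> D * exp (e * s\<^sup>2)"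
    using poly_exp_bound[of e "[:0, 1:]"] linear by auto
  obtain K where K: "0 \<le> K" "\<And>x. norm (Q x) \<le> norm x * K"
    using bounded_linear.nonneg_bounded[OF linear(1)] by auto
  have "\<bar>Q x\<bar> \<le> (D * K) * exp (e * (norm x)\<^sup>2)" for x
  proof -
    have "\<bar>Q x\<bar> \<le> norm x * K" using K(2)[of x] by simp
    also have "\<dots> \<le> (D * exp (e * (norm x)\<^sup>2)) * K" using D(2)[of "norm x"] K by (intro mult_right_mono) auto
    finally show ?thesis by (simp add: mult_ac)
  qed
  then show ?case using D K by (intro exI[of _ "D * K"]) auto
next
  case (const c)
  have "\<bar>c\<bar> \<le> \<bar>c\<bar> * exp (e * (norm x)\<^sup>2)" for x :: "real ^ 'd"
    using const mult_left_mono[of 1 "exp (e * (norm x)\<^sup>2)" "\<bar>c\<bar>"] by simp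
  then show ?case by (intro exI[of _ "\<bar>c\<bar>"]) auto
next
  case (add Q R)
  obtain C D where C: "C \<ge> 0" "\<And>x. \<bar>Q x\<bar> \<le> C * exp (e * (norm x)\<^sup>2)" and D: "D \<ge> 0" "\<And>x. \<bar>R x\<bar> \<le> D * exp (e * (norm x)\<^sup>2)"
    using add.IH(1)[OF add.prems] add.IH(2)[OF add.prems] by auto
  have "\<bar>Q x + R x\<bar> \<le> (C + D) * exp (e * (norm x)\<^sup>2)" for x
    using C(2)[of x] D(2)[of x] abs_triangle_ineq[of "Q x" "R x"] unfolding distrib_right by linarith
  then show ?case using C D by (intro exI[of _ "C + D"]) auto
next
  case (mult Q R)
  obtain C D where C: "C \<ge> 0" "\<And>x. \<bar>Q x\<bar> \<le> C * exp (e / 2 * (norm x)\<^sup>2)" and D: "D \<ge> 0" "\<And>x. \<bar>R x\<bar> \<le> D * exp (e / 2 * (norm x)\<^sup>2)"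
    using mult.IH(1)[of "e / 2"] mult.IH(2)[of "e / 2"] mult.prems by auto
  have "\<bar>Q x * R x\<bar> \<le> (C * D) * exp (e * (norm x)\<^sup>2)" for x
  proof -
    have "\<bar>Q x\<bar> * \<bar>R x\<bar> \<le> (C * exp (e / 2 * (norm x)\<^sup>2)) * (D * exp (e / 2 * (norm x)\<^sup>2))"
      using C D by (intro mult_mono) auto
    also have "\<dots> = (C * D) * exp (e / 2 * (norm x)\<^sup>2 + e / 2 * (norm x)\<^sup>2)"
      by (simp only: exp_add) (simp only: mult_ac)
    finally show ?thesis by (simp add: abs_mult)
  qed
  then show ?case using C D by (intro exI[of _ "C * D"]) auto
qed

lemma lebesgue_from_lborel:
  fixes f :: "real ^ 'd \<Rightarrow> 'b::euclidean_space"
  assumes "f \<in> borel_measurable borel"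
  shows "f \<in> borel_measurable lebesgue" "integrable lebesgue f \<longleftrightarrow> integrable lborel f"
    "(\<integral>x. f x \<partial>lebesgue) = (\<integral>x. f x \<partial>lborel)"
  using assms by (auto intro: measurable_completion simp: integrable_completion integral_completion)

lemma Lp_space_gauss_dominated:
  fixes f :: "real ^ 'd \<Rightarrow> 'b::euclidean_space"
  assumes f: "f \<in> borel_measurable borel" and s: "0 < s" and p: "0 < p"
    and bnd: "\<And>x. norm (f x) \<le> C * exp (- s * (norm x)\<^sup>2)"
  shows "f \<in> Lp_space p"
proof (rule Lp_spaceI)
  note [measurable] = f
  show "f \<in> borel_measurable lebesgue" by (rule lebesgue_from_lborel(1)[OF f])
  have m: "(\<lambda>x. norm (f x) powr p) \<in> borel_measurable borel" by measurable
  have "integrable lborel (\<lambda>x. norm (f x) powr p)"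
  proof (rule integrable_gauss_dominated[OF m])
    fix x
    have "norm (f x) powr p \<le> (C * exp (- s * (norm x)\<^sup>2)) powr p"
      using bnd p by (intro powr_mono2) auto
    also have "\<dots> = C powr p * exp (- (s * p) * (norm x)\<^sup>2)"
      by (simp add: powr_mult exp_powr_real mult_ac)
    finally show "\<bar>norm (f x) powr p\<bar> \<le> C powr p * exp (- (s * p) * (norm x)\<^sup>2)" by simp
  qed (use s p in simp)
  then show "integrable lebesgue (\<lambda>x. norm (f x) powr p)" using lebesgue_from_lborel(2)[OF m] by simp
qed

lemma hermite_Lp: "0 < p \<Longrightarrow> hermite n \<in> Lp_space p"
proof -
  assume p: "0 < p"
  obtain C where "\<And>x. \<bar>hermite n x\<bar> \<le> C * exp (- (1 / 2 - 1 / 4) * (norm x)\<^sup>2)"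
    using hermite_bound[of "1/4" n] by auto
  then show ?thesis by (intro Lp_space_gauss_dominated[where s = "1/4" and C = C] p) auto
qed

lemma hermite_span_Lp:
  assumes "f \<in> hermite_span" "1 \<le> p" shows "f \<in> Lp_space p"
proof -
  obtain S c where S: "finite S" "f = (\<lambda>x. \<Sum>n\<in>S. c n * hermite n x)"
    using assms unfolding hermite_span_def by auto
  have "(\<lambda>x. c n * hermite n x) \<in> Lp_space p" for n
    using Lp_space_scaleR[OF hermite_Lp[of p n], of "c n"] assms by simp
  then show ?thesis unfolding S(2) using Lp_sum[OF S(1), of "\<lambda>n x. c n * hermite n x" p] assms by auto
qed

text \<open>The closure of the span in L^p, to be enlarged by sums and limits until it is all of
  L^p.\<close>

definition approximable :: "real \<Rightarrow> (real ^ 'd \<Rightarrow> real) \<Rightarrow> bool" where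
  "approximable p f \<longleftrightarrow> f \<in> Lp_space p \<and> (\<forall>e>0. \<exists>h\<in>hermite_span. Lp_norm p (\<lambda>x. f x - h x) < e)"

lemma approximable_span: "f \<in> hermite_span \<Longrightarrow> 1 \<le> p \<Longrightarrow> approximable p f"
  unfolding approximable_def using hermite_span_Lp[of f p]
  by (auto intro!: bexI[of _ f] simp: Lp_norm_def)

lemma approximable_limit:
  assumes p: "1 \<le> p" and f: "f \<in> Lp_space p"
    and g: "\<And>e. 0 < e \<Longrightarrow> \<exists>g. approximable p g \<and> Lp_norm p (\<lambda>x. f x - g x) < e"
  shows "approximable p f"
  unfolding approximable_def
proof (intro conjI f allI impI)
  fix e :: real assume e: "0 < e"
  obtain g where g': "approximable p g" "Lp_norm p (\<lambda>x. f x - g x) < e / 2" using g[of "e / 2"] e by auto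
  then obtain h where h: "h \<in> hermite_span" "Lp_norm p (\<lambda>x. g x - h x) < e / 2"
    using e unfolding approximable_def by (metis half_gt_zero)
  have "Lp_norm p (\<lambda>x. f x - h x) \<le> Lp_norm p (\<lambda>x. f x - g x) + Lp_norm p (\<lambda>x. g x - h x)"
    using g' hermite_span_Lp[OF h(1) p] f p by (intro Lp_norm_triangle_diff) (auto simp: approximable_def)
  then show "\<exists>h\<in>hermite_span. Lp_norm p (\<lambda>x. f x - h x) < e"
    using h g' by (intro bexI[of _ h]) auto
qed

lemma approximable_seq:
  assumes p: "1 \<le> p" and f: "f \<in> Lp_space p" and g: "\<And>n :: nat. approximable p (g n)"
    and lim: "(\<lambda>n. Lp_norm p (\<lambda>x. g n x - f x)) \<longlonglongrightarrow> 0"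
  shows "approximable p f"
proof (rule approximable_limit[OF p f])
  fix e :: real assume "0 < e"
  then have "eventually (\<lambda>n. Lp_norm p (\<lambda>x. g n x - f x) < e) sequentially"
    using lim by (simp add: order_tendsto_iff)
  then obtain n where "Lp_norm p (\<lambda>x. g n x - f x) < e" by (auto simp: eventually_sequentially)
  then show "\<exists>g. approximable p g \<and> Lp_norm p (\<lambda>x. f x - g x) < e"
    using g[of n] by (auto simp: Lp_norm_diff_commute)
qed

lemma approximable_add:
  assumes p: "1 \<le> p" and "approximable p f" "approximable p g"
  shows "approximable p (\<lambda>x. f x + g x)"
  unfolding approximable_def
proof (intro conjI allI impI)
  have f: "f \<in> Lp_space p" and g: "g \<in> Lp_space p" using assms by (auto simp: approximable_def)
  show "(\<lambda>x. f x + g x) \<in> Lp_space p" using Lp_space_add[OF f g] p by simp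
  fix e :: real assume e: "0 < e"
  obtain h k where h: "h \<in> hermite_span" "Lp_norm p (\<lambda>x. f x - h x) < e / 2"
    and k: "k \<in> hermite_span" "Lp_norm p (\<lambda>x. g x - k x) < e / 2"
    using assms(2,3) e unfolding approximable_def by (metis half_gt_zero)
  have "Lp_norm p (\<lambda>x. (f x - h x) + (g x - k x)) \<le> Lp_norm p (\<lambda>x. f x - h x) + Lp_norm p (\<lambda>x. g x - k x)"
    using hermite_span_Lp[OF h(1) p] hermite_span_Lp[OF k(1) p] f g p
    by (intro Lp_norm_triangle Lp_space_diff) auto
  also have "\<dots> < e" using h k by simp
  finally show "\<exists>h\<in>hermite_span. Lp_norm p (\<lambda>x. f x + g x - h x) < e"
    using hermite_span_add[OF h(1) k(1)]
    by (intro bexI[of _ "\<lambda>x. h x + k x"]) (simp_all add: algebra_simps)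
qed

lemma approximable_sum:
  assumes p: "1 \<le> p" and "finite I" "\<And>i. i \<in> I \<Longrightarrow> approximable p (f i)"
  shows "approximable p (\<lambda>x. \<Sum>i\<in>I. f i x)"
  using assms(2,3)
proof (induction I)
  case empty
  have "(\<lambda>x. \<Sum>i\<in>{}. f i x) \<in> hermite_span" by (rule hermite_span_sum) auto
  then show ?case using approximable_span[OF _ p] by simp
next
  case (insert i I)
  then show ?case using approximable_add[OF p, of "f i" "\<lambda>x. \<Sum>i\<in>I. f i x"] by simp
qed

lemma continuous_on_poly_gauss:
  "real_polynomial_function Q \<Longrightarrow> continuous_on UNIV (\<lambda>x :: real ^ 'd. Q x * exp (- s * (norm x)\<^sup>2))"
  by (intro continuous_intros continuous_on_polymonial_function) (simp add: real_polynomial_function_eq)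

lemma poly_gauss_Lp:
  fixes Q :: "real ^ 'd \<Rightarrow> real"
  assumes Q: "real_polynomial_function Q" and s: "0 < s" and p: "0 < p"
  shows "(\<lambda>x. Q x * exp (- s * (norm x)\<^sup>2)) \<in> Lp_space p"
proof -
  obtain C where C: "C \<ge> 0" "\<And>x. \<bar>Q x\<bar> \<le> C * exp (s / 2 * (norm x)\<^sup>2)"
    using real_polynomial_function_exp_bound[OF Q, of "s / 2"] s by auto
  show ?thesis
  proof (rule Lp_space_gauss_dominated[where s = "s / 2" and C = C])
    show "(\<lambda>x. Q x * exp (- s * (norm x)\<^sup>2)) \<in> borel_measurable borel"
      by (intro borel_measurable_continuous_onI continuous_on_poly_gauss Q)
    fix x
    have "\<bar>Q x\<bar> * exp (- s * (norm x)\<^sup>2) \<le> C * exp (s / 2 * (norm x)\<^sup>2) * exp (- s * (norm x)\<^sup>2)"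
      using C by (intro mult_right_mono) auto
    also have "\<dots> = C * exp (- (s / 2) * (norm x)\<^sup>2)"
      by (simp add: mult.assoc exp_add[symmetric])
    finally show "norm (Q x * exp (- s * (norm x)\<^sup>2)) \<le> C * exp (- (s / 2) * (norm x)\<^sup>2)"
      by (simp add: abs_mult)
  qed (use s p in auto)
qed

text \<open>Multiplication by \<open>exp (- r |x|\<^sup>2)\<close> is expanded into its Taylor series; the partial sums stay
  below \<open>exp (r |x|\<^sup>2)\<close>, so the step width must be smaller than the available decay.\<close>

lemma approximable_poly_gauss:
  fixes Q :: "real ^ 'd \<Rightarrow> real"
  assumes p: "1 \<le> p"
  shows "real_polynomial_function Q \<Longrightarrow> approximable p (\<lambda>x. Q x * exp (- (1 / 2 + real j / 8) * (norm x)\<^sup>2))"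
proof (induction j arbitrary: Q)
  case 0
  define k where "k = (pi powr (- 1 / 4)) ^ CARD('d)"
  have "k > 0" by (simp add: k_def)
  have "(\<lambda>x. Q x * ((1 / k) * hermite 0 x)) \<in> hermite_span"
    by (intro hermite_span_poly 0 hermite_span_scale hermite_in_span)
  moreover have "Q x * ((1 / k) * hermite 0 x) = Q x * exp (- (1 / 2 + real 0 / 8) * (norm x)\<^sup>2)" for x
  proof -
    have "hermite 0 x = k * exp (- ((norm x)\<^sup>2) / 2)" by (simp only: hermite_0 k_def)
    then show ?thesis using \<open>k > 0\<close> by simp
  qed
  ultimately show ?case using approximable_span[OF _ p] by simp
next
  case (Suc j)
  define s where "s = 1 / 2 + real j / 8"
  have s: "1 / 2 \<le> s" by (simp add: s_def)
  define r where "r x = - ((norm x)\<^sup>2) / 8" for x :: "real ^ 'd"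
  define f where "f N x = (\<Sum>k<N. (Q x * ((r x) ^ k / fact k)) * exp (- s * (norm x)\<^sup>2))" for N x
  have "real_polynomial_function r"
    unfolding r_def using real_polynomial_function.intros(4)[OF real_polynomial_function.intros(2)[of "- 1 / 8"] real_polynomial_function_norm_sq]
    by simp
  then have "real_polynomial_function (\<lambda>x. Q x * ((r x) ^ k * (1 / fact k)))" for k
    by (intro real_polynomial_function.intros(4) Suc.prems real_polynomial_function_power real_polynomial_function.intros(2))
  then have appr: "approximable p (f N)" for N
    unfolding f_def[abs_def] by (intro approximable_sum[OF p] Suc.IH[folded s_def]) auto
  let ?g = "\<lambda>x. Q x * exp (- (1 / 2 + real (Suc j) / 8) * (norm x)\<^sup>2)"
  have gL: "?g \<in> Lp_space p" 
  proof (rule poly_gauss_Lp[OF Suc.prems])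
    show "0 < 1 / 2 + real (Suc j) / 8" by (rule add_pos_nonneg) auto
  qed (use p in simp)
  have geq: "?g x = Q x * exp (- s * (norm x)\<^sup>2) * exp (r x)" for x
    by (simp add: s_def r_def exp_add[symmetric] mult.assoc) (simp add: field_simps)
  have feq: "f N x = Q x * exp (- s * (norm x)\<^sup>2) * (\<Sum>k<N. (r x) ^ k / fact k)" for N x
    by (simp add: f_def sum_distrib_left mult_ac)
  have es: "(\<lambda>k. t ^ k / fact k) sums exp t" for t :: real
    using exp_converges[of t] by (simp add: scaleR_conv_of_real divide_inverse mult_ac)
  show ?case
  proof (rule approximable_seq[OF p gL appr])
    show "(\<lambda>N. Lp_norm p (\<lambda>x. f N x - ?g x)) \<longlonglongrightarrow> 0"
    proof (rule Lp_dominated_convergence)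
      show "f N \<in> borel_measurable lebesgue" for N
        using appr[of N] by (auto simp: approximable_def Lp_space_def)
      show "?g \<in> borel_measurable lebesgue" by (rule Lp_spaceD[OF gL])
      show "AE x in lebesgue. (\<lambda>N. f N x) \<longlonglongrightarrow> ?g x"
        unfolding feq geq using es by (intro AE_I2 tendsto_mult_left) (simp add: sums_def)
      \<comment> \<open>Since s >= 1/2, the exponent s - 1/8 is at least 3/8, so the dominating
        function is Gaussian at every step of the induction.\<close>
      have "(\<lambda>x. 2 *\<^sub>R (Q x * exp (- (s - 1 / 8) * (norm x)\<^sup>2))) \<in> Lp_space p"
        using p s by (intro Lp_space_scaleR poly_gauss_Lp Suc.prems) auto
      then show "(\<lambda>x. \<bar>2 * (Q x * exp (- (s - 1 / 8) * (norm x)\<^sup>2))\<bar>) \<in> Lp_space p"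
        by (auto simp: Lp_space_def)
      show "AE x in lebesgue. norm (f N x - ?g x) \<le> \<bar>2 * (Q x * exp (- (s - 1 / 8) * (norm x)\<^sup>2))\<bar>" for N
      proof (rule AE_I2)
        fix x :: "real ^ 'd"
        have "\<bar>\<Sum>k<N. (r x) ^ k / fact k\<bar> \<le> (\<Sum>k<N. \<bar>r x\<bar> ^ k / fact k)"
          by (rule order.trans[OF sum_abs]) (simp add: power_abs)
        also have "\<dots> \<le> exp \<bar>r x\<bar>"
          using sum_le_suminf[OF sums_summable[OF es[of "\<bar>r x\<bar>"]], of "{..<N}"] sums_unique[OF es[of "\<bar>r x\<bar>"]]
          by simp
        finally have 1: "\<bar>\<Sum>k<N. (r x) ^ k / fact k\<bar> \<le> exp \<bar>r x\<bar>" .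
        have "\<bar>(\<Sum>k<N. (r x) ^ k / fact k) - exp (r x)\<bar> \<le> 2 * exp \<bar>r x\<bar>"
          using 1 abs_ge_self[of "r x"] exp_gt_zero[of "r x"] exp_le_cancel_iff[of "r x" "\<bar>r x\<bar>"] by linarith
        then have "\<bar>Q x * exp (- s * (norm x)\<^sup>2)\<bar> * \<bar>(\<Sum>k<N. (r x) ^ k / fact k) - exp (r x)\<bar>
            \<le> \<bar>Q x * exp (- s * (norm x)\<^sup>2)\<bar> * (2 * exp \<bar>r x\<bar>)"
          by (intro mult_left_mono) auto
        also have "\<dots> = 2 * (\<bar>Q x\<bar> * (exp (- s * (norm x)\<^sup>2) * exp \<bar>r x\<bar>))" by (simp add: abs_mult)
        also have "exp (- s * (norm x)\<^sup>2) * exp \<bar>r x\<bar> = exp (- (s - 1 / 8) * (norm x)\<^sup>2)"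
          by (simp add: exp_add[symmetric] r_def) (simp add: field_simps)
        finally show "norm (f N x - ?g x) \<le> \<bar>2 * (Q x * exp (- (s - 1 / 8) * (norm x)\<^sup>2))\<bar>"
          unfolding feq geq right_diff_distrib[symmetric] by (simp add: abs_mult)
      qed
    qed (use p in auto)
  qed
qed

inductive gauss_poly :: "(real ^ 'd \<Rightarrow> real) \<Rightarrow> bool" where
  base: "real_polynomial_function Q \<Longrightarrow> gauss_poly (\<lambda>x. Q x * exp (- (real j / 8) * (norm x)\<^sup>2))"
| sum: "gauss_poly F \<Longrightarrow> gauss_poly G \<Longrightarrow> gauss_poly (\<lambda>x. F x + G x)"

lemma gauss_poly_mult:
  assumes "gauss_poly F" "gauss_poly G"
  shows "gauss_poly (\<lambda>x. F x * G x)"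
  using assms
proof (induction F rule: gauss_poly.induct)
  case (base Q j)
  from base(2) show ?case
  proof (induction G rule: gauss_poly.induct)
    case (base R k)
    have "gauss_poly (\<lambda>x. (Q x * R x) * exp (- (real (j + k) / 8) * (norm x)\<^sup>2))"
      by (intro gauss_poly.base real_polynomial_function.intros(4) base \<open>real_polynomial_function Q\<close>)
    moreover have "(Q x * exp (- (real j / 8) * (norm x)\<^sup>2)) * (R x * exp (- (real k / 8) * (norm x)\<^sup>2))
        = (Q x * R x) * exp (- (real (j + k) / 8) * (norm x)\<^sup>2)" for x
    proof -
      have "- (real (j + k) / 8) * (norm x)\<^sup>2 = - (real j / 8) * (norm x)\<^sup>2 + - (real k / 8) * (norm x)\<^sup>2"
        by (simp add: field_simps)
      then show ?thesis by (simp only: exp_add) simp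
    qed
    ultimately show ?case by (simp only:)
  next
    case (sum F G)
    then show ?case using gauss_poly.sum[OF sum.IH] by (simp add: distrib_left)
  qed
next
  case (sum F1 F2)
  then show ?case using gauss_poly.sum[OF sum.IH(1) sum.IH(2)] by (simp add: distrib_right)
qed

text \<open>The second coordinate is positive, so x is recovered as a quotient, while the image
  stays bounded.\<close>

definition compactify :: "real ^ 'd \<Rightarrow> (real ^ 'd) \<times> real" where
  "compactify x = (exp (- ((norm x)\<^sup>2) / 8) *\<^sub>R x, exp (- ((norm x)\<^sup>2) / 8))"

text \<open>Both coordinates carry the same Gaussian factor, so a linear form turns into an affine
  function times exp(- |x|^2 / 8); sums and products stay in the algebra.\<close>

lemma gauss_poly_compactify:
  fixes P :: "(real ^ 'd) \<times> real \<Rightarrow> real"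
  assumes "real_polynomial_function P"
  shows "gauss_poly (\<lambda>x. P (compactify x))"
  using assms
proof induction
  case lin: (linear P)
  interpret bounded_linear P by (rule lin)
  have "bounded_linear (\<lambda>x :: real ^ 'd. P (x, 0))"
    by (rule bounded_linear_compose[OF lin]) (intro bounded_linear_intros)
  then have "real_polynomial_function (\<lambda>x. P (x, 0) + P (0, 1))"
    by (intro real_polynomial_function.intros)
  then have "gauss_poly (\<lambda>x. (P (x, 0) + P (0, 1)) * exp (- (real 1 / 8) * (norm x)\<^sup>2))"
    by (rule gauss_poly.base)
  moreover have "P (compactify x) = (P (x, 0) + P (0, 1)) * exp (- (real 1 / 8) * (norm x)\<^sup>2)" for x
  proof -
    have "P (compactify x) = P (exp (- ((norm x)\<^sup>2) / 8) *\<^sub>R ((x, 0) + (0, 1)))"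
      by (simp add: compactify_def)
    also have "\<dots> = (P (x, 0) + P (0, 1)) * exp (- (real 1 / 8) * (norm x)\<^sup>2)"
      by (simp only: scaleR add) simp
    finally show ?thesis .
  qed
  ultimately show ?case by (simp only:)
next
  case (const c)
  show ?case using gauss_poly.base[OF real_polynomial_function.intros(2), of c 0] by simp
next
  case (add P Q)
  then show ?case by (intro gauss_poly.sum)
next
  case (mult P Q)
  then show ?case by (intro gauss_poly_mult)
qed

lemma approximable_gauss_poly:
  assumes "1 \<le> p" "gauss_poly F"
  shows "approximable p (\<lambda>x. F x * exp (- ((norm x)\<^sup>2) / 2))"
  using assms(2)
proof induction
  case (base Q j)
  have "Q x * exp (- (real j / 8) * (norm x)\<^sup>2) * exp (- ((norm x)\<^sup>2) / 2) = Q x * exp (- (1 / 2 + real j / 8) * (norm x)\<^sup>2)" for x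
    by (simp add: mult.assoc exp_add[symmetric] algebra_simps)
  then show ?case using approximable_poly_gauss[OF assms(1) base, of j] by (simp only:)
next
  case (sum F G)
  then show ?case using approximable_add[OF assms(1) sum.IH] by (simp add: distrib_right)
qed

text \<open>The radius is 2 + 1: the vector part is bounded through |x| <= 2 exp(|x|^2 / 8), the
  scalar part by 1.\<close>

lemma compactify_bounded: "compactify x \<in> cball 0 3"
proof -
  have "norm x \<le> 2 * (1 + (norm x)\<^sup>2 / 8)"
    using zero_le_power2[of "norm x - 2"] by (simp add: power2_diff)
  also have "\<dots> \<le> 2 * exp ((norm x)\<^sup>2 / 8)" by (intro mult_left_mono) auto
  finally have "exp (- ((norm x)\<^sup>2) / 8) * norm x \<le> exp (- ((norm x)\<^sup>2) / 8) * (2 * exp ((norm x)\<^sup>2 / 8))"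
    by (rule mult_left_mono) simp
  also have "\<dots> = 2" by (simp add: exp_minus)
  finally have 1: "norm (exp (- ((norm x)\<^sup>2) / 8) *\<^sub>R x) \<le> 2" by simp
  have "norm (compactify x) \<le> norm (exp (- ((norm x)\<^sup>2) / 8) *\<^sub>R x) + norm (exp (- ((norm x)\<^sup>2) / 8))"
    unfolding compactify_def by (rule norm_Pair_le)
  also have "\<dots> \<le> 2 + 1" using 1 by (intro add_mono) auto
  finally show ?thesis by simp
qed

text \<open>A compactly supported function factors continuously through \<open>compactify\<close>, whose range is
  bounded; hence Stone-Weierstrass on a ball gives an approximation that is uniform on the whole
  space.\<close>

lemma approximable_compact_support:
  fixes f :: "real ^ 'd \<Rightarrow> real"
  assumes p: "1 \<le> p" and cont: "continuous_on UNIV f" and supp: "\<And>x. N \<le> norm x \<Longrightarrow> f x = 0" and N: "0 \<le> N"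
  shows "approximable p f"
proof -
  \<comment> \<open>The ground state is divided out, so that a uniform error for \<open>f'\<close>
    becomes an error for \<open>f\<close> proportional to the Gaussian \<open>g\<close>, which lies
    in L^p.\<close>
  define f' where "f' x = f x * exp ((norm x)\<^sup>2 / 2)" for x
  have contf': "continuous_on UNIV f'" unfolding f'_def[abs_def] by (intro continuous_intros cont) auto
  define e where "e x = exp (- ((norm x)\<^sup>2) / 8)" for x :: "real ^ 'd"
  \<comment> \<open>The values of the second coordinate of \<open>compactify\<close> at radius N and
    N + 1.\<close>
  define r0 r1 where "r0 = exp (- (N\<^sup>2) / 8)" and "r1 = exp (- ((N + 1)\<^sup>2) / 8)"
  have r: "0 < r1" "r1 < r0" using N by (auto simp: r0_def r1_def power_strict_mono)
  \<comment> \<open>A continuous function on the whole target that restricts to \<open>f'\<close>: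
    the clamped quotient recovers x where \<open>snd z\<close> is at least \<open>r1\<close>, and
    the cut-off is 0 below \<open>r1\<close>, which on the image belongs to points outside the
    support.\<close>
  define G where "G z = max 0 (min 1 ((snd z - r1) / (r0 - r1))) * f' ((1 / max (snd z) r1) *\<^sub>R fst z)" for z
  have contG: "continuous_on UNIV G"
    unfolding G_def using r
    by (intro continuous_intros continuous_on_compose2[OF contf']) (auto simp: max_def)
  have Gf: "G (compactify x) = f' x" for x
  proof (cases "r1 < e x")
    case True
    then have "(1 / max (e x) r1) *\<^sub>R (e x *\<^sub>R x) = x" using r by simp
    then have *: "G (compactify x) = max 0 (min 1 ((e x - r1) / (r0 - r1))) * f' x"
      by (simp add: G_def compactify_def e_def)
    show ?thesis
    proof (cases "norm x \<le> N")
      case True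
      then have "(norm x)\<^sup>2 \<le> N\<^sup>2" by (intro power_mono) auto
      then have "r0 \<le> e x" by (simp add: r0_def e_def)
      then have "1 \<le> (e x - r1) / (r0 - r1)" using r by (simp add: field_simps)
      then show ?thesis unfolding * by simp
    next
      case False
      then have "f' x = 0" using supp[of x] by (simp add: f'_def)
      then show ?thesis unfolding * by simp
    qed
  next
    case False
    have "norm x > N"
    proof (rule ccontr)
      assume "\<not> norm x > N"
      then have "(norm x)\<^sup>2 \<le> N\<^sup>2" by (intro power_mono) auto
      then have "r0 \<le> e x" by (simp add: r0_def e_def)
      then show False using False r by simp
    qed
    then have "f' x = 0" using supp[of x] by (simp add: f'_def)
    moreover have "(e x - r1) / (r0 - r1) \<le> 0" using False r by (simp add: divide_nonpos_pos)
    then have "G (compactify x) = 0" by (simp add: G_def compactify_def e_def)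
    ultimately show ?thesis by simp
  qed
  define g where "g x = exp (- ((norm x)\<^sup>2) / 2)" for x :: "real ^ 'd"
  have gL: "g \<in> Lp_space p"
    by (rule Lp_space_gauss_dominated[where s = "1/2" and C = 1])
       (use p in \<open>auto simp: g_def intro!: borel_measurable_continuous_onI continuous_intros\<close>)
  have fL: "f \<in> Lp_space p"
  proof -
    have "compact (cball (0 :: real ^ 'd) N)" by simp
    then have "bounded (f ` cball 0 N)"
      using cont by (intro compact_imp_bounded compact_continuous_image) (auto intro: continuous_on_subset)
    then obtain B where B: "0 < B" "\<And>x. norm x \<le> N \<Longrightarrow> \<bar>f x\<bar> \<le> B"
      unfolding bounded_pos by auto
    show ?thesis
    proof (rule Lp_space_gauss_dominated[where s = 1 and C = "B * exp (N\<^sup>2)"])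
      show "f \<in> borel_measurable borel" by (intro borel_measurable_continuous_onI cont)
      show "norm (f x) \<le> B * exp (N\<^sup>2) * exp (- 1 * (norm x)\<^sup>2)" for x
      proof (cases "norm x \<le> N")
        case True
        then have "(norm x)\<^sup>2 \<le> N\<^sup>2" by (intro power_mono) auto
        then have "1 \<le> exp (N\<^sup>2) * exp (- 1 * (norm x)\<^sup>2)" by (simp add: exp_add[symmetric])
        from mult_mono[OF B(2)[OF True] this] B(1) show ?thesis by (simp add: mult.assoc)
      qed (use supp[of x] B in auto)
    qed (use p in auto)
  qed
  show ?thesis
  proof (rule approximable_limit[OF p fL])
    fix \<epsilon> :: real assume eps: "0 < \<epsilon>"
    define d where "d = \<epsilon> / (2 * (Lp_norm p g + 1))"
    have d: "0 < d" using eps Lp_norm_nonneg[of p g] by (simp add: d_def)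
    obtain P where P: "real_polynomial_function P" "\<And>z. z \<in> cball 0 3 \<Longrightarrow> \<bar>G z - P z\<bar> < d"
      by (rule Stone_Weierstrass_real_polynomial_function[of "cball 0 3" G d])
         (use d contG in \<open>auto intro: continuous_on_subset\<close>)
    define h where "h x = P (compactify x) * g x" for x
    have h: "approximable p h"
      unfolding h_def[abs_def] g_def by (rule approximable_gauss_poly[OF p gauss_poly_compactify[OF P(1)]])
    have b: "norm (f x - h x) \<le> norm (d *\<^sub>R g x)" for x
    proof -
      have "f x = f' x * g x" by (simp add: f'_def g_def exp_minus mult.assoc)
      then have "f x - h x = (G (compactify x) - P (compactify x)) * g x"
        by (simp add: h_def Gf left_diff_distrib)
      moreover have "\<bar>G (compactify x) - P (compactify x)\<bar> \<le> d"
        using P(2)[OF compactify_bounded[of x]] by simp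
      ultimately show ?thesis using d by (simp add: abs_mult mult_right_mono)
    qed
    have "Lp_norm p (\<lambda>x. f x - h x) \<le> Lp_norm p (\<lambda>x. d *\<^sub>R g x)"
    proof (rule Lp_space_bound(2))
      show "(\<lambda>x. f x - h x) \<in> borel_measurable lebesgue"
        using fL h by (auto simp: approximable_def Lp_space_def)
      show "(\<lambda>x. d *\<^sub>R g x) \<in> Lp_space p" by (rule Lp_space_scaleR[OF gL])
    qed (use b p in auto)
    also have "\<dots> = d * Lp_norm p g" using p d by (subst Lp_norm_scaleR) auto
    also have "\<dots> \<le> d * (Lp_norm p g + 1)" using d by simp
    also have "\<dots> = \<epsilon> / 2" using Lp_norm_nonneg[of p g] by (simp add: d_def field_simps)
    also have "\<dots> < \<epsilon>" using eps by simp
    finally show "\<exists>g. approximable p g \<and> Lp_norm p (\<lambda>x. f x - g x) < \<epsilon>" using h by blast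
  qed
qed

text \<open>Two truncations, \<open>cl\<close> of the values and \<open>ch\<close> of the support,
  reduce to bounded functions of compact support. Such a function is a limit almost everywhere of
  continuous ones, which \<open>measurable_on\<close> provides; truncating these in the same way
  brings them under \<open>approximable_compact_support\<close> and dominates the
  convergence.\<close>

lemma approximable_Lp:
  fixes f :: "real ^ 'd \<Rightarrow> real"
  assumes p: "1 \<le> p" and f: "f \<in> Lp_space p"
  shows "approximable p f"
proof -
  note [measurable] = Lp_spaceD(1)[OF f]
  define ch where "ch k x = max 0 (min 1 (real k - norm x))" for k and x :: "real ^ 'd"
  define cl where "cl k a = max (- real k) (min (real k) a)" for k and a :: real
  have contch: "continuous_on UNIV (ch k)" for k unfolding ch_def[abs_def] by (intro continuous_intros)
  have ch: "0 \<le> ch k x" "ch k x \<le> 1" "real k \<le> norm x \<Longrightarrow> ch k x = 0" for k x by (auto simp: ch_def)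
  have cl: "\<bar>cl k a\<bar> \<le> \<bar>a\<bar>" "\<bar>cl k a\<bar> \<le> real k" for k a by (auto simp: cl_def)
  have [measurable]: "ch k \<in> borel_measurable lebesgue" for k
    by (rule lebesgue_from_lborel(1)) (rule borel_measurable_continuous_onI[OF contch])
  define F where "F k x = cl k (f x) * ch k x" for k x
  have Fm[measurable]: "F k \<in> borel_measurable lebesgue" for k unfolding F_def[abs_def] cl_def by measurable
  have Fb: "\<bar>F k x\<bar> \<le> \<bar>f x\<bar>" for k x
    unfolding F_def abs_mult using mult_mono[OF cl(1)[of k "f x"], of "ch k x" 1] ch[of k x] by simp
  have FL: "F k \<in> Lp_space p" for k
    by (rule Lp_space_bound(1)[OF Fm f]) (use Fb p in auto)
  have "f measurable_on UNIV"
    using Lp_spaceD(1)[OF f] by (subst measurable_on_iff_borel_measurable) auto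
  then obtain Z g where Z: "negligible Z" and g: "\<And>n. continuous_on UNIV (g n)" "\<And>x. x \<notin> Z \<Longrightarrow> (\<lambda>n. g n x) \<longlonglongrightarrow> f x"
    unfolding measurable_on_def by auto
  have AEZ: "AE x in lebesgue. x \<notin> Z"
    using Z by (simp add: negligible_iff_null_sets AE_not_in)
  have Fapp: "approximable p (F k)" for k
  proof (rule approximable_seq[OF p FL])
    let ?g = "\<lambda>n x. cl k (g n x) * ch k x"
    show app: "approximable p (?g n)" for n
    proof (rule approximable_compact_support[OF p])
      show "continuous_on UNIV (?g n)"
        unfolding cl_def by (intro continuous_intros g contch)
    qed (use ch(3) in auto)
    show "(\<lambda>n. Lp_norm p (\<lambda>x. ?g n x - F k x)) \<longlonglongrightarrow> 0"
    proof (rule Lp_dominated_convergence[OF _ Fm])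
      show "?g n \<in> borel_measurable lebesgue" for n
        using app[of n] by (auto simp: approximable_def Lp_space_def)
      show "AE x in lebesgue. (\<lambda>n. ?g n x) \<longlonglongrightarrow> F k x"
        using AEZ unfolding F_def cl_def
        by eventually_elim (intro tendsto_intros g(2))
      have chL: "ch k \<in> Lp_space p"
        using approximable_compact_support[OF p contch ch(3), of k] by (simp add: approximable_def)
      show "(\<lambda>x. (2 * real k) *\<^sub>R ch k x) \<in> Lp_space p"
        by (rule Lp_space_scaleR[OF chL])
      show "AE x in lebesgue. norm (?g n x - F k x) \<le> (2 * real k) *\<^sub>R ch k x" for n
      proof (rule AE_I2)
        fix x
        have "\<bar>cl k (g n x) - cl k (f x)\<bar> \<le> 2 * real k"
          using cl(2)[of k "g n x"] cl(2)[of k "f x"] by linarith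
        from mult_right_mono[OF this ch(1)[of k x]]
        show "norm (?g n x - F k x) \<le> (2 * real k) *\<^sub>R ch k x"
          unfolding F_def left_diff_distrib[symmetric] using ch(1)[of k x] by (simp add: abs_mult)
      qed
    qed (use p in auto)
  qed
  show ?thesis
  proof (rule approximable_seq[OF p f Fapp])
    show "(\<lambda>k. Lp_norm p (\<lambda>x. F k x - f x)) \<longlonglongrightarrow> 0"
    proof (rule Lp_dominated_convergence[OF Fm Lp_spaceD(1)[OF f]])
      show "AE x in lebesgue. (\<lambda>k. F k x) \<longlonglongrightarrow> f x"
      proof (rule AE_I2)
        fix x
        obtain m where m: "\<bar>f x\<bar> + norm x + 1 \<le> real m" using real_arch_simple by blast
        have "F k x = f x" if "m \<le> k" for k
        proof -
          have "real m \<le> real k" using that by simp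
          then have "\<bar>f x\<bar> \<le> real k" "1 \<le> real k - norm x" using m norm_ge_zero[of x] by linarith+
          then show ?thesis by (auto simp: F_def cl_def ch_def)
        qed
        then have "eventually (\<lambda>k. F k x = f x) sequentially" by (auto simp: eventually_sequentially)
        then show "(\<lambda>k. F k x) \<longlonglongrightarrow> f x" by (rule tendsto_eventually)
      qed
      have "(\<lambda>x. 2 *\<^sub>R f x) \<in> Lp_space p" by (rule Lp_space_scaleR[OF f])
      then show "(\<lambda>x. norm (2 *\<^sub>R f x)) \<in> Lp_space p" by (auto simp: Lp_space_def)
      show "AE x in lebesgue. norm (F k x - f x) \<le> norm (2 *\<^sub>R f x)" for k
      proof (rule AE_I2)
        fix x
        show "norm (F k x - f x) \<le> norm (2 *\<^sub>R f x)"
          using Fb[of k x] abs_triangle_ineq4[of "F k x" "f x"] by (simp add: abs_mult)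
      qed
    qed (use p in auto)
  qed
qed

lemma hermite_span_dense:
  fixes f :: "real ^ 'd \<Rightarrow> real"
  assumes "1 \<le> p" "f \<in> Lp_space p" "0 < e"
  obtains h where "h \<in> hermite_span" "Lp_norm p (\<lambda>x. f x - h x) < e"
  using approximable_Lp[OF assms(1,2)] assms(3) unfolding approximable_def by blast

text \<open>Each of the d components is approximated up to e / d. The d-dependence affects only the
  choice of the approximant and enters no estimate.\<close>

lemma hermite_span_dense_vec:
  fixes F :: "real ^ 'd \<Rightarrow> real ^ 'd"
  assumes p: "1 \<le> p" and F: "F \<in> Lp_space p" and e: "0 < e"
  obtains H where "\<And>i. (\<lambda>x. H x $ i) \<in> hermite_span" "H \<in> Lp_space p" "Lp_norm p (\<lambda>x. F x - H x) < e"
proof -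
  note [measurable] = Lp_spaceD(1)[OF F]
  have Fi: "(\<lambda>x. F x $ i) \<in> Lp_space p" for i
  proof (rule Lp_space_bound(1)[OF _ F])
    show "(\<lambda>x. F x $ i) \<in> borel_measurable lebesgue" unfolding cart_eq_inner_axis by measurable
    show "AE x in lebesgue. norm (F x $ i) \<le> norm (F x)" by (intro AE_I2) (simp add: component_le_norm_cart)
  qed (use p in simp)
  define n where "n = real CARD('d)"
  have n: "0 < n" by (simp add: n_def)
  have "\<exists>h. \<forall>i. h i \<in> hermite_span \<and> Lp_norm p (\<lambda>x. F x $ i - h i x) < e / n"
  proof (rule choice, rule allI)
    fix i
    show "\<exists>h. h \<in> hermite_span \<and> Lp_norm p (\<lambda>x. F x $ i - h x) < e / n"
      using hermite_span_dense[OF p Fi[of i], of "e / n"] e n by (metis divide_pos_pos)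
  qed
  then obtain h where h: "\<And>i. h i \<in> hermite_span" "\<And>i. Lp_norm p (\<lambda>x. F x $ i - h i x) < e / n" by blast
  define H where "H x = (\<chi> i. h i x)" for x
  define D where "D i x = (F x $ i - h i x) *\<^sub>R axis i (1::real)" for i :: 'd and x
  have nD: "norm (D i x) = norm (F x $ i - h i x)" for i x by (simp add: D_def)
  have DL: "D i \<in> Lp_space p" "Lp_norm p (D i) < e / n" for i
  proof -
    have d: "(\<lambda>x. F x $ i - h i x) \<in> Lp_space p"
      using Lp_space_diff[OF Fi hermite_span_Lp[OF h(1) p]] p by simp
    have m: "D i \<in> borel_measurable lebesgue"
      unfolding D_def[abs_def] using Lp_spaceD(1)[OF d] by (intro borel_measurable_scaleR) auto
    show "D i \<in> Lp_space p"
      by (rule Lp_space_bound(1)[OF m d]) (use p nD in auto)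
    show "Lp_norm p (D i) < e / n" using h(2)[of i] by (simp add: Lp_norm_def nD)
  qed
  have sumD: "(\<lambda>x. \<Sum>i\<in>UNIV. D i x) = (\<lambda>x. F x - H x)"
  proof
    fix x
    have "(\<Sum>i\<in>UNIV. D i x) $ j = (F x - H x) $ j" for j
    proof -
      have "(\<Sum>i\<in>UNIV. D i x) $ j = (\<Sum>i\<in>UNIV. if i = j then F x $ j - h j x else 0)"
        unfolding sum_component by (intro sum.cong) (auto simp: D_def axis_def)
      then show ?thesis by (simp add: H_def)
    qed
    then show "(\<Sum>i\<in>UNIV. D i x) = F x - H x" by (simp add: vec_eq_iff)
  qed
  have S: "(\<lambda>x. F x - H x) \<in> Lp_space p" "Lp_norm p (\<lambda>x. F x - H x) \<le> (\<Sum>i\<in>UNIV. Lp_norm p (D i))"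
    using Lp_sum[of UNIV D p] DL p unfolding sumD by auto
  have "(\<Sum>i\<in>UNIV. Lp_norm p (D i)) < (\<Sum>i\<in>(UNIV :: 'd set). e / n)"
    by (intro sum_strict_mono DL) auto
  also have "\<dots> = e" using n by (simp add: n_def)
  finally have "Lp_norm p (\<lambda>x. F x - H x) < e" using S(2) by simp
  moreover have "H \<in> Lp_space p"
    using Lp_space_diff[OF F S(1)] p by simp
  moreover have "(\<lambda>x. H x $ i) \<in> hermite_span" for i using h(1)[of i] by (simp add: H_def)
  ultimately show ?thesis using that by blast
qed

section \<open>Weighted resolvents\<close>

text \<open>The weight satisfies \<open>(- \<Delta> + |x|\<^sup>2) psi \<ge> psi / 4\<close> and oscillates only by the factor 4/3.\<close>

definition psi :: "real ^ 'd \<Rightarrow> real" where "psi x = 1 + exp (- ((norm x)\<^sup>2) / 2) / 3"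
definition psi_x :: "'d \<Rightarrow> real ^ 'd \<Rightarrow> real" where "psi_x i x = - (x $ i) * exp (- ((norm x)\<^sup>2) / 2) / 3"
definition psi_xx :: "'d \<Rightarrow> real ^ 'd \<Rightarrow> real" where "psi_xx i x = ((x $ i)\<^sup>2 - 1) * exp (- ((norm x)\<^sup>2) / 2) / 3"

lemma psi_bounds: "1 < psi x" "psi x \<le> 4 / 3"
  by (auto simp: psi_def)

lemma DERIV_gauss_line:
  "((\<lambda>s. exp (- ((norm (x + s *\<^sub>R axis i 1 :: real ^ 'd))\<^sup>2) / 2)) has_real_derivative
     - ((x + s *\<^sub>R axis i 1) $ i) * exp (- ((norm (x + s *\<^sub>R axis i 1))\<^sup>2) / 2)) (at s)"
proof -
  have "(norm (x + s *\<^sub>R axis i 1))\<^sup>2 = (norm x)\<^sup>2 + 2 * s * x $ i + s\<^sup>2" for s :: real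
  proof -
    have "(norm (x + s *\<^sub>R axis i 1))\<^sup>2 = x \<bullet> x + 2 * (s * (x \<bullet> axis i 1)) + s * (s * (axis i 1 \<bullet> axis i (1::real)))"
      by (simp only: power2_norm_eq_inner inner_add_left inner_add_right inner_scaleR_left inner_scaleR_right
          inner_commute[of "axis i 1" x]) (simp only: distrib_left mult_2 add_ac)
    then show ?thesis by (simp add: inner_axis power2_norm_eq_inner[of x] power2_eq_square[of s])
  qed
  then show ?thesis
    by (auto intro!: derivative_eq_intros simp: axis_def field_simps)
qed

lemma psi_derivs:
  "((\<lambda>s. psi (x + s *\<^sub>R axis i 1)) has_real_derivative psi_x i (x + s *\<^sub>R axis i 1)) (at s)"
  "((\<lambda>s. psi_x i (x + s *\<^sub>R axis i 1)) has_real_derivative psi_xx i (x + s *\<^sub>R axis i 1)) (at s)"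
proof -
  have c: "((\<lambda>s. (x + s *\<^sub>R axis i 1) $ i) has_real_derivative 1) (at s)"
    by (auto intro!: derivative_eq_intros simp: axis_def)
  show "((\<lambda>s. psi (x + s *\<^sub>R axis i 1)) has_real_derivative psi_x i (x + s *\<^sub>R axis i 1)) (at s)"
    unfolding psi_def psi_x_def
    by (rule DERIV_cong[OF DERIV_add[OF DERIV_const DERIV_cdivide[OF DERIV_gauss_line]]]) simp
  show "((\<lambda>s. psi_x i (x + s *\<^sub>R axis i 1)) has_real_derivative psi_xx i (x + s *\<^sub>R axis i 1)) (at s)"
    unfolding psi_x_def psi_xx_def
    by (rule DERIV_cong[OF DERIV_cdivide[OF DERIV_mult[OF DERIV_minus[OF c] DERIV_gauss_line]]])
       (simp add: power2_eq_square algebra_simps)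
qed

text \<open>With r = |x|^2 and h = exp(- r / 2) >= 1 - r / 2, dimension one is the worst case, and
  the difference of the two sides is at least 7 r / 8. At the origin in dimension one there is
  equality, so 1/4 is the best gain for this weight.\<close>

lemma psi_supersolution:
  fixes x :: "real ^ 'd"
  shows "(9 / 4) * psi x \<le> ((norm x)\<^sup>2 + 2) * psi x - (\<Sum>i\<in>UNIV. psi_xx i x)"
proof -
  define r where "r = (norm x)\<^sup>2"
  define h where "h = exp (- r / 2)"
  have S: "(\<Sum>i\<in>UNIV. psi_xx i x) = (r - real CARD('d)) * h / 3"
    unfolding psi_xx_def sum_divide_distrib[symmetric] sum_distrib_right[symmetric]
    by (simp add: sum_subtractf norm_power2_vec[symmetric] r_def h_def)
  have h: "1 - r / 2 \<le> h" "0 < h" using exp_ge_add_one_self[of "- r / 2"] by (auto simp: h_def)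
  have d: "1 \<le> real CARD('d)" by (simp add: Suc_leI)
  have "1 * h \<le> real CARD('d) * h" using h d by (intro mult_right_mono) auto
  then have "0 \<le> (r - 1 / 4) * (1 + h / 3) - (r - real CARD('d)) * h / 3"
  proof -
    have "(r - 1 / 4) * (1 + h / 3) - (r - real CARD('d)) * h / 3 = r - 1 / 4 - h / 12 + (real CARD('d) * h) / 3"
      by (simp add: field_simps)
    moreover have "0 \<le> r" by (simp add: r_def)
    ultimately show ?thesis using h \<open>1 * h \<le> real CARD('d) * h\<close> by linarith
  qed
  then show ?thesis unfolding S unfolding psi_def r_def[symmetric] h_def[symmetric]
  proof -
    assume "0 \<le> (r - 1 / 4) * (1 + h / 3) - (r - real CARD('d)) * h / 3"
    moreover have "(r + 2) * (1 + h / 3) - 9 / 4 * (1 + h / 3) = (r - 1 / 4) * (1 + h / 3)"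
      by (simp add: field_simps)
    ultimately show "9 / 4 * (1 + h / 3) \<le> (r + 2) * (1 + h / 3) - (r - real CARD('d)) * h / 3" by linarith
  qed
qed

context wave
begin

text \<open>The \<open>i\<close>-th component of \<open>psi\<^sup>2 \<nabla> (|U| / psi)\<^sup>p\<close> and its \<open>i\<close>-th partial derivative.\<close>

definition flux :: "real \<Rightarrow> 'd \<Rightarrow> real ^ 'd \<Rightarrow> real" where
  "flux p i x = (psi x)\<^sup>2 * (p / 2) * ((U x 0 \<bullet> U x 0) / (psi x)\<^sup>2) powr (p / 2)
     * (2 * (U x 0 \<bullet> Ux i x 0) / (U x 0 \<bullet> U x 0) - 2 * (psi_x i x / psi x))"

definition flux_x :: "real \<Rightarrow> 'd \<Rightarrow> real ^ 'd \<Rightarrow> real" where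
  "flux_x p i x = (psi x)\<^sup>2 * (p / 2) * ((U x 0 \<bullet> U x 0) / (psi x)\<^sup>2) powr (p / 2)
     * (2 * (psi_x i x / psi x) * (2 * (U x 0 \<bullet> Ux i x 0) / (U x 0 \<bullet> U x 0) - 2 * (psi_x i x / psi x))
        + p / 2 * (2 * (U x 0 \<bullet> Ux i x 0) / (U x 0 \<bullet> U x 0) - 2 * (psi_x i x / psi x))\<^sup>2
        + ((2 * (Ux i x 0 \<bullet> Ux i x 0) + 2 * (U x 0 \<bullet> Uxx i x 0)) / (U x 0 \<bullet> U x 0) - (2 * (U x 0 \<bullet> Ux i x 0) / (U x 0 \<bullet> U x 0))\<^sup>2)
        - 2 * (psi_xx i x / psi x - (psi_x i x / psi x)\<^sup>2))"

lemma flux_deriv: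
  "((\<lambda>s. flux p i (x + s *\<^sub>R axis i 1)) has_real_derivative flux_x p i x) (at 0)"
proof -
  let ?x = "\<lambda>s. x + s *\<^sub>R axis i (1::real)"
  define A where "A s = U (?x s) 0 \<bullet> U (?x s) 0" for s
  define A1 where "A1 s = 2 * (U (?x s) 0 \<bullet> Ux i (?x s) 0)" for s
  define A2 where "A2 s = 2 * (Ux i (?x s) 0 \<bullet> Ux i (?x s) 0) + 2 * (U (?x s) 0 \<bullet> Uxx i (?x s) 0)" for s
  define w w1 w2 where "w s = psi (?x s)" and "w1 s = psi_x i (?x s)" and "w2 s = psi_xx i (?x s)" for s
  have A: "0 < A s" for s by (simp only: A_def U_pos)
  have w: "0 < w s" for s using psi_bounds[of "?x s"] by (simp add: w_def)
  have dA: "(A has_real_derivative A1 s) (at s)" for s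
    unfolding A_def[abs_def] A1_def using DERIV_inner[OF U_derivs(3)[where x = x and i = i and t = 0 and s = s] U_derivs(3)[where x = x and i = i and t = 0 and s = s]]
    by (simp add: inner_commute)
  have dA1: "(A1 has_real_derivative A2 s) (at s)" for s
    unfolding A1_def[abs_def] A2_def
    using DERIV_cmult[OF DERIV_inner[OF U_derivs(3)[where x = x and i = i and t = 0 and s = s] U_derivs(4)[where x = x and i = i and t = 0 and s = s]], of 2] by (simp add: algebra_simps)
  have dw: "(w has_real_derivative w1 s) (at s)" "(w1 has_real_derivative w2 s) (at s)" for s
    unfolding w_def[abs_def] w1_def[abs_def] w2_def by (rule psi_derivs)+
  have nz: "A s \<noteq> 0" "w s \<noteq> 0" for s using A[of s] w[of s] by auto
  have dy: "((\<lambda>s. A1 s / A s) has_real_derivative A2 s / A s - (A1 s / A s)\<^sup>2) (at s)" for s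
    by (rule DERIV_cong[OF DERIV_divide[OF dA1 dA nz(1)]]) (simp add: nz field_simps power2_eq_square)
  have dz: "((\<lambda>s. w1 s / w s) has_real_derivative w2 s / w s - (w1 s / w s)\<^sup>2) (at s)" for s
    by (rule DERIV_cong[OF DERIV_divide[OF dw(2,1) nz(2)]]) (simp add: nz field_simps power2_eq_square)
  have dQ: "((\<lambda>s. A s / (w s)\<^sup>2) has_real_derivative (A s / (w s)\<^sup>2) * (A1 s / A s - 2 * (w1 s / w s))) (at s)" for s
    by (rule DERIV_cong[OF DERIV_divide[OF dA DERIV_power[OF dw(1)]]])
       (simp_all add: nz field_simps power2_eq_square)
  have Q: "0 < A s / (w s)\<^sup>2" for s using A[of s] w[of s] by simp
  have dX: "((\<lambda>s. (A s / (w s)\<^sup>2) powr (p / 2)) has_real_derivative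
      (p / 2) * ((A s / (w s)\<^sup>2) powr (p / 2)) * (A1 s / A s - 2 * (w1 s / w s))) (at s)" for s
    by (rule DERIV_cong[OF DERIV_powr_log[OF dQ Q]]) (use Q[of s] in simp)
  have dW: "((\<lambda>s. (w s)\<^sup>2 * (p / 2)) has_real_derivative ((w s)\<^sup>2 * (p / 2)) * (2 * (w1 s / w s))) (at s)" for s
    by (rule DERIV_cong[OF DERIV_cmult_right[OF DERIV_power[OF dw(1)]]])
       (simp add: nz field_simps power2_eq_square)
  have alg: "(W * (2 * z) * X + p / 2 * X * u * W) * u + (y' - 2 * z') * (W * X)
      = W * X * (2 * z * u + p / 2 * u\<^sup>2 + y' - 2 * z')" for W X z u y' z' :: real
    by (simp add: algebra_simps power2_eq_square)
  have "((\<lambda>s. (w s)\<^sup>2 * (p / 2) * (A s / (w s)\<^sup>2) powr (p / 2) * (A1 s / A s - 2 * (w1 s / w s))) has_real_derivative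
     (w s)\<^sup>2 * (p / 2) * (A s / (w s)\<^sup>2) powr (p / 2)
     * (2 * (w1 s / w s) * (A1 s / A s - 2 * (w1 s / w s))
        + p / 2 * (A1 s / A s - 2 * (w1 s / w s))\<^sup>2
        + (A2 s / A s - (A1 s / A s)\<^sup>2)
        - 2 * (w2 s / w s - (w1 s / w s)\<^sup>2))) (at s)" for s
    by (rule DERIV_cong[OF DERIV_mult[OF DERIV_mult[OF dW dX] DERIV_diff[OF dy DERIV_cmult[OF dz]]]])
       (rule alg)
  from this[of 0] show ?thesis
    by (simp add: flux_def flux_x_def A_def A1_def A2_def w_def w1_def w2_def)
qed

text \<open>Two nonnegative quantities are discarded: a square with the factor (p - 1) / 2, and
  \<open>2 * E / A - y^2 / 2\<close>, whose sign is Cauchy-Schwarz. What remains contains only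
  second derivatives, which the equation for \<open>U\<close> and the supersolution property
  control.\<close>

lemma flux_x_lower:
  assumes p: "1 \<le> p"
  shows "(psi x)\<^sup>2 * (p / 2) * ((U x 0 \<bullet> U x 0) / (psi x)\<^sup>2) powr (p / 2)
     * (2 * (U x 0 \<bullet> Uxx i x 0) / (U x 0 \<bullet> U x 0) - 2 * (psi_xx i x / psi x)) \<le> flux_x p i x"
proof -
  define A where "A = U x 0 \<bullet> U x 0"
  define y where "y = 2 * (U x 0 \<bullet> Ux i x 0) / A"
  define z where "z = psi_x i x / psi x"
  define E where "E = Ux i x 0 \<bullet> Ux i x 0"
  have A: "0 < A" by (simp only: A_def U_pos)
  have y2: "y\<^sup>2 / 2 \<le> 2 * E / A"
  proof -
    have "(U x 0 \<bullet> Ux i x 0)\<^sup>2 \<le> A * E" unfolding A_def E_def by (rule Cauchy_Schwarz_ineq)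
    then have "4 * (U x 0 \<bullet> Ux i x 0)\<^sup>2 / A\<^sup>2 \<le> 4 * (A * E) / A\<^sup>2"
      by (intro divide_right_mono mult_left_mono) auto
    then show ?thesis using A by (simp add: y_def power_divide power_mult_distrib power2_eq_square)
  qed
  have "0 \<le> (p / 2 - 1 / 2) * (y - 2 * z)\<^sup>2" using p by (intro mult_nonneg_nonneg) auto
  then have core: "0 \<le> 2 * z * (y - 2 * z) + p / 2 * (y - 2 * z)\<^sup>2 + 2 * E / A - y\<^sup>2 + 2 * z\<^sup>2"
  proof -
    have "2 * z * (y - 2 * z) + p / 2 * (y - 2 * z)\<^sup>2 + 2 * E / A - y\<^sup>2 + 2 * z\<^sup>2
       = (p / 2 - 1 / 2) * (y - 2 * z)\<^sup>2 + (2 * E / A - y\<^sup>2 / 2)"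
      by (simp add: power2_eq_square field_simps)
    then show ?thesis using y2 \<open>0 \<le> (p / 2 - 1 / 2) * (y - 2 * z)\<^sup>2\<close> by linarith
  qed
  have "0 \<le> (psi x)\<^sup>2 * (p / 2) * (A / (psi x)\<^sup>2) powr (p / 2)" using p by simp
  from mult_left_mono[OF _ this, of "2 * (U x 0 \<bullet> Uxx i x 0) / A - 2 * (psi_xx i x / psi x)"
      "2 * z * (y - 2 * z) + p / 2 * (y - 2 * z)\<^sup>2 + ((2 * E + 2 * (U x 0 \<bullet> Uxx i x 0)) / A - y\<^sup>2) - 2 * (psi_xx i x / psi x - z\<^sup>2)"]
  show ?thesis using core
    unfolding flux_x_def A_def[symmetric] E_def[symmetric] y_def[symmetric] z_def[symmetric]
    by (simp add: add_divide_distrib)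
qed

text \<open>Serves integrability: rate 7/16 for the p-th power, minus 1/16 for squared ratios of
  derivatives; the logarithmic derivatives of \<open>psi\<close> are bounded.\<close>

lemma flux_bounds:
  assumes p: "1 \<le> p"
  shows "\<exists>K\<ge>0. \<forall>x i. \<bar>flux p i x\<bar> \<le> K * exp (- (1 / 4) * (norm x)\<^sup>2) \<and> \<bar>flux_x p i x\<bar> \<le> K * exp (- (1 / 4) * (norm x)\<^sup>2)"
proof -
  obtain C where C: "1 \<le> C" "\<And>x. norm (U x 0) \<le> C * exp (- (7 / 16) * (norm x)\<^sup>2)"
    using U_bound by fastforce
  obtain D where D: "1 \<le> D" "\<And>x i. norm (Ux i x 0) \<le> D * exp ((norm x)\<^sup>2 / 32) * norm (U x 0) \<and>
     norm (Uxx i x 0) \<le> D * exp ((norm x)\<^sup>2 / 32) * norm (U x 0)"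
    using U_derivs_bound by (metis order_refl)
  \<comment> \<open>The factor 2 bounds psi^2, and 40 + 20 p bounds the bracket in
    \<open>flux_x\<close> in units of r^2.\<close>
  define K where "K = 2 * (p / 2) * C powr p * (40 + 20 * p) * D\<^sup>2"
  have K0: "0 \<le> K" using p by (simp add: K_def)
  {
    fix x :: "real ^ 'd" and i :: 'd
    define r where "r = D * exp ((norm x)\<^sup>2 / 32)"
    have r: "1 \<le> r" unfolding r_def using D mult_mono[of 1 D 1 "exp ((norm x)\<^sup>2 / 32)"] by simp
    have rr: "r \<le> r\<^sup>2" using r by (simp add: power2_eq_square)
    define A where "A = U x 0 \<bullet> U x 0"
    have A: "0 < A" by (simp only: A_def U_pos)
    have Us: "norm (U x 0) * norm (U x 0) = A" by (simp add: A_def dot_square_norm power2_eq_square)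
    define y where "y = 2 * (U x 0 \<bullet> Ux i x 0) / A"
    define z where "z = psi_x i x / psi x"
    define q where "q = psi_xx i x / psi x"
    define b where "b = (2 * (Ux i x 0 \<bullet> Ux i x 0) + 2 * (U x 0 \<bullet> Uxx i x 0)) / A"
    have ip: "\<bar>U x 0 \<bullet> v\<bar> \<le> r * A" if "norm v \<le> r * norm (U x 0)" for v
      using Cauchy_Schwarz_ineq2[of "U x 0" v] mult_left_mono[OF that norm_ge_zero[of "U x 0"]] Us
      by (simp add: mult_ac)
    have n1: "norm (Ux i x 0) \<le> r * norm (U x 0)" and n2: "norm (Uxx i x 0) \<le> r * norm (U x 0)"
      using D(2)[of i x] by (auto simp: r_def)
    have y: "\<bar>y\<bar> \<le> 2 * r" using ip[OF n1] A by (simp add: y_def abs_mult abs_divide field_simps)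
    have b: "\<bar>b\<bar> \<le> 4 * r\<^sup>2"
    proof -
      have "Ux i x 0 \<bullet> Ux i x 0 \<le> r\<^sup>2 * A"
      proof -
        have "norm (Ux i x 0) * norm (Ux i x 0) \<le> (r * norm (U x 0)) * (r * norm (U x 0))"
          using n1 r by (intro mult_mono) auto
        also have "\<dots> = r\<^sup>2 * A" unfolding Us[symmetric] by (simp add: power2_eq_square)
        finally show ?thesis by (simp add: dot_square_norm power2_eq_square)
      qed
      moreover have "\<bar>U x 0 \<bullet> Uxx i x 0\<bar> \<le> r\<^sup>2 * A"
        using ip[OF n2] mult_right_mono[OF rr, of A] A by linarith
      ultimately have "\<bar>2 * (Ux i x 0 \<bullet> Ux i x 0) + 2 * (U x 0 \<bullet> Uxx i x 0)\<bar> \<le> 4 * (r\<^sup>2 * A)"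
        using inner_ge_zero[of "Ux i x 0"] by linarith
      then show ?thesis using A by (simp add: b_def abs_divide field_simps)
    qed
    have h: "\<bar>x $ i\<bar> * exp (- ((norm x)\<^sup>2) / 2) \<le> 1" "(x $ i)\<^sup>2 * exp (- ((norm x)\<^sup>2) / 2) \<le> 2"
    proof -
      have "(x $ i)\<^sup>2 \<le> (norm x)\<^sup>2" using power_mono[OF component_le_norm_cart[of x i], of 2] by simp
      moreover have "1 + (norm x)\<^sup>2 / 2 \<le> exp ((norm x)\<^sup>2 / 2)" by (rule exp_ge_add_one_self)
      moreover have "\<bar>x $ i\<bar> \<le> 1 / 2 + (x $ i)\<^sup>2 / 2" using zero_le_power2[of "\<bar>x $ i\<bar> - 1"] by (simp add: power2_diff)
      ultimately have "\<bar>x $ i\<bar> \<le> 1 * exp ((norm x)\<^sup>2 / 2)" "(x $ i)\<^sup>2 \<le> 2 * exp ((norm x)\<^sup>2 / 2)"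
        by linarith+
      from this[THEN mult_right_mono, of "exp (- ((norm x)\<^sup>2) / 2)"]
      show "\<bar>x $ i\<bar> * exp (- ((norm x)\<^sup>2) / 2) \<le> 1" "(x $ i)\<^sup>2 * exp (- ((norm x)\<^sup>2) / 2) \<le> 2"
        by (simp_all add: mult.assoc exp_add[symmetric])
    qed
    have div: "\<bar>a / psi x\<bar> \<le> 1" if "\<bar>a\<bar> \<le> 1" for a
      using psi_bounds[of x] that by (simp add: abs_divide)
    have z: "\<bar>z\<bar> \<le> 1" unfolding z_def
      by (rule div) (use h(1) in \<open>simp add: psi_x_def abs_mult\<close>)
    have q: "\<bar>q\<bar> \<le> 1" unfolding q_def
    proof (rule div)
      have "exp (- ((norm x)\<^sup>2) / 2) \<le> 1" by simp
      moreover have "\<bar>(a - 1 * b) / 3\<bar> \<le> 1" if "0 \<le> a" "a \<le> 2" "0 < b" "b \<le> 1" for a b :: real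
        using that by simp
      ultimately have "\<bar>((x $ i)\<^sup>2 * exp (- ((norm x)\<^sup>2) / 2) - 1 * exp (- ((norm x)\<^sup>2) / 2)) / 3\<bar> \<le> 1"
        using h(2) by simp
      then show "\<bar>psi_xx i x\<bar> \<le> 1" by (simp only: psi_xx_def left_diff_distrib)
    qed
    have yz: "\<bar>y - 2 * z\<bar> \<le> 4 * r" using y z r by linarith
    have yz2: "(y - 2 * z)\<^sup>2 \<le> 16 * r\<^sup>2" using power_mono[OF yz, of 2] by (simp add: power_mult_distrib)
    have y2: "y\<^sup>2 \<le> 4 * r\<^sup>2" using power_mono[OF y, of 2] by (simp add: power_mult_distrib)
    have z2: "z\<^sup>2 \<le> 1" using power_mono[OF z, of 2] by simp
    have r2: "1 \<le> r\<^sup>2" using r by simp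
    have X: "(psi x)\<^sup>2 * (p / 2) * (A / (psi x)\<^sup>2) powr (p / 2) \<le> 2 * (p / 2) * (C powr p * exp (- (7 / 16) * (norm x)\<^sup>2))"
    proof (intro mult_mono)
      have "(psi x)\<^sup>2 \<le> (4 / 3)\<^sup>2" using psi_bounds[of x] by (intro power_mono) auto
      then show "(psi x)\<^sup>2 \<le> 2" by (simp add: power2_eq_square)
      have "1 \<le> (psi x)\<^sup>2" using psi_bounds[of x] by simp
      then have "A / (psi x)\<^sup>2 \<le> A / 1" using A by (intro divide_left_mono) auto
      then have "A / (psi x)\<^sup>2 \<le> A" by simp
      then have "(A / (psi x)\<^sup>2) powr (p / 2) \<le> A powr (p / 2)" using A p by (intro powr_mono2) auto
      also have "A powr (p / 2) = norm (U x 0) powr p"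
        using A by (simp add: A_def dot_square_norm powr_powr flip: powr_numeral)
      also have "\<dots> \<le> (C * exp (- (7 / 16) * (norm x)\<^sup>2)) powr p"
        using C p by (intro powr_mono2) auto
      also have "\<dots> = C powr p * exp (- (7 / 16) * (norm x)\<^sup>2) powr p" by (rule powr_mult)
      also have "exp (- (7 / 16) * (norm x)\<^sup>2) powr p \<le> exp (- (7 / 16) * (norm x)\<^sup>2) powr 1"
        using p by (intro powr_mono') auto
      finally show "(A / (psi x)\<^sup>2) powr (p / 2) \<le> C powr p * exp (- (7 / 16) * (norm x)\<^sup>2)"
        by (simp add: mult_left_mono)
    qed (use p in auto)
    have fin: "\<bar>(psi x)\<^sup>2 * (p / 2) * (A / (psi x)\<^sup>2) powr (p / 2) * e\<bar> \<le> K * exp (- (1 / 4) * (norm x)\<^sup>2)"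
      if "\<bar>e\<bar> \<le> (40 + 20 * p) * r\<^sup>2" for e
    proof -
      have "\<bar>(psi x)\<^sup>2 * (p / 2) * (A / (psi x)\<^sup>2) powr (p / 2) * e\<bar>
         = (psi x)\<^sup>2 * (p / 2) * (A / (psi x)\<^sup>2) powr (p / 2) * \<bar>e\<bar>" using p by (simp add: abs_mult)
      also have "\<dots> \<le> (2 * (p / 2) * (C powr p * exp (- (7 / 16) * (norm x)\<^sup>2))) * ((40 + 20 * p) * r\<^sup>2)"
        by (rule mult_mono[OF X that]) (use p in auto)
      also have "\<dots> = K * (exp (- (7 / 16) * (norm x)\<^sup>2) * exp ((norm x)\<^sup>2 / 16))"
        by (simp add: K_def r_def power_mult_distrib exp_double[symmetric])
      also have "exp (- (7 / 16) * (norm x)\<^sup>2) * exp ((norm x)\<^sup>2 / 16) = exp (- (7 / 16) * (norm x)\<^sup>2 + (norm x)\<^sup>2 / 16)"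
        by (simp only: exp_add)
      also have "K * \<dots> \<le> K * exp (- (1 / 4) * (norm x)\<^sup>2)" using K0 by (intro mult_left_mono) auto
      finally show ?thesis .
    qed
    have "\<bar>flux p i x\<bar> \<le> K * exp (- (1 / 4) * (norm x)\<^sup>2)"
      unfolding flux_def A_def[symmetric] y_def[symmetric] z_def[symmetric]
    proof (rule fin)
      have "4 * r \<le> 40 * r\<^sup>2" using rr r2 by linarith
      also have "\<dots> \<le> (40 + 20 * p) * r\<^sup>2" using p by (intro mult_right_mono) auto
      finally show "\<bar>y - 2 * z\<bar> \<le> (40 + 20 * p) * r\<^sup>2" using yz by linarith
    qed
    moreover have "\<bar>flux_x p i x\<bar> \<le> K * exp (- (1 / 4) * (norm x)\<^sup>2)"
      unfolding flux_x_def A_def[symmetric] y_def[symmetric] z_def[symmetric] q_def[symmetric] b_def[symmetric]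
    proof (rule fin)
      have 1: "\<bar>2 * z * (y - 2 * z)\<bar> \<le> 8 * r\<^sup>2"
      proof -
        have "\<bar>z\<bar> * \<bar>y - 2 * z\<bar> \<le> 1 * (4 * r)" using z yz by (intro mult_mono) auto
        then have "\<bar>2 * z * (y - 2 * z)\<bar> \<le> 8 * r" by (simp add: abs_mult)
        then show ?thesis using rr by linarith
      qed
      have 2: "\<bar>p / 2 * (y - 2 * z)\<^sup>2\<bar> \<le> p / 2 * (16 * r\<^sup>2)"
        using p yz2 by (simp add: abs_mult)
      have "\<bar>2 * z * (y - 2 * z) + p / 2 * (y - 2 * z)\<^sup>2 + (b - y\<^sup>2) - 2 * (q - z\<^sup>2)\<bar>
          \<le> 8 * r\<^sup>2 + p / 2 * (16 * r\<^sup>2) + 8 * r\<^sup>2 + 4 * r\<^sup>2"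
      proof -
        have gen: "\<bar>t1 + t2 + (b - u) - 2 * (q - v)\<bar> \<le> 8 * R + T + 8 * R + 4 * R"
          if "\<bar>t1\<bar> \<le> 8 * R" "\<bar>t2\<bar> \<le> T" "\<bar>b\<bar> \<le> 4 * R" "u \<le> 4 * R" "0 \<le> u" "\<bar>q\<bar> \<le> 1" "v \<le> 1" "0 \<le> v" "1 \<le> R"
          for t1 t2 b u q v R T :: real
          using that by (simp add: abs_le_iff)
        show ?thesis by (rule gen[OF 1 2 b y2 _ q z2 _ r2]) auto
      qed
      also have "\<dots> \<le> (40 + 20 * p) * r\<^sup>2"
        using p r2 mult_nonneg_nonneg[of p "r\<^sup>2"] by (simp add: algebra_simps)
      finally show "\<bar>2 * z * (y - 2 * z) + p / 2 * (y - 2 * z)\<^sup>2 + (b - y\<^sup>2) - 2 * (q - z\<^sup>2)\<bar> \<le> (40 + 20 * p) * r\<^sup>2" .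
    qed
    ultimately have "\<bar>flux p i x\<bar> \<le> K * exp (- (1 / 4) * (norm x)\<^sup>2) \<and> \<bar>flux_x p i x\<bar> \<le> K * exp (- (1 / 4) * (norm x)\<^sup>2)" ..
  }
  then show ?thesis using K0 by blast
qed

lemma flux_continuous: "continuous_on UNIV (flux p i)" "continuous_on UNIV (flux_x p i)"
proof -
  have S: "continuous_on UNIV (\<lambda>x. g x 0)" if "continuous_on UNIV (\<lambda>z. g (fst z) (snd z))" for g :: "real ^ 'd \<Rightarrow> real \<Rightarrow> 'e"
    using continuous_on_compose2[OF that, of UNIV "\<lambda>x. (x, 0)"] by (simp add: continuous_intros)
  note c = U_cont[THEN S]
  have psic: "continuous_on UNIV (psi :: real ^ 'd \<Rightarrow> real)" "continuous_on UNIV (psi_x i)" "continuous_on UNIV (psi_xx i)"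
    unfolding psi_def[abs_def] psi_x_def[abs_def] psi_xx_def[abs_def] by (intro continuous_intros; simp)+
  have nz: "U x 0 \<bullet> U x 0 \<noteq> 0" "psi x \<noteq> 0" for x
    using U_pos[of x 0] psi_bounds[of x] by auto
  show "continuous_on UNIV (flux p i)" "continuous_on UNIV (flux_x p i)"
    unfolding flux_def[abs_def] flux_x_def[abs_def]
    by (intro continuous_intros c psic; use nz in simp)+
qed

text \<open>At t = 0 the Laplacian of \<open>U\<close> is (|x|^2 + 2) U - \<open>Utt\<close>, and
  \<open>Utt\<close> is L + 2 applied to \<open>U\<close>. The supersolution property turns the
  potential minus the Laplacian of \<open>psi\<close> over \<open>psi\<close> into 9/4, and Young's
  inequality separates \<open>Utt\<close>.\<close>

lemma flux_x_sum_lower: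
  assumes p: "1 < p" and kappa2: "\<kappa> = 2"
  shows "9 / 4 * (psi x powr (2 - p) * norm (U x 0) powr p - (4 / 9) powr p * (psi x powr (2 - p) * norm (Utt x 0) powr p))
     \<le> (\<Sum>i\<in>UNIV. flux_x p i x)"
proof -
  define A where "A = U x 0 \<bullet> U x 0"
  have A: "0 < A" by (simp only: A_def U_pos)
  define a where "a = norm (U x 0)"
  have a: "0 < a" "A = a\<^sup>2" using A by (auto simp: a_def A_def dot_square_norm)
  define F where "F = norm (Utt x 0)"
  define w where "w = psi x"
  have w: "0 < w" using psi_bounds[of x] by (simp add: w_def)
  define X where "X = (A / w\<^sup>2) powr (p / 2)"
  have X: "X = (a / w) powr p"
  proof -
    have "(A / w\<^sup>2) powr (p / 2) = ((a / w) powr 2) powr (p / 2)" using a w by (simp add: power_divide)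
    then show ?thesis by (simp add: X_def powr_powr)
  qed
  have X0: "0 \<le> X" by (simp add: X_def)
  have "(\<Sum>i\<in>UNIV. w\<^sup>2 * (p / 2) * X * (2 * (U x 0 \<bullet> Uxx i x 0) / A - 2 * (psi_xx i x / w))) \<le> (\<Sum>i\<in>UNIV. flux_x p i x)"
    unfolding w_def X_def A_def using p by (intro sum_mono flux_x_lower) auto
  also have "(\<Sum>i\<in>UNIV. w\<^sup>2 * (p / 2) * X * (2 * (U x 0 \<bullet> Uxx i x 0) / A - 2 * (psi_xx i x / w)))
     = w\<^sup>2 * p * X * ((U x 0 \<bullet> (\<Sum>i\<in>UNIV. Uxx i x 0)) / A - (\<Sum>i\<in>UNIV. psi_xx i x) / w)"
    by (simp only: sum_distrib_left[symmetric] sum_subtractf sum_divide_distrib[symmetric] inner_sum_right) (simp add: mult.commute)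
  also have "(\<Sum>i\<in>UNIV. Uxx i x 0) = ((norm x)\<^sup>2 + 2) *\<^sub>R U x 0 - Utt x 0"
    using U_pde[of x 0] kappa2 by (simp add: algebra_simps)
  also have "(U x 0 \<bullet> (((norm x)\<^sup>2 + 2) *\<^sub>R U x 0 - Utt x 0)) / A = (norm x)\<^sup>2 + 2 - (U x 0 \<bullet> Utt x 0) / A"
    using A by (simp add: inner_diff_right A_def[symmetric] diff_divide_distrib)
  finally have 1: "w\<^sup>2 * p * X * ((norm x)\<^sup>2 + 2 - (U x 0 \<bullet> Utt x 0) / A - (\<Sum>i\<in>UNIV. psi_xx i x) / w) \<le> (\<Sum>i\<in>UNIV. flux_x p i x)" .
  have ps: "9 / 4 \<le> (norm x)\<^sup>2 + 2 - (\<Sum>i\<in>UNIV. psi_xx i x) / w"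
    using psi_supersolution[of x] w unfolding w_def[symmetric] by (simp add: field_simps)
  have uf: "(U x 0 \<bullet> Utt x 0) / A \<le> F / a"
  proof -
    have "(U x 0 \<bullet> Utt x 0) / A \<le> (a * F) / A"
      using norm_cauchy_schwarz[of "U x 0" "Utt x 0"] A by (intro divide_right_mono) (auto simp: a_def F_def)
    then show ?thesis using a by (simp add: power2_eq_square)
  qed
  \<comment> \<open>Scaled by 9/4 so that the constant part 1 - 1/p consumes all of the gain 9/4
    except its p-th part.\<close>
  have young: "F / a \<le> 9 / 4 * ((4 / 9 * F / a) powr p / p + (1 - 1 / p))"
  proof -
    define q where "q = p / (p - 1)"
    have q: "1 < q" "1 / p + 1 / q = 1" "1 / q = 1 - 1 / p" using p by (auto simp: q_def field_simps)
    have "(4 / 9 * F / a) * 1 \<le> (4 / 9 * F / a) powr p / p + 1 powr q / q"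
      by (rule Youngs_inequality) (use p q a in \<open>auto simp: F_def\<close>)
    then have "9 / 4 * (4 / 9 * F / a) \<le> 9 / 4 * ((4 / 9 * F / a) powr p / p + (1 - 1 / p))"
      using q(3) by (intro mult_left_mono) auto
    then show ?thesis by simp
  qed
  have "9 / 4 / p * (1 - (4 / 9 * F / a) powr p) \<le> (norm x)\<^sup>2 + 2 - (U x 0 \<bullet> Utt x 0) / A - (\<Sum>i\<in>UNIV. psi_xx i x) / w"
  proof -
    have "9 / 4 / p * (1 - (4 / 9 * F / a) powr p) = 9 / 4 - 9 / 4 * ((4 / 9 * F / a) powr p / p + (1 - 1 / p))"
      by (simp add: algebra_simps)
    then show ?thesis using ps uf young by linarith
  qed
  then have "w\<^sup>2 * p * X * (9 / 4 / p * (1 - (4 / 9 * F / a) powr p)) \<le> (\<Sum>i\<in>UNIV. flux_x p i x)"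
    by (intro order.trans[OF mult_left_mono 1]) (use p X0 in auto)
  also have "w\<^sup>2 * p * X * (9 / 4 / p * (1 - (4 / 9 * F / a) powr p)) = 9 / 4 * (w\<^sup>2 * X - w\<^sup>2 * (X * (4 / 9 * F / a) powr p))"
    using p by (simp add: field_simps)
  also have "X * (4 / 9 * F / a) powr p = (4 / 9) powr p * (F / w) powr p"
  proof -
    have "(a / w) * (4 / 9 * F / a) = 4 / 9 * (F / w)" using a by simp
    then show ?thesis unfolding X by (simp only: powr_mult[symmetric])
  qed
  also have "w\<^sup>2 * X = w powr (2 - p) * a powr p"
    unfolding X using w a by (simp add: powr_divide powr_diff)
  also have "w\<^sup>2 * ((4 / 9) powr p * (F / w) powr p) = (4 / 9) powr p * (w powr (2 - p) * F powr p)"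
    using w by (simp add: powr_divide powr_diff F_def)
  finally show ?thesis by (simp add: w_def a_def F_def)
qed

text \<open>The divergence of the flux integrates to 0, so the integrated lower bound of
  \<open>flux_x_sum_lower\<close> is at most 0.\<close>

lemma weighted_resolvent:
  assumes p: "1 < p" and kappa2: "\<kappa> = 2"
    and int: "integrable lborel (\<lambda>x. psi x powr (2 - p) * norm (U x 0) powr p)"
      "integrable lborel (\<lambda>x. psi x powr (2 - p) * norm (Utt x 0) powr p)"
  shows "(\<integral>x. psi x powr (2 - p) * norm (U x 0) powr p \<partial>lborel)
     \<le> (4 / 9) powr p * (\<integral>x. psi x powr (2 - p) * norm (Utt x 0) powr p \<partial>lborel)"
proof -
  obtain K where K: "\<And>x i. \<bar>flux p i x\<bar> \<le> K * exp (- (1 / 4) * (norm x)\<^sup>2) \<and> \<bar>flux_x p i x\<bar> \<le> K * exp (- (1 / 4) * (norm x)\<^sup>2)"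
    using flux_bounds[of p] p by auto
  have i: "integrable lborel (flux p i)" "integrable lborel (flux_x p i)" for i
    by (rule integrable_gauss_dominated[where K = K and s = "1/4"];
        use K flux_continuous in \<open>auto intro!: borel_measurable_continuous_onI\<close>)+
  have "(\<integral>x. flux_x p i x \<partial>lborel) = 0" for i
    by (rule integral_directional_derivative_eq_0[OF flux_deriv flux_continuous(2) i])
  then have 0: "(\<integral>x. (\<Sum>i\<in>UNIV. flux_x p i x) \<partial>lborel) = 0"
    using i by (simp add: Bochner_Integration.integral_sum)
  have "(\<integral>x. 9 / 4 * (psi x powr (2 - p) * norm (U x 0) powr p - (4 / 9) powr p * (psi x powr (2 - p) * norm (Utt x 0) powr p)) \<partial>lborel)
     \<le> (\<integral>x. (\<Sum>i\<in>UNIV. flux_x p i x) \<partial>lborel)"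
    using int i by (intro integral_mono flux_x_sum_lower p kappa2) auto
  then show ?thesis unfolding 0 using int by simp
qed

end

text \<open>For p >= 1, |2 - p| <= p; hence the weight varies by a factor of at most (4/3)^p, and
  exchanging the norms costs 4/3, whatever p is.\<close>

lemma psi_powr_range:
  assumes p: "1 \<le> p"
  obtains m where "0 < m" "\<And>x :: real ^ 'd. m \<le> psi x powr (2 - p)" "\<And>x :: real ^ 'd. psi x powr (2 - p) \<le> (4 / 3) powr p * m"
proof (cases "p \<le> 2")
  case True
  show ?thesis
  proof (rule that[of 1])
    fix x :: "real ^ 'd"
    show "1 \<le> psi x powr (2 - p)" using psi_bounds[of x] True by (intro ge_one_powr_ge_zero) auto
    have "psi x powr (2 - p) \<le> (4 / 3) powr (2 - p)" using psi_bounds[of x] True by (intro powr_mono2) auto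
    also have "\<dots> \<le> (4 / 3) powr p" using p by (intro powr_mono) auto
    finally show "psi x powr (2 - p) \<le> (4 / 3) powr p * 1" by simp
  qed simp
next
  case False
  show ?thesis
  proof (rule that[of "(4 / 3) powr (2 - p)"])
    fix x :: "real ^ 'd"
    show "(4 / 3) powr (2 - p) \<le> psi x powr (2 - p)"
      using psi_bounds[of x] False by (intro powr_mono2') auto
    have "psi x powr (2 - p) \<le> psi x powr 0" using psi_bounds[of x] False by (intro powr_mono) auto
    also have "\<dots> = 1" using psi_bounds[of x] by simp
    also have "1 \<le> (4 / 3) powr p * (4 / 3) powr (2 - p)" by (simp add: powr_add[symmetric])
    finally show "psi x powr (2 - p) \<le> (4 / 3) powr p * (4 / 3) powr (2 - p)" .
  qed simp
qed

section \<open>Powers of the resolvent and the binomial series\<close>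

lemma borel_measurable_psi [measurable]: "psi \<in> borel_measurable borel"
  unfolding psi_def[abs_def] by measurable

lemma integrable_weighted:
  fixes g :: "real ^ 'd \<Rightarrow> 'b::euclidean_space"
  assumes p: "1 \<le> p" and g: "g \<in> borel_measurable borel" "g \<in> Lp_space p"
  shows "integrable lborel (\<lambda>x. psi x powr (2 - p) * norm (g x) powr p)"
proof -
  note [measurable] = g(1)
  obtain m where m: "0 < m" "\<And>x :: real ^ 'd. m \<le> psi x powr (2 - p)" "\<And>x :: real ^ 'd. psi x powr (2 - p) \<le> (4 / 3) powr p * m"
    using psi_powr_range[OF p] by blast
  have "integrable lborel (\<lambda>x. norm (g x) powr p)"
    using Lp_spaceD(2)[OF g(2)] by (subst lebesgue_from_lborel(2)[symmetric]) auto
  then have i: "integrable lborel (\<lambda>x. (4 / 3) powr p * m * norm (g x) powr p)" by simp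
  show ?thesis
  proof (rule Bochner_Integration.integrable_bound[OF i])
    show "AE x in lborel. norm (psi x powr (2 - p) * norm (g x) powr p) \<le> norm ((4 / 3) powr p * m * norm (g x) powr p)"
      using m by (intro AE_I2) (simp add: abs_mult mult_right_mono)
  qed measurable
qed

definition hexp :: "(nat ^ 'd) set \<Rightarrow> (nat ^ 'd \<Rightarrow> real) \<Rightarrow> real ^ 'd \<Rightarrow> real" where
  "hexp S c x = (\<Sum>n\<in>S. c n * hermite n x)"

lemma hexp_span: "finite S \<Longrightarrow> hexp S c \<in> hermite_span"
  unfolding hermite_span_def hexp_def[abs_def] by blast

lemma hexp_borel [measurable]: "hexp S c \<in> borel_measurable borel"
  unfolding hexp_def[abs_def] by measurable

text \<open>The locale \<open>wave\<close> asks for a ground state component, which the pair of the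
  expansion and \<open>\<epsilon>\<close> times the ground state has. The pair dominates its first
  component on the left; on the right \<open>\<epsilon>\<close> tends to 0 by dominated
  convergence.\<close>

lemma resolvent_weighted_le:
  fixes c :: "nat ^ 'd \<Rightarrow> real"
  assumes p: "1 < p" and S: "finite S"
  shows "(\<integral>x. psi x powr (2 - p) * norm (hexp S c x) powr p \<partial>lborel)
     \<le> (4 / 9) powr p * (\<integral>x. psi x powr (2 - p) * norm (hexp S (\<lambda>n. (eigval n + 2) * c n) x) powr p \<partial>lborel)"
proof -
  define w where "w = hexp S c"
  define F where "F = hexp S (\<lambda>n. (eigval n + 2) * c n)"
  \<comment> \<open>The eigenvalue of L + 2 on the ground state, which multiplies the added
    component in \<open>Utt\<close>.\<close>
  define b where "b = eigval (0 :: nat ^ 'd) + 2"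
  define h0 where "h0 = hermite (0 :: nat ^ 'd)"
  have [measurable]: "w \<in> borel_measurable borel" "F \<in> borel_measurable borel" "h0 \<in> borel_measurable borel"
    by (auto simp: w_def F_def h0_def)
  have wL: "w \<in> Lp_space p" and FL: "F \<in> Lp_space p" and hL: "h0 \<in> Lp_space p"
    using p S by (auto simp: w_def F_def h0_def intro!: hermite_span_Lp hexp_span hermite_Lp)
  have pairL: "(\<lambda>x. (f x, a * h0 x)) \<in> Lp_space p" if f: "f \<in> Lp_space p" "f \<in> borel_measurable borel" for f :: "real ^ 'd \<Rightarrow> real" and a
  proof -
    note [measurable] = f(2)
    have m: "(\<lambda>x. (f x, a * h0 x)) \<in> borel_measurable borel" by measurable
    have 1: "(\<lambda>x. norm (f x)) \<in> Lp_space p" "(\<lambda>x. norm (a *\<^sub>R h0 x)) \<in> Lp_space p"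
      using f Lp_space_scaleR[OF hL, of a] by (auto simp: Lp_space_def)
    have "(\<lambda>x. norm (f x) + norm (a *\<^sub>R h0 x)) \<in> Lp_space p"
      using Lp_space_add[OF 1] p by simp
    then show ?thesis
      by (rule Lp_space_bound(1)[OF lebesgue_from_lborel(1)[OF m]])
         (use p norm_Pair_le in \<open>auto intro!: AE_I2 intro: order.trans[OF norm_Pair_le] simp: abs_mult\<close>)
  qed
  have eps: "(\<integral>x. psi x powr (2 - p) * norm (w x) powr p \<partial>lborel)
     \<le> (4 / 9) powr p * (\<integral>x. psi x powr (2 - p) * norm (F x, (\<epsilon> * b) * h0 x) powr p \<partial>lborel)" if e: "0 < \<epsilon>" for \<epsilon>
  proof -
    define c' where "c' n = ((if n \<in> S then c n else 0), (if n = 0 then \<epsilon> else 0))" for n :: "nat ^ 'd"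
    interpret wave "insert 0 S" c' 2 "(0, 1)"
      by unfold_locales (use S e in \<open>auto simp: c'_def\<close>)
    have split: "(\<Sum>n\<in>insert 0 S. (g n * hermite n x) *\<^sub>R c' n) = (\<Sum>n\<in>S. g n * c n * hermite n x, \<epsilon> * g 0 * h0 x)" for g x
    proof -
      have "fst (\<Sum>n\<in>insert 0 S. (g n * hermite n x) *\<^sub>R c' n) = (\<Sum>n\<in>insert 0 S. if n \<in> S then g n * c n * hermite n x else 0)"
        unfolding fst_sum by (intro sum.cong) (auto simp: c'_def)
      also have "\<dots> = (\<Sum>n\<in>S. g n * c n * hermite n x)"
        using S by (intro sum.mono_neutral_cong_right) auto
      finally have 1: "fst (\<Sum>n\<in>insert 0 S. (g n * hermite n x) *\<^sub>R c' n) = (\<Sum>n\<in>S. g n * c n * hermite n x)" .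
      have "snd (\<Sum>n\<in>insert 0 S. (g n * hermite n x) *\<^sub>R c' n) = (\<Sum>n\<in>insert 0 S. if n = 0 then \<epsilon> * g 0 * h0 x else 0)"
        unfolding snd_sum by (intro sum.cong) (auto simp: c'_def h0_def)
      also have "\<dots> = \<epsilon> * g 0 * h0 x" using S by simp
      finally show ?thesis using 1 by (simp add: prod_eq_iff)
    qed
    have fr: "freq n * freq n = eigval n + 2" for n
      using eigval_ge_1[of n] by (simp add: freq_def)
    have U0: "U x 0 = (w x, \<epsilon> * h0 x)" for x
      using split[of "\<lambda>_. 1" x] by (simp add: U_def wave_sum_def w_def hexp_def)
    have Utt0: "Utt x 0 = (F x, (\<epsilon> * b) * h0 x)" for x
      using split[of "\<lambda>n. eigval n + 2" x]
      by (simp add: Utt_def wave_sum_def F_def hexp_def b_def fr[symmetric] mult_ac)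
    have Um: "(\<lambda>x. U x 0) \<in> borel_measurable borel" "(\<lambda>x. Utt x 0) \<in> borel_measurable borel"
      unfolding U0 Utt0 by measurable
    have UL: "(\<lambda>x. U x 0) \<in> Lp_space p" "(\<lambda>x. Utt x 0) \<in> Lp_space p"
      unfolding U0 Utt0 by (rule pairL; use wL FL in measurable)+
    have i1: "integrable lborel (\<lambda>x. psi x powr (2 - p) * norm (U x 0) powr p)"
      and i2: "integrable lborel (\<lambda>x. psi x powr (2 - p) * norm (Utt x 0) powr p)"
      using p by (intro integrable_weighted Um UL; simp)+
    have "(\<integral>x. psi x powr (2 - p) * norm (w x) powr p \<partial>lborel) \<le> (\<integral>x. psi x powr (2 - p) * norm (U x 0) powr p \<partial>lborel)"
    proof (rule integral_mono[OF _ i1])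
      show "integrable lborel (\<lambda>x. psi x powr (2 - p) * norm (w x) powr p)"
        using p wL by (intro integrable_weighted) auto
      show "psi x powr (2 - p) * norm (w x) powr p \<le> psi x powr (2 - p) * norm (U x 0) powr p" for x
        unfolding U0 using p norm_fst_le[of "w x" "\<epsilon> * h0 x"] by (intro mult_left_mono powr_mono2) auto
    qed
    also have "\<dots> \<le> (4 / 9) powr p * (\<integral>x. psi x powr (2 - p) * norm (Utt x 0) powr p \<partial>lborel)"
      by (rule weighted_resolvent[OF p refl i1 i2])
    finally show ?thesis unfolding Utt0 .
  qed
  have lim: "(\<lambda>k. \<integral>x. psi x powr (2 - p) * norm (F x, (inverse (real (Suc k)) * b) * h0 x) powr p \<partial>lborel)
     \<longlonglongrightarrow> (\<integral>x. psi x powr (2 - p) * norm (F x) powr p \<partial>lborel)"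
  proof (rule integral_dominated_convergence)
    show "integrable lborel (\<lambda>x. psi x powr (2 - p) * norm (F x, b * h0 x) powr p)"
      using p pairL[OF FL, of b] by (intro integrable_weighted) auto
    show "AE x in lborel. (\<lambda>k. psi x powr (2 - p) * norm (F x, (inverse (real (Suc k)) * b) * h0 x) powr p)
        \<longlonglongrightarrow> psi x powr (2 - p) * norm (F x) powr p"
    proof (rule AE_I2)
      fix x
      have "(\<lambda>k. norm (F x, (inverse (real (Suc k)) * b) * h0 x)) \<longlonglongrightarrow> norm (F x, (0 * b) * h0 x)"
        by (intro tendsto_intros LIMSEQ_inverse_real_of_nat)
      then have "(\<lambda>k. norm (F x, (inverse (real (Suc k)) * b) * h0 x) powr p) \<longlonglongrightarrow> norm (F x) powr p"
        using p by (intro tendsto_powr') (auto simp: norm_Pair)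
      then show "(\<lambda>k. psi x powr (2 - p) * norm (F x, (inverse (real (Suc k)) * b) * h0 x) powr p)
        \<longlonglongrightarrow> psi x powr (2 - p) * norm (F x) powr p" by (rule tendsto_mult_left)
    qed
    show "AE x in lborel. norm (psi x powr (2 - p) * norm (F x, (inverse (real (Suc k)) * b) * h0 x) powr p)
        \<le> psi x powr (2 - p) * norm (F x, b * h0 x) powr p" for k
    proof (rule AE_I2)
      fix x
      have k: "0 < inverse (real (Suc k))" "inverse (real (Suc k)) \<le> 1" by (auto simp: field_simps)
      have "((inverse (real (Suc k)) * b) * h0 x)\<^sup>2 \<le> (b * h0 x)\<^sup>2"
        unfolding power_mult_distrib mult.assoc using power_mono[OF k(2), of 2] k
        by (intro mult_left_le_one_le) auto
      then have "norm (F x, (inverse (real (Suc k)) * b) * h0 x) \<le> norm (F x, b * h0 x)"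
        by (simp add: norm_Pair)
      then show "norm (psi x powr (2 - p) * norm (F x, (inverse (real (Suc k)) * b) * h0 x) powr p)
        \<le> psi x powr (2 - p) * norm (F x, b * h0 x) powr p"
        using p by (simp add: abs_mult mult_left_mono powr_mono2)
    qed
  qed measurable
  have "(\<integral>x. psi x powr (2 - p) * norm (w x) powr p \<partial>lborel)
     \<le> (4 / 9) powr p * (\<integral>x. psi x powr (2 - p) * norm (F x) powr p \<partial>lborel)"
    by (rule LIMSEQ_le_const[OF tendsto_mult_left[OF lim]]) (use eps in auto)
  then show ?thesis by (simp add: w_def F_def)
qed

text \<open>All k steps are taken in the weighted norm and the two norms are compared only once, so
  the factor 4/3 does not grow with k.\<close>

lemma resolvent_power_Lp:
  fixes c :: "nat ^ 'd \<Rightarrow> real"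
  assumes p: "1 < p" and S: "finite S"
  shows "Lp_norm p (hexp S (\<lambda>n. c n / (eigval n + 2) ^ k)) \<le> (4 / 3) * (4 / 9) ^ k * Lp_norm p (hexp S c)"
proof -
  define N where "N c = (\<integral>x. psi x powr (2 - p) * norm (hexp S c x) powr p \<partial>lborel)" for c :: "nat ^ 'd \<Rightarrow> real"
  have step: "N (\<lambda>n. c n / (eigval n + 2)) \<le> (4 / 9) powr p * N c" for c
  proof -
    have "(\<lambda>n :: nat ^ 'd. (eigval n + 2) * (c n / (eigval n + 2))) = c"
    proof
      fix n :: "nat ^ 'd"
      show "(eigval n + 2) * (c n / (eigval n + 2)) = c n" using eigval_ge_1[of n] by simp
    qed
    then show ?thesis
      using resolvent_weighted_le[OF p S, of "\<lambda>n. c n / (eigval n + 2)"] by (simp add: N_def)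
  qed
  have N: "N (\<lambda>n. c n / (eigval n + 2) ^ k) \<le> ((4 / 9) powr p) ^ k * N c"
  proof (induction k)
    case (Suc k)
    have "N (\<lambda>n. c n / (eigval n + 2) ^ Suc k) = N (\<lambda>n. (c n / (eigval n + 2) ^ k) / (eigval n + 2))"
      by (simp add: mult.commute)
    also have "\<dots> \<le> (4 / 9) powr p * N (\<lambda>n. c n / (eigval n + 2) ^ k)" by (rule step)
    also have "\<dots> \<le> (4 / 9) powr p * (((4 / 9) powr p) ^ k * N c)" by (intro mult_left_mono Suc) auto
    finally show ?case by simp
  qed simp
  obtain m where m: "0 < m" "\<And>x :: real ^ 'd. m \<le> psi x powr (2 - p)" "\<And>x :: real ^ 'd. psi x powr (2 - p) \<le> (4 / 3) powr p * m"
    using psi_powr_range[of p] p by auto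
  have LI: "integrable lborel (\<lambda>x. norm (hexp S c x) powr p)"
    "(\<integral>x. norm (hexp S c x) powr p \<partial>lebesgue) = (\<integral>x. norm (hexp S c x) powr p \<partial>lborel)" for c
  proof -
    have m: "(\<lambda>x. norm (hexp S c x) powr p) \<in> borel_measurable borel" by measurable
    show "integrable lborel (\<lambda>x. norm (hexp S c x) powr p)"
      using Lp_spaceD(2)[OF hermite_span_Lp[OF hexp_span[OF S, of c]]] p lebesgue_from_lborel(2)[OF m] by auto
    show "(\<integral>x. norm (hexp S c x) powr p \<partial>lebesgue) = (\<integral>x. norm (hexp S c x) powr p \<partial>lborel)"
      by (rule lebesgue_from_lborel(3)[OF m])
  qed
  have WI: "integrable lborel (\<lambda>x. psi x powr (2 - p) * norm (hexp S c x) powr p)" for c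
    using p S by (intro integrable_weighted hexp_borel hermite_span_Lp hexp_span) auto
  let ?g = "\<lambda>n. c n / (eigval n + 2) ^ k"
  have "m * (\<integral>x. norm (hexp S ?g x) powr p \<partial>lborel) \<le> N ?g"
    unfolding N_def integral_mult_right_zero[symmetric]
    by (rule integral_mono[OF integrable_mult_right[OF LI(1)] WI]) (use m in \<open>auto intro: mult_right_mono\<close>)
  also have "\<dots> \<le> ((4 / 9) powr p) ^ k * N c" by (rule N)
  also have "\<dots> \<le> ((4 / 9) powr p) ^ k * ((4 / 3) powr p * m * (\<integral>x. norm (hexp S c x) powr p \<partial>lborel))"
  proof (rule mult_left_mono)
    show "N c \<le> (4 / 3) powr p * m * (\<integral>x. norm (hexp S c x) powr p \<partial>lborel)"
      unfolding N_def integral_mult_right_zero[symmetric]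
      by (rule integral_mono[OF WI integrable_mult_right[OF LI(1)]]) (use m in \<open>auto intro: mult_right_mono\<close>)
  qed simp
  finally have "m * (\<integral>x. norm (hexp S ?g x) powr p \<partial>lborel)
     \<le> m * (((4 / 9) powr p) ^ k * (4 / 3) powr p * (\<integral>x. norm (hexp S c x) powr p \<partial>lborel))" by (simp add: mult_ac)
  then have "(\<integral>x. norm (hexp S ?g x) powr p \<partial>lborel)
     \<le> ((4 / 9) powr p) ^ k * (4 / 3) powr p * (\<integral>x. norm (hexp S c x) powr p \<partial>lborel)" using m(1) by simp
  also have "(\<integral>x. norm (hexp S c x) powr p \<partial>lborel) = Lp_norm p (hexp S c) powr p"
  proof -
    have "0 < p" using p by simp
    then show ?thesis by (simp only: Lp_norm_powr LI(2))
  qed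
  also have "((4 / 9) powr p) ^ k * (4 / 3) powr p * Lp_norm p (hexp S c) powr p = ((4 / 3) * (4 / 9) ^ k * Lp_norm p (hexp S c)) powr p"
  proof -
    have "((4 / 9 :: real) powr p) ^ k = ((4 / 9) ^ k) powr p"
      by (simp add: powr_realpow[symmetric] powr_powr mult.commute)
    then show ?thesis by (simp only: powr_mult mult_ac)
  qed
  finally show ?thesis
    using p Lp_norm_nonneg[of p "hexp S c"] by (subst Lp_norm_le_iff) (simp_all only: LI(2), simp_all)
qed

text \<open>With z = 2 / (lambda + 2) the multiplier is (1 - z)^(-1/2), and \<open>b\<close> are its
  binomial coefficients. The norms of the partial sums \<open>T K\<close> are bounded uniformly in K
  by the resolvent estimate, which amounts to z = 2 * 4/9; on a finite expansion they converge
  coefficient by coefficient.\<close>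

lemma multiplier_Lp:
  fixes c :: "nat ^ 'd \<Rightarrow> real"
  assumes p: "1 < p" and S: "finite S"
  shows "Lp_norm p (hexp S (\<lambda>n. sqrt ((eigval n + 2) / eigval n) * c n)) \<le> 11 / 3 * Lp_norm p (hexp S c)"
proof -
  define b where "b k = pochhammer (1 / 2 :: real) k / fact k" for k
  have b0: "0 \<le> b k" "b 0 = 1" for k by (auto simp: b_def intro!: divide_nonneg_nonneg pochhammer_nonneg)
  have bs: "(\<lambda>k. b k * z ^ k) sums (1 - z) powr (- 1 / 2)" if "\<bar>z\<bar> < 1" for z
  proof -
    have "(\<lambda>n. ((- 1 / 2) gchoose n) * (- z) ^ n) sums (1 + - z) powr (- 1 / 2)"
      by (rule gen_binomial_real) (use that in simp)
    moreover have "((- 1 / 2 :: real) gchoose n) * (- z) ^ n = b n * z ^ n" for n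
    proof -
      have "((- 1 / 2 :: real) gchoose n) * (- z) ^ n = ((-1) ^ n * (-1) ^ n) * (b n * z ^ n)"
        by (simp add: gbinomial_pochhammer b_def power_minus[of z])
      also have "(-1 :: real) ^ n * (-1) ^ n = 1" by (simp add: power_mult_distrib[symmetric])
      finally show ?thesis by simp
    qed
    ultimately show ?thesis by simp
  qed
  define f where "f = hexp S c"
  define w where "w k = hexp S (\<lambda>n. c n / (eigval n + 2) ^ k)" for k
  define T where "T K x = (\<Sum>k<K. (b k * 2 ^ k) * w k x)" for K x
  define g where "g = hexp S (\<lambda>n. sqrt ((eigval n + 2) / eigval n) * c n)"
  have p1: "1 \<le> p" "0 < p" using p by auto
  have L: "f \<in> Lp_space p" "g \<in> Lp_space p" "w k \<in> Lp_space p" for k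
    using p1 S by (auto simp: f_def g_def w_def intro!: hermite_span_Lp hexp_span)
  have N0: "0 \<le> Lp_norm p f" by (rule Lp_norm_nonneg)
  have wb: "Lp_norm p (w 0) = Lp_norm p f" "Lp_norm p (w k) \<le> (4 / 3) * (4 / 9) ^ k * Lp_norm p f" for k
    using resolvent_power_Lp[OF p S, of c k] by (simp_all add: w_def f_def)
  have TL: "T K \<in> Lp_space p \<and> Lp_norm p (T K) \<le> 11 / 3 * Lp_norm p f" for K
  proof -
    have wk: "(\<lambda>x. (b k * 2 ^ k) * w k x) \<in> Lp_space p" "Lp_norm p (\<lambda>x. (b k * 2 ^ k) * w k x) = b k * 2 ^ k * Lp_norm p (w k)" for k
      using Lp_space_scaleR[OF L(3), of "b k * 2 ^ k" k] Lp_norm_scaleR[OF p1(2), of "b k * 2 ^ k" "w k"] b0(1)[of k]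
      by auto
    have "T K \<in> Lp_space p \<and> Lp_norm p (T K) \<le> (\<Sum>k<K. Lp_norm p (\<lambda>x. (b k * 2 ^ k) * w k x))"
      unfolding T_def[abs_def] by (rule Lp_sum[OF _ _ p1(1)]) (use wk in auto)
    \<comment> \<open>For k = 0 the term is \<open>f\<close> itself, with the factor 1 instead of
      4/3; this correction by 1/3 turns the total 4/3 * 3 = 4 into 11/3.\<close>
    moreover have "(\<Sum>k<K. Lp_norm p (\<lambda>x. (b k * 2 ^ k) * w k x))
        \<le> (\<Sum>k<K. ((4 / 3) * (b k * (8 / 9) ^ k) - (if k = 0 then 1 / 3 else 0)) * Lp_norm p f)"
    proof (rule sum_mono)
      fix k
      show "Lp_norm p (\<lambda>x. (b k * 2 ^ k) * w k x) \<le> ((4 / 3) * (b k * (8 / 9) ^ k) - (if k = 0 then 1 / 3 else 0)) * Lp_norm p f"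
      proof (cases "k = 0")
        case True
        then show ?thesis using wb(1) by (simp add: wk(2) b0)
      next
        case False
        have "b k * 2 ^ k * Lp_norm p (w k) \<le> b k * 2 ^ k * ((4 / 3) * (4 / 9) ^ k * Lp_norm p f)"
          using b0 by (intro mult_left_mono wb) auto
        also have "\<dots> = (4 / 3) * (b k * (2 * (4 / 9)) ^ k) * Lp_norm p f"
          by (simp only: power_mult_distrib mult_ac)
        finally show ?thesis using False by (simp add: wk(2))
      qed
    qed
    moreover have "(\<Sum>k<K. ((4 / 3) * (b k * (8 / 9) ^ k) - (if k = 0 then 1 / 3 else 0)) * Lp_norm p f) \<le> 11 / 3 * Lp_norm p f"
    proof (cases K)
      case 0
      then show ?thesis using N0 by simp
    next
      case (Suc J)
      have s: "(\<lambda>k. b k * (8 / 9) ^ k) sums 3"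
      proof -
        have "(1 - 8 / 9 :: real) powr (- 1 / 2) = 3"
        proof -
          have "sqrt (1 / 9 :: real) = 1 / 3" by (rule real_sqrt_unique) (auto simp: power2_eq_square)
          moreover have "1 - 8 / 9 = (1 / 9 :: real)" by simp
          moreover have "(1 / 9 :: real) powr (- 1 / 2) = 1 / sqrt (1 / 9)" by (rule powr_minus_half) simp
          ultimately show ?thesis by (simp only:) simp
        qed
        then show ?thesis using bs[of "8 / 9"] by simp
      qed
      have "(\<Sum>k<K. b k * (8 / 9) ^ k) \<le> 3"
        using sum_le_suminf[OF sums_summable[OF s], of "{..<K}"] sums_unique[OF s] b0 by simp
      moreover have "(\<Sum>k<K. if k = 0 then 1 / 3 else 0 :: real) = 1 / 3" using Suc by simp
      ultimately have "(\<Sum>k<K. ((4 / 3) * (b k * (8 / 9) ^ k) - (if k = 0 then 1 / 3 else 0))) \<le> 11 / 3"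
        by (simp only: sum_subtractf sum_distrib_left[symmetric])
      from mult_right_mono[OF this N0] show ?thesis by (simp only: sum_distrib_right)
    qed
    ultimately show ?thesis by linarith
  qed
  define r where "r n K = (\<Sum>k<K. b k * (2 / (eigval n + 2)) ^ k) - sqrt ((eigval n + 2) / eigval n)" for n :: "nat ^ 'd" and K
  have r0: "(\<lambda>K. r n K) \<longlonglongrightarrow> 0" for n :: "nat ^ 'd"
  proof -
    have e: "1 \<le> eigval n" by (rule eigval_ge_1)
    have "(1 - 2 / (eigval n + 2)) powr (- 1 / 2) = sqrt ((eigval n + 2) / eigval n)"
    proof -
      have q: "1 - 2 / (eigval n + 2) = eigval n / (eigval n + 2)" using e by (simp add: field_simps)
      show ?thesis unfolding q using e by (subst powr_minus_half) (auto simp: real_sqrt_divide)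
    qed
    then have "(\<lambda>k. b k * (2 / (eigval n + 2)) ^ k) sums sqrt ((eigval n + 2) / eigval n)"
      using bs[of "2 / (eigval n + 2)"] e by (simp add: abs_divide)
    then have "(\<lambda>K. (\<Sum>k<K. b k * (2 / (eigval n + 2)) ^ k)) \<longlonglongrightarrow> sqrt ((eigval n + 2) / eigval n)"
      by (simp add: sums_def)
    then show ?thesis unfolding r_def by (rule LIM_zero)
  qed
  have diff: "T K x - g x = (\<Sum>n\<in>S. (r n K * c n) * hermite n x)" for K x
  proof -
    have "T K x = (\<Sum>n\<in>S. (\<Sum>k<K. b k * (2 / (eigval n + 2)) ^ k) * c n * hermite n x)"
      unfolding T_def w_def hexp_def sum_distrib_left sum_distrib_right
      by (subst sum.swap) (intro sum.cong refl, simp add: power_divide)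
    then show ?thesis by (simp add: g_def hexp_def r_def sum_subtractf[symmetric] left_diff_distrib)
  qed
  have hb: "(\<lambda>x. (r n K * c n) * hermite n x) \<in> Lp_space p" "Lp_norm p (\<lambda>x. (r n K * c n) * hermite n x) = \<bar>r n K * c n\<bar> * Lp_norm p (hermite n)" for n K
    using Lp_space_scaleR[OF hermite_Lp[OF p1(2)], of "r n K * c n" n] Lp_norm_scaleR[OF p1(2), of "r n K * c n" "hermite n"] by auto
  have gT: "Lp_norm p g \<le> 11 / 3 * Lp_norm p f + (\<Sum>n\<in>S. \<bar>r n K * c n\<bar> * Lp_norm p (hermite n))" for K
  proof -
    have "Lp_norm p g \<le> Lp_norm p (T K) + Lp_norm p (\<lambda>x. g x - T K x)"
      using L(2) TL[of K] p1(1) by (intro Lp_norm_le_add_diff) auto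
    also have "Lp_norm p (\<lambda>x. g x - T K x) = Lp_norm p (\<lambda>x. \<Sum>n\<in>S. (r n K * c n) * hermite n x)"
      by (subst Lp_norm_diff_commute) (simp only: diff)
    also have "\<dots> \<le> (\<Sum>n\<in>S. \<bar>r n K * c n\<bar> * Lp_norm p (hermite n))"
      using Lp_sum[OF S, of "\<lambda>n x. (r n K * c n) * hermite n x" p] hb p1(1) by simp
    finally show ?thesis using TL[of K] by linarith
  qed
  have "(\<lambda>K. 11 / 3 * Lp_norm p f + (\<Sum>n\<in>S. \<bar>r n K * c n\<bar> * Lp_norm p (hermite n)))
      \<longlonglongrightarrow> 11 / 3 * Lp_norm p f + (\<Sum>n\<in>S. \<bar>0 * c n\<bar> * Lp_norm p (hermite n))"
    by (intro tendsto_intros r0)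
  then have "Lp_norm p g \<le> 11 / 3 * Lp_norm p f + (\<Sum>n\<in>S. \<bar>0 * c n\<bar> * Lp_norm p (hermite n))"
    by (rule LIMSEQ_le_const) (use gT in auto)
  then show ?thesis by (simp add: g_def f_def)
qed

section \<open>The bilinear estimate\<close>

text \<open>The energies of \<open>wave_pair\<close>, freed from the assignment of exponents to
  waves, because \<open>half_riesz_pairing\<close> uses both assignments.\<close>

definition energy :: "(nat ^ 'd) set \<Rightarrow> (nat ^ 'd \<Rightarrow> real) \<Rightarrow> (nat ^ 'd \<Rightarrow> 'e::euclidean_space) \<Rightarrow> real ^ 'd \<Rightarrow> real \<Rightarrow> real" where
  "energy S \<mu> c x t =
     (norm (wave_sum hermite S \<mu> (\<lambda>n. - \<mu> n *\<^sub>R c n) x t))\<^sup>2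
     + (\<Sum>i\<in>UNIV. (norm (wave_sum (hermite_dx i) S \<mu> c x t))\<^sup>2)
     + (norm x)\<^sup>2 * (norm (wave_sum hermite S \<mu> c x t))\<^sup>2"

lemma (in wave_pair) energy_eq:
  "eU x t = energy S u.freq c x t" "eV x t = energy S' v.freq c' x t"
  by (simp_all add: eU_def eV_def energy_def AA_def BB_def power2_norm_eq_inner u.U_def u.Ut_def u.Ux_def v.U_def v.Ut_def v.Ux_def)

text \<open>The second component adds \<open>\<epsilon>\<close> times the ground state, so that the resulting wave never vanishes.\<close>

definition augment :: "(nat ^ 'd) set \<Rightarrow> real \<Rightarrow> (nat ^ 'd \<Rightarrow> 'e::euclidean_space) \<Rightarrow> nat ^ 'd \<Rightarrow> 'e \<times> real" where
  "augment S \<epsilon> c n = (if n \<in> S then c n else 0, if n = 0 then \<epsilon> else 0)"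

lemma augment_wave:
  assumes "finite S" "0 < \<epsilon>" "0 \<le> \<kappa>"
  shows "wave (insert 0 S) (augment S \<epsilon> c) \<kappa> (0, 1)"
  by unfold_locales (use assms in \<open>auto simp: augment_def\<close>)

lemma fst_augment_sum:
  assumes "finite S"
  shows "fst (wave_sum F (insert 0 S) \<mu> (augment S \<epsilon> c) x t) = wave_sum F S \<mu> c x t"
    "fst (wave_sum F (insert 0 S) \<mu> (\<lambda>n. a n *\<^sub>R augment S \<epsilon> c n) x t) = wave_sum F S \<mu> (\<lambda>n. a n *\<^sub>R c n) x t"
proof -
  show *: "fst (wave_sum F (insert 0 S) \<mu> (\<lambda>n. a n *\<^sub>R augment S \<epsilon> c n) x t) = wave_sum F S \<mu> (\<lambda>n. a n *\<^sub>R c n) x t" for a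
  proof -
    have "fst (wave_sum F (insert 0 S) \<mu> (\<lambda>n. a n *\<^sub>R augment S \<epsilon> c n) x t)
       = (\<Sum>n\<in>insert 0 S. if n \<in> S then (exp (- (t * \<mu> n)) * F n x) *\<^sub>R a n *\<^sub>R c n else 0)"
      unfolding wave_sum_def fst_sum by (intro sum.cong) (auto simp: augment_def)
    also have "\<dots> = wave_sum F S \<mu> (\<lambda>n. a n *\<^sub>R c n) x t"
      unfolding wave_sum_def using assms by (intro sum.mono_neutral_cong_right) auto
    finally show ?thesis .
  qed
  from *[of "\<lambda>_. 1"]
  show "fst (wave_sum F (insert 0 S) \<mu> (augment S \<epsilon> c) x t) = wave_sum F S \<mu> c x t" by simp
qed

lemma augment_at_0:
  assumes "finite S"
  shows "wave_sum hermite (insert 0 S) \<mu> (augment S \<epsilon> c) x 0 = ((\<Sum>n\<in>S. hermite n x *\<^sub>R c n), \<epsilon> * hermite 0 x)"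
proof -
  have "snd (wave_sum hermite (insert 0 S) \<mu> (augment S \<epsilon> c) x 0) = (\<Sum>n\<in>insert 0 S. if n = 0 then \<epsilon> * hermite 0 x else 0)"
    unfolding wave_sum_def snd_sum by (intro sum.cong) (auto simp: augment_def)
  also have "\<dots> = \<epsilon> * hermite 0 x" using assms by simp
  finally show ?thesis
    using fst_augment_sum(1)[OF assms, of hermite \<mu> \<epsilon> c x 0] by (simp add: prod_eq_iff wave_sum_def)
qed

text \<open>The factor sqrt 2 stems from (a - b)^2 <= 2 a^2 + 2 b^2, applied to x u - grad u. The
  added ground state components can only increase the energies.\<close>

lemma pairing_le_energy:
  fixes c :: "nat ^ 'd \<Rightarrow> real" and g :: "nat ^ 'd \<Rightarrow> real ^ 'd"
  assumes S: "finite S"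
  shows "\<bar>\<Sum>i\<in>UNIV. (x $ i * wave_sum hermite S \<mu> c x t - wave_sum (hermite_dx i) S \<mu> c x t)
       * (wave_sum hermite S \<nu> (\<lambda>n. - \<nu> n *\<^sub>R g n) x t $ i)\<bar>
    \<le> sqrt 2 * (sqrt (energy (insert 0 S) \<mu> (augment S \<epsilon> c) x t) * sqrt (energy (insert 0 S) \<nu> (augment S \<epsilon> g) x t))"
proof -
  define u where "u = wave_sum hermite S \<mu> c x t"
  define ux where "ux i = wave_sum (hermite_dx i) S \<mu> c x t" for i
  define vt where "vt = wave_sum hermite S \<nu> (\<lambda>n. - \<nu> n *\<^sub>R g n) x t"
  define D where "D = (\<chi> i. x $ i * u - ux i)"
  have fstle: "(norm (fst y))\<^sup>2 \<le> (norm y)\<^sup>2" for y :: "'a::real_normed_vector \<times> real"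
    using norm_fst_le[of "fst y" "snd y"] by (simp add: power_mono)
  have "(norm D)\<^sup>2 = (\<Sum>i\<in>UNIV. (x $ i * u - ux i)\<^sup>2)" by (simp add: norm_power2_vec D_def)
  also have "\<dots> \<le> (\<Sum>i\<in>UNIV. 2 * ((x $ i)\<^sup>2 * u\<^sup>2 + (ux i)\<^sup>2))"
  proof (rule sum_mono)
    fix i
    show "(x $ i * u - ux i)\<^sup>2 \<le> 2 * ((x $ i)\<^sup>2 * u\<^sup>2 + (ux i)\<^sup>2)"
      using zero_le_power2[of "x $ i * u + ux i"] by (simp add: power2_eq_square algebra_simps)
  qed
  also have "\<dots> = 2 * ((norm x)\<^sup>2 * u\<^sup>2 + (\<Sum>i\<in>UNIV. (ux i)\<^sup>2))"
    by (simp add: norm_power2_vec sum_distrib_left[symmetric] sum.distrib sum_distrib_right)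
  also have "\<dots> \<le> 2 * energy (insert 0 S) \<mu> (augment S \<epsilon> c) x t"
  proof -
    have e1: "(norm x)\<^sup>2 * u\<^sup>2 \<le> (norm x)\<^sup>2 * (norm (wave_sum hermite (insert 0 S) \<mu> (augment S \<epsilon> c) x t))\<^sup>2"
      using fstle[of "wave_sum hermite (insert 0 S) \<mu> (augment S \<epsilon> c) x t"]
      by (intro mult_left_mono) (auto simp: fst_augment_sum[OF S] u_def)
    have e2: "(\<Sum>i\<in>UNIV. (ux i)\<^sup>2) \<le> (\<Sum>i\<in>UNIV. (norm (wave_sum (hermite_dx i) (insert 0 S) \<mu> (augment S \<epsilon> c) x t))\<^sup>2)"
    proof (rule sum_mono)
      fix i
      show "(ux i)\<^sup>2 \<le> (norm (wave_sum (hermite_dx i) (insert 0 S) \<mu> (augment S \<epsilon> c) x t))\<^sup>2"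
        using fstle[of "wave_sum (hermite_dx i) (insert 0 S) \<mu> (augment S \<epsilon> c) x t"]
        by (simp add: fst_augment_sum[OF S] ux_def)
    qed
    have gen: "2 * (a + b) \<le> 2 * (z + b' + a')" if "a \<le> a'" "b \<le> b'" "0 \<le> z" for a b a' b' z :: real
      using that by simp
    show ?thesis unfolding energy_def by (rule gen[OF e1 e2]) simp
  qed
  finally have D: "norm D \<le> sqrt 2 * sqrt (energy (insert 0 S) \<mu> (augment S \<epsilon> c) x t)"
    by (simp add: real_le_rsqrt real_sqrt_mult[symmetric])
  have "(norm vt)\<^sup>2 \<le> energy (insert 0 S) \<nu> (augment S \<epsilon> g) x t"
  proof -
    have e1: "(norm vt)\<^sup>2 \<le> (norm (wave_sum hermite (insert 0 S) \<nu> (\<lambda>n. - \<nu> n *\<^sub>R augment S \<epsilon> g n) x t))\<^sup>2"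
      using fstle[of "wave_sum hermite (insert 0 S) \<nu> (\<lambda>n. - \<nu> n *\<^sub>R augment S \<epsilon> g n) x t"]
      by (simp only: fst_augment_sum(2)[OF S] vt_def)
    have e2: "0 \<le> (\<Sum>i\<in>UNIV. (norm (wave_sum (hermite_dx i) (insert 0 S) \<nu> (augment S \<epsilon> g) x t))\<^sup>2)"
      "0 \<le> (norm x)\<^sup>2 * (norm (wave_sum hermite (insert 0 S) \<nu> (augment S \<epsilon> g) x t))\<^sup>2"
      by (auto intro!: sum_nonneg)
    have gen: "v \<le> z + b + a" if "v \<le> z" "0 \<le> b" "0 \<le> a" for a b z v :: real
      using that by simp
    show ?thesis unfolding energy_def by (rule gen[OF e1 e2])
  qed
  then have V: "norm vt \<le> sqrt (energy (insert 0 S) \<nu> (augment S \<epsilon> g) x t)"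
    by (rule real_le_rsqrt)
  have "\<bar>\<Sum>i\<in>UNIV. (x $ i * u - ux i) * (vt $ i)\<bar> = \<bar>D \<bullet> vt\<bar>"
    by (simp add: D_def inner_vec_def)
  also have "\<dots> \<le> norm D * norm vt" by (rule Cauchy_Schwarz_ineq2)
  also have "\<dots> \<le> (sqrt 2 * sqrt (energy (insert 0 S) \<mu> (augment S \<epsilon> c) x t)) * sqrt (energy (insert 0 S) \<nu> (augment S \<epsilon> g) x t)"
    using D V by (intro mult_mono) (auto intro: order.trans[OF norm_ge_zero])
  finally show ?thesis by (simp add: u_def ux_def vt_def mult.assoc)
qed

text \<open>The left side is \<open>delta_star i\<close> applied to the wave, so only raised indices
  occur.\<close>

lemma wave_sum_lower_operator:
  "x $ i * wave_sum hermite S \<mu> c x t - wave_sum (hermite_dx i) S \<mu> c x t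
     = (\<Sum>n\<in>S. exp (- (t * \<mu> n)) * c n * sqrt (2 * (real (n $ i) + 1)) * hermite (raise i n) x)"
  unfolding wave_sum_def sum_distrib_left sum_subtractf[symmetric]
  by (intro sum.cong) (auto simp: hermite_dx_def algebra_simps)

text \<open>The contribution of the single mode \<open>n\<close> to the pairing with the field of
  coefficients \<open>g\<close>; where the raised index leaves \<open>S\<close>, orthogonality makes
  it 0.\<close>

definition pair_coeff :: "(nat ^ 'd) set \<Rightarrow> (nat ^ 'd \<Rightarrow> real) \<Rightarrow> (nat ^ 'd \<Rightarrow> real ^ 'd) \<Rightarrow> nat ^ 'd \<Rightarrow> real" where
  "pair_coeff S c g n = (\<Sum>i\<in>UNIV. c n * sqrt (2 * (real (n $ i) + 1)) * (if raise i n \<in> S then g (raise i n) $ i else 0))"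

lemma hermite_sums_inner:
  fixes a b :: "nat ^ 'd \<Rightarrow> real"
  assumes "finite S"
  shows "integrable lborel (\<lambda>x. (\<Sum>n\<in>S. a n * hermite (raise i n) x) * (\<Sum>m\<in>S. b m * hermite m x))"
    "(\<integral>x. (\<Sum>n\<in>S. a n * hermite (raise i n) x) * (\<Sum>m\<in>S. b m * hermite m x) \<partial>lborel)
     = (\<Sum>n\<in>S. a n * (if raise i n \<in> S then b (raise i n) else 0))"
proof -
  have eq: "(\<Sum>n\<in>S. a n * hermite (raise i n) x) * (\<Sum>m\<in>S. b m * hermite m x)
     = (\<Sum>n\<in>S. \<Sum>m\<in>S. (a n * b m) * (hermite (raise i n) x * hermite m x))" for x
    unfolding sum_product by (intro sum.cong) auto
  show "integrable lborel (\<lambda>x. (\<Sum>n\<in>S. a n * hermite (raise i n) x) * (\<Sum>m\<in>S. b m * hermite m x))"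
    unfolding eq by (intro Bochner_Integration.integrable_sum integrable_mult_right hermite_orthonormal(1))
  have "(\<integral>x. (\<Sum>n\<in>S. a n * hermite (raise i n) x) * (\<Sum>m\<in>S. b m * hermite m x) \<partial>lborel)
     = (\<Sum>n\<in>S. \<Sum>m\<in>S. (a n * b m) * (if raise i n = m then 1 else 0))"
    unfolding eq by (simp add: Bochner_Integration.integral_sum Bochner_Integration.integrable_sum hermite_orthonormal)
  also have "\<dots> = (\<Sum>n\<in>S. a n * (if raise i n \<in> S then b (raise i n) else 0))"
    using assms by (intro sum.cong refl) (simp add: if_distrib[of "\<lambda>z. _ * z"] cong: if_cong)
  finally show "(\<integral>x. (\<Sum>n\<in>S. a n * hermite (raise i n) x) * (\<Sum>m\<in>S. b m * hermite m x) \<partial>lborel)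
     = (\<Sum>n\<in>S. a n * (if raise i n \<in> S then b (raise i n) else 0))" .
qed

text \<open>By \<open>eigval_raise\<close> the frequency \<open>\<nu>\<close> at the raised index
  equals \<open>\<mu> n\<close>, so the two exponentials merge into one with rate
  \<open>2 * \<mu> n\<close>. The factor \<open>\<mu> n\<close> and the minus sign come from the
  time derivative of the second wave.\<close>

lemma pairing_integral:
  fixes c :: "nat ^ 'd \<Rightarrow> real" and g :: "nat ^ 'd \<Rightarrow> real ^ 'd"
  assumes S: "finite S"
  defines "\<mu> \<equiv> \<lambda>n :: nat ^ 'd. sqrt (eigval n + 2)" and "\<nu> \<equiv> \<lambda>n :: nat ^ 'd. sqrt (eigval n + 0)"
  shows "(\<integral>x. (\<Sum>i\<in>UNIV. (x $ i * wave_sum hermite S \<mu> c x t - wave_sum (hermite_dx i) S \<mu> c x t)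
       * (wave_sum hermite S \<nu> (\<lambda>n. - \<nu> n *\<^sub>R g n) x t $ i)) \<partial>lborel)
     = - (\<Sum>n\<in>S. \<mu> n * pair_coeff S c g n * exp (- (2 * \<mu> n) * t))"
proof -
  have vt: "wave_sum hermite S \<nu> (\<lambda>n. - \<nu> n *\<^sub>R g n) x t $ i = (\<Sum>m\<in>S. (- exp (- (t * \<nu> m)) * \<nu> m * g m $ i) * hermite m x)" for x i
    unfolding wave_sum_def sum_component by (intro sum.cong) auto
  have lo: "x $ i * wave_sum hermite S \<mu> c x t - wave_sum (hermite_dx i) S \<mu> c x t
     = (\<Sum>n\<in>S. (exp (- (t * \<mu> n)) * c n * sqrt (2 * (real (n $ i) + 1))) * hermite (raise i n) x)" for x i
    by (rule wave_sum_lower_operator)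
  have nu: "\<nu> (raise i n) = \<mu> n" for i n unfolding \<mu>_def \<nu>_def by (simp only: eigval_raise add_0_right)
  have "(\<integral>x. (\<Sum>i\<in>UNIV. (x $ i * wave_sum hermite S \<mu> c x t - wave_sum (hermite_dx i) S \<mu> c x t)
       * (wave_sum hermite S \<nu> (\<lambda>n. - \<nu> n *\<^sub>R g n) x t $ i)) \<partial>lborel)
     = (\<Sum>i\<in>UNIV. \<Sum>n\<in>S. (exp (- (t * \<mu> n)) * c n * sqrt (2 * (real (n $ i) + 1)))
          * (if raise i n \<in> S then - exp (- (t * \<nu> (raise i n))) * \<nu> (raise i n) * g (raise i n) $ i else 0))"
    unfolding vt lo
    by (subst Bochner_Integration.integral_sum, rule hermite_sums_inner(1)[OF S], simp only: hermite_sums_inner(2)[OF S])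
  also have "\<dots> = (\<Sum>n\<in>S. \<Sum>i\<in>UNIV. (exp (- (t * \<mu> n)) * c n * sqrt (2 * (real (n $ i) + 1)))
          * (if raise i n \<in> S then - exp (- (t * \<nu> (raise i n))) * \<nu> (raise i n) * g (raise i n) $ i else 0))"
    by (rule sum.swap)
  also have "\<dots> = (\<Sum>n\<in>S. - (\<mu> n * pair_coeff S c g n * exp (- (2 * \<mu> n) * t)))"
  proof (intro sum.cong refl)
    fix n
    have e: "exp (- (2 * \<mu> n) * t) = exp (- (t * \<mu> n)) * exp (- (t * \<mu> n))"
      by (simp add: exp_add[symmetric] algebra_simps)
    show "(\<Sum>i\<in>UNIV. (exp (- (t * \<mu> n)) * c n * sqrt (2 * (real (n $ i) + 1)))
          * (if raise i n \<in> S then - exp (- (t * \<nu> (raise i n))) * \<nu> (raise i n) * g (raise i n) $ i else 0))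
       = - (\<mu> n * pair_coeff S c g n * exp (- (2 * \<mu> n) * t))"
      unfolding pair_coeff_def nu e sum_distrib_left sum_distrib_right sum_negf[symmetric]
      by (intro sum.cong) auto
  qed
  finally show ?thesis by (simp add: sum_negf)
qed

lemma exp_sum_derivs:
  fixes k :: "'i \<Rightarrow> real" and a :: "'i \<Rightarrow> real"
  shows "((\<lambda>t. \<Sum>n\<in>S. k n * exp (a n * t)) has_real_derivative (\<Sum>n\<in>S. (k n * a n) * exp (a n * t))) (at t)"
  by (intro DERIV_sum) (auto intro!: derivative_eq_intros)

text \<open>Supplies the limit hypothesis of \<open>bilinear_bound\<close>: a negative rate beats
  the factor T.\<close>

lemma exp_sum_limit:
  fixes k :: "'i \<Rightarrow> real" and a :: "'i \<Rightarrow> real"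
  assumes "\<And>n. a n < 0"
  shows "((\<lambda>T. (\<Sum>n\<in>S. k n * exp (a n * T)) - T * (\<Sum>n\<in>S. (k n * a n) * exp (a n * T))) \<longlongrightarrow> 0) at_top"
proof -
  have 1: "((\<lambda>T. T ^ j * exp (a n * T)) \<longlongrightarrow> 0) at_top" if "j \<le> 1" for n and j :: nat
  proof -
    have f: "filterlim (\<lambda>T. (- a n) * T) at_top at_top"
      using assms[of n] by (intro filterlim_tendsto_pos_mult_at_top[OF tendsto_const]) (auto simp: filterlim_ident)
    have "((\<lambda>T. ((- a n) * T) ^ j / exp ((- a n) * T)) \<longlongrightarrow> 0) at_top"
      by (rule filterlim_compose[OF tendsto_power_div_exp_0 f])
    from tendsto_mult_left[OF this, of "(1 / (- a n)) ^ j"]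
    have l: "((\<lambda>T. (1 / (- a n)) ^ j * (((- a n) * T) ^ j / exp ((- a n) * T))) \<longlongrightarrow> 0) at_top" by simp
    have "(1 / (- a n)) ^ j * (((- a n) * T) ^ j / exp ((- a n) * T)) = T ^ j * exp (a n * T)" for T
    proof -
      have "(1 / (- a n)) ^ j * (((- a n) * T) ^ j / exp ((- a n) * T)) = (1 / (- a n) * ((- a n) * T)) ^ j * exp (a n * T)"
        by (simp only: power_mult_distrib[of "1 / (- a n)"] mult_minus_left exp_minus divide_inverse[of "_ ^ _"] inverse_inverse_eq mult.assoc)
      also have "1 / (- a n) * ((- a n) * T) = T" using assms[of n] by simp
      finally show ?thesis .
    qed
    with l show ?thesis by (simp only:)
  qed
  have "((\<lambda>T. \<Sum>n\<in>S. k n * (T ^ 0 * exp (a n * T)) - (k n * a n) * (T ^ 1 * exp (a n * T))) \<longlongrightarrow> (\<Sum>n\<in>S. k n * 0 - (k n * a n) * 0)) at_top"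
    by (intro tendsto_intros 1) auto
  then show ?thesis
    by (simp add: sum_subtractf sum_distrib_left mult_ac)
qed

text \<open>Bounds the initial data of the perturbed waves; the bound tends to 1 with
  \<open>\<epsilon>\<close>.\<close>

lemma perturbed_Lp:
  fixes f :: "real ^ 'd \<Rightarrow> 'b::euclidean_space" and h :: "real ^ 'd \<Rightarrow> real"
  assumes p: "1 \<le> p" and f: "f \<in> Lp_space p" "f \<in> borel_measurable borel" and h: "h \<in> Lp_space p" "h \<in> borel_measurable borel"
    and e: "0 \<le> \<epsilon>" and F: "Lp_norm p f \<le> 1"
  shows "integrable lborel (\<lambda>x. norm (f x, \<epsilon> * h x) powr p)"
    "(\<integral>x. norm (f x, \<epsilon> * h x) powr p \<partial>lborel) \<le> (1 + \<epsilon> * Lp_norm p h) powr p"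
proof -
  note [measurable] = f(2) h(2)
  have m: "(\<lambda>x. (f x, \<epsilon> * h x)) \<in> borel_measurable borel" by measurable
  have mp: "(\<lambda>x. norm (f x, \<epsilon> * h x) powr p) \<in> borel_measurable borel" by measurable
  have 1: "(\<lambda>x. norm (f x)) \<in> Lp_space p" "(\<lambda>x. norm (\<epsilon> *\<^sub>R h x)) \<in> Lp_space p"
    using f Lp_space_scaleR[OF h(1), of \<epsilon>] by (auto simp: Lp_space_def)
  have n: "Lp_norm p (\<lambda>x. norm (f x)) = Lp_norm p f" "Lp_norm p (\<lambda>x. norm (\<epsilon> *\<^sub>R h x)) = \<epsilon> * Lp_norm p h"
    using Lp_norm_scaleR[of p \<epsilon> h] p e by (simp_all add: Lp_norm_def)
  have S: "(\<lambda>x. norm (f x) + norm (\<epsilon> *\<^sub>R h x)) \<in> Lp_space p" using Lp_space_add[OF 1] p by simp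
  have AE: "AE x in lebesgue. norm (f x, \<epsilon> * h x) \<le> norm (norm (f x) + norm (\<epsilon> *\<^sub>R h x))"
    by (intro AE_I2) (use norm_Pair_le[of "f _" "\<epsilon> * h _"] in \<open>auto simp: abs_mult\<close>)
  note b = Lp_space_bound[OF lebesgue_from_lborel(1)[OF m] S AE]
  have L: "(\<lambda>x. (f x, \<epsilon> * h x)) \<in> Lp_space p" using b(1) p by simp
  have "Lp_norm p (\<lambda>x. (f x, \<epsilon> * h x)) \<le> Lp_norm p (\<lambda>x. norm (f x) + norm (\<epsilon> *\<^sub>R h x))" using b(2) p by simp
  also have "\<dots> \<le> Lp_norm p f + \<epsilon> * Lp_norm p h" using Lp_norm_triangle[OF 1 p] unfolding n .
  also have "\<dots> \<le> 1 + \<epsilon> * Lp_norm p h" using F by simp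
  finally have N: "Lp_norm p (\<lambda>x. (f x, \<epsilon> * h x)) \<le> 1 + \<epsilon> * Lp_norm p h" .
  show "integrable lborel (\<lambda>x. norm (f x, \<epsilon> * h x) powr p)"
    using Lp_spaceD(2)[OF L] lebesgue_from_lborel(2)[OF mp] by simp
  have "0 \<le> 1 + \<epsilon> * Lp_norm p h" using e Lp_norm_nonneg[of p h] by simp
  then show "(\<integral>x. norm (f x, \<epsilon> * h x) powr p \<partial>lborel) \<le> (1 + \<epsilon> * Lp_norm p h) powr p"
    using N p Lp_norm_le_iff[of p "1 + \<epsilon> * Lp_norm p h" "\<lambda>x. (f x, \<epsilon> * h x)"] lebesgue_from_lborel(3)[OF mp]
    by simp
qed

text \<open>The left side is sqrt 2 times 2 + 1 / dl, and 1 / dl = 8 (P - 1) / Q = 8 (P - 1) - 8 (P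
  - 1) / P. The subtracted term is at least 4 for P >= 2 and absorbs the 2.\<close>

lemma (in bellman) bellman_constant: "sqrt 2 / dl * (dl * 1 + (1 + dl) * 1) \<le> 8 * sqrt 2 * (P - 1)"
proof -
  have d: "0 < dl" using dl_bounds by simp
  have q: "1 / dl = 8 * (P - 1) / Q"
  proof -
    have "Q * (Q - 1) * (P - 1) = Q * ((Q - 1) * P - (Q - 1))" by (simp add: algebra_simps)
    also have "(Q - 1) * P - (Q - 1) = 1" using PQ by (simp add: algebra_simps)
    finally have "8 * dl * (P - 1) = Q" by (simp add: dl_def)
    then show ?thesis using d Q_bounds by (simp add: field_simps)
  qed
  have "2 \<le> 8 * (P - 1) / P" using P_ge_2 by (simp add: field_simps)
  moreover have "8 * (P - 1) / Q = 8 * (P - 1) - 8 * (P - 1) / P"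
  proof -
    have "1 / Q = 1 - 1 / P" using conj by simp
    then have "8 * (P - 1) * (1 / Q) = 8 * (P - 1) * (1 - 1 / P)" by simp
    then show ?thesis by (simp add: right_diff_distrib)
  qed
  ultimately have "2 + 1 / dl \<le> 8 * (P - 1)" unfolding q by linarith
  then have "sqrt 2 * (2 + 1 / dl) \<le> sqrt 2 * (8 * (P - 1))" by (intro mult_left_mono) auto
  moreover have "sqrt 2 / dl * (dl * 1 + (1 + dl) * 1) = sqrt 2 * (2 + 1 / dl)" using d by (simp add: field_simps)
  ultimately show ?thesis by simp
qed

text \<open>The prefactor 4 sqrt 2 combines the 4 from differentiating an exponential of rate 2 mu
  twice with the sqrt 2 lost in \<open>pairing_le_energy\<close>.\<close>

lemma (in wave_pair) bilinear_bound_norms: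
  fixes J J1 J2 :: "real \<Rightarrow> real"
  assumes J: "\<And>t. (J has_real_derivative J1 t) (at t)" "\<And>t. (J1 has_real_derivative J2 t) (at t)"
    and J2: "continuous_on UNIV J2"
    and q: "\<And>t. 0 \<le> t \<Longrightarrow> \<exists>q. (\<forall>x. \<bar>q x\<bar> \<le> sqrt (eU x t) * sqrt (eV x t)) \<and> J2 t = (4 * sqrt 2) * (\<integral>x. q x \<partial>lborel)"
    and lim: "((\<lambda>T. J T - T * J1 T) \<longlongrightarrow> 0) at_top"
    and X: "integrable lborel (\<lambda>x. norm (u.U x 0) powr P)" "(\<integral>x. norm (u.U x 0) powr P \<partial>lborel) \<le> X"
    and Y: "integrable lborel (\<lambda>x. norm (v.U x 0) powr Q)" "(\<integral>x. norm (v.U x 0) powr Q \<partial>lborel) \<le> Y"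
  shows "\<bar>J 0\<bar> \<le> sqrt 2 / dl * (dl * X + (1 + dl) * Y)"
proof -
  have d: "0 < dl" using dl_bounds by simp
  have "\<bar>J 0\<bar> \<le> (4 * sqrt 2) / (4 * dl) * (\<integral>x. f0 x 0 \<partial>lborel)"
    by (rule bilinear_bound[OF J J2 _ q lim]) auto
  also have "(4 * sqrt 2) / (4 * dl) = sqrt 2 / dl" by simp
  also have "sqrt 2 / dl * (\<integral>x. f0 x 0 \<partial>lborel) \<le> sqrt 2 / dl * (dl * X + (1 + dl) * Y)"
  proof (rule mult_left_mono)
    have "(\<integral>x. f0 x 0 \<partial>lborel) \<le> dl * (\<integral>x. norm (u.U x 0) powr P \<partial>lborel) + (1 + dl) * (\<integral>x. norm (v.U x 0) powr Q \<partial>lborel)"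
      using f0_integral_le[OF X(1) Y(1)] X(1) Y(1) by simp
    also have "\<dots> \<le> dl * X + (1 + dl) * Y"
      using X(2) Y(2) d by (intro add_mono mult_left_mono) auto
    finally show "(\<integral>x. f0 x 0 \<partial>lborel) \<le> dl * X + (1 + dl) * Y" .
  qed (use d in simp)
  finally show ?thesis .
qed

lemma p_star_eq:
  assumes "1 < p" "1 / p + 1 / q = (1::real)"
  shows "2 \<le> p \<Longrightarrow> p_star p = p" "p < 2 \<Longrightarrow> p_star p = q" "1 < q"
proof -
  have q: "q = p / (p - 1)"
  proof -
    have "1 / q = (p - 1) / p" using assms by (simp add: field_simps)
    then show ?thesis by (metis inverse_eq_divide inverse_divide inverse_inverse_eq)
  qed
  show "1 < q" unfolding q using assms by (simp add: field_simps)
  show "p_star p = p" if "2 \<le> p"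
  proof -
    have "p \<le> p * (p - 1)" using that mult_left_mono[of 1 "p - 1" p] by simp
    then have "p / (p - 1) \<le> p" using that by (simp add: field_simps)
    then show ?thesis by (simp add: p_star_def)
  qed
  show "p_star p = q" if "p < 2"
  proof -
    have "p * (p - 1) \<le> p" using that assms mult_left_mono[of "p - 1" 1 p] by simp
    then have "p \<le> p / (p - 1)" using assms by (simp add: field_simps)
    then show ?thesis by (simp add: p_star_def q)
  qed
qed

section \<open>The estimate for normalised expansions\<close>

definition vexp :: "(nat ^ 'd) set \<Rightarrow> (nat ^ 'd \<Rightarrow> 'e::euclidean_space) \<Rightarrow> real ^ 'd \<Rightarrow> 'e" where
  "vexp S g x = (\<Sum>n\<in>S. hermite n x *\<^sub>R g n)"

lemma vexp_borel [measurable]: "vexp S g \<in> borel_measurable borel"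
  unfolding vexp_def[abs_def] by measurable

lemma vexp_Lp:
  assumes "finite S" "1 \<le> p" shows "vexp S g \<in> Lp_space p"
  unfolding vexp_def[abs_def]
proof (rule conjunct1[OF Lp_sum[OF assms(1) _ assms(2)]])
  fix n
  have p: "0 < p" using assms by simp
  show "(\<lambda>x. hermite n x *\<^sub>R g n) \<in> Lp_space p"
  proof (rule Lp_space_bound(1)[OF _ Lp_space_scaleR[OF hermite_Lp[OF p], of "norm (g n)" n]])
    show "(\<lambda>x. hermite n x *\<^sub>R g n) \<in> borel_measurable lebesgue"
      by (rule lebesgue_from_lborel(1)) measurable
  qed (use p in \<open>auto simp: abs_mult mult.commute\<close>)
qed

text \<open>\<open>J\<close> is the wanted sum with each mode damped by its rate
  \<open>2 * \<mu> n\<close>. Since \<open>k\<close> contains 1 / mu and two derivatives bring 4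
  mu^2, J'' is -4 times the integral of \<open>pairing_integral\<close>. The added ground state does
  not enter \<open>J\<close>, so the bound persists as \<open>\<epsilon>\<close> tends to 0.\<close>

lemma half_riesz_pairing:
  fixes c :: "nat ^ 'd \<Rightarrow> real" and g :: "nat ^ 'd \<Rightarrow> real ^ 'd"
  assumes p: "1 < p" and pq: "1 / p + 1 / q = 1" and S: "finite S"
    and f: "Lp_norm p (vexp S c) \<le> 1" and G: "Lp_norm q (vexp S g) \<le> 1"
  shows "\<bar>\<Sum>n\<in>S. pair_coeff S c g n / sqrt (eigval n + 2)\<bar> \<le> 8 * sqrt 2 * (p_star p - 1)"
proof -
  have q: "1 < q" by (rule p_star_eq(3)[OF p pq])
  define \<mu> where "\<mu> n = sqrt (eigval n + 2)" for n :: "nat ^ 'd"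
  define \<nu> where "\<nu> n = sqrt (eigval n + 0)" for n :: "nat ^ 'd"
  have mf: "\<mu> = (\<lambda>n. sqrt (eigval n + 2))" "\<nu> = (\<lambda>n. sqrt (eigval n + 0))"
    by (rule ext, simp only: \<mu>_def \<nu>_def)+
  have mu: "0 < \<mu> n" for n using eigval_ge_1[of n] by (simp add: \<mu>_def)
  define k where "k n = pair_coeff S c g n / \<mu> n" for n
  define a where "a n = - (2 * \<mu> n)" for n
  define J J1 J2 where "J t = (\<Sum>n\<in>S. k n * exp (a n * t))" and "J1 t = (\<Sum>n\<in>S. (k n * a n) * exp (a n * t))"
    and "J2 t = (\<Sum>n\<in>S. ((k n * a n) * a n) * exp (a n * t))" for t
  have J: "(J has_real_derivative J1 t) (at t)" "(J1 has_real_derivative J2 t) (at t)" for t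
    unfolding J_def[abs_def] J1_def[abs_def] J2_def by (rule exp_sum_derivs)+
  have J2c: "continuous_on UNIV J2" unfolding J2_def[abs_def] by (intro continuous_intros)
  have lim: "((\<lambda>T. J T - T * J1 T) \<longlongrightarrow> 0) at_top"
    unfolding J_def J1_def by (rule exp_sum_limit) (use mu in \<open>simp add: a_def\<close>)
  \<comment> \<open>The factor 1 / sqrt 2 offsets the loss in \<open>pairing_le_energy\<close>, and
    the sign offsets that of \<open>pairing_integral\<close>.\<close>
  define qq where "qq t x = - (1 / sqrt 2) * (\<Sum>i\<in>UNIV. (x $ i * wave_sum hermite S \<mu> c x t - wave_sum (hermite_dx i) S \<mu> c x t)
       * (wave_sum hermite S \<nu> (\<lambda>n. - \<nu> n *\<^sub>R g n) x t $ i))" for t x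
  have J2q: "J2 t = (4 * sqrt 2) * (\<integral>x. qq t x \<partial>lborel)" for t
  proof -
    have "(\<integral>x. qq t x \<partial>lborel) = - (1 / sqrt 2) * - (\<Sum>n\<in>S. \<mu> n * pair_coeff S c g n * exp (- (2 * \<mu> n) * t))"
      unfolding qq_def mf integral_mult_right_zero pairing_integral[OF S, of c t g] ..
    then have "(4 * sqrt 2) * (\<integral>x. qq t x \<partial>lborel) = 4 * (\<Sum>n\<in>S. \<mu> n * pair_coeff S c g n * exp (- (2 * \<mu> n) * t))"
      by simp
    also have "\<dots> = J2 t"
      unfolding J2_def sum_distrib_left using mu by (intro sum.cong) (auto simp: k_def a_def less_imp_neq[symmetric])
    finally show ?thesis by simp
  qed
  have qb: "\<bar>qq t x\<bar> \<le> sqrt (energy (insert 0 S) \<mu> (augment S \<epsilon> c) x t) * sqrt (energy (insert 0 S) \<nu> (augment S \<epsilon> g) x t)" for t x \<epsilon>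
  proof -
    have "\<bar>qq t x\<bar> = (1 / sqrt 2) * \<bar>\<Sum>i\<in>UNIV. (x $ i * wave_sum hermite S \<mu> c x t - wave_sum (hermite_dx i) S \<mu> c x t)
       * (wave_sum hermite S \<nu> (\<lambda>n. - \<nu> n *\<^sub>R g n) x t $ i)\<bar>"
      unfolding qq_def abs_mult by simp
    also have "\<dots> \<le> (1 / sqrt 2) * (sqrt 2 * (sqrt (energy (insert 0 S) \<mu> (augment S \<epsilon> c) x t) * sqrt (energy (insert 0 S) \<nu> (augment S \<epsilon> g) x t)))"
      by (intro mult_left_mono pairing_le_energy S) auto
    finally show ?thesis by simp
  qed
  define h0 where "h0 = hermite (0 :: nat ^ 'd)"
  have h0m: "h0 \<in> borel_measurable borel" by (simp add: h0_def)
  have hL: "h0 \<in> Lp_space p" "h0 \<in> Lp_space q" using p q by (auto simp: h0_def hermite_Lp)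
  have fL: "vexp S c \<in> Lp_space p" "vexp S g \<in> Lp_space q" using p q S by (auto intro: vexp_Lp)
  define \<alpha> \<beta> where "\<alpha> \<epsilon> = (1 + \<epsilon> * Lp_norm p h0) powr p" and "\<beta> \<epsilon> = (1 + \<epsilon> * Lp_norm q h0) powr q" for \<epsilon>
  have fX: "integrable lborel (\<lambda>x. norm (vexp S c x, \<epsilon> * h0 x) powr p)" "(\<integral>x. norm (vexp S c x, \<epsilon> * h0 x) powr p \<partial>lborel) \<le> \<alpha> \<epsilon>"
    and gY: "integrable lborel (\<lambda>x. norm (vexp S g x, \<epsilon> * h0 x) powr q)" "(\<integral>x. norm (vexp S g x, \<epsilon> * h0 x) powr q \<partial>lborel) \<le> \<beta> \<epsilon>"
    if "0 < \<epsilon>" for \<epsilon>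
    unfolding \<alpha>_def \<beta>_def
    using perturbed_Lp[OF _ fL(1) vexp_borel hL(1) h0m _ f, of \<epsilon>] perturbed_Lp[OF _ fL(2) vexp_borel hL(2) h0m _ G, of \<epsilon>] p q that
    by auto
  have limab: "(\<lambda>j. \<alpha> (inverse (real (Suc j)))) \<longlonglongrightarrow> 1" "(\<lambda>j. \<beta> (inverse (real (Suc j)))) \<longlonglongrightarrow> 1"
  proof -
    have "(\<lambda>j. (1 + inverse (real (Suc j)) * H) powr r) \<longlonglongrightarrow> (1 + 0 * H) powr r" for H r :: real
      by (intro tendsto_intros LIMSEQ_inverse_real_of_nat) auto
    then show "(\<lambda>j. \<alpha> (inverse (real (Suc j)))) \<longlonglongrightarrow> 1" "(\<lambda>j. \<beta> (inverse (real (Suc j)))) \<longlonglongrightarrow> 1"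
      by (simp_all add: \<alpha>_def \<beta>_def)
  qed
  \<comment> \<open>The passage to the limit, with free \<open>x\<close> and \<open>y\<close> so
    that it fits both orders of the exponents.\<close>
  have fin: "\<bar>J 0\<bar> \<le> C" if "\<And>\<epsilon>. 0 < \<epsilon> \<Longrightarrow> \<bar>J 0\<bar> \<le> sqrt 2 / D * (D * x \<epsilon> + (1 + D) * y \<epsilon>)"
    "(\<lambda>j. x (inverse (real (Suc j)))) \<longlonglongrightarrow> 1" "(\<lambda>j. y (inverse (real (Suc j)))) \<longlonglongrightarrow> 1"
    "sqrt 2 / D * (D * 1 + (1 + D) * 1) \<le> C" for C D and x y :: "real \<Rightarrow> real"
  proof -
    have "(\<lambda>j. sqrt 2 / D * (D * x (inverse (real (Suc j))) + (1 + D) * y (inverse (real (Suc j))))) \<longlonglongrightarrow> sqrt 2 / D * (D * 1 + (1 + D) * 1)"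
      by (intro tendsto_intros that)
    then have "\<bar>J 0\<bar> \<le> sqrt 2 / D * (D * 1 + (1 + D) * 1)"
      by (rule LIMSEQ_le_const) (use that(1) in auto)
    then show ?thesis using that(4) by linarith
  qed
  have J0: "J 0 = (\<Sum>n\<in>S. pair_coeff S c g n / sqrt (eigval n + 2))" by (simp add: J_def k_def \<mu>_def)
  show ?thesis
  proof (cases "2 \<le> p")
    case True
    interpret B: bellman p q by unfold_locales (use True pq in auto)
    have "\<bar>J 0\<bar> \<le> sqrt 2 / B.dl * (B.dl * \<alpha> \<epsilon> + (1 + B.dl) * \<beta> \<epsilon>)" if e: "0 < \<epsilon>" for \<epsilon>
    proof -
      interpret u: wave "insert 0 S" "augment S \<epsilon> c" 2 "(0, 1)" by (rule augment_wave[OF S e]) simp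
      interpret v: wave "insert 0 S" "augment S \<epsilon> g" 0 "(0, 1)" by (rule augment_wave[OF S e]) simp
      interpret W: wave_pair p q "insert 0 S" "augment S \<epsilon> c" 2 "(0, 1)" "insert 0 S" "augment S \<epsilon> g" 0 "(0, 1)" ..
      have fr: "u.freq = \<mu>" "v.freq = \<nu>" by (auto simp: fun_eq_iff u.freq_def v.freq_def \<mu>_def \<nu>_def)
      have U0: "u.U x 0 = (vexp S c x, \<epsilon> * h0 x)" "v.U x 0 = (vexp S g x, \<epsilon> * h0 x)" for x
        by (simp_all add: u.U_def v.U_def augment_at_0[OF S] vexp_def h0_def)
      show ?thesis
      proof (rule W.bilinear_bound_norms[OF J J2c _ lim])
        show "\<exists>q. (\<forall>x. \<bar>q x\<bar> \<le> sqrt (W.eU x t) * sqrt (W.eV x t)) \<and> J2 t = 4 * sqrt 2 * (\<integral>x. q x \<partial>lborel)" for t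
          unfolding W.energy_eq fr by (intro exI[of _ "qq t"] conjI allI qb J2q)
      qed (use fX[OF e] gY[OF e] in \<open>simp_all only: U0\<close>)
    qed
    from fin[OF this limab B.bellman_constant]
    show ?thesis unfolding J0 p_star_eq(1)[OF p pq True] .
  next
    case False
    then have p2: "p < 2" by simp
    have q2: "2 \<le> q"
    proof -
      have "1 / q = 1 - 1 / p" using pq by simp
      also have "\<dots> \<le> 1 / 2" using p p2 by (simp add: field_simps)
      finally show ?thesis using q by (simp add: field_simps)
    qed
    \<comment> \<open>For p < 2 the dual field has the exponent of at least 2 and becomes the first
      wave; the bound by the product of energies is symmetric.\<close>
    interpret B: bellman q p by unfold_locales (use q2 pq in auto)
    have "\<bar>J 0\<bar> \<le> sqrt 2 / B.dl * (B.dl * \<beta> \<epsilon> + (1 + B.dl) * \<alpha> \<epsilon>)" if e: "0 < \<epsilon>" for \<epsilon>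
    proof -
      interpret u: wave "insert 0 S" "augment S \<epsilon> g" 0 "(0, 1)" by (rule augment_wave[OF S e]) simp
      interpret v: wave "insert 0 S" "augment S \<epsilon> c" 2 "(0, 1)" by (rule augment_wave[OF S e]) simp
      interpret W: wave_pair q p "insert 0 S" "augment S \<epsilon> g" 0 "(0, 1)" "insert 0 S" "augment S \<epsilon> c" 2 "(0, 1)" ..
      have fr: "u.freq = \<nu>" "v.freq = \<mu>" by (auto simp: fun_eq_iff u.freq_def v.freq_def \<mu>_def \<nu>_def)
      have U0: "u.U x 0 = (vexp S g x, \<epsilon> * h0 x)" "v.U x 0 = (vexp S c x, \<epsilon> * h0 x)" for x
        by (simp_all add: u.U_def v.U_def augment_at_0[OF S] vexp_def h0_def)
      show ?thesis
      proof (rule W.bilinear_bound_norms[OF J J2c _ lim])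
        show "\<exists>q. (\<forall>x. \<bar>q x\<bar> \<le> sqrt (W.eU x t) * sqrt (W.eV x t)) \<and> J2 t = 4 * sqrt 2 * (\<integral>x. q x \<partial>lborel)" for t
          unfolding W.energy_eq fr
          by (intro exI[of _ "qq t"] conjI allI J2q) (subst mult.commute, rule qb)
      qed (use fX[OF e] gY[OF e] in \<open>simp_all only: U0\<close>)
    qed
    from fin[OF this limab(2,1) B.bellman_constant]
    show ?thesis unfolding J0 p_star_eq(2)[OF p pq p2] .
  qed
qed

section \<open>The Riesz transforms\<close>

text \<open>The operator with L + 2 in place of L, written in coefficients by the raising
  relation.\<close>

definition half_riesz :: "(nat ^ 'd) set \<Rightarrow> (nat ^ 'd \<Rightarrow> real) \<Rightarrow> real ^ 'd \<Rightarrow> real ^ 'd" where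
  "half_riesz S c x = (\<chi> i. \<Sum>n\<in>S. (c n * sqrt (2 * (real (n $ i) + 1)) / sqrt (eigval n + 2)) * hermite (raise i n) x)"

lemma half_riesz_inner:
  assumes S: "finite S"
  shows "(\<integral>x. half_riesz S c x \<bullet> vexp S g x \<partial>lborel) = (\<Sum>n\<in>S. pair_coeff S c g n / sqrt (eigval n + 2))"
proof -
  have v: "vexp S g x $ i = (\<Sum>m\<in>S. (g m $ i) * hermite m x)" for x i
    unfolding vexp_def sum_component by (intro sum.cong) auto
  have "(\<integral>x. half_riesz S c x \<bullet> vexp S g x \<partial>lborel)
     = (\<integral>x. (\<Sum>i\<in>UNIV. (\<Sum>n\<in>S. (c n * sqrt (2 * (real (n $ i) + 1)) / sqrt (eigval n + 2)) * hermite (raise i n) x)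
          * (\<Sum>m\<in>S. (g m $ i) * hermite m x)) \<partial>lborel)"
    by (simp add: inner_vec_def half_riesz_def v)
  also have "\<dots> = (\<Sum>i\<in>UNIV. \<Sum>n\<in>S. (c n * sqrt (2 * (real (n $ i) + 1)) / sqrt (eigval n + 2)) * (if raise i n \<in> S then g (raise i n) $ i else 0))"
    by (subst Bochner_Integration.integral_sum, rule hermite_sums_inner(1)[OF S], simp only: hermite_sums_inner(2)[OF S])
  also have "\<dots> = (\<Sum>n\<in>S. \<Sum>i\<in>UNIV. (c n * sqrt (2 * (real (n $ i) + 1)) / sqrt (eigval n + 2)) * (if raise i n \<in> S then g (raise i n) $ i else 0))"
    by (rule sum.swap)
  also have "\<dots> = (\<Sum>n\<in>S. pair_coeff S c g n / sqrt (eigval n + 2))"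
    unfolding pair_coeff_def sum_divide_distrib by (intro sum.cong) auto
  finally show ?thesis .
qed

lemma vec_Lp:
  fixes F :: "real ^ 'd \<Rightarrow> real ^ 'd"
  assumes p: "1 \<le> p" and "\<And>i. (\<lambda>x. F x $ i) \<in> Lp_space p"
  shows "F \<in> Lp_space p"
proof -
  have "(\<lambda>x. (F x $ i) *\<^sub>R axis i (1::real)) \<in> Lp_space p" for i :: 'd
  proof (rule Lp_space_bound(1)[OF _ assms(2)[of i]])
    show "(\<lambda>x. (F x $ i) *\<^sub>R axis i (1::real)) \<in> borel_measurable lebesgue"
      using Lp_spaceD(1)[OF assms(2)[of i]] by (intro borel_measurable_scaleR) auto
  qed (use p in auto)
  then have "(\<lambda>x. \<Sum>i\<in>UNIV. (F x $ i) *\<^sub>R axis i (1::real)) \<in> Lp_space p"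
    using Lp_sum[of UNIV "\<lambda>i x. (F x $ i) *\<^sub>R axis i (1::real)" p] p by auto
  moreover have "(\<Sum>i\<in>UNIV. (F x $ i) *\<^sub>R axis i (1::real)) = F x" for x
    using basis_expansion[of "F x"] by (simp add: scalar_mult_eq_scaleR)
  ultimately show ?thesis by simp
qed

lemma half_riesz_components: "finite S \<Longrightarrow> (\<lambda>x. half_riesz S c x $ i) \<in> hermite_span"
  unfolding half_riesz_def vec_lambda_beta by (intro hermite_span_sum hermite_span_scale hermite_in_span)

lemma half_riesz_Lp: "finite S \<Longrightarrow> 1 \<le> p \<Longrightarrow> half_riesz S c \<in> Lp_space p"
  by (intro vec_Lp hermite_span_Lp half_riesz_components)

lemma hexp_mono:
  assumes "finite S'" "S \<subseteq> S'"
  shows "hexp S c = hexp S' (\<lambda>n. if n \<in> S then c n else 0)"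
  unfolding hexp_def[abs_def] using assms by (intro ext sum.mono_neutral_cong_left) auto

lemma half_riesz_mono:
  assumes "finite S'" "S \<subseteq> S'"
  shows "half_riesz S c = half_riesz S' (\<lambda>n. if n \<in> S then c n else 0)"
proof
  fix x
  show "half_riesz S c x = half_riesz S' (\<lambda>n. if n \<in> S then c n else 0) x"
    unfolding half_riesz_def vec_eq_iff using assms by (auto intro!: sum.mono_neutral_cong_left)
qed

lemma span_hexp: "f \<in> hermite_span \<Longrightarrow> \<exists>S c. finite S \<and> f = hexp S c"
  unfolding hermite_span_def hexp_def[abs_def] by blast

text \<open>Homogeneity. Both norms are enlarged by 1 / (j + 1) before the division, so that
  vanishing norms need no separate case.\<close>

lemma half_riesz_pairing_scaled:
  fixes c :: "nat ^ 'd \<Rightarrow> real" and g :: "nat ^ 'd \<Rightarrow> real ^ 'd"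
  assumes p: "1 < p" and pq: "1 / p + 1 / q = 1" and S: "finite S"
  shows "\<bar>\<Sum>n\<in>S. pair_coeff S c g n / sqrt (eigval n + 2)\<bar>
     \<le> 8 * sqrt 2 * (p_star p - 1) * (Lp_norm p (hexp S c) * Lp_norm q (vexp S g))"
proof -
  have q: "1 < q" by (rule p_star_eq(3)[OF p pq])
  define M where "M = (\<Sum>n\<in>S. pair_coeff S c g n / sqrt (eigval n + 2))"
  define K where "K = 8 * sqrt 2 * (p_star p - 1)"
  have hv: "vexp S c = hexp S c" by (simp add: vexp_def[abs_def] hexp_def[abs_def] mult.commute)
  have st: "\<bar>M\<bar> \<le> K * (s * t)" if s: "0 < s" "Lp_norm p (hexp S c) \<le> s" and t: "0 < t" "Lp_norm q (vexp S g) \<le> t" for s t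
  proof -
    have "vexp S (\<lambda>n. (1 / s) *\<^sub>R c n) = (\<lambda>x. (1 / s) *\<^sub>R hexp S c x)"
      by (simp add: vexp_def[abs_def] hexp_def[abs_def] sum_distrib_left mult_ac)
    moreover have "vexp S (\<lambda>n. (1 / t) *\<^sub>R g n) = (\<lambda>x. (1 / t) *\<^sub>R vexp S g x)"
      by (simp add: vexp_def[abs_def] scaleR_sum_right mult_ac)
    ultimately have "Lp_norm p (vexp S (\<lambda>n. (1 / s) *\<^sub>R c n)) \<le> 1" "Lp_norm q (vexp S (\<lambda>n. (1 / t) *\<^sub>R g n)) \<le> 1"
      using Lp_norm_scaleR[of p "1 / s" "hexp S c"] Lp_norm_scaleR[of q "1 / t" "vexp S g"] s t p q by simp_all
    from half_riesz_pairing[OF p pq S this]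
    have "\<bar>\<Sum>n\<in>S. pair_coeff S (\<lambda>n. (1 / s) *\<^sub>R c n) (\<lambda>n. (1 / t) *\<^sub>R g n) n / sqrt (eigval n + 2)\<bar> \<le> K"
      by (simp only: K_def)
    also have "(\<Sum>n\<in>S. pair_coeff S (\<lambda>n. (1 / s) *\<^sub>R c n) (\<lambda>n. (1 / t) *\<^sub>R g n) n / sqrt (eigval n + 2)) = M * (1 / (s * t))"
      unfolding M_def sum_distrib_right
    proof (intro sum.cong refl)
      fix n
      have "pair_coeff S (\<lambda>n. (1 / s) *\<^sub>R c n) (\<lambda>n. (1 / t) *\<^sub>R g n) n = pair_coeff S c g n * (1 / (s * t))"
        unfolding pair_coeff_def sum_distrib_right by (intro sum.cong) auto
      then show "pair_coeff S (\<lambda>n. (1 / s) *\<^sub>R c n) (\<lambda>n. (1 / t) *\<^sub>R g n) n / sqrt (eigval n + 2)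
          = pair_coeff S c g n / sqrt (eigval n + 2) * (1 / (s * t))" by simp
    qed
    finally show ?thesis using s t by (simp add: abs_mult field_simps)
  qed
  have "(\<lambda>j. K * ((Lp_norm p (hexp S c) + inverse (real (Suc j))) * (Lp_norm q (vexp S g) + inverse (real (Suc j)))))
     \<longlonglongrightarrow> K * ((Lp_norm p (hexp S c) + 0) * (Lp_norm q (vexp S g) + 0))"
    by (intro tendsto_intros LIMSEQ_inverse_real_of_nat)
  moreover have "\<bar>M\<bar> \<le> K * ((Lp_norm p (hexp S c) + inverse (real (Suc j))) * (Lp_norm q (vexp S g) + inverse (real (Suc j))))" for j
    using Lp_norm_nonneg[of p "hexp S c"] Lp_norm_nonneg[of q "vexp S g"] by (intro st) (auto intro!: add_nonneg_pos)
  ultimately have "\<bar>M\<bar> \<le> K * ((Lp_norm p (hexp S c) + 0) * (Lp_norm q (vexp S g) + 0))"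
    by (intro LIMSEQ_le_const) auto
  then show ?thesis by (simp add: M_def K_def)
qed

text \<open>The pairing is computed over one index set, so the sets of the function and of all
  components of \<open>G\<close> are merged into \<open>S'\<close>, with coefficients extended by
  0.\<close>

lemma half_riesz_dual:
  fixes c :: "nat ^ 'd \<Rightarrow> real" and G :: "real ^ 'd \<Rightarrow> real ^ 'd"
  assumes p: "1 < p" and pq: "1 / p + 1 / q = 1" and S: "finite S" and G: "\<And>i. (\<lambda>x. G x $ i) \<in> hermite_span"
  shows "\<bar>\<integral>x. half_riesz S c x \<bullet> G x \<partial>lebesgue\<bar>
     \<le> 8 * sqrt 2 * (p_star p - 1) * (Lp_norm p (hexp S c) * Lp_norm q G)"
proof -
  have "\<exists>R. \<forall>i. \<exists>d. finite (R i) \<and> (\<lambda>x. G x $ i) = hexp (R i) d"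
    using span_hexp[OF G] by (intro choice) blast
  then obtain R where "\<forall>i. \<exists>d. finite (R i) \<and> (\<lambda>x. G x $ i) = hexp (R i) d" by blast
  then have "\<exists>d. \<forall>i. finite (R i) \<and> (\<lambda>x. G x $ i) = hexp (R i) (d i)" by (rule choice)
  then obtain d where R: "\<And>i. finite (R i)" "\<And>i. (\<lambda>x. G x $ i) = hexp (R i) (d i)" by blast
  define S' where "S' = S \<union> (\<Union>i. R i)"
  have S': "finite S'" "S \<subseteq> S'" "\<And>i. R i \<subseteq> S'" using S R(1) by (auto simp: S'_def)
  define c' where "c' n = (if n \<in> S then c n else 0)" for n
  define g where "g n = (\<chi> i. if n \<in> R i then d i n else 0)" for n
  have Gv: "G = vexp S' g"
  proof
    fix x
    have "G x $ i = vexp S' g x $ i" for i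
    proof -
      have "G x $ i = hexp S' (\<lambda>n. if n \<in> R i then d i n else 0) x"
        using fun_cong[OF R(2)[of i], of x] hexp_mono[OF S'(1) S'(3)[of i], of "d i"] by simp
      then show ?thesis
        unfolding vexp_def sum_component hexp_def by (simp add: g_def mult.commute)
    qed
    then show "G x = vexp S' g x" by (simp add: vec_eq_iff)
  qed
  have f: "hexp S c = hexp S' c'" "half_riesz S c = half_riesz S' c'"
    unfolding c'_def by (rule hexp_mono[OF S'(1,2)] half_riesz_mono[OF S'(1,2)])+
  have hb: "half_riesz S' c' \<in> borel_measurable borel"
  proof -
    have "continuous_on UNIV (half_riesz S' c')"
      unfolding half_riesz_def[abs_def] by (intro continuous_intros continuous_on_hermite)
    then show ?thesis by (rule borel_measurable_continuous_onI)
  qed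
  note [measurable] = hb
  have m: "(\<lambda>x. half_riesz S' c' x \<bullet> vexp S' g x) \<in> borel_measurable borel" by measurable
  show ?thesis
    unfolding f Gv lebesgue_from_lborel(3)[OF m] half_riesz_inner[OF S'(1)]
    by (rule half_riesz_pairing_scaled[OF p pq S'(1)])
qed

text \<open>Duality with the extremal field |r|^(p - 2) r, approximated in L^q by fields with
  components in the span, to which \<open>half_riesz_dual\<close> applies. The result N^p <= K N^(p
  - 1) is then divided by N^(p - 1).\<close>

lemma half_riesz_bound:
  fixes c :: "nat ^ 'd \<Rightarrow> real"
  assumes p: "1 < p" and S: "finite S"
  shows "Lp_norm p (half_riesz S c) \<le> 8 * sqrt 2 * (p_star p - 1) * Lp_norm p (hexp S c)"
proof -
  define q where "q = p / (p - 1)"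
  have pq: "1 / p + 1 / q = 1" using p by (simp add: q_def field_simps)
  have q: "1 < q" by (rule p_star_eq(3)[OF p pq])
  have qe: "(p - 1) * q = p" using p by (simp add: q_def)
  define r where "r = half_riesz S c"
  define N where "N = Lp_norm p r"
  define K where "K = 8 * sqrt 2 * (p_star p - 1) * Lp_norm p (hexp S c)"
  have rL: "r \<in> Lp_space p" using p by (auto simp: r_def intro!: half_riesz_Lp S)
  note [measurable] = Lp_spaceD(1)[OF rL]
  have ps: "1 \<le> p_star p"
    using p by (auto simp: p_star_def)
  have K0: "0 \<le> K" using ps Lp_norm_nonneg[of p "hexp S c"] by (simp add: K_def)
  have N0: "0 \<le> N" by (simp add: N_def Lp_norm_nonneg)
  \<comment> \<open>Where \<open>r\<close> vanishes the scalar is \<open>0 powr (p - 2) = 0\<close>,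
    also for p < 2, and \<open>g\<close> is 0 in any case.\<close>
  define g where "g x = norm (r x) powr (p - 2) *\<^sub>R r x" for x
  have gn: "norm (g x) = norm (r x) powr (p - 1)" for x
    by (cases "r x = 0") (use powr_add[of "norm (r x)" "p - 2" 1] in \<open>simp_all add: g_def\<close>)
  have gq: "norm (g x) powr q = norm (r x) powr p" for x by (simp add: gn powr_powr qe)
  have rg: "r x \<bullet> g x = norm (r x) powr p" for x
    by (cases "r x = 0") (simp_all add: g_def dot_square_norm powr_diff flip: powr_numeral)
  have gL: "g \<in> Lp_space q"
  proof (rule Lp_spaceI)
    show "g \<in> borel_measurable lebesgue" unfolding g_def[abs_def] by measurable
    show "integrable lebesgue (\<lambda>x. norm (g x) powr q)" unfolding gq by (rule Lp_spaceD[OF rL])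
  qed
  have gN: "Lp_norm q g = N powr (p - 1)"
  proof -
    have "Lp_norm q g = (N powr p) powr (1 / q)"
      unfolding N_def using p by (subst Lp_norm_powr) (simp_all add: Lp_norm_def gq)
    also have "p * (1 / q) = p - 1" using p by (simp add: q_def)
    then have "(N powr p) powr (1 / q) = N powr (p - 1)" by (simp only: powr_powr)
    finally show ?thesis .
  qed
  have Np: "(\<integral>x. r x \<bullet> g x \<partial>lebesgue) = N powr p"
    unfolding rg N_def using p by (simp add: Lp_norm_powr)
  have step: "N powr p \<le> K * (N powr (p - 1) + e) + N * e" if e: "0 < e" for e
  proof -
    obtain G where G: "\<And>i. (\<lambda>x. G x $ i) \<in> hermite_span" "G \<in> Lp_space q" "Lp_norm q (\<lambda>x. g x - G x) < e"
      using hermite_span_dense_vec[OF _ gL e] q by auto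
    have dL: "(\<lambda>x. g x - G x) \<in> Lp_space q" using Lp_space_diff[OF gL G(2)] q by simp
    note H1 = Holder_Lp[OF rL G(2) p q pq] and H2 = Holder_Lp[OF rL dL p q pq]
    have GN: "Lp_norm q G \<le> N powr (p - 1) + e"
      using Lp_norm_le_add_diff[OF G(2) gL] q G(3) gN Lp_norm_diff_commute[of q G g] by simp
    have "N powr p = (\<integral>x. r x \<bullet> G x + r x \<bullet> (g x - G x) \<partial>lebesgue)"
      unfolding Np[symmetric] by (simp add: inner_diff_right)
    also have "\<dots> = (\<integral>x. r x \<bullet> G x \<partial>lebesgue) + (\<integral>x. r x \<bullet> (g x - G x) \<partial>lebesgue)"
      by (rule Bochner_Integration.integral_add[OF H1(1) H2(1)])
    also have "\<dots> \<le> K * Lp_norm q G + N * Lp_norm q (\<lambda>x. g x - G x)"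
      using half_riesz_dual[OF p pq S G(1), of c] H2(2) by (simp add: K_def N_def r_def mult.assoc)
    also have "\<dots> \<le> K * (N powr (p - 1) + e) + N * e"
      using G(3) GN K0 N0 by (intro add_mono mult_left_mono) auto
    finally show ?thesis .
  qed
  have "(\<lambda>j. K * (N powr (p - 1) + inverse (real (Suc j))) + N * inverse (real (Suc j))) \<longlonglongrightarrow> K * (N powr (p - 1) + 0) + N * 0"
    by (intro tendsto_intros LIMSEQ_inverse_real_of_nat)
  then have "N powr p \<le> K * (N powr (p - 1) + 0) + N * 0"
    by (rule LIMSEQ_le_const) (use step in auto)
  then have fin: "N powr p \<le> K * N powr (p - 1)" by simp
  have "N \<le> K"
  proof (cases "N = 0")
    case False
    then have "0 < N" using N0 by simp
    then have "N powr p = N * N powr (p - 1)" by (simp add: powr_mult_base)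
    then show ?thesis using fin \<open>0 < N\<close> by simp
  qed (use K0 in simp)
  then show ?thesis by (simp add: N_def K_def r_def)
qed

section \<open>The Riesz transforms on the span and their extension\<close>

lemma L2_inner_hexp:
  assumes "finite S"
  shows "L2_inner (hexp S c) (hermite n) = (if n \<in> S then c n else 0)"
proof -
  have m: "(\<lambda>x. hexp S c x * hermite n x) \<in> borel_measurable borel" by measurable
  have "L2_inner (hexp S c) (hermite n) = (\<integral>x. (\<Sum>k\<in>S. c k * (hermite k x * hermite n x)) \<partial>lborel)"
    unfolding L2_inner_def lebesgue_from_lborel(3)[OF m] by (simp add: hexp_def sum_distrib_right mult.assoc)
  also have "\<dots> = (\<Sum>k\<in>S. c k * (if k = n then 1 else 0))"
    by (subst Bochner_Integration.integral_sum) (simp_all add: hermite_orthonormal)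
  also have "\<dots> = (if n \<in> S then c n else 0)" using assms by (simp add: if_distrib[of "\<lambda>z. _ * z"] cong: if_cong)
  finally show ?thesis .
qed

text \<open>Orthogonality confines the infinite sum to \<open>S\<close>, and the coefficient
  lambda^(-1/2) splits into the multiplier times (lambda + 2)^(-1/2).\<close>

lemma Riesz_hexp:
  assumes S: "finite S"
  shows "Riesz (hexp S c) = half_riesz S (\<lambda>n. sqrt ((eigval n + 2) / eigval n) * c n)"
proof
  fix x
  have "Riesz_comp i (hexp S c) x = (\<Sum>n\<in>S. (sqrt ((eigval n + 2) / eigval n) * c n * sqrt (2 * (real (n $ i) + 1)) / sqrt (eigval n + 2)) * hermite (raise i n) x)" for i
  proof -
    let ?t = "\<lambda>n. eigval n powr (- 1 / 2) * L2_inner (hexp S c) (hermite n) * delta_star i (hermite n) x"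
    have "Riesz_comp i (hexp S c) x = infsum ?t S"
      unfolding Riesz_comp_def by (rule infsum_cong_neutral) (auto simp: L2_inner_hexp[OF S])
    also have "\<dots> = sum ?t S" using S by (rule infsum_finite)
    also have "\<dots> = (\<Sum>n\<in>S. (sqrt ((eigval n + 2) / eigval n) * c n * sqrt (2 * (real (n $ i) + 1)) / sqrt (eigval n + 2)) * hermite (raise i n) x)"
    proof (intro sum.cong refl)
      fix n assume n: "n \<in> S"
      have e: "1 \<le> eigval n" by (rule eigval_ge_1)
      have "eigval n powr (- 1 / 2) = sqrt ((eigval n + 2) / eigval n) / sqrt (eigval n + 2)"
        using e by (subst powr_minus_half) (auto simp: real_sqrt_divide)
      then show "?t n = (sqrt ((eigval n + 2) / eigval n) * c n * sqrt (2 * (real (n $ i) + 1)) / sqrt (eigval n + 2)) * hermite (raise i n) x"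
        unfolding delta_star_hermite L2_inner_hexp[OF S] using n by simp
    qed
    finally show ?thesis .
  qed
  then show "Riesz (hexp S c) x = half_riesz S (\<lambda>n. sqrt ((eigval n + 2) / eigval n) * c n) x"
    by (simp only: Riesz_def half_riesz_def)
qed

lemma Riesz_span_bound:
  fixes f :: "real ^ 'd \<Rightarrow> real"
  assumes p: "1 < p" and f: "f \<in> hermite_span"
  shows "Riesz f \<in> Lp_space p" "Lp_norm p (Riesz f) \<le> 42 * (p_star p - 1) * Lp_norm p f"
proof -
  obtain S c where S: "finite S" "f = hexp S c" using span_hexp[OF f] by blast
  show "Riesz f \<in> Lp_space p"
    unfolding S(2) Riesz_hexp[OF S(1)] using p S(1) by (intro half_riesz_Lp) auto
  have ps: "1 \<le> p_star p" using p by (auto simp: p_star_def)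
  \<comment> \<open>This precision suffices: 88 / 3 times 1.4143 is about 41.49.\<close>
  have s2: "sqrt 2 \<le> 1.4143" by (rule real_le_lsqrt) (auto simp: power2_eq_square)
  have "Lp_norm p (Riesz f) \<le> 8 * sqrt 2 * (p_star p - 1) * Lp_norm p (hexp S (\<lambda>n. sqrt ((eigval n + 2) / eigval n) * c n))"
    unfolding S(2) Riesz_hexp[OF S(1)] by (rule half_riesz_bound[OF p S(1)])
  also have "\<dots> \<le> 8 * sqrt 2 * (p_star p - 1) * (11 / 3 * Lp_norm p f)"
    unfolding S(2) using ps by (intro mult_left_mono multiplier_Lp[OF p S(1)]) auto
  also have "\<dots> = (88 / 3 * sqrt 2) * ((p_star p - 1) * Lp_norm p f)" by simp
  also have "\<dots> \<le> 42 * ((p_star p - 1) * Lp_norm p f)"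
    using s2 ps Lp_norm_nonneg[of p f] by (intro mult_right_mono) auto
  finally show "Lp_norm p (Riesz f) \<le> 42 * (p_star p - 1) * Lp_norm p f" by (simp only: mult.assoc)
qed

lemma Riesz_linear:
  fixes f g :: "real ^ 'd \<Rightarrow> real"
  assumes f: "f \<in> hermite_span" and g: "g \<in> hermite_span"
  shows "Riesz (\<lambda>x. a * f x + b * g x) = (\<lambda>x. a *\<^sub>R Riesz f x + b *\<^sub>R Riesz g x)"
proof -
  obtain S c where S: "finite S" "f = hexp S c" using span_hexp[OF f] by blast
  obtain S' d where S': "finite S'" "g = hexp S' d" using span_hexp[OF g] by blast
  define R where "R = S \<union> S'"
  have R: "finite R" "S \<subseteq> R" "S' \<subseteq> R" using S S' by (auto simp: R_def)
  define c' d' where "c' n = (if n \<in> S then c n else 0)" and "d' n = (if n \<in> S' then d n else 0)" for n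
  have fg: "f = hexp R c'" "g = hexp R d'"
    unfolding S(2) S'(2) c'_def d'_def by (rule hexp_mono[OF R(1,2)] hexp_mono[OF R(1,3)])+
  have "(\<lambda>x. a * f x + b * g x) = hexp R (\<lambda>n. a * c' n + b * d' n)"
    unfolding fg hexp_def[abs_def] by (simp add: sum_distrib_left sum.distrib distrib_right mult.assoc)
  then show ?thesis
    unfolding fg
    by (simp add: Riesz_hexp[OF R(1)] half_riesz_def fun_eq_iff vec_eq_iff sum_distrib_left
        sum.distrib[symmetric] algebra_simps add_divide_distrib)
qed

text \<open>\<open>Riesz_limit p f F\<close>: \<open>F\<close> is a value at \<open>f\<close> of the closure of \<open>Riesz\<close> in \<open>L\<^sup>p\<close>.\<close>

definition Riesz_limit :: "real \<Rightarrow> (real ^ 'd \<Rightarrow> real) \<Rightarrow> (real ^ 'd \<Rightarrow> real ^ 'd) \<Rightarrow> bool" where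
  "Riesz_limit p f F \<longleftrightarrow> f \<in> Lp_space p \<and> F \<in> Lp_space p \<and>
     (\<exists>h :: nat \<Rightarrow> real ^ 'd \<Rightarrow> real. (\<forall>k. h k \<in> hermite_span) \<and>
        (\<lambda>k. Lp_norm p (\<lambda>x. h k x - f x)) \<longlonglongrightarrow> 0 \<and> (\<lambda>k. Lp_norm p (\<lambda>x. Riesz (h k) x - F x)) \<longlonglongrightarrow> 0)"

lemma Riesz_limit_exists:
  fixes f :: "real ^ 'd \<Rightarrow> real"
  assumes p: "1 < p" and f: "f \<in> Lp_space p"
  shows "\<exists>F. Riesz_limit p f F"
proof -
  define A where "A = 42 * (p_star p - 1)"
  have A: "0 \<le> A" using p by (auto simp: A_def p_star_def)
  have p1: "1 \<le> p" using p by simp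
  \<comment> \<open>Neighbouring approximants differ by at most \<open>2 * e k\<close>; the scaling
    makes \<open>A\<close> times this at most (1/2)^k, the rate that \<open>Lp_complete\<close>
    demands.\<close>
  define e where "e k = (1 / 2) ^ k / (2 * (A + 1))" for k :: nat
  have e: "0 < e k" for k using A by (simp add: e_def)
  have "\<exists>h. \<forall>k. h k \<in> hermite_span \<and> Lp_norm p (\<lambda>x. f x - h k x) < e k"
    by (intro choice allI) (metis hermite_span_dense[OF p1 f e])
  then obtain h where h: "\<And>k. h k \<in> hermite_span" "\<And>k. Lp_norm p (\<lambda>x. f x - h k x) < e k" by blast
  have hL: "h k \<in> Lp_space p" for k by (rule hermite_span_Lp[OF h(1) p1])
  have RL: "Riesz (h k) \<in> Lp_space p" for k by (rule Riesz_span_bound(1)[OF p h(1)])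
  have "Lp_norm p (\<lambda>x. Riesz (h (Suc k)) x - Riesz (h k) x) \<le> (1 / 2) ^ k" for k
  proof -
    have "(\<lambda>x. Riesz (h (Suc k)) x - Riesz (h k) x) = Riesz (\<lambda>x. 1 * h (Suc k) x + (- 1) * h k x)"
      by (subst Riesz_linear[OF h(1) h(1)]) simp
    then have "Lp_norm p (\<lambda>x. Riesz (h (Suc k)) x - Riesz (h k) x) \<le> A * Lp_norm p (\<lambda>x. 1 * h (Suc k) x + (- 1) * h k x)"
      using Riesz_span_bound(2)[OF p, of "\<lambda>x. 1 * h (Suc k) x + (- 1) * h k x"]
        hermite_span_diff[OF h(1) h(1), of "Suc k" k] by (simp add: A_def)
    also have "Lp_norm p (\<lambda>x. 1 * h (Suc k) x + (- 1) * h k x) \<le> e (Suc k) + e k"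
      using Lp_norm_triangle_diff[OF hL f hL p1, of "Suc k" k] h(2)[of "Suc k"] h(2)[of k]
        Lp_norm_diff_commute[of p "h (Suc k)" f] by simp
    also have "\<dots> \<le> 2 * e k"
      using A divide_right_mono[OF power_decreasing[of k "Suc k" "1 / 2 :: real"], of "2 * (A + 1)"] by (simp only: e_def) simp
    also have "A * (2 * e k) = (A / (A + 1)) * (1 / 2) ^ k"
    proof -
      have "A * (2 * (y / (2 * (A + 1)))) = (A / (A + 1)) * y" for y using A by (simp add: field_simps)
      then show ?thesis unfolding e_def .
    qed
    also have "\<dots> \<le> 1 * (1 / 2) ^ k" using A by (intro mult_right_mono) auto
    finally show ?thesis using A by (simp add: mult_left_mono)
  qed
  from Lp_complete[OF RL p1 this] obtain F where F: "F \<in> Lp_space p" "(\<lambda>k. Lp_norm p (\<lambda>x. Riesz (h k) x - F x)) \<longlonglongrightarrow> 0"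
    by blast
  have "(\<lambda>k. Lp_norm p (\<lambda>x. h k x - f x)) \<longlonglongrightarrow> 0"
  proof (rule tendsto_sandwich[OF _ _ tendsto_const])
    show "e \<longlonglongrightarrow> 0" unfolding e_def[abs_def]
      using LIMSEQ_power_zero[of "1 / 2 :: real"] by (intro tendsto_divide_zero) simp
    show "\<forall>\<^sub>F k in sequentially. Lp_norm p (\<lambda>x. h k x - f x) \<le> e k"
      using h(2) by (intro always_eventually allI) (simp add: Lp_norm_diff_commute[of p "h _" f] less_imp_le)
  qed (simp add: Lp_norm_nonneg)
  then show ?thesis unfolding Riesz_limit_def using f F h(1) by blast
qed

lemma Riesz_limit_bound:
  fixes f :: "real ^ 'd \<Rightarrow> real"
  assumes p: "1 < p" and F: "Riesz_limit p f F"
  shows "Lp_norm p F \<le> 42 * (p_star p - 1) * Lp_norm p f"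
proof -
  define A where "A = 42 * (p_star p - 1)"
  have A: "0 \<le> A" using p by (auto simp: A_def p_star_def)
  have p1: "1 \<le> p" using p by simp
  obtain h where h: "f \<in> Lp_space p" "F \<in> Lp_space p" "\<And>k. h k \<in> hermite_span"
    "(\<lambda>k. Lp_norm p (\<lambda>x. h k x - f x)) \<longlonglongrightarrow> 0" "(\<lambda>k. Lp_norm p (\<lambda>x. Riesz (h k) x - F x)) \<longlonglongrightarrow> 0"
    using F unfolding Riesz_limit_def by blast
  have "Lp_norm p F \<le> A * (Lp_norm p f + Lp_norm p (\<lambda>x. h k x - f x)) + Lp_norm p (\<lambda>x. Riesz (h k) x - F x)" for k
  proof -
    have "Lp_norm p F \<le> Lp_norm p (Riesz (h k)) + Lp_norm p (\<lambda>x. F x - Riesz (h k) x)"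
      by (rule Lp_norm_le_add_diff[OF h(2) Riesz_span_bound(1)[OF p h(3)] p1])
    moreover have "Lp_norm p (Riesz (h k)) \<le> A * Lp_norm p (h k)"
      unfolding A_def by (rule Riesz_span_bound(2)[OF p h(3)])
    moreover have "A * Lp_norm p (h k) \<le> A * (Lp_norm p f + Lp_norm p (\<lambda>x. h k x - f x))"
      using A by (intro mult_left_mono Lp_norm_le_add_diff hermite_span_Lp h p1)
    ultimately show ?thesis by (simp add: Lp_norm_diff_commute[of p F])
  qed
  moreover have "(\<lambda>k. A * (Lp_norm p f + Lp_norm p (\<lambda>x. h k x - f x)) + Lp_norm p (\<lambda>x. Riesz (h k) x - F x))
     \<longlonglongrightarrow> A * (Lp_norm p f + 0) + 0"
    by (intro tendsto_intros h)
  ultimately have "Lp_norm p F \<le> A * (Lp_norm p f + 0) + 0" by (intro LIMSEQ_le_const) auto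
  then show ?thesis by (simp add: A_def)
qed

lemma Riesz_limit_linear:
  fixes f g :: "real ^ 'd \<Rightarrow> real"
  assumes p: "1 < p" and F: "Riesz_limit p f F" and G: "Riesz_limit p g G"
  shows "Riesz_limit p (\<lambda>x. a * f x + b * g x) (\<lambda>x. a *\<^sub>R F x + b *\<^sub>R G x)"
proof -
  have p1: "1 \<le> p" and p0: "0 \<le> p" "0 < p" using p by auto
  obtain h where h: "f \<in> Lp_space p" "F \<in> Lp_space p" "\<And>k. h k \<in> hermite_span"
    "(\<lambda>k. Lp_norm p (\<lambda>x. h k x - f x)) \<longlonglongrightarrow> 0" "(\<lambda>k. Lp_norm p (\<lambda>x. Riesz (h k) x - F x)) \<longlonglongrightarrow> 0"
    using F unfolding Riesz_limit_def by blast
  obtain j where j: "g \<in> Lp_space p" "G \<in> Lp_space p" "\<And>k. j k \<in> hermite_span"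
    "(\<lambda>k. Lp_norm p (\<lambda>x. j k x - g x)) \<longlonglongrightarrow> 0" "(\<lambda>k. Lp_norm p (\<lambda>x. Riesz (j k) x - G x)) \<longlonglongrightarrow> 0"
    using G unfolding Riesz_limit_def by blast
  define m where "m k x = a * h k x + b * j k x" for k x
  have m: "m k \<in> hermite_span" for k
    unfolding m_def[abs_def] by (intro hermite_span_add hermite_span_scale h j)
  have comb: "(\<lambda>k. Lp_norm p (\<lambda>x. (a *\<^sub>R u k x + b *\<^sub>R v k x) - (a *\<^sub>R u' x + b *\<^sub>R v' x))) \<longlonglongrightarrow> 0"
    if "\<And>k. u k \<in> Lp_space p" "\<And>k. v k \<in> Lp_space p" "u' \<in> Lp_space p" "v' \<in> Lp_space p"
      "(\<lambda>k. Lp_norm p (\<lambda>x. u k x - u' x)) \<longlonglongrightarrow> 0" "(\<lambda>k. Lp_norm p (\<lambda>x. v k x - v' x)) \<longlonglongrightarrow> 0"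
    for u v :: "nat \<Rightarrow> real ^ 'd \<Rightarrow> 'g::euclidean_space" and u' v'
  proof (rule tendsto_sandwich[OF _ _ tendsto_const])
    have "(\<lambda>k. \<bar>a\<bar> * Lp_norm p (\<lambda>x. u k x - u' x) + \<bar>b\<bar> * Lp_norm p (\<lambda>x. v k x - v' x)) \<longlonglongrightarrow> \<bar>a\<bar> * 0 + \<bar>b\<bar> * 0"
      by (intro tendsto_intros that)
    then show "(\<lambda>k. \<bar>a\<bar> * Lp_norm p (\<lambda>x. u k x - u' x) + \<bar>b\<bar> * Lp_norm p (\<lambda>x. v k x - v' x)) \<longlonglongrightarrow> 0" by simp
    show "\<forall>\<^sub>F k in sequentially. Lp_norm p (\<lambda>x. (a *\<^sub>R u k x + b *\<^sub>R v k x) - (a *\<^sub>R u' x + b *\<^sub>R v' x))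
        \<le> \<bar>a\<bar> * Lp_norm p (\<lambda>x. u k x - u' x) + \<bar>b\<bar> * Lp_norm p (\<lambda>x. v k x - v' x)"
    proof (intro always_eventually allI)
      fix k
      have "(a *\<^sub>R u k x + b *\<^sub>R v k x) - (a *\<^sub>R u' x + b *\<^sub>R v' x) = a *\<^sub>R (u k x - u' x) + b *\<^sub>R (v k x - v' x)" for x
        by (simp add: algebra_simps)
      then show "Lp_norm p (\<lambda>x. (a *\<^sub>R u k x + b *\<^sub>R v k x) - (a *\<^sub>R u' x + b *\<^sub>R v' x))
        \<le> \<bar>a\<bar> * Lp_norm p (\<lambda>x. u k x - u' x) + \<bar>b\<bar> * Lp_norm p (\<lambda>x. v k x - v' x)"
        using Lp_norm_triangle[OF Lp_space_scaleR[OF Lp_space_diff[OF that(1,3) p0(1)]] Lp_space_scaleR[OF Lp_space_diff[OF that(2,4) p0(1)]] p1, of a k b k]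
        by (simp only: Lp_norm_scaleR[OF p0(2)])
    qed
  qed (simp add: Lp_norm_nonneg)
  have L1: "(\<lambda>k. Lp_norm p (\<lambda>x. m k x - (a * f x + b * g x))) \<longlonglongrightarrow> 0"
    using comb[of h j f g] hermite_span_Lp[OF h(3) p1] hermite_span_Lp[OF j(3) p1] h j by (simp add: m_def)
  have "Riesz (m k) = (\<lambda>x. a *\<^sub>R Riesz (h k) x + b *\<^sub>R Riesz (j k) x)" for k
    unfolding m_def[abs_def] by (rule Riesz_linear[OF h(3) j(3)])
  then have L2: "(\<lambda>k. Lp_norm p (\<lambda>x. Riesz (m k) x - (a *\<^sub>R F x + b *\<^sub>R G x))) \<longlonglongrightarrow> 0"
    using comb[of "\<lambda>k. Riesz (h k)" "\<lambda>k. Riesz (j k)" F G] Riesz_span_bound(1)[OF p h(3)] Riesz_span_bound(1)[OF p j(3)] h j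
    by simp
  have "(\<lambda>x. a * f x + b * g x) \<in> Lp_space p"
    using Lp_space_add[OF Lp_space_scaleR[OF h(1), of a] Lp_space_scaleR[OF j(1), of b] p0(1)] by simp
  moreover have "(\<lambda>x. a *\<^sub>R F x + b *\<^sub>R G x) \<in> Lp_space p"
    by (rule Lp_space_add[OF Lp_space_scaleR[OF h(2)] Lp_space_scaleR[OF j(2)] p0(1)])
  ultimately show ?thesis unfolding Riesz_limit_def using m L1 L2 by blast
qed

text \<open>The difference is a limit value at f - f = 0, so \<open>Riesz_limit_bound\<close> makes
  its norm 0.\<close>

lemma Riesz_limit_unique:
  fixes f :: "real ^ 'd \<Rightarrow> real"
  assumes p: "1 < p" and F: "Riesz_limit p f F" and G: "Riesz_limit p f G"
  shows "AE x in lebesgue. F x = G x"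
proof -
  have lim: "Riesz_limit p (\<lambda>x. 1 * f x + (- 1) * f x) (\<lambda>x. 1 *\<^sub>R F x + (- 1) *\<^sub>R G x)"
    by (rule Riesz_limit_linear[OF p F G])
  have "Lp_norm p (\<lambda>x. 1 *\<^sub>R F x + (- 1) *\<^sub>R G x) = 0"
    using Riesz_limit_bound[OF p lim] Lp_norm_nonneg[of p "\<lambda>x. 1 *\<^sub>R F x + (- 1) *\<^sub>R G x"] by (simp add: Lp_norm_def)
  moreover have "(\<lambda>x. 1 *\<^sub>R F x + (- 1) *\<^sub>R G x) \<in> Lp_space p" using lim by (simp add: Riesz_limit_def)
  ultimately have "AE x in lebesgue. 1 *\<^sub>R F x + (- 1) *\<^sub>R G x = 0"
    using p by (intro Lp_norm_zero_AE) auto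
  then show ?thesis by eventually_elim simp
qed

lemma Riesz_limit_span:
  assumes p: "1 < p" and f: "f \<in> hermite_span"
  shows "Riesz_limit p f (Riesz f)"
  unfolding Riesz_limit_def
  using hermite_span_Lp[OF f] Riesz_span_bound(1)[OF p f] p f
  by (intro conjI exI[of _ "\<lambda>_. f"]) (auto simp: Lp_norm_def)

text \<open>Existence keeps the last clause from being vacuous. For an arbitrary extension
  \<open>T\<close> the unknown bound of \<open>T\<close> multiplies only the error of approximating
  f from the span, so it disappears in the limit and the constant of the span remains.\<close>

theorem theorem12:
  fixes p :: real
  assumes "1 < p"
  shows "(\<forall>f \<in> (hermite_span :: (real ^ 'd \<Rightarrow> real) set).
            Riesz f \<in> Lp_space p \<and>
            Lp_norm p (Riesz f) \<le> 42 * (p_star p - 1) * Lp_norm p f) \<and>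
         (\<exists>T :: (real ^ 'd \<Rightarrow> real) \<Rightarrow> real ^ 'd \<Rightarrow> real ^ 'd. Riesz_extension p T) \<and>
         (\<forall>T :: (real ^ 'd \<Rightarrow> real) \<Rightarrow> real ^ 'd \<Rightarrow> real ^ 'd. Riesz_extension p T \<longrightarrow>
            (\<forall>f\<in>Lp_space p. Lp_norm p (T f) \<le> 42 * (p_star p - 1) * Lp_norm p f))"
proof (intro conjI ballI allI impI)
  note p = assms
  have p1: "1 \<le> p" and p0: "0 \<le> p" using p by auto
  fix f :: "real ^ 'd \<Rightarrow> real"
  assume f: "f \<in> hermite_span"
  show "Riesz f \<in> Lp_space p" "Lp_norm p (Riesz f) \<le> 42 * (p_star p - 1) * Lp_norm p f"
    by (rule Riesz_span_bound[OF p f])+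
next
  note p = assms
  \<comment> \<open>Limit values are determined up to null sets, so a representative is chosen for
    each f; linearity of \<open>T\<close> is therefore obtained almost everywhere, through
    \<open>Riesz_limit_unique\<close>.\<close>
  define T where "T f = (SOME F. Riesz_limit p f F)" for f :: "real ^ 'd \<Rightarrow> real"
  have T: "Riesz_limit p f (T f)" if "f \<in> Lp_space p" for f
    unfolding T_def using Riesz_limit_exists[OF p that] by (rule someI_ex)
  have "Riesz_extension p T"
    unfolding Riesz_extension_def
  proof (intro conjI ballI allI)
    fix f :: "real ^ 'd \<Rightarrow> real" assume f: "f \<in> Lp_space p"
    show "T f \<in> Lp_space p" using T[OF f] by (simp add: Riesz_limit_def)
    fix g :: "real ^ 'd \<Rightarrow> real" and a b assume g: "g \<in> Lp_space p"
    note L = Riesz_limit_linear[OF p T[OF f] T[OF g], of a b]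
    have "(\<lambda>y. a * f y + b * g y) \<in> Lp_space p" using L by (simp add: Riesz_limit_def)
    from Riesz_limit_unique[OF p T[OF this] L]
    show "AE x in lebesgue. T (\<lambda>y. a * f y + b * g y) x = a *\<^sub>R T f x + b *\<^sub>R T g x" .
  next
    show "\<exists>C. \<forall>f\<in>Lp_space p. Lp_norm p (T f) \<le> C * Lp_norm p f"
      using Riesz_limit_bound[OF p T] by blast
  next
    fix f :: "real ^ 'd \<Rightarrow> real" assume f: "f \<in> hermite_span"
    have "f \<in> Lp_space p" using hermite_span_Lp[OF f] p by simp
    from Riesz_limit_unique[OF p T[OF this] Riesz_limit_span[OF p f]]
    show "AE x in lebesgue. T f x = Riesz f x" .
  qed
  then show "\<exists>T :: (real ^ 'd \<Rightarrow> real) \<Rightarrow> real ^ 'd \<Rightarrow> real ^ 'd. Riesz_extension p T" by (rule exI[of _ T])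
next
  note p = assms
  have p1: "1 \<le> p" and p0: "0 \<le> p" using p by auto
  fix T :: "(real ^ 'd \<Rightarrow> real) \<Rightarrow> real ^ 'd \<Rightarrow> real ^ 'd" and f :: "real ^ 'd \<Rightarrow> real"
  assume T: "Riesz_extension p T" and f: "f \<in> Lp_space p"
  define A where "A = 42 * (p_star p - 1)"
  have A: "0 \<le> A" using p by (auto simp: A_def p_star_def)
  have TL: "T g \<in> Lp_space p" if "g \<in> Lp_space p" for g
    using T that unfolding Riesz_extension_def by blast
  have Tlin: "AE x in lebesgue. T (\<lambda>y. a * g y + b * k y) x = a *\<^sub>R T g x + b *\<^sub>R T k x"
    if "g \<in> Lp_space p" "k \<in> Lp_space p" for g k a b
    using T that unfolding Riesz_extension_def by blast
  have TR: "AE x in lebesgue. T g x = Riesz g x" if "g \<in> hermite_span" for g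
    using T that unfolding Riesz_extension_def by blast
  obtain C where C: "\<And>g. g \<in> Lp_space p \<Longrightarrow> Lp_norm p (T g) \<le> C * Lp_norm p g"
    using T unfolding Riesz_extension_def by blast
  have step: "Lp_norm p (T f) \<le> A * (Lp_norm p f + e) + \<bar>C\<bar> * e" if e: "0 < e" for e
  proof -
    obtain h where h: "h \<in> hermite_span" "Lp_norm p (\<lambda>x. f x - h x) < e"
      by (rule hermite_span_dense[OF p1 f e])
    have hL: "h \<in> Lp_space p" by (rule hermite_span_Lp[OF h(1) p1])
    define d where "d x = f x - h x" for x
    have dL: "d \<in> Lp_space p" unfolding d_def[abs_def] by (rule Lp_space_diff[OF f hL p0])
    have feq: "f = (\<lambda>y. 1 * h y + 1 * d y)" by (simp add: d_def)
    have "AE x in lebesgue. T f x = 1 *\<^sub>R T h x + 1 *\<^sub>R T d x"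
      by (subst (1) feq) (rule Tlin[OF hL dL])
    then have "Lp_norm p (T f) = Lp_norm p (\<lambda>x. T h x + T d x)"
      using Lp_spaceD(1)[OF TL[OF f]] Lp_spaceD(1)[OF TL[OF hL]] Lp_spaceD(1)[OF TL[OF dL]]
      by (intro Lp_norm_cong) auto
    also have "\<dots> \<le> Lp_norm p (T h) + Lp_norm p (T d)"
      by (rule Lp_norm_triangle[OF TL[OF hL] TL[OF dL] p1])
    also have "Lp_norm p (T h) = Lp_norm p (Riesz h)"
      using Lp_spaceD(1)[OF TL[OF hL]] Lp_spaceD(1)[OF Riesz_span_bound(1)[OF p h(1)]] TR[OF h(1)]
      by (rule Lp_norm_cong)
    also have "\<dots> \<le> A * Lp_norm p h" unfolding A_def by (rule Riesz_span_bound(2)[OF p h(1)])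
    also have "Lp_norm p h \<le> Lp_norm p f + e"
      using Lp_norm_le_add_diff[OF hL f p1] h(2) Lp_norm_diff_commute[of p h f] by simp
    also have "Lp_norm p (T d) \<le> \<bar>C\<bar> * e"
    proof -
      have "Lp_norm p (T d) \<le> C * Lp_norm p d" by (rule C[OF dL])
      also have "\<dots> \<le> \<bar>C\<bar> * Lp_norm p d" by (intro mult_right_mono Lp_norm_nonneg) simp
      also have "\<dots> \<le> \<bar>C\<bar> * e" using h(2) by (intro mult_left_mono) (auto simp: d_def[abs_def])
      finally show ?thesis .
    qed
    finally show ?thesis using A by (simp add: mult_left_mono)
  qed
  have "(\<lambda>j. A * (Lp_norm p f + inverse (real (Suc j))) + \<bar>C\<bar> * inverse (real (Suc j))) \<longlonglongrightarrow> A * (Lp_norm p f + 0) + \<bar>C\<bar> * 0"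
    by (intro tendsto_intros LIMSEQ_inverse_real_of_nat)
  then have "Lp_norm p (T f) \<le> A * (Lp_norm p f + 0) + \<bar>C\<bar> * 0"
    by (rule LIMSEQ_le_const) (use step in auto)
  then show "Lp_norm p (T f) \<le> 42 * (p_star p - 1) * Lp_norm p f" by (simp add: A_def)
qed

end
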